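(* Let $q=5^k$ for some $k\in\mathbb{N}$ and let $m\geq 3$ be an integer. Then $(q,m)\in T_2$ unless one of the following holds: (1) $q\in\{5,5^2,5^3,5^4,5^5,5^6,5^8,5^{10}\}$ and $m=3$; (2) $q\in\{5,5^2,5^3,5^4\}$ and $m=4$; (3) $q\in\{5,5^2\}$ and $m\in\{5,6\}$; (4) $q=5$ and $m\in\{7,8,10,12\}$.
   Context: $\mathbb{F}_q$ is the finite field of order $q$ and $\mathbb{F}_{q^m}$ its extension of degree $m$; $k\geq 1$. An element of $\mathbb{F}_{q^m}$ is primitive if it generates the cyclic group $\mathbb{F}_{q^m}^*$. For a rational function $f\in\mathbb{F}_{q^m}(x)$ and $\alpha\in\mathbb{F}_{q^m}$, $(\alpha,f(\alpha))$ is a primitive pair in $\mathbb{F}_{q^m}$ if both $\alpha$ and $f(\alpha)$ are primitive elements of $\mathbb{F}_{q^m}$. An element $\alpha\in\mathbb{F}_{q^m}$ is normal over $\mathbb{F}_q$ if $\{\alpha,\alpha^q,\dots,\alpha^{q^{m-1}}\}$ is a basis of $\mathbb{F}_{q^m}$ over $\mathbb{F}_q$. $\mathrm{Tr}_{\mathbb{F}_{q^m}/\mathbb{F}_q}(\alpha)=\alpha+\alpha^q+\cdots+\alpha^{q^{m-1}}$. Rational functions are written $f=f_1/f_2$ with $f_1,f_2\in\mathbb{F}_{q^m}[x]$ coprime nonzero polynomials and $f_2$ monic. A rational function $f\in\mathbb{F}_{q^m}(x)$ is exceptional if $f=cx^ig^d$ for some $c\in\mathbb{F}_{q^m}$, $i\in\mathbb{Z}$,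 $g\in\mathbb{F}_{q^m}(x)$ and some integer $d>1$ dividing $q^m-1$, or if $f(x)=x^i$ for some $i\in\mathbb{Z}$ with $\gcd(q^m-1,i)\neq 1$. For non-negative integers $n_1,n_2$, $S_{q,m}(n_1,n_2)$ is the set of non-exceptional rational functions $f=f_1/f_2\in\mathbb{F}_{q^m}(x)$ with $\deg f_1\leq n_1$ and $\deg f_2\leq n_2$. $T_{n_1,n_2}$ is the set of pairs $(q,m)\in\mathbb{N}\times\mathbb{N}$ ($q$ a prime power) such that for every $f\in S_{q,m}(n_1,n_2)$ and every $a\in\mathbb{F}_q$ there is an element $\alpha\in\mathbb{F}_{q^m}$, normal over $\mathbb{F}_q$, such that $(\alpha,f(\alpha))$ is a primitive pair in $\mathbb{F}_{q^m}$ and $\mathrm{Tr}_{\mathbb{F}_{q^m}/\mathbb{F}_q}(\alpha^{-1})=a$. $T_n=\bigcap_{n_1+n_2=n}T_{n_1,n_2}$; in particular $T_2=T_{2,0}\cap T_{1,1}\cap T_{0,2}$. *)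

theory Defs
  imports
    "HOL-Computational_Algebra.Computational_Algebra"
    "HOL-Number_Theory.Cong"
    "HOL-Number_Theory.Prime_Powers"
    "HOL-Library.Cardinality"
begin

text \<open>
  The field with \<open>q ^ m\<close> elements is modelled by a type \<open>'a\<close> of class \<open>finite_field\<close> with
  \<open>CARD('a) = q ^ m\<close>; as a type variable it stands for an arbitrary such field.
  Rational functions over it are the elements of the fraction field \<open>'a poly fract\<close>.
\<close>

subsection \<open>The subfield with \<open>q\<close> elements\<close>

definition is_subfield :: "'a::field set \<Rightarrow> bool" where
  "is_subfield F \<longleftrightarrow>
     0 \<in> F \<and> 1 \<in> F \<and>
     (\<forall>x\<in>F. \<forall>y\<in>F. x + y \<in> F \<and> x * y \<in> F) \<and>
     (\<forall>x\<in>F. - x \<in> F \<and> inverse x \<in> F)"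

text \<open>When \<open>CARD('a) = q ^ m\<close> with \<open>q\<close> and \<open>m\<close> positive, there is exactly one subfield with
  \<open>q\<close> elements; see \<open>GF_sub_unique\<close> and \<open>GF_sub_eq\<close> below.\<close>

definition GF_sub :: "nat \<Rightarrow> 'a::finite_field set" where
  "GF_sub q = (THE F. is_subfield F \<and> card F = q)"

lemma card_finite_field_gt_1: "CARD('a::finite_field) > 1"
proof -
  have "card {0, 1 :: 'a} \<le> CARD('a)"
    by (rule card_mono) auto
  thus ?thesis by simp
qed

lemma finite_field_subset_power_eq_1:
  fixes F :: "'a::finite_field set"
  assumes F: "is_subfield F" and x: "x \<in> F" "x \<noteq> 0"
  shows "x ^ (card F - 1) = 1"
proof -
  let ?F = "F - {0}"
  have 0: "0 \<in> F" and mult: "\<And>x y. x \<in> F \<Longrightarrow> y \<in> F \<Longrightarrow> x * y \<in> F"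
    and inv: "\<And>x. x \<in> F \<Longrightarrow> inverse x \<in> F"
    using F by (auto simp: is_subfield_def)
  have "(\<Prod>y\<in>?F. x * y) = \<Prod>?F"
    by (rule prod.reindex_bij_witness[of _ "\<lambda>y. inverse x * y" "\<lambda>y. x * y"])
       (use x mult inv in \<open>auto simp flip: mult.assoc\<close>)
  hence "x ^ card ?F * \<Prod>?F = 1 * \<Prod>?F"
    by (simp add: prod.distrib)
  moreover have "\<Prod>?F \<noteq> 0"
    by simp
  ultimately have "x ^ card ?F = 1"
    using mult_right_cancel by blast
  thus ?thesis
    using 0 by (simp add: card_Diff_singleton)
qed

lemma card_power_eq_1_le:
  assumes "n > 0"
  shows "card {x :: 'a::finite_field. x ^ n = 1} \<le> n"
proof -
  let ?p = "monom 1 n - 1 :: 'a poly"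
  have "coeff ?p n = 1"
    using assms by (simp add: coeff_1)
  hence "?p \<noteq> 0"
    by (metis coeff_0 zero_neq_one)
  hence "card {x. poly ?p x = 0} \<le> degree ?p"
    by (rule card_poly_roots_bound)
  also have "degree ?p \<le> n"
    by (rule degree_diff_le) (auto simp: degree_monom_le)
  finally show ?thesis
    by (simp add: poly_monom)
qed

lemma card_power_eq_1:
  assumes n: "n > 0" and N: "CARD('a::finite_field) - 1 = n * N"
  shows "card {x :: 'a. x ^ n = 1} = n"
proof (rule antisym)
  show "card {x :: 'a. x ^ n = 1} \<le> n"
    by (rule card_power_eq_1_le) fact
next
  have N0: "N > 0"
    using N card_finite_field_gt_1[where 'a='a] by (cases N) auto
  define h :: "'a poly" where "h = (\<Sum>i<N. monom 1 (n * i))"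
  have "coeff h 0 = (\<Sum>i<N. if i = 0 then 1 else 0)"
    unfolding h_def coeff_sum using n by (intro sum.cong) auto
  also have "\<dots> = 1"
    using N0 by simp
  finally have "h \<noteq> 0"
    by auto
  hence "card {x. poly h x = 0} \<le> degree h"
    by (rule card_poly_roots_bound)
  also have "degree h \<le> n * (N - 1)"
    unfolding h_def
    by (intro degree_sum_le) (auto intro!: order.trans[OF degree_monom_le])
  finally have roots: "card {x. poly h x = 0} \<le> n * (N - 1)" .
  have "x ^ n = 1 \<or> poly h x = 0" if "x \<noteq> 0" for x :: 'a
  proof -
    have "x ^ (n * N) = 1"
      using finite_field_subset_power_eq_1[of UNIV x] that N by (simp add: is_subfield_def)
    hence "0 = (x ^ n) ^ N - 1"
      by (simp add: power_mult)
    also have "\<dots> = (x ^ n - 1) * poly h x"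
      by (simp add: power_diff_1_eq h_def poly_sum poly_monom power_mult)
    finally show ?thesis
      by simp
  qed
  hence "UNIV - {0} \<subseteq> {x :: 'a. x ^ n = 1} \<union> {x. poly h x = 0}"
    by blast
  hence "card (UNIV - {0 :: 'a}) \<le> card ({x :: 'a. x ^ n = 1} \<union> {x. poly h x = 0})"
    by (intro card_mono) auto
  also have "\<dots> \<le> card {x :: 'a. x ^ n = 1} + card {x. poly h x = 0}"
    by (rule card_Un_le)
  finally have "n * N \<le> card {x :: 'a. x ^ n = 1} + n * (N - 1)"
    using roots N by (simp add: card_Diff_singleton)
  moreover have "n * N = n + n * (N - 1)"
    using N0 by (cases N) auto
  ultimately show "n \<le> card {x :: 'a. x ^ n = 1}"
    by linarith
qed

lemma CHAR_finite_field:
  assumes "prime p" "CARD('a::finite_field) = p ^ n"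
  shows "CHAR('a) = p"
proof -
  have "prime CHAR('a)"
    by simp
  moreover have "CHAR('a) dvd p ^ n"
  proof -
    have "(\<Sum>x\<in>UNIV. x + 1) = (\<Sum>x\<in>UNIV. x :: 'a)"
      by (rule sum.reindex_bij_witness[of _ "\<lambda>x. x - 1" "\<lambda>x. x + 1"]) auto
    hence "(of_nat (p ^ n) :: 'a) = 0"
      by (simp add: sum.distrib flip: assms(2))
    thus ?thesis
      unfolding of_nat_eq_0_iff_char_dvd .
  qed
  ultimately show ?thesis
    using assms(1) prime_dvd_power primes_dvd_imp_eq by blast
qed

lemma is_subfield_Frobenius:
  assumes q: "primepow q" and card: "CARD('a::finite_field) = q ^ m"
  shows "is_subfield {x :: 'a. x ^ q = x} \<and> card {x :: 'a. x ^ q = x} = q"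
proof
  obtain p e where p: "prime p" "e > 0" "q = p ^ e"
    using q by (auto simp: primepow_def)
  have CHAR: "CHAR('a) = p"
    using CHAR_finite_field[where 'a='a, of p "e * m"] p card by (simp add: power_mult)
  have q1: "q > 1"
    using q primepow_gt_Suc_0 by auto
  have add: "(x + y) ^ q = x ^ q + y ^ q" for x y :: 'a
    using freshmans_dream'[where 'a='a, of q e] p CHAR by simp
  have minus: "(- x) ^ q = - (x ^ q)" for x :: 'a
    using add[of x "- x"] q1 by (simp add: power_0_left add_eq_0_iff)
  show "is_subfield {x :: 'a. x ^ q = x}"
    using q1 by (auto simp: is_subfield_def add minus power_mult_distrib power_inverse)
  have *: "x ^ q = x \<longleftrightarrow> x = 0 \<or> x ^ (q - 1) = 1" for x :: 'a
    using q1 by (cases q) auto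
  have "[q ^ m - 1 = 1 ^ m - 1] (mod (q - 1))"
  proof (rule cong_diff_nat)
    show "[q ^ m = 1 ^ m] (mod (q - 1))"
      using q1 by (intro cong_pow) (auto simp: cong_altdef_nat)
  qed (use q1 in auto)
  hence "q - 1 dvd CARD('a) - 1"
    by (simp add: card cong_0_iff)
  then obtain N where N: "CARD('a) - 1 = (q - 1) * N"
    by (elim dvdE)
  have "{x :: 'a. x ^ q = x} = insert 0 {x. x ^ (q - 1) = 1}"
    by (auto simp: *)
  also have "card \<dots> = Suc (card {x :: 'a. x ^ (q - 1) = 1})"
    using q1 by (subst card_insert_disjoint) (auto simp: power_0_left)
  also have "card {x :: 'a. x ^ (q - 1) = 1} = q - 1"
    using q1 N by (intro card_power_eq_1) auto
  finally show "card {x :: 'a. x ^ q = x} = q"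
    using q1 by simp
qed

lemma is_subfield_imp_Frobenius:
  fixes F :: "'a::finite_field set"
  assumes q: "primepow q" and card: "CARD('a) = q ^ m"
    and F: "is_subfield F" "card F = q"
  shows "F = {x. x ^ q = x}"
proof (rule card_subset_eq)
  have q1: "q > 1"
    using q primepow_gt_Suc_0 by auto
  show "F \<subseteq> {x. x ^ q = x}"
  proof
    fix x assume x: "x \<in> F"
    have "x ^ q = x"
    proof (cases "x = 0")
      case False
      have "x ^ q = x * x ^ (q - 1)"
        using q1 by (simp flip: power_Suc)
      thus ?thesis
        using finite_field_subset_power_eq_1[OF F(1) x False] F(2) by simp
    qed (use q1 in auto)
    thus "x \<in> {x. x ^ q = x}"
      by simp
  qed
  show "card F = card {x :: 'a. x ^ q = x}"
    using is_subfield_Frobenius[OF q card] F(2) by simp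
qed auto

lemma GF_sub_unique:
  assumes "primepow q" "CARD('a::finite_field) = q ^ m"
  shows "\<exists>!F :: 'a set. is_subfield F \<and> card F = q"
  using is_subfield_Frobenius[OF assms] is_subfield_imp_Frobenius[OF assms] by blast

lemma GF_sub_eq:
  assumes "primepow q" "CARD('a::finite_field) = q ^ m"
  shows "(GF_sub q :: 'a set) = {x. x ^ q = x}"
  unfolding GF_sub_def
  by (rule the1_equality[OF GF_sub_unique[OF assms] is_subfield_Frobenius[OF assms]])


subsection \<open>Primitive and normal elements, trace\<close>

text \<open>Since \<open>0 powi i = 0\<close> for \<open>i \<noteq> 0\<close>, the element \<open>0\<close> is not primitive.\<close>

definition primitive_elem :: "'a::finite_field \<Rightarrow> bool" where
  "primitive_elem \<alpha> \<longleftrightarrow> range (\<lambda>i::int. \<alpha> powi i) = UNIV - {0}"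

definition basis_over :: "'a::finite_field set \<Rightarrow> nat \<Rightarrow> (nat \<Rightarrow> 'a) \<Rightarrow> bool" where
  "basis_over F m v \<longleftrightarrow>
     (\<forall>c. (\<forall>i<m. c i \<in> F) \<and> (\<Sum>i<m. c i * v i) = 0 \<longrightarrow> (\<forall>i<m. c i = 0)) \<and>
     (\<forall>\<beta>. \<exists>c. (\<forall>i<m. c i \<in> F) \<and> \<beta> = (\<Sum>i<m. c i * v i))"

definition normal_elem :: "nat \<Rightarrow> nat \<Rightarrow> 'a::finite_field \<Rightarrow> bool" where
  "normal_elem q m \<alpha> \<longleftrightarrow> basis_over (GF_sub q) m (\<lambda>i. \<alpha> ^ (q ^ i))"

definition field_trace :: "nat \<Rightarrow> nat \<Rightarrow> 'a::finite_field \<Rightarrow> 'a" where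
  "field_trace q m \<alpha> = (\<Sum>i<m. \<alpha> ^ (q ^ i))"


subsection \<open>Rational functions\<close>

definition reduced_form :: "'a::finite_field poly fract \<Rightarrow> 'a poly \<Rightarrow> 'a poly \<Rightarrow> bool" where
  "reduced_form f f1 f2 \<longleftrightarrow>
     f = Fract f1 f2 \<and> f1 \<noteq> 0 \<and> f2 \<noteq> 0 \<and> coprime f1 f2 \<and> lead_coeff f2 = 1"

lemma coprime_poly_dvd_multD:
  fixes p q r :: "'a::field poly"
  assumes cop: "coprime p q" and dvd: "p dvd q * r"
  shows "p dvd r"
proof (cases "p = 0 \<and> q = 0")
  case False
  define I where "I = {a * p + b * q | a b. True}"
  have comb: "a * p + b * q \<in> I" for a b
    by (auto simp: I_def)
  have "p \<in> I" "q \<in> I"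
    using comb[of 1 0] comb[of 0 1] by simp_all
  hence "\<exists>g. g \<in> I \<and> g \<noteq> 0"
    using False by blast
  then obtain g where g: "g \<in> I" "g \<noteq> 0"
    and min: "\<And>h. h \<in> I \<and> h \<noteq> 0 \<Longrightarrow> degree g \<le> degree h"
    using ex_has_least_nat[of "\<lambda>g. g \<in> I \<and> g \<noteq> 0" _ degree] by blast
  obtain a b where ab: "g = a * p + b * q"
    using g(1) by (auto simp: I_def)
  have g_dvd: "g dvd h" if h: "h \<in> I" for h
  proof -
    obtain c d where cd: "h = c * p + d * q"
      using h by (auto simp: I_def)
    have "h mod g = h - h div g * g"
      by (simp add: minus_div_mult_eq_mod)
    also have "\<dots> = (c - h div g * a) * p + (d - h div g * b) * q"
      by (subst (1) cd, subst (2) ab) (simp add: algebra_simps)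
    finally have "h mod g \<in> I"
      using comb by metis
    hence "h mod g = 0"
      using min[of "h mod g"] degree_mod_less[OF g(2), of h] by force
    thus ?thesis
      by (simp add: dvd_eq_mod_eq_0)
  qed
  have "is_unit g"
    using cop g_dvd \<open>p \<in> I\<close> \<open>q \<in> I\<close> by (blast intro: coprime_common_divisor)
  moreover have "p dvd g * r"
    unfolding ab using dvd by (simp add: algebra_simps)
  ultimately show ?thesis
    by (simp add: dvd_mult_unit_iff')
qed (use cop in auto)

lemma reduced_form_unique:
  assumes "reduced_form f f1 f2" "reduced_form f g1 g2"
  shows "f1 = g1 \<and> f2 = g2"
proof -
  from assms have eq: "f1 * g2 = g1 * f2"
    by (auto simp: reduced_form_def eq_fract)
  have dvd1: "f2 dvd f1 * g2"
    by (simp add: eq)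
  have dvd2: "g2 dvd g1 * f2"
    by (simp flip: eq)
  have cop: "coprime f2 f1" "coprime g2 g1"
    using assms by (simp_all add: reduced_form_def coprime_commute)
  obtain h where h: "g2 = f2 * h"
    using coprime_poly_dvd_multD[OF cop(1) dvd1] by (elim dvdE)
  obtain h' where h': "f2 = g2 * h'"
    using coprime_poly_dvd_multD[OF cop(2) dvd2] by (elim dvdE)
  have nz: "f2 \<noteq> 0" "g2 \<noteq> 0" and lc: "lead_coeff f2 = 1" "lead_coeff g2 = 1"
    using assms by (auto simp: reduced_form_def)
  have "f2 * (h * h') = f2 * 1"
    using h h' by (metis mult.assoc mult.right_neutral)
  hence "h * h' = 1"
    using nz by (metis mult_left_cancel)
  hence "is_unit h"
    by (metis dvd_triv_left)
  then obtain c where c: "h = [:c:]"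
    by (metis is_unit_polyE)
  have "c = 1"
    using lc h by (cases "c = 0") (simp_all add: c)
  hence "f2 = g2"
    by (simp add: h c)
  thus ?thesis
    using eq nz by auto
qed

definition ratfun_X :: "'a::finite_field poly fract" where
  "ratfun_X = Fract [:0, 1:] 1"

definition ratfun_const :: "'a::finite_field \<Rightarrow> 'a poly fract" where
  "ratfun_const c = Fract [:c:] 1"

text \<open>\<open>f\<close> takes the value \<open>\<beta>\<close> at \<open>\<alpha>\<close>; there is no such \<open>\<beta>\<close> if \<open>\<alpha>\<close> is a pole of \<open>f\<close>.\<close>

definition ratfun_value :: "'a::finite_field poly fract \<Rightarrow> 'a \<Rightarrow> 'a \<Rightarrow> bool" where
  "ratfun_value f \<alpha> \<beta> \<longleftrightarrow>
     (\<exists>f1 f2. reduced_form f f1 f2 \<and> poly f2 \<alpha> \<noteq> 0 \<and> \<beta> = poly f1 \<alpha> / poly f2 \<alpha>)"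

definition primitive_pair :: "'a::finite_field \<Rightarrow> 'a poly fract \<Rightarrow> bool" where
  "primitive_pair \<alpha> f \<longleftrightarrow>
     primitive_elem \<alpha> \<and> (\<exists>\<beta>. ratfun_value f \<alpha> \<beta> \<and> primitive_elem \<beta>)"

definition exceptional :: "'a::finite_field poly fract \<Rightarrow> bool" where
  "exceptional f \<longleftrightarrow>
     (\<exists>(c::'a) (i::int) (g::'a poly fract) (d::nat).
        d > 1 \<and> d dvd CARD('a) - 1 \<and> f = ratfun_const c * ratfun_X powi i * g ^ d) \<or>
     (\<exists>i::int. gcd (int (CARD('a) - 1)) i \<noteq> 1 \<and> f = ratfun_X powi i)"


subsection \<open>The sets \<open>S\<close> and \<open>T\<close>\<close>

definition S_set :: "nat \<Rightarrow> nat \<Rightarrow> 'a::finite_field poly fract set" where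
  "S_set n1 n2 =
     {f. \<not> exceptional f \<and>
         (\<exists>f1 f2. reduced_form f f1 f2 \<and> degree f1 \<le> n1 \<and> degree f2 \<le> n2)}"

text \<open>The type argument is a model of the field with \<open>q ^ m\<close> elements. This field is unique up to
  isomorphism, so which model is chosen is immaterial.\<close>

definition T_set :: "'a::finite_field itself \<Rightarrow> nat \<Rightarrow> nat \<Rightarrow> (nat \<times> nat) set" where
  "T_set _ n1 n2 =
     {(q, m). primepow q \<and> CARD('a) = q ^ m \<and>
        (\<forall>f \<in> (S_set n1 n2 :: 'a poly fract set). \<forall>a \<in> GF_sub q.
           \<exists>\<alpha>. normal_elem q m \<alpha> \<and> primitive_pair \<alpha> f \<and> field_trace q m (inverse \<alpha>) = a)}"

definition T_total :: "'a::finite_field itself \<Rightarrow> nat \<Rightarrow> (nat \<times> nat) set" where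
  "T_total t n = (\<Inter>(n1, n2) \<in> {(n1, n2). n1 + n2 = n}. T_set t n1 n2)"

end

theory Submission imports Defs "HOL-Algebra.Algebraic_Closure_Type" "HOL-Complex_Analysis.Complex_Analysis"
begin
hide_const (open) Divisibility.prime Divisibility.irreducible Coset.order Polynomials.degree
  up_ring.coeff up_ring.monom module.smult Polynomials.lead_coeff

text \<open>
  Everything happens inside an algebraic closure \<open>K\<close> of the field with \<open>Q = q ^ m\<close> elements. Mixed sums of
  \<open>ch1 x * ch2 (H x) * \<psi> (u / x + v * x)\<close>, where \<open>H\<close> has a set \<open>R\<close> of nonzero roots, one of them simple, are bounded
  by \<open>(card R + 2) * sqrt Q\<close>. In Stepanov's method in the form of Bombieri, an auxiliary polynomial vanishing to
  high order on a class of points with prescribed character values bounds the sums over all extension fields up to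
  an unspecified constant; since the \<open>L\<close>-function is a polynomial of degree at most \<open>card R + 2\<close>, this locates its
  zeros and makes the constant explicit.

  An element is primitive unless it is an \<open>l\<close>-th power for a prime \<open>l dvd Q - 1\<close>, and normal unless it is annihilated by
  a cofactor of one of the irreducible factors of \<open>x ^ m - 1\<close>, that is, of a Frobenius orbit of \<open>m\<close>-th roots of unity.
  The indicators of these events and of the trace condition are character sums, and a weighted sieve produces the
  required element as soon as \<open>sqrt Q \<ge> 4 * q * 2 ^ (2 * t + g) * ((s - 1) / \<delta> + 2)\<close> for \<open>t\<close> primes and \<open>g\<close> orbits that
  are not sieved. With \<open>n = k * m\<close>, this inequality is checked with the prime divisors of \<open>5 ^ n - 1\<close> below 150 for small \<open>n\<close>
  and follows from estimates for \<open>n \<ge> 432\<close>.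
\<close>

section \<open>Finite subfields of an algebraically closed field\<close>

text \<open>The sieve needs a square-root bound with the constant 4, whereas the auxiliary
  polynomial alone gives a constant that grows with Q. It is harmless as long as it is independent
  of the extension degree: it leaves the radius of convergence of the logarithmic derivative
  untouched, and only the degree of the L-function survives. The method also gives only upper bounds
  for class sizes; as the classes partition a set of known size, these imply lower bounds on
  average.

  Nonvanishing of the auxiliary polynomial is the delicate point. It is read off at two places: at
  0, where the pole of u / x produces separated orders of vanishing, and at the simple root of H,
  which allows an Eisenstein argument. A sum without a pole at 0 but with one at infinity is moved
  by x -> 1/x.

  Rational functions become products because inversion is the power Q - 2, and Q - 2 is prime to Q -
  1. At most two nonzero zeros and poles occur, whence 2 + 2 = 4. Each prime counts twice, once for
  \<alpha> and once for f(\<alpha>), whence 2 * t in the exponent.\<close>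

definition FF :: "nat \<Rightarrow> 'k::field set" where
  "FF r = {x. x ^ r = x}"

lemma FF_0 [simp]: "r > 0 \<Longrightarrow> 0 \<in> FF r" and FF_1 [simp]: "1 \<in> FF r"
  by (auto simp: FF_def)

lemma FF_mult: "x \<in> FF r \<Longrightarrow> y \<in> FF r \<Longrightarrow> x * y \<in> FF r"
  and FF_power: "x \<in> FF r \<Longrightarrow> x ^ n \<in> FF r"
  and FF_inverse: "x \<in> FF r \<Longrightarrow> inverse x \<in> FF r"
  and FF_divide: "x \<in> FF r \<Longrightarrow> y \<in> FF r \<Longrightarrow> x / y \<in> FF r"
  by (auto simp: FF_def power_mult_distrib power_inverse power_divide simp flip: power_mult)
     (metis power_mult mult.commute)

lemma FF_powD: "x \<in> FF r \<Longrightarrow> x ^ (r ^ i) = x"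
  by (induction i) (auto simp: FF_def power_mult)

lemma FF_mono: "FF r \<subseteq> FF (r ^ j)"
  using FF_powD by (fastforce simp: FF_def)

lemma FF_power_minus_1: "x \<in> FF r \<Longrightarrow> x \<noteq> 0 \<Longrightarrow> r > 0 \<Longrightarrow> x ^ (r - 1) = (1::'k::field)"
  by (cases r) (auto simp: FF_def)

lemma size_proots_alg_closed: "size (proots (p :: 'k::alg_closed_field poly)) = degree p"
proof (cases "p = 0")
  case False
  obtain A where A: "size A = degree p" "p = smult (lead_coeff p) (\<Prod>x\<in>#A. [:-x, 1:])"
    using alg_closed_imp_factorization[OF False] by blast
  have "proots p = proots (\<Prod>x\<in>#A. [:-x, 1:])"
    by (subst A(2)) (use False in auto)
  also have "\<dots> = A"
    by (induction A) (simp_all add: proots_mult image_iff del: mult_pCons_left)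
  finally show ?thesis
    using A by simp
qed auto

lemma card_roots_rsquarefree:
  fixes p :: "'k::alg_closed_field poly"
  assumes p: "p \<noteq> 0" and sf: "\<And>x. poly p x = 0 \<Longrightarrow> poly (pderiv p) x \<noteq> 0"
  shows "card {x. poly p x = 0} = degree p"
proof -
  have 1: "order x p = 1" if x: "poly p x = 0" for x
  proof (rule ccontr)
    assume "order x p \<noteq> 1"
    hence "2 \<le> order x p"
      using x p order_root[of p x] by auto
    hence "[:-x, 1:] ^ 2 dvd p"
      using order_divides by blast
    define l where "l = [:-x, 1:]"
    have l: "poly l x = 0" by (simp add: l_def)
    obtain h where "p = l ^ 2 * h"
      using \<open>[:-x, 1:] ^ 2 dvd p\<close> by (auto simp: l_def elim!: dvdE)
    hence "poly (pderiv p) x = 0"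
      by (simp add: power2_eq_square pderiv_mult l)
    thus False using sf x by blast
  qed
  have "degree p = size (proots p)"
    by (simp add: size_proots_alg_closed)
  also have "\<dots> = (\<Sum>x\<in>{x. poly p x = 0}. 1)"
    unfolding size_multiset_overloaded_eq using p 1 by (intro sum.cong) auto
  finally show ?thesis by simp
qed

section \<open>Finite subfields and roots of unity in characteristic p\<close>

locale pchar =
  fixes p :: nat and K :: "'k::alg_closed_field itself"
  assumes p: "prime p" and CHAR: "CHAR('k) = p"
begin

lemma p1: "p > 1" using p prime_gt_1_nat by blast

lemma of_nat_p [simp]: "of_nat p = (0::'k)"
  by (simp add: of_nat_eq_0_iff_char_dvd CHAR)

lemma of_nat_p_pow: "i > 0 \<Longrightarrow> of_nat (p ^ i) = (0::'k)"
  by (simp add: power_0_left)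

lemma frob_add: "(x + y :: 'k) ^ (p ^ i) = x ^ (p ^ i) + y ^ (p ^ i)"
  using freshmans_dream'[where 'a='k, of "p ^ i" i] p CHAR by simp

lemma frob_sum: "(\<Sum>x\<in>A. f x :: 'k) ^ (p ^ i) = (\<Sum>x\<in>A. f x ^ (p ^ i))"
  using freshmans_dream_sum'[where 'a='k, of "p ^ i" i f A] p CHAR by simp

lemma frob_minus: "(- x :: 'k) ^ (p ^ i) = - (x ^ (p ^ i))"
  using frob_add[of x "-x" i] p1 by (simp add: power_0_left add_eq_0_iff)

lemma frob_diff: "(x - y :: 'k) ^ (p ^ i) = x ^ (p ^ i) - y ^ (p ^ i)"
  using frob_add[of x "-y" i] by (simp add: frob_minus)

lemma frob_inj: "(x :: 'k) ^ (p ^ i) = y ^ (p ^ i) \<Longrightarrow> x = y"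
  using frob_diff[of x y i] p1 by auto

lemma frob_surj: "\<exists>y. y ^ (p ^ i) = (x :: 'k)"
  using nth_root_exists[of "p ^ i" x] p1 by simp

lemma FF_add: "x \<in> FF (p ^ i) \<Longrightarrow> y \<in> FF (p ^ i) \<Longrightarrow> x + y \<in> (FF (p ^ i) :: 'k set)"
  and FF_uminus: "x \<in> FF (p ^ i) \<Longrightarrow> - x \<in> (FF (p ^ i) :: 'k set)"
  and FF_diff: "x \<in> FF (p ^ i) \<Longrightarrow> y \<in> FF (p ^ i) \<Longrightarrow> x - y \<in> (FF (p ^ i) :: 'k set)"
  and FF_sum: "(\<And>j. j \<in> A \<Longrightarrow> f j \<in> FF (p ^ i)) \<Longrightarrow> (\<Sum>j\<in>A. f j) \<in> (FF (p ^ i) :: 'k set)"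
  by (auto simp: FF_def frob_add frob_minus frob_diff frob_sum)

lemma
  assumes "i > 0"
  shows card_FF: "card (FF (p ^ i) :: 'k set) = p ^ i"
    and finite_FF: "finite (FF (p ^ i) :: 'k set)"
proof -
  let ?r = "p ^ i"
  have r: "?r > 1" using assms p1 by (metis one_less_power)
  let ?f = "monom 1 ?r - monom 1 1 :: 'k poly"
  have eq: "FF ?r = {x :: 'k. poly ?f x = 0}"
    by (auto simp: FF_def poly_monom)
  have c: "coeff ?f ?r = 1" using r by auto
  have f0: "?f \<noteq> 0" using c by (metis coeff_0 zero_neq_one)
  have "degree ?f = ?r"
  proof (rule antisym)
    show "degree ?f \<le> ?r" using r by (intro degree_diff_le) (auto simp: degree_monom_eq)
    show "?r \<le> degree ?f" using c by (intro le_degree) auto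
  qed
  moreover have "pderiv ?f = - 1"
    using assms by (simp add: pderiv_diff pderiv_monom of_nat_p_pow power_0_left)
  ultimately show "card (FF ?r :: 'k set) = ?r"
    unfolding eq using card_roots_rsquarefree[OF f0] by simp
  show "finite (FF ?r :: 'k set)"
    unfolding eq using f0 by (rule poly_roots_finite)
qed

lemma card_roots_of_unity:
  assumes "n > 0" "\<not> p dvd n"
  shows "card {x :: 'k. x ^ n = 1} = n"
proof -
  let ?f = "monom 1 n - 1 :: 'k poly"
  have eq: "{x :: 'k. x ^ n = 1} = {x :: 'k. poly ?f x = 0}"
    by (auto simp: poly_monom)
  have c: "coeff ?f n = 1" using assms by (auto simp: coeff_1)
  have f0: "?f \<noteq> 0" using c by (metis coeff_0 zero_neq_one)
  have "degree ?f = n"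
  proof (rule antisym)
    show "degree ?f \<le> n" using assms by (intro degree_diff_le) (auto simp: degree_monom_eq)
    show "n \<le> degree ?f" using c by (intro le_degree) auto
  qed
  moreover have "poly (pderiv ?f) x \<noteq> 0" if "poly ?f x = 0" for x
  proof -
    have "x \<noteq> 0" using that assms by (auto simp: poly_monom power_0_left)
    moreover have "of_nat n \<noteq> (0 :: 'k)"
      using assms by (simp add: of_nat_eq_0_iff_char_dvd CHAR)
    ultimately show ?thesis by (simp add: pderiv_diff pderiv_monom poly_monom)
  qed
  ultimately show ?thesis
    unfolding eq using card_roots_rsquarefree[OF f0] by simp
qed

end

section \<open>Homogeneous linear systems\<close>

text \<open>An equation with a nonzero coefficient serves to eliminate one unknown. Both the Kummer
  cofactor and the auxiliary polynomial get their nonzero solution from this count.\<close>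

lemma homogeneous_system_nontrivial:
  fixes M :: "'j \<Rightarrow> 'i \<Rightarrow> 'k::field"
  assumes "finite J" "finite I" "card J < card I"
  shows "\<exists>x. (\<exists>i\<in>I. x i \<noteq> 0) \<and> (\<forall>j\<in>J. (\<Sum>i\<in>I. M j i * x i) = 0)"
  using assms
proof (induction J arbitrary: I M rule: finite_induct)
  case empty
  then obtain i where "i \<in> I" by (metis card_gt_0_iff card.empty ex_in_conv)
  thus ?case by (intro exI[of _ "\<lambda>_. 1"]) auto
next
  case (insert j J)
  show ?case
  proof (cases "\<forall>i\<in>I. M j i = 0")
    case True
    have "card J < card I" using insert by simp
    from insert.IH[OF insert.prems(1) this, of M] True show ?thesis by auto
  next
    case False
    then obtain i0 where i0: "i0 \<in> I" "M j i0 \<noteq> 0" by blast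
    define I' where "I' = I - {i0}"
    have I': "finite I'" "card J < card I'"
      using insert i0 by (auto simp: I'_def)
    define M' where "M' = (\<lambda>l i. M l i - M l i0 * M j i / M j i0)"
    from insert.IH[OF I', of M'] obtain x where
      x: "\<exists>i\<in>I'. x i \<noteq> 0" "\<forall>l\<in>J. (\<Sum>i\<in>I'. M' l i * x i) = 0" by blast
    define s where "s = (\<Sum>i\<in>I'. M j i * x i)"
    define y where "y = (\<lambda>i. if i = i0 then - s / M j i0 else x i)"
    have split: "(\<Sum>i\<in>I. M l i * y i) = - M l i0 * s / M j i0 + (\<Sum>i\<in>I'. M l i * x i)" for l
    proof -
      have "(\<Sum>i\<in>I. M l i * y i) = M l i0 * y i0 + (\<Sum>i\<in>I'. M l i * y i)"
        unfolding I'_def using i0 insert.prems by (simp add: sum.remove)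
      moreover have "(\<Sum>i\<in>I'. M l i * y i) = (\<Sum>i\<in>I'. M l i * x i)"
        by (intro sum.cong) (auto simp: y_def I'_def)
      ultimately show ?thesis by (simp add: y_def)
    qed
    have "(\<Sum>i\<in>I. M l i * y i) = 0" if l: "l \<in> J" for l
    proof -
      have "0 = (\<Sum>i\<in>I'. M' l i * x i)" using x l by simp
      also have "\<dots> = (\<Sum>i\<in>I'. M l i * x i) - M l i0 * s / M j i0"
        unfolding M'_def s_def
        by (simp add: left_diff_distrib sum_subtractf sum_distrib_left sum_divide_distrib field_simps)
      finally show ?thesis unfolding split by simp
    qed
    moreover have "(\<Sum>i\<in>I. M j i * y i) = 0"
      unfolding split using i0 by (simp add: s_def)
    moreover have "\<exists>i\<in>I. y i \<noteq> 0"
      using x(1) by (auto simp: I'_def y_def)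
    ultimately show ?thesis by (intro exI[of _ y]) auto
  qed
qed

section \<open>Multiplication in $K[x][Z]/(Z^d - \kappa H)$\<close>

text \<open>Elements are coefficient families indexed by \<open>i < d\<close>; this is the coefficient of \<open>Z ^ n\<close>
  in the product of two of them.\<close>

definition kmult :: "nat \<Rightarrow> 'k::field poly \<Rightarrow> (nat \<Rightarrow> 'k poly) \<Rightarrow> (nat \<Rightarrow> 'k poly) \<Rightarrow> nat \<Rightarrow> 'k poly" where
  "kmult d H A E n = (\<Sum>i<d. \<Sum>j<d.
     if i + j = n then A i * E j else if i + j = n + d then H * A i * E j else 0)"

lemma kmult_eval:
  "(\<Sum>n<d. kmult d H A E n * y ^ n) =
   (\<Sum>i<d. \<Sum>j<d. A i * E j * (if i + j < d then y ^ (i + j) else H * y ^ (i + j - d)))"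
proof -
  have inner: "(\<Sum>n<d. (if i + j = n then A i * E j else if i + j = n + d then H * A i * E j else 0) * y ^ n)
      = A i * E j * (if i + j < d then y ^ (i + j) else H * y ^ (i + j - d))"
    if ij: "i < d" "j < d" for i j
  proof (cases "i + j < d")
    case True
    have "(\<Sum>n<d. (if i + j = n then A i * E j else if i + j = n + d then H * A i * E j else 0) * y ^ n)
        = (\<Sum>n<d. if i + j = n then A i * E j * y ^ (i + j) else 0)"
      using True by (intro sum.cong) auto
    thus ?thesis using True by simp
  next
    case False
    have "(\<Sum>n<d. (if i + j = n then A i * E j else if i + j = n + d then H * A i * E j else 0) * y ^ n)
        = (\<Sum>n<d. if i + j - d = n then H * A i * E j * y ^ (i + j - d) else 0)"
      using False by (intro sum.cong) auto
    also have "\<dots> = H * A i * E j * y ^ (i + j - d)"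
      using False ij by simp
    finally show ?thesis using False by (simp add: mult_ac)
  qed
  have "(\<Sum>n<d. kmult d H A E n * y ^ n) = (\<Sum>n<d. \<Sum>i<d. \<Sum>j<d.
     (if i + j = n then A i * E j else if i + j = n + d then H * A i * E j else 0) * y ^ n)"
    unfolding kmult_def by (simp add: sum_distrib_right)
  also have "\<dots> = (\<Sum>i<d. \<Sum>n<d. \<Sum>j<d.
     (if i + j = n then A i * E j else if i + j = n + d then H * A i * E j else 0) * y ^ n)"
    by (rule sum.swap)
  also have "\<dots> = (\<Sum>i<d. \<Sum>j<d. \<Sum>n<d.
     (if i + j = n then A i * E j else if i + j = n + d then H * A i * E j else 0) * y ^ n)"
    by (intro sum.cong sum.swap refl)
  also have "\<dots> = (\<Sum>i<d. \<Sum>j<d. A i * E j * (if i + j < d then y ^ (i + j) else H * y ^ (i + j - d)))"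
    by (intro sum.cong refl inner) auto
  finally show ?thesis .
qed

text \<open>Families stand for sums of \<open>A i * y ^ i\<close>. Wrapping an exponent around
  replaces \<open>y ^ d\<close> by \<open>H\<close>, so a relation that holds only modulo
  \<open>g\<close> makes \<open>kmult\<close> the product modulo \<open>g\<close>. Later
  \<open>g\<close> is a power of x.\<close>

lemma kmult_cong_dvd:
  assumes "g dvd y ^ d - H"
  shows "g dvd (\<Sum>i<d. A i * y ^ i) * (\<Sum>j<d. E j * y ^ j) - (\<Sum>n<d. kmult d H A E n * y ^ n)"
proof -
  have *: "g dvd A i * y ^ i * (E j * y ^ j) - A i * E j * (if i + j < d then y ^ (i + j) else H * y ^ (i + j - d))"
    if "i < d" "j < d" for i j
  proof (cases "i + j < d")
    case False
    have "y ^ (i + j) = y ^ d * y ^ (i + j - d)"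
      using False by (simp flip: power_add)
    hence "A i * y ^ i * (E j * y ^ j) - A i * E j * (H * y ^ (i + j - d))
        = (A i * E j * y ^ (i + j - d)) * (y ^ d - H)"
      by (simp add: power_add algebra_simps)
    thus ?thesis using False assms by simp
  qed (simp add: power_add mult_ac)
  have "(\<Sum>i<d. A i * y ^ i) * (\<Sum>j<d. E j * y ^ j) - (\<Sum>n<d. kmult d H A E n * y ^ n)
    = (\<Sum>i<d. \<Sum>j<d. A i * y ^ i * (E j * y ^ j) - A i * E j * (if i + j < d then y ^ (i + j) else H * y ^ (i + j - d)))"
    unfolding kmult_eval sum_product by (simp add: sum_subtractf)
  also have "g dvd \<dots>"
    by (intro dvd_sum *) auto
  finally show ?thesis .
qed

text \<open>Here \<alpha> is the least order of vanishing at \<rho> among the nonzero members. After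
  division by that power the family is not zero modulo x - \<rho>, and \<open>i0\<close> is the
  first index where this shows.\<close>

lemma clear_root:
  fixes A :: "nat \<Rightarrow> 'k::field poly"
  assumes "\<exists>i<d. A i \<noteq> 0"
  obtains \<alpha> A' i0 where "\<And>i. i < d \<Longrightarrow> A i = [:-\<rho>, 1:] ^ \<alpha> * A' i"
    "i0 < d" "poly (A' i0) \<rho> \<noteq> 0" "\<And>i. i < i0 \<Longrightarrow> poly (A' i) \<rho> = 0"
proof -
  define S where "S = {i. i < d \<and> A i \<noteq> 0}"
  have S: "finite S" "S \<noteq> {}" using assms by (auto simp: S_def)
  define \<alpha> where "\<alpha> = Min ((\<lambda>i. order \<rho> (A i)) ` S)"
  have "\<exists>B. A i = [:-\<rho>, 1:] ^ \<alpha> * B" if "i < d" for i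
  proof (cases "A i = 0")
    case False
    hence "\<alpha> \<le> order \<rho> (A i)" using that S unfolding \<alpha>_def by (auto simp: S_def)
    hence "[:-\<rho>, 1:] ^ \<alpha> dvd A i" using order_divides by blast
    thus ?thesis by (elim dvdE) blast
  qed (auto intro: exI[of _ 0])
  then obtain A' where A': "\<And>i. i < d \<Longrightarrow> A i = [:-\<rho>, 1:] ^ \<alpha> * A' i"
    by metis
  have "\<alpha> \<in> (\<lambda>i. order \<rho> (A i)) ` S" unfolding \<alpha>_def using S by (intro Min_in) auto
  then obtain i where i: "i < d" "A i \<noteq> 0" "order \<rho> (A i) = \<alpha>" by (auto simp: S_def)
  have "poly (A' i) \<rho> \<noteq> 0"
  proof
    assume "poly (A' i) \<rho> = 0"
    then obtain C where "A' i = [:-\<rho>, 1:] * C" using poly_eq_0_iff_dvd by (metis dvdE)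
    hence "A i = [:-\<rho>, 1:] ^ Suc \<alpha> * C" using A'[OF i(1)] by (simp only: power_Suc2 mult.assoc)
    hence "Suc \<alpha> \<le> order \<rho> (A i)" using i order_divides by (metis dvd_triv_left)
    thus False using i by simp
  qed
  hence ex: "\<exists>i. i < d \<and> poly (A' i) \<rho> \<noteq> 0" using i by blast
  obtain i0 where i0: "i0 < d" "poly (A' i0) \<rho> \<noteq> 0"
      "\<forall>i<i0. \<not> (i < d \<and> poly (A' i) \<rho> \<noteq> 0)"
    using exists_least_iff[THEN iffD1, OF ex] by blast
  have "poly (A' i) \<rho> = 0" if "i < i0" for i
    using i0 that by (meson order_less_trans)
  thus ?thesis using A' i0 that by blast
qed

text \<open>An Eisenstein argument at the simple root \<open>\<rho>\<close>.\<close>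

lemma kmult_nonzero:
  fixes H :: "'k::field poly"
  assumes H: "poly H \<rho> = 0" "poly (pderiv H) \<rho> \<noteq> 0"
    and A: "\<exists>i<d. A i \<noteq> 0" and E: "\<exists>i<d. E i \<noteq> 0"
  shows "\<exists>n<d. kmult d H A E n \<noteq> 0"
proof -
  obtain \<alpha> A' i0 where A': "\<And>i. i < d \<Longrightarrow> A i = [:-\<rho>, 1:] ^ \<alpha> * A' i"
    "i0 < d" "poly (A' i0) \<rho> \<noteq> 0" "\<And>i. i < i0 \<Longrightarrow> poly (A' i) \<rho> = 0"
    using clear_root[where \<rho> = \<rho>, OF A] by blast
  obtain \<beta> E' j0 where E': "\<And>i. i < d \<Longrightarrow> E i = [:-\<rho>, 1:] ^ \<beta> * E' i"
    "j0 < d" "poly (E' j0) \<rho> \<noteq> 0" "\<And>i. i < j0 \<Longrightarrow> poly (E' i) \<rho> = 0"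
    using clear_root[where \<rho> = \<rho>, OF E] by blast
  have scale: "kmult d H A E n = [:-\<rho>, 1:] ^ (\<alpha> + \<beta>) * kmult d H A' E' n" for n
    unfolding kmult_def sum_distrib_left
    by (intro sum.cong refl) (auto simp: A'(1) E'(1) power_add mult_ac)
  have "\<exists>n<d. kmult d H A' E' n \<noteq> 0"
  proof (cases "i0 + j0 < d")
    case True
    \<comment> \<open>Terms that wrap around carry the factor \<open>H\<close>, which vanishes at
      \<rho>. In the others \<open>i + j = i0 + j0\<close>, so away from \<open>(i0, j0)\<close> one
      index lies below \<open>i0\<close> or \<open>j0\<close> and its factor vanishes.\<close>
    have "poly (kmult d H A' E' (i0 + j0)) \<rho> =
        (\<Sum>i<d. \<Sum>j<d. if i = i0 \<and> j = j0 then poly (A' i0) \<rho> * poly (E' j0) \<rho> else 0)"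
      unfolding kmult_def poly_sum
    proof (intro sum.cong refl)
      fix i j assume ij: "i \<in> {..<d}" "j \<in> {..<d}"
      show "poly (if i + j = i0 + j0 then A' i * E' j else if i + j = i0 + j0 + d then H * A' i * E' j else 0) \<rho>
         = (if i = i0 \<and> j = j0 then poly (A' i0) \<rho> * poly (E' j0) \<rho> else 0)"
        using A'(4)[of i] E'(4)[of j] H by (cases i i0 rule: linorder_cases) auto
    qed
    also have "\<dots> = (\<Sum>i<d. if i = i0 then poly (A' i0) \<rho> * poly (E' j0) \<rho> else 0)"
      using E' by (intro sum.cong refl) (auto simp: sum.delta)
    also have "\<dots> = poly (A' i0) \<rho> * poly (E' j0) \<rho>"
      using A' by simp
    finally have "kmult d H A' E' (i0 + j0) \<noteq> 0" using A'(3) E'(3) by auto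
    thus ?thesis using True by blast
  next
    case False
    define n where "n = i0 + j0 - d"
    have n: "n < d" "n < i0" "n < j0" "n + d = i0 + j0" using False A'(2) E'(2) by (auto simp: n_def)
    \<comment> \<open>Without wrapping, \<open>i + j = n\<close> forces \<open>i < i0\<close> and
      \<open>j < j0\<close>, so the product has a double zero at \<rho>. With wrapping, only
      \<open>(i0, j0)\<close> survives, and the simple zero of \<open>H\<close> shows in the
      derivative.\<close>
    have "poly (pderiv (kmult d H A' E' n)) \<rho> =
        (\<Sum>i<d. \<Sum>j<d. if i = i0 \<and> j = j0 then poly (pderiv H) \<rho> * poly (A' i0) \<rho> * poly (E' j0) \<rho> else 0)"
      unfolding kmult_def higher_pderiv_sum[where n = 1, simplified] poly_sum
    proof (intro sum.cong refl)
      fix i j assume ij: "i \<in> {..<d}" "j \<in> {..<d}"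
      show "poly (pderiv (if i + j = n then A' i * E' j else if i + j = n + d then H * A' i * E' j else 0)) \<rho>
         = (if i = i0 \<and> j = j0 then poly (pderiv H) \<rho> * poly (A' i0) \<rho> * poly (E' j0) \<rho> else 0)"
        using A'(4)[of i] E'(4)[of j] H n by (cases i i0 rule: linorder_cases) (auto simp: pderiv_mult)
    qed
    also have "\<dots> = (\<Sum>i<d. if i = i0 then poly (pderiv H) \<rho> * poly (A' i0) \<rho> * poly (E' j0) \<rho> else 0)"
      using E' by (intro sum.cong refl) (auto simp: sum.delta)
    also have "\<dots> = poly (pderiv H) \<rho> * poly (A' i0) \<rho> * poly (E' j0) \<rho>"
      using A' by simp
    finally have "kmult d H A' E' n \<noteq> 0" using A'(3) E'(3) H by auto
    thus ?thesis using n by blast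
  qed
  thus ?thesis unfolding scale by auto
qed

lemma sum_monom_zero_iff: "(\<Sum>r<L. monom (x r) r) = 0 \<longleftrightarrow> (\<forall>r<L. x r = (0::'k::field))"
proof
  assume *: "(\<Sum>r<L. monom (x r) r) = 0"
  show "\<forall>r<L. x r = 0"
  proof (intro allI impI)
    fix r assume "r < L"
    have "coeff (\<Sum>r<L. monom (x r) r) r = x r" using \<open>r < L\<close> by (simp add: coeff_sum)
    thus "x r = 0" using * by simp
  qed
qed auto

lemma kmult_sum_right:
  "kmult d H A (\<lambda>j. \<Sum>r\<in>S. F j r) n = (\<Sum>j<d. \<Sum>r\<in>S. kmult d H A (\<lambda>j'. if j' = j then F j r else 0) n)"
proof -
  have "(\<Sum>j<d. \<Sum>r\<in>S. kmult d H A (\<lambda>j'. if j' = j then F j r else 0) n)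
    = (\<Sum>j<d. \<Sum>r\<in>S. \<Sum>i<d. if i + j = n then A i * F j r else if i + j = n + d then H * A i * F j r else 0)"
    unfolding kmult_def
  proof (intro sum.cong refl)
    fix j r i assume j: "j \<in> {..<d}"
    have "(\<Sum>ja<d. if i + ja = n then A i * (if ja = j then F j r else 0) else
        if i + ja = n + d then H * A i * (if ja = j then F j r else 0) else 0)
        = (\<Sum>ja<d. if ja = j then (if i + j = n then A i * F j r else if i + j = n + d then H * A i * F j r else 0) else 0)"
      by (intro sum.cong) auto
    also have "\<dots> = (if i + j = n then A i * F j r else if i + j = n + d then H * A i * F j r else 0)"
      using j by simp
    finally show "(\<Sum>ja<d. if i + ja = n then A i * (if ja = j then F j r else 0) else
        if i + ja = n + d then H * A i * (if ja = j then F j r else 0) else 0)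
        = (if i + j = n then A i * F j r else if i + j = n + d then H * A i * F j r else 0)" .
  qed
  also have "\<dots> = (\<Sum>j<d. \<Sum>i<d. \<Sum>r\<in>S. if i + j = n then A i * F j r else if i + j = n + d then H * A i * F j r else 0)"
    by (intro sum.cong sum.swap refl)
  also have "\<dots> = (\<Sum>i<d. \<Sum>j<d. \<Sum>r\<in>S. if i + j = n then A i * F j r else if i + j = n + d then H * A i * F j r else 0)"
    by (rule sum.swap)
  also have "\<dots> = kmult d H A (\<lambda>j. \<Sum>r\<in>S. F j r) n"
    unfolding kmult_def by (intro sum.cong refl) (simp add: sum_distrib_left)
  finally show ?thesis by simp
qed

lemma kmult_smult_right:
  "kmult d H A (\<lambda>j. smult c (F j)) n = smult c (kmult d H A F n)"
proof -
  have *: "smult c q = [:c:] * q" for q by simp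
  show ?thesis
    unfolding kmult_def * sum_distrib_left by (intro sum.cong refl) (auto simp del: mult_pCons_left simp: mult_ac)
qed

lemma degree_kmult_le:
  assumes "\<And>i. i < d \<Longrightarrow> degree (A i) \<le> a" "\<And>i. i < d \<Longrightarrow> degree (E i) \<le> b"
  shows "degree (kmult d H A E n) \<le> degree H + a + b"
proof -
  have "degree (if i + j = n then A i * E j else if i + j = n + d then H * A i * E j else 0) \<le> degree H + a + b"
    if "i < d" "j < d" for i j
  proof -
    have "degree (A i * E j) \<le> a + b"
      using degree_mult_le[of "A i" "E j"] assms that by (meson add_mono le_trans)
    moreover have "degree (H * A i * E j) \<le> degree H + a + b"
      using degree_mult_le[of "H * A i" "E j"] degree_mult_le[of H "A i"] assms(1)[of i] assms(2)[of j] that by linarith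
    ultimately show ?thesis by auto
  qed
  thus ?thesis unfolding kmult_def by (intro degree_sum_le) auto
qed

text \<open>A substitute for the norm from K[x][Z] / (Z ^ d - H) to K[x]: some multiple of the
  family \<open>A\<close> is a polynomial in x alone. It comes from linear algebra, and
  \<open>kmult_nonzero\<close> ensures that it is not zero.\<close>

lemma kmult_cofactor:
  fixes H :: "'k::field poly"
  assumes H: "poly H \<rho> = 0" "poly (pderiv H) \<rho> \<noteq> 0"
    and A: "\<exists>i<d. A i \<noteq> 0" and dA: "\<And>i. i < d \<Longrightarrow> degree (A i) \<le> a"
  obtains E where "kmult d H A E 0 \<noteq> 0" "degree (kmult d H A E 0) \<le> d * (degree H + a + 1)"
    "\<And>n. 0 < n \<Longrightarrow> n < d \<Longrightarrow> kmult d H A E n = 0"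
proof -
  have d0: "d > 0" using A by auto
  define h where "h = degree H"
  \<comment> \<open>Members of degree below \<open>L\<close> give \<open>d * L\<close> unknowns;
    killing the coefficients of Z, ..., Z ^ (d - 1) takes \<open>(d - 1) * (L + h + a)\<close>
    equations. With this \<open>L\<close> there is exactly one unknown more than equations.\<close>
  define L where "L = (d - 1) * (h + a) + 1"
  define V where "V = (\<lambda>(j, r) n. kmult d H A (\<lambda>j'. if j' = j then monom 1 r else 0 :: 'k poly) n)"
  define I where "I = {..<d} \<times> {..<L}"
  define J where "J = {1..<d} \<times> {..<L + h + a}"
  have "card J = (d - 1) * (L + h + a)" by (simp add: J_def)
  also have "\<dots> = (d - 1) * (h + a) + (d - 1) * L" by (simp add: algebra_simps)
  also have "\<dots> < L + (d - 1) * L" by (simp add: L_def)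
  also have "\<dots> = card I" using d0 by (cases d) (simp_all add: I_def)
  finally have "card J < card I" .
  then obtain x where x: "\<exists>i\<in>I. x i \<noteq> 0" "\<forall>j\<in>J. (\<Sum>i\<in>I. (\<lambda>(n, t) i. coeff (V i n) t) j i * x i) = 0"
    using homogeneous_system_nontrivial[of J I "\<lambda>(n, t) i. coeff (V i n) t"]
    unfolding I_def J_def by auto
  define E where "E = (\<lambda>j. \<Sum>r<L. smult (x (j, r)) (monom 1 r))"
  have EV: "kmult d H A E n = (\<Sum>i\<in>I. smult (x i) (V i n))" for n
  proof -
    have "kmult d H A E n = (\<Sum>j<d. \<Sum>r<L. kmult d H A (\<lambda>j'. if j' = j then smult (x (j, r)) (monom 1 r) else 0) n)"
      unfolding E_def by (rule kmult_sum_right)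
    also have "\<dots> = (\<Sum>j<d. \<Sum>r<L. kmult d H A (\<lambda>j'. smult (x (j, r)) (if j' = j then monom 1 r else 0)) n)"
      by (intro sum.cong refl arg_cong[where f = "\<lambda>F. kmult d H A F n"]) auto
    also have "\<dots> = (\<Sum>j<d. \<Sum>r<L. smult (x (j, r)) (V (j, r) n))"
      unfolding kmult_smult_right V_def by simp
    finally show ?thesis unfolding I_def by (simp add: sum.cartesian_product)
  qed
  have dE: "degree (E j) \<le> L - 1" for j
    unfolding E_def by (intro degree_sum_le) (auto simp: degree_monom_eq L_def)
  have deg: "degree (kmult d H A E n) \<le> h + a + (L - 1)" for n
    unfolding h_def by (rule degree_kmult_le) (use dA dE in auto)
  have zero: "kmult d H A E n = 0" if n: "0 < n" "n < d" for n
  proof (rule poly_eqI)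
    fix t
    show "coeff (kmult d H A E n) t = coeff 0 t"
    proof (cases "t < L + h + a")
      case True
      hence "(n, t) \<in> J" using n by (auto simp: J_def)
      thus ?thesis using x(2) by (auto simp: EV coeff_sum mult.commute)
    next
      case False
      hence "degree (kmult d H A E n) < t" using deg[of n] by (auto simp: L_def)
      thus ?thesis by (simp add: coeff_eq_0)
    qed
  qed
  have "\<exists>j<d. E j \<noteq> 0"
  proof -
    obtain j r where jr: "j < d" "r < L" "x (j, r) \<noteq> 0" using x(1) by (auto simp: I_def)
    have "E j = (\<Sum>r<L. monom (x (j, r)) r)" by (simp add: E_def smult_monom)
    thus ?thesis using jr sum_monom_zero_iff[of "\<lambda>r. x (j, r)" L] by auto
  qed
  from kmult_nonzero[OF H A this] zero have nz: "kmult d H A E 0 \<noteq> 0" by (metis not_gr_zero)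
  have "h + a + (L - 1) = d * (h + a)" using d0 by (cases d) (simp_all add: L_def)
  hence "degree (kmult d H A E 0) \<le> d * (degree H + a + 1)"
    using deg[of 0] by (simp add: h_def algebra_simps)
  from that[OF nz this zero] show ?thesis .
qed

text \<open>Here \<open>Y\<close> behaves like a \<open>d\<close>-th root of \<open>H\<close>, up to a constant, modulo \<open>x ^ w\<close>.\<close>

lemma kummer_order_bound:
  fixes H Y :: "'k::field poly"
  assumes H: "poly H \<rho> = 0" "poly (pderiv H) \<rho> \<noteq> 0"
    and Y: "monom 1 w dvd Y ^ d - smult \<kappa> H" and \<kappa>: "\<kappa> \<noteq> 0"
    and A: "\<exists>i<d. A i \<noteq> 0" and dA: "\<And>i. i < d \<Longrightarrow> degree (A i) \<le> a"
    and r: "r \<le> w" "r > d * (degree H + a + 1)"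
  shows "\<not> monom 1 r dvd (\<Sum>i<d. A i * Y ^ i)"
proof
  assume dvd: "monom 1 r dvd (\<Sum>i<d. A i * Y ^ i)"
  have H': "poly (smult \<kappa> H) \<rho> = 0" "poly (pderiv (smult \<kappa> H)) \<rho> \<noteq> 0"
    using H \<kappa> by (auto simp: pderiv_smult)
  obtain E where E: "kmult d (smult \<kappa> H) A E 0 \<noteq> 0"
    "degree (kmult d (smult \<kappa> H) A E 0) \<le> d * (degree (smult \<kappa> H) + a + 1)"
    "\<And>n. 0 < n \<Longrightarrow> n < d \<Longrightarrow> kmult d (smult \<kappa> H) A E n = 0"
    using kmult_cofactor[OF H' A dA] by blast
  have d0: "d > 0" using A by auto
  have sumE: "(\<Sum>n<d. kmult d (smult \<kappa> H) A E n * Y ^ n) = kmult d (smult \<kappa> H) A E 0"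
  proof -
    have "(\<Sum>n<d. kmult d (smult \<kappa> H) A E n * Y ^ n) = (\<Sum>n\<in>{0}. kmult d (smult \<kappa> H) A E n * Y ^ n)"
      using E(3) d0 by (intro sum.mono_neutral_right) auto
    thus ?thesis by simp
  qed
  have rw: "monom (1::'k) r dvd monom 1 w"
    using r by (simp add: monom_1_dvd_iff')
  \<comment> \<open>Modulo x ^ r the product with the cofactor \<open>E\<close> is the polynomial
    \<open>kmult d (smult \<kappa> H) A E 0\<close>. If x ^ r divided the sum, it would divide this
    nonzero polynomial, whose degree is below \<open>r\<close>.\<close>
  have "monom 1 r dvd (\<Sum>i<d. A i * Y ^ i) * (\<Sum>j<d. E j * Y ^ j) - (\<Sum>n<d. kmult d (smult \<kappa> H) A E n * Y ^ n)"
    by (rule dvd_trans[OF rw kmult_cong_dvd[OF Y]])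
  hence "monom 1 r dvd (\<Sum>i<d. A i * Y ^ i) * (\<Sum>j<d. E j * Y ^ j) - kmult d (smult \<kappa> H) A E 0"
    unfolding sumE .
  moreover have "monom 1 r dvd (\<Sum>i<d. A i * Y ^ i) * (\<Sum>j<d. E j * Y ^ j)"
    using dvd by (rule dvd_mult2)
  ultimately have "monom 1 r dvd (\<Sum>i<d. A i * Y ^ i) * (\<Sum>j<d. E j * Y ^ j)
      - ((\<Sum>i<d. A i * Y ^ i) * (\<Sum>j<d. E j * Y ^ j) - kmult d (smult \<kappa> H) A E 0)"
    by (rule dvd_diff[rotated])
  hence "monom 1 r dvd kmult d (smult \<kappa> H) A E 0"
    by (simp only: diff_diff_eq2 add_diff_cancel_left')
  hence "degree (monom (1::'k) r) \<le> degree (kmult d (smult \<kappa> H) A E 0)"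
    using E(1) by (intro dvd_imp_degree_le)
  moreover have "degree (smult \<kappa> H) = degree H" using \<kappa> by simp
  ultimately show False using E(2) r by (simp add: degree_monom_eq)
qed

section \<open>The Stepanov--Bombieri bound\<close>

lemma monom_dvd_mult_cancel:
  fixes q B :: "'k::field poly"
  assumes "monom 1 r dvd q * B" "poly q 0 \<noteq> 0"
  shows "monom 1 r dvd B"
proof (cases "B = 0")
  case False
  have m: "monom (1::'k) r = [:-0, 1:] ^ r" by (simp add: monom_altdef)
  have q0: "q \<noteq> 0" using assms by auto
  have "r \<le> order 0 (q * B)"
    using assms(1) False q0 unfolding m by (simp only: order_divides) simp
  also have "\<dots> = order 0 B"
    using False q0 assms(2) by (subst order_mult) (auto simp: order_0I)
  finally show ?thesis unfolding m using order_divides by blast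
qed auto

text \<open>A nonzero \<open>G t\<close> has order below \<open>r\<close> at 0, so its shifted copy
  has order in the window from \<open>e t\<close> to \<open>e t + r\<close>. The windows are
  disjoint, hence the term with the least \<open>e t\<close> cannot be cancelled.\<close>

lemma sum_monom_spaced_nonzero:
  fixes G :: "'t \<Rightarrow> 'k::field poly" and e :: "'t \<Rightarrow> nat"
  assumes T: "finite T" and G: "\<And>t. t \<in> T \<Longrightarrow> G t \<noteq> 0 \<Longrightarrow> \<not> monom 1 r dvd G t"
    and e: "\<And>t t'. t \<in> T \<Longrightarrow> t' \<in> T \<Longrightarrow> t \<noteq> t' \<Longrightarrow> e t + r \<le> e t' \<or> e t' + r \<le> e t"
    and ex: "\<exists>t\<in>T. G t \<noteq> 0"
  shows "(\<Sum>t\<in>T. monom 1 (e t) * G t) \<noteq> 0"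
proof
  assume 0: "(\<Sum>t\<in>T. monom 1 (e t) * G t) = 0"
  define t0 where "t0 = arg_min_on e {t \<in> T. G t \<noteq> 0}"
  have fin: "finite {t \<in> T. G t \<noteq> 0}" "{t \<in> T. G t \<noteq> 0} \<noteq> {}" using T ex by auto
  have t0: "t0 \<in> T" "G t0 \<noteq> 0"
    using arg_min_if_finite(1)[OF fin, of e] unfolding t0_def by auto
  have min: "e t0 \<le> e t" if "t \<in> T" "G t \<noteq> 0" for t
    using arg_min_least[OF fin, of t e] that unfolding t0_def by auto
  have r0: "r > 0"
    using G[OF t0] by (metis gr0I is_unit_triv monom_0 one_dvd one_pCons)
  have "monom 1 (e t0 + r) dvd (\<Sum>t\<in>T - {t0}. monom 1 (e t) * G t)"
  proof (rule dvd_sum)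
    fix t assume t: "t \<in> T - {t0}"
    show "monom 1 (e t0 + r) dvd monom 1 (e t) * G t"
    proof (cases "G t = 0")
      case False
      hence "e t0 + r \<le> e t" using e[OF t0(1), of t] min[of t] t r0 by auto
      hence "monom (1::'k) (e t0 + r) dvd monom 1 (e t)" by (simp add: monom_1_dvd_iff')
      thus ?thesis by (rule dvd_mult2)
    qed auto
  qed
  moreover have "monom 1 (e t0) * G t0 = - (\<Sum>t\<in>T - {t0}. monom 1 (e t) * G t)"
    using 0 T t0 by (simp add: sum.remove add_eq_0_iff2)
  ultimately have "monom 1 (e t0 + r) dvd monom 1 (e t0) * G t0" by simp
  hence "monom 1 (e t0) * monom 1 r dvd monom 1 (e t0) * G t0" by (simp add: mult_monom)
  hence "monom 1 r dvd G t0" by (subst (asm) dvd_mult_cancel_left) auto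
  thus False using G[OF t0] by blast
qed

lemma poly_family_dependent:
  fixes Z :: "'i \<Rightarrow> 'k::field poly"
  assumes I: "finite I" and deg: "\<And>i. i \<in> I \<Longrightarrow> degree (Z i) \<le> D" and card: "D + 1 < card I"
  obtains y where "\<exists>i\<in>I. y i \<noteq> 0" "(\<Sum>i\<in>I. smult (y i) (Z i)) = 0"
proof -
  have "card {..D} < card I" using card by simp
  from homogeneous_system_nontrivial[OF _ I this, of "\<lambda>t i. coeff (Z i) t"]
  obtain y where y: "\<exists>i\<in>I. y i \<noteq> 0" "\<forall>t\<in>{..D}. (\<Sum>i\<in>I. coeff (Z i) t * y i) = 0" by blast
  have "(\<Sum>i\<in>I. smult (y i) (Z i)) = 0"
  proof (rule poly_eqI)
    fix t
    show "coeff (\<Sum>i\<in>I. smult (y i) (Z i)) t = coeff 0 t"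
    proof (cases "t \<le> D")
      case True
      thus ?thesis using y(2) by (simp add: coeff_sum mult.commute)
    next
      case False
      have "coeff (Z i) t = 0" if "i \<in> I" for i
        using deg[OF that] False by (intro coeff_eq_0) auto
      thus ?thesis by (simp add: coeff_sum)
    qed
  qed
  thus ?thesis using that y(1) by blast
qed

section \<open>Partial traces of u / x + v x and their exponents at the place 0\<close>

context pchar
begin

text \<open>The first \<open>a\<close> terms of the absolute trace of u / x + v x, multiplied by x ^
  (p ^ a) to clear the denominators.\<close>

definition stepV :: "'k \<Rightarrow> 'k \<Rightarrow> nat \<Rightarrow> 'k poly" where
  "stepV u v a = (\<Sum>i<a. monom (u ^ (p ^ i)) (p ^ a - p ^ i) + monom (v ^ (p ^ i)) (p ^ a + p ^ i))"

lemma poly_stepV: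
  assumes "x \<noteq> 0"
  shows "poly (stepV u v a) x = x ^ (p ^ a) * (\<Sum>i<a. (u / x + v * x) ^ (p ^ i))"
  unfolding stepV_def poly_sum sum_distrib_left
proof (intro sum.cong refl)
  fix i assume "i \<in> {..<a}"
  hence le: "p ^ i \<le> p ^ a" using p1 by (intro power_increasing) auto
  have "x ^ (p ^ a) = x ^ (p ^ a - p ^ i) * x ^ (p ^ i)" using le by (simp flip: power_add)
  thus "poly (monom (u ^ (p ^ i)) (p ^ a - p ^ i) + monom (v ^ (p ^ i)) (p ^ a + p ^ i)) x
      = x ^ (p ^ a) * (u / x + v * x) ^ (p ^ i)"
    using assms by (simp add: poly_monom frob_add power_divide power_mult_distrib power_add field_simps)
qed

lemma degree_stepV: "degree (stepV u v a) \<le> 2 * p ^ a"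
  unfolding stepV_def
proof (intro degree_sum_le)
  fix i assume "i \<in> {..<a}"
  hence le: "p ^ i \<le> p ^ a" using p1 by (intro power_increasing) auto
  show "degree (monom (u ^ (p ^ i)) (p ^ a - p ^ i) + monom (v ^ (p ^ i)) (p ^ a + p ^ i)) \<le> 2 * p ^ a"
    using le by (intro degree_add_le order.trans[OF degree_monom_le]) auto
qed auto

text \<open>The pole of highest order comes from the last summand, where u / x is raised to p ^ (a -
  1). This is where \<open>u \<noteq> 0\<close> enters: the exact order of vanishing makes the
  powers of \<open>stepV\<close> distinguishable at 0.\<close>

lemma stepV_factor:
  assumes "u \<noteq> 0" "a > 0"
  obtains V where "stepV u v a = monom 1 (p ^ a - p ^ (a - 1)) * V" "poly V 0 \<noteq> 0"
proof -
  define V where "V = (\<Sum>i<a. monom (u ^ (p ^ i)) (p ^ (a - 1) - p ^ i) + monom (v ^ (p ^ i)) (p ^ (a - 1) + p ^ i))"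
  have le: "p ^ i \<le> p ^ (a - 1)" "p ^ (a - 1) \<le> p ^ a" if "i < a" for i
    using p1 that by (auto intro!: power_increasing)
  have "stepV u v a = monom 1 (p ^ a - p ^ (a - 1)) * V"
    unfolding stepV_def V_def sum_distrib_left
    by (intro sum.cong refl) (use le in \<open>auto simp: distrib_left mult_monom\<close>)
  moreover have "poly V 0 = (\<Sum>i<a. if i = a - 1 then u ^ (p ^ i) else 0)"
    unfolding V_def poly_sum
  proof (intro sum.cong refl)
    fix i assume i: "i \<in> {..<a}"
    have "p ^ i < p ^ (a - 1)" if "i \<noteq> a - 1" using that i p1 by (intro power_strict_increasing) auto
    thus "poly (monom (u ^ (p ^ i)) (p ^ (a - 1) - p ^ i) + monom (v ^ (p ^ i)) (p ^ (a - 1) + p ^ i)) 0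
      = (if i = a - 1 then u ^ (p ^ i) else 0)"
      using p1 by (auto simp: poly_monom power_0_left)
  qed
  hence "poly V 0 = u ^ (p ^ (a - 1))" using assms(2) by simp
  ultimately show ?thesis using that assms(1) by auto
qed

text \<open>The exponents occurring at the place \<open>0\<close> are well separated, because \<open>p\<close> and \<open>d\<close> are coprime.\<close>

lemma stepanov_spacing:
  fixes d :: nat
  assumes d: "d > 0" "\<not> p dvd d" "d dvd p ^ a - 1" and a: "a > 0"
    and big: "d * p * (r + 1) \<le> p ^ a"
    and e: "\<And>i j k. e (i, j, k) = i * (p ^ a - (p ^ a - 1) div d) + k * p ^ a + j * (p ^ a - p ^ (a - 1))"
    and t: "t \<in> {..<d} \<times> {..<p} \<times> {..<m}" "t' \<in> {..<d} \<times> {..<p} \<times> {..<m}" "t \<noteq> t'"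
  shows "e t + r \<le> e t' \<or> e t' + r \<le> (e t :: nat)"
proof -
  define w where "w = p ^ a"
  obtain s where s: "p ^ a - 1 = d * s" using d(3) by (elim dvdE)
  have w: "w = d * s + 1" using s p1 unfolding w_def by (metis Suc_eq_plus1 Suc_pred' less_imp_le_nat one_le_power order_less_le_trans zero_less_one diff_add_inverse2 le_add_diff_inverse2 less_nat_zero_code not_gr_zero power_eq_0_iff)
  define w' where "w' = p ^ (a - 1)"
  have ww: "w = p * w'" using a by (cases a) (auto simp: w_def w'_def)
  obtain i j k i' j' k' where tt: "t = (i, j, k)" "t' = (i', j', k')" by (metis prod_cases3)
  have b: "i < d" "i' < d" "j < p" "j' < p" using t tt by auto
  \<comment> \<open>Relative to \<open>w\<close>, the exponent weighs i, j, k by about 1 - 1/d, 1 -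
    1/p and 1. \<open>nu\<close> is this combination with the denominators cleared by
    \<open>d * p\<close>; the exact difference is the term \<open>p * i\<close> in
    \<open>E\<close>.\<close>
  define nu :: "nat \<Rightarrow> nat \<Rightarrow> nat \<Rightarrow> int" where
    "nu = (\<lambda>i j k. int p * (int d - 1) * int i + int d * (int p - 1) * int j + int d * int p * int k)"
  have E: "int d * int p * int (e (i, j, k)) = int w * nu i j k + int p * int i" for i j k
  proof -
    have "w - (w - 1) div d = w - s" using w d by simp
    have "s \<le> d * s" using d by simp
    hence "s \<le> w" using w by linarith
    hence "int (w - s) = int w - int s" by simp
    moreover have "int (w - w') = int w - int w'" using ww p1 by (simp add: of_nat_diff)
    ultimately have e': "int (e (i, j, k)) = int i * (int w - int s) + int k * int w + int j * (int w - int w')"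
      using e[of i j k] \<open>w - (w - 1) div d = w - s\<close> unfolding w_def[symmetric] w'_def[symmetric] by simp
    have ds: "int d * int s = int w - 1" using w by simp
    have pw: "int p * int w' = int w" using ww by simp
    have "int d * int p * int (e (i, j, k)) = int d * int p * int i * int w - int p * int i * (int d * int s)
        + int d * int p * int k * int w + int d * int p * int j * int w - int d * int j * (int p * int w')"
      unfolding e' by (simp add: algebra_simps)
    thus ?thesis unfolding ds pw nu_def by (simp add: algebra_simps)
  qed
  \<comment> \<open>Modulo p the value is -d * j and modulo d it is -p * i, so coprimality recovers
    j and i, and then k.\<close>
  have "nu i j k \<noteq> nu i' j' k'"
  proof
    assume eq: "nu i j k = nu i' j' k'"
    have cop: "coprime (int p) (int d)"
      using d p by (simp add: prime_imp_coprime)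
    have "int p dvd int d * (int j - int j')"
    proof -
      have "int d * (int j - int j') = int p * ((int d - 1) * (int i - int i') + int d * (int j - int j') + int d * (int k - int k'))"
        using eq unfolding nu_def by (simp add: algebra_simps)
      thus ?thesis by (metis dvd_triv_left)
    qed
    hence "int p dvd int j - int j'" using cop by (simp add: coprime_dvd_mult_right_iff)
    hence j: "j = j'" using b by (metis mod_eq_dvd_iff mod_less zmod_int of_nat_eq_iff)
    have "int d dvd int p * (int i - int i')"
    proof -
      have "int p * (int i - int i') = int d * (int p * (int i - int i') + (int p - 1) * (int j - int j') + int p * (int k - int k'))"
        using eq unfolding nu_def by (simp add: algebra_simps)
      thus ?thesis by (metis dvd_triv_left)
    qed
    hence "int d dvd int i - int i'" using cop by (simp add: coprime_dvd_mult_right_iff coprime_commute)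
    hence i: "i = i'" using b by (metis mod_eq_dvd_iff mod_less zmod_int of_nat_eq_iff)
    have "k = k'" using eq i j d p1 unfolding nu_def by simp
    thus False using i j t(3) tt by simp
  qed
  hence nu1: "nu i j k + 1 \<le> nu i' j' k' \<or> nu i' j' k' + 1 \<le> nu i j k" by linarith
  \<comment> \<open>Distinct integers \<open>nu\<close> differ by at least 1, so the exponents
    differ by \<open>w / (d * p)\<close> up to a loss of at most 1, which is why the hypothesis on p
    ^ a has \<open>r + 1\<close>.\<close>
  have gap: "int (e (i1, j1, k1)) + int r \<le> int (e (i2, j2, k2))"
    if "nu i1 j1 k1 + 1 \<le> nu i2 j2 k2" "i1 < d" for i1 j1 k1 i2 j2 k2
  proof -
    have "int w * (nu i1 j1 k1 + 1) \<le> int w * nu i2 j2 k2" using that by (intro mult_left_mono) auto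
    hence "int d * int p * int (e (i1, j1, k1)) + int w - int p * int i1 \<le> int d * int p * int (e (i2, j2, k2))"
      unfolding E by (simp add: algebra_simps add_increasing)
    moreover have "int p * int i1 \<le> int p * int d" using that by (intro mult_left_mono) auto
    moreover have "int d * int p * (int r + 1) \<le> int w" using big unfolding w_def[symmetric]
      by (metis of_nat_1 of_nat_add of_nat_le_iff of_nat_mult)
    ultimately have "int d * int p * (int (e (i1, j1, k1)) + int r) \<le> int d * int p * int (e (i2, j2, k2))"
      by (simp add: algebra_simps)
    thus ?thesis using d p1 by simp
  qed
  show ?thesis using nu1 gap[of i j k i' j' k'] gap[of i' j' k' i j k] b unfolding tt by linarith
qed

end

section \<open>The auxiliary polynomial and its nonvanishing\<close>

context pchar
begin

text \<open>For positive d dividing p ^ a - 1, d times this exponent is (d - 1) * p ^ a + 1. Thus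
  \<open>H ^ stepE d a\<close> is a d-th root of \<open>H\<close> up to a p ^ a-th power, and at a
  point with prescribed power residue its p ^ b-th power collapses to low degree.\<close>

definition stepE :: "nat \<Rightarrow> nat \<Rightarrow> nat" where
  "stepE d a = p ^ a - (p ^ a - 1) div d"

lemma stepE_mult:
  assumes "d dvd p ^ a - 1"
  shows "d * stepE d a + (p ^ a - 1) = d * p ^ a"
proof -
  have "d * ((p ^ a - 1) div d) = p ^ a - 1" using assms by simp
  moreover have "d * ((p ^ a - 1) div d) \<le> d * p ^ a"
    by (intro mult_le_mono2 order.trans[OF div_le_dividend]) simp
  ultimately show ?thesis unfolding stepE_def right_diff_distrib' by linarith
qed

text \<open>Exponents of, in this order, x ^ stepE, \<open>stepV\<close>, x ^ (p ^ a), H ^ stepE and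
  x. The first three are told apart by orders at 0, the last two by the Kummer bound.\<close>

definition step_index :: "nat \<Rightarrow> nat \<Rightarrow> nat \<Rightarrow> ((nat \<times> nat \<times> nat) \<times> nat \<times> nat) set" where
  "step_index d m l = ({..<d} \<times> {..<p} \<times> {..<m}) \<times> {..<d} \<times> {..<l}"

definition step_fun :: "'k poly \<Rightarrow> 'k \<Rightarrow> 'k \<Rightarrow> nat \<Rightarrow> nat \<Rightarrow> nat \<Rightarrow> nat \<Rightarrow>
    ((nat \<times> nat \<times> nat) \<times> nat \<times> nat \<Rightarrow> 'k) \<Rightarrow> 'k poly" where
  "step_fun H u v a d m l c = (\<Sum>((i, j, k), i', r) \<in> step_index d m l.
     monom (c ((i, j, k), i', r)) (r + i * stepE d a + k * p ^ a) * stepV u v a ^ j * (H ^ stepE d a) ^ i')"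

text \<open>For a fixed \<open>(i, j, k)\<close> the inner sum over powers of H ^ stepE has order
  below \<open>r\<close> at 0 by \<open>kummer_order_bound\<close>, and the triples shift these
  orders into disjoint windows.\<close>

lemma step_fun_nonzero:
  assumes H: "poly H \<rho> = 0" "poly (pderiv H) \<rho> \<noteq> 0" "poly H 0 \<noteq> 0"
    and u: "u \<noteq> 0" and a: "a > 0"
    and d: "d > 0" "\<not> p dvd d" "d dvd p ^ a - 1"
    and big: "d * p * (d * (degree H + l) + 2) \<le> p ^ a"
    and c: "\<exists>t\<in>step_index d m l. c t \<noteq> 0"
  shows "step_fun H u v a d m l c \<noteq> 0"
proof -
  define w where "w = p ^ a"
  define Y where "Y = H ^ stepE d a"
  obtain V where V: "stepV u v a = monom 1 (p ^ a - p ^ (a - 1)) * V" "poly V 0 \<noteq> 0"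
    using stepV_factor[OF u a] .
  define T where "T = {..<d} \<times> {..<p} \<times> {..<m}"
  define A where "A = (\<lambda>t i'. \<Sum>r<l. monom (c (t, i', r)) r)"
  define e where "e = (\<lambda>(i, j, k). i * (p ^ a - (p ^ a - 1) div d) + k * p ^ a + j * (p ^ a - p ^ (a - 1)))"
  define G where "G = (\<lambda>t. V ^ (fst (snd t)) * (\<Sum>i'<d. A t i' * Y ^ i'))"
  define r where "r = d * (degree H + l) + 1"
  have finT: "finite T" by (simp add: T_def)
  have eq: "step_fun H u v a d m l c = (\<Sum>t\<in>T. monom 1 (e t) * G t)"
  proof -
    have "step_fun H u v a d m l c = (\<Sum>t\<in>T. \<Sum>i'<d. \<Sum>s<l. case t of (i, j, k) \<Rightarrow>
      monom (c ((i, j, k), i', s)) (s + i * stepE d a + k * p ^ a) * stepV u v a ^ j * (H ^ stepE d a) ^ i')"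
      unfolding step_fun_def step_index_def T_def
      by (simp add: sum.cartesian_product case_prod_unfold)
    also have "\<dots> = (\<Sum>t\<in>T. monom 1 (e t) * G t)"
    proof (rule sum.cong[OF refl])
      fix t assume "t \<in> T"
      obtain i j k where t: "t = (i, j, k)" by (metis prod_cases3)
      have "monom 1 (e t) * G t = (\<Sum>i'<d. \<Sum>s<l. monom 1 (e t) * (V ^ j * (monom (c (t, i', s)) s * Y ^ i')))"
        unfolding G_def A_def t by (simp add: sum_distrib_left sum_distrib_right)
      also have "\<dots> = (\<Sum>i'<d. \<Sum>s<l. case t of (i, j, k) \<Rightarrow>
         monom (c ((i, j, k), i', s)) (s + i * stepE d a + k * p ^ a) * stepV u v a ^ j * (H ^ stepE d a) ^ i')"
      proof (intro sum.cong refl)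
        fix i' s
        have "monom 1 (e t) * monom (c (t, i', s)) s
            = monom (c (t, i', s)) (s + i * stepE d a + k * p ^ a) * monom 1 (p ^ a - p ^ (a - 1)) ^ j"
          unfolding t e_def stepE_def by (simp add: mult_monom monom_power algebra_simps)
        thus "monom 1 (e t) * (V ^ j * (monom (c (t, i', s)) s * Y ^ i')) = (case t of (i, j, k) \<Rightarrow>
          monom (c ((i, j, k), i', s)) (s + i * stepE d a + k * p ^ a) * stepV u v a ^ j * (H ^ stepE d a) ^ i')"
          unfolding t Y_def V(1) power_mult_distrib by (simp add: mult_ac)
      qed
      finally show "(\<Sum>i'<d. \<Sum>s<l. case t of (i, j, k) \<Rightarrow>
         monom (c ((i, j, k), i', s)) (s + i * stepE d a + k * p ^ a) * stepV u v a ^ j * (H ^ stepE d a) ^ i')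
         = monom 1 (e t) * G t" ..
    qed
    finally show ?thesis .
  qed
  \<comment> \<open>\<open>Y ^ d\<close> is \<open>(H ^ w) ^ (d - 1) * H\<close>, and Frobenius
    gives H ^ w = H(0) ^ w modulo x ^ w. So the first factor becomes the constant required by the
    Kummer bound.\<close>
  have Yd: "monom 1 w dvd Y ^ d - smult ((poly H 0) ^ (w * (d - 1))) H"
  proof -
    have "d * stepE d a + (w - 1) = d * w" using stepE_mult[OF d(3)] by (simp add: w_def)
    moreover have "d * w = w * (d - 1) + w" using d by (cases d) auto
    moreover have "w \<ge> 1" using p1 by (simp add: w_def)
    ultimately have E: "d * stepE d a = w * (d - 1) + 1" by linarith
    have YE: "Y ^ d = (H ^ w) ^ (d - 1) * H"
      unfolding Y_def power_mult[symmetric] mult.commute[of "stepE d a"] E by (simp add: power_add power_mult)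
    have m: "monom (1::'k) w = [:-0, 1:] ^ w" by (simp add: monom_altdef)
    have "[:-0, 1:] dvd H - [:poly H 0:]" by (simp only: poly_eq_0_iff_dvd[symmetric]) simp
    hence "monom 1 w dvd (H - [:poly H 0:]) ^ w" unfolding m by (rule dvd_power_same)
    moreover have "(H - [:poly H 0:]) ^ w = H ^ w - [:poly H 0:] ^ w"
    proof -
      have CHp: "CHAR('k poly) = p" using CHAR by simp
      have "(H - [:poly H 0:] + [:poly H 0:]) ^ w = (H - [:poly H 0:]) ^ w + [:poly H 0:] ^ w"
        using freshmans_dream'[where 'a="'k poly", of w a] p CHp unfolding w_def by blast
      thus ?thesis by simp
    qed
    ultimately have "monom 1 w dvd H ^ w - [:poly H 0:] ^ w" by simp
    also have "H ^ w - [:poly H 0:] ^ w dvd (H ^ w) ^ (d - 1) - ([:poly H 0:] ^ w) ^ (d - 1)"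
    proof (cases "d - 1 = 0")
      case False
      then show ?thesis by (metis dvd_triv_left power_diff_sumr2)
    qed auto
    finally have "monom 1 w dvd ((H ^ w) ^ (d - 1) - ([:poly H 0:] ^ w) ^ (d - 1)) * H" by (rule dvd_mult2)
    also have "((H ^ w) ^ (d - 1) - ([:poly H 0:] ^ w) ^ (d - 1)) * H = Y ^ d - smult ((poly H 0) ^ (w * (d - 1))) H"
      unfolding YE by (simp add: left_diff_distrib power_mult poly_const_pow)
    finally show ?thesis .
  qed
  have dA: "degree (A t i') \<le> l - 1" for t i'
    unfolding A_def by (intro degree_sum_le) (auto intro!: order.trans[OF degree_monom_le])
  have l0: "l > 0" using c by (auto simp: step_index_def)
  have nd: "\<not> monom 1 r dvd (\<Sum>i'<d. A t i' * Y ^ i')" if "\<exists>i'<d. A t i' \<noteq> 0" for t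
  proof (rule kummer_order_bound[OF H(1,2) Yd])
    show "(poly H 0) ^ (w * (d - 1)) \<noteq> 0" using H by simp
    show "r \<le> w"
    proof -
      have "1 * (d * (degree H + l) + 2) \<le> d * p * (d * (degree H + l) + 2)"
        using d p1 by (intro mult_right_mono) auto
      from order.trans[OF this big] show ?thesis unfolding r_def w_def by simp
    qed
    show "d * (degree H + (l - 1) + 1) < r" using l0 by (simp add: r_def)
    show "degree (A t i) \<le> l - 1" if "i < d" for i by (rule dA)
    show "\<exists>i'<d. A t i' \<noteq> 0" by (rule that)
  qed
  have "(\<Sum>t\<in>T. monom 1 (e t) * G t) \<noteq> 0"
  proof (rule sum_monom_spaced_nonzero[where G = G and r = r and e = e, OF finT])
    show "\<not> monom 1 r dvd G t" if "t \<in> T" "G t \<noteq> 0" for t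
    proof
      assume "monom 1 r dvd G t"
      hence "monom 1 r dvd (\<Sum>i'<d. A t i' * Y ^ i')"
        unfolding G_def by (rule monom_dvd_mult_cancel) (simp add: V(2))
      moreover have "\<exists>i'<d. A t i' \<noteq> 0"
      proof (rule ccontr)
        assume "\<not> ?thesis"
        hence "(\<Sum>i'<d. A t i' * Y ^ i') = 0" by (intro sum.neutral) auto
        thus False using that(2) unfolding G_def by simp
      qed
      ultimately show False using nd by blast
    qed
    show "e t + r \<le> e t' \<or> e t' + r \<le> e t" if "t \<in> T" "t' \<in> T" "t \<noteq> t'" for t t'
    proof (rule stepanov_spacing[OF d a _ _ that(1)[unfolded T_def] that(2)[unfolded T_def] that(3)])
      show "d * p * (r + 1) \<le> p ^ a" using big by (simp add: r_def)
      show "e (i, j, k) = i * (p ^ a - (p ^ a - 1) div d) + k * p ^ a + j * (p ^ a - p ^ (a - 1))" for i j k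
        by (simp add: e_def)
    qed
    show "\<exists>t\<in>T. G t \<noteq> 0"
    proof -
      obtain t i' s where t: "t \<in> T" "i' < d" "s < l" "c (t, i', s) \<noteq> 0"
        using c by (auto simp: step_index_def T_def)
      have "A t i' \<noteq> 0" using t sum_monom_zero_iff[of "\<lambda>s. c (t, i', s)" l] by (auto simp: A_def)
      hence "\<not> monom 1 r dvd (\<Sum>i'<d. A t i' * Y ^ i')" using nd t by blast
      hence "(\<Sum>i'<d. A t i' * Y ^ i') \<noteq> 0" by auto
      moreover have "V \<noteq> 0" using V(2) by auto
      ultimately show ?thesis using t by (intro bexI[of _ t]) (auto simp: G_def)
    qed
  qed
  thus ?thesis using eq by simp
qed

lemma degree_step_fun:
  assumes l: "l \<le> p ^ a" and d: "d > 0"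
  shows "degree (step_fun H u v a d m l c) \<le> p ^ a * (m + d + 2 * p + d * degree H)"
  unfolding step_fun_def
proof (intro degree_sum_le)
  show "finite (step_index d m l)" by (simp add: step_index_def)
  fix t assume t: "t \<in> step_index d m l"
  obtain i j k i' r where tt: "t = ((i, j, k), i', r)" by (metis surj_pair)
  have b: "i < d" "j < p" "k < m" "i' < d" "r < l" using t tt by (auto simp: step_index_def)
  define w where "w = p ^ a"
  have sE: "stepE d a \<le> w" by (simp add: stepE_def w_def)
  have "degree (monom (c t) (r + i * stepE d a + k * p ^ a) * stepV u v a ^ j * (H ^ stepE d a) ^ i')
     \<le> (r + i * stepE d a + k * w) + j * (2 * w) + i' * (stepE d a * degree H)"
  proof (intro order.trans[OF degree_mult_le] add_mono)
    show "degree (monom (c t) (r + i * stepE d a + k * p ^ a)) \<le> r + i * stepE d a + k * w"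
      unfolding w_def by (rule degree_monom_le)
    show "degree (stepV u v a ^ j) \<le> j * (2 * w)"
      using order.trans[OF degree_power_le mult_le_mono1[OF degree_stepV[of u v a], of j]] unfolding w_def
      by (simp add: mult.commute)
    show "degree ((H ^ stepE d a) ^ i') \<le> i' * (stepE d a * degree H)"
      using degree_power_le[of H "stepE d a * i'"] unfolding power_mult by (simp add: mult_ac)
  qed
  also have "\<dots> \<le> (w + (d - 1) * w + (m - 1) * w) + p * (2 * w) + d * (w * degree H)"
  proof (intro add_mono mult_mono)
    show "r \<le> w" using b l by (simp add: w_def)
  qed (use b sE in auto)
  also have "\<dots> \<le> w * (m + d + 2 * p + d * degree H)"
    using d b by (cases d; cases m) (auto simp: algebra_simps)
  finally show "degree (case t of (x, xa) \<Rightarrow> (case x of (i, j, k) \<Rightarrow> \<lambda>(i', r). monom (c ((i, j, k), i', r)) (r + i * stepE d a + k * p ^ a) *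
                 stepV u v a ^ j * (H ^ stepE d a) ^ i') xa) \<le> p ^ a * (m + d + 2 * p + d * degree H)"
    by (simp add: tt w_def)
qed


section \<open>Evaluation on a class of points and the resulting count\<close>

definition stepU :: "'k \<Rightarrow> 'k \<Rightarrow> 'k \<Rightarrow> nat \<Rightarrow> 'k poly" where
  "stepU u v \<tau> b = monom \<tau> (p ^ b) - stepV u v b"

definition step_good :: "'k poly \<Rightarrow> 'k \<Rightarrow> 'k \<Rightarrow> nat \<Rightarrow> nat \<Rightarrow> 'k \<Rightarrow> 'k \<Rightarrow> 'k \<Rightarrow> 'k set" where
  "step_good H u v d n z1 z2 \<tau> = {x \<in> FF (p ^ n). x \<noteq> 0 \<and> x ^ ((p ^ n - 1) div d) = z1 \<and>
     poly H x ^ ((p ^ n - 1) div d) = z2 \<and> (\<Sum>i<n. (u / x + v * x) ^ (p ^ i)) = \<tau>}"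

text \<open>With A = (p ^ a - 1) / d and B = (p ^ b - 1) / d the residue exponent is A * p ^ b + B,
  while (stepE + A) * p ^ b = p ^ (a + b). As y ^ (p ^ (a + b)) = y, a huge exponent drops to 1 + B;
  this is the gain of the method.\<close>

lemma stepE_power:
  fixes y z :: 'k
  assumes y: "y ^ (p ^ (a + b)) = y" "y ^ ((p ^ (a + b) - 1) div d) = z" "z \<noteq> 0"
    and d: "d dvd p ^ a - 1" "d dvd p ^ b - 1"
  shows "(y ^ stepE d a) ^ (p ^ b) = inverse z * y ^ (1 + (p ^ b - 1) div d)"
proof -
  define A B where "A = (p ^ a - 1) div d" and "B = (p ^ b - 1) div d"
  have A: "p ^ a = d * A + 1" and B: "p ^ b = d * B + 1"
    using d p1 by (auto simp: A_def B_def)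
  have "p ^ (a + b) - 1 = d * (A * p ^ b + B)"
    unfolding power_add using A B by (simp add: algebra_simps)
  moreover have "d = 0 \<Longrightarrow> A = 0 \<and> B = 0" by (simp add: A_def B_def)
  ultimately have AB: "(p ^ (a + b) - 1) div d = A * p ^ b + B" by (cases "d = 0") auto
  have "A \<le> p ^ a" unfolding A_def by (intro order.trans[OF div_le_dividend]) simp
  hence "stepE d a * p ^ b + A * p ^ b = p ^ (a + b)"
    unfolding stepE_def A_def[symmetric] by (simp add: power_add flip: distrib_right)
  hence "stepE d a * p ^ b + (A * p ^ b + B) = p ^ (a + b) + B" by simp
  hence "y ^ (stepE d a * p ^ b + (A * p ^ b + B)) = y ^ (p ^ (a + b) + B)" by (rule arg_cong)
  hence "(y ^ stepE d a) ^ (p ^ b) * y ^ (A * p ^ b + B) = y ^ (p ^ (a + b)) * y ^ B"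
    by (simp only: power_add[of y] power_mult[of y])
  hence "(y ^ stepE d a) ^ (p ^ b) * z = y * y ^ B"
    using y AB by simp
  thus ?thesis using y(3) by (simp add: field_simps B_def)
qed

text \<open>The p ^ b-th power moves the first \<open>a\<close> terms of the trace to the last
  \<open>a\<close>; since the full trace is \<tau>, they equal \<tau> minus the first
  \<open>b\<close> terms, which is what \<open>stepU\<close> encodes. The factor x ^ (p ^ b) clears
  its denominators.\<close>

lemma stepV_power:
  assumes x: "x \<in> FF (p ^ (a + b))" "x \<noteq> 0" and \<tau>: "(\<Sum>i<a+b. (u / x + v * x) ^ (p ^ i)) = \<tau>"
  shows "poly (stepV u v a) x ^ (p ^ b) * x ^ (p ^ b) = x * poly (stepU u v \<tau> b) x"
proof -
  define g where "g = u / x + v * x"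
  have "poly (stepV u v a) x ^ (p ^ b) = x ^ (p ^ (a + b)) * (\<Sum>i<a. g ^ (p ^ i)) ^ (p ^ b)"
    unfolding poly_stepV[OF x(2)] g_def[symmetric] by (simp add: power_mult_distrib power_add flip: power_mult)
  also have "x ^ (p ^ (a + b)) = x" using x by (simp add: FF_def)
  also have "(\<Sum>i<a. g ^ (p ^ i)) ^ (p ^ b) = (\<Sum>i<a. g ^ (p ^ (b + i)))"
    unfolding frob_sum by (simp add: power_add mult.commute flip: power_mult)
  also have "\<dots> = \<tau> - (\<Sum>i<b. g ^ (p ^ i))"
  proof -
    have "\<tau> = (\<Sum>i<b+a. g ^ (p ^ i))" using \<tau> by (simp add: g_def add.commute)
    also have "\<dots> = (\<Sum>i<b. g ^ (p ^ i)) + (\<Sum>i<a. g ^ (p ^ (b + i)))"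
      by (induction a) (simp_all add: algebra_simps)
    finally show ?thesis by simp
  qed
  finally have V: "poly (stepV u v a) x ^ (p ^ b) = x * (\<tau> - (\<Sum>i<b. g ^ (p ^ i)))" .
  hence "poly (stepV u v a) x ^ (p ^ b) * x ^ (p ^ b) = x * (\<tau> - (\<Sum>i<b. g ^ (p ^ i))) * x ^ (p ^ b)"
    by (simp only:)
  also have "\<dots> = x * poly (stepU u v \<tau> b) x"
    unfolding stepU_def poly_diff poly_stepV[OF x(2)] g_def[symmetric]
    by (simp add: poly_monom algebra_simps)
  finally show ?thesis .
qed

text \<open>The value on a class of the p ^ b-th power of a monomial of \<open>step_fun\<close>,
  times x ^ (p ^ b * (p - 1)). Each of the \<open>j\<close> factors \<open>stepV\<close> uses up one
  x ^ (p ^ b) for its denominators; the other p - 1 - j remain in the exponent of x.\<close>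

definition step_aux :: "'k poly \<Rightarrow> 'k \<Rightarrow> 'k \<Rightarrow> nat \<Rightarrow> nat \<Rightarrow> 'k \<Rightarrow> 'k \<Rightarrow> 'k \<Rightarrow>
    (nat \<times> nat \<times> nat) \<times> nat \<times> nat \<Rightarrow> 'k poly" where
  "step_aux H u v b d z1 z2 \<tau> = (\<lambda>((i, j, k), i', r).
     monom (inverse z1 ^ i * inverse z2 ^ i') (r * p ^ b + i * (1 + (p ^ b - 1) div d) + k + j + p ^ b * (p - 1 - j))
     * H ^ (i' * (1 + (p ^ b - 1) div d)) * stepU u v \<tau> b ^ j)"

text \<open>The p ^ b-th power is additive, and each factor collapses on the class. Vanishing on the
  whole class thus follows from a single polynomial identity of low degree that is linear in y = c ^
  (p ^ b).\<close>

lemma step_fun_at_good: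
  assumes d: "d dvd p ^ a - 1" "d dvd p ^ b - 1"
    and HF: "\<And>x. x \<in> FF (p ^ (a + b)) \<Longrightarrow> poly H x \<in> FF (p ^ (a + b))"
    and z: "z1 \<noteq> 0" "z2 \<noteq> 0"
    and x: "x \<in> step_good H u v d (a + b) z1 z2 \<tau>"
    and y: "\<And>t. c t ^ (p ^ b) = y t"
  shows "poly (step_fun H u v a d m l c) x ^ (p ^ b) * x ^ (p ^ b * (p - 1))
    = poly (\<Sum>t\<in>step_index d m l. smult (y t) (step_aux H u v b d z1 z2 \<tau> t)) x"
proof -
  have x': "x \<in> FF (p ^ (a + b))" "x \<noteq> 0" "x ^ ((p ^ (a + b) - 1) div d) = z1"
     "poly H x ^ ((p ^ (a + b) - 1) div d) = z2" "(\<Sum>i<a+b. (u / x + v * x) ^ (p ^ i)) = \<tau>"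
    using x by (auto simp: step_good_def)
  have H': "poly H x ^ (p ^ (a + b)) = poly H x" using HF[OF x'(1)] by (simp add: FF_def)
  have X: "x ^ (p ^ (a + b)) = x" using x'(1) by (simp add: FF_def)
  define f where "f = 1 + (p ^ b - 1) div d"
  note E1 = stepE_power[OF X x'(3) z(1) d, folded f_def]
  note E2 = stepE_power[OF H' x'(4) z(2) d, folded f_def]
  note E3 = stepV_power[OF x'(1,2,5)]
  have E4: "(x ^ (p ^ a)) ^ (p ^ b) = x" using X by (simp add: power_add power_mult)
  show ?thesis
    unfolding step_fun_def poly_sum frob_sum sum_distrib_right
  proof (rule sum.cong[OF refl])
    fix t assume t: "t \<in> step_index d m l"
    obtain i j k i' r where tt: "t = ((i, j, k), i', r)" by (metis surj_pair)
    have j: "j < p" using t tt by (auto simp: step_index_def)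
    define P where "P = p ^ b"
    define V where "V = poly (stepV u v a) x"
    define W where "W = poly (stepU u v \<tau> b) x"
    have E3': "V ^ P * x ^ P = x * W" using E3 by (simp add: P_def V_def W_def)
    have xp: "x ^ (P * (p - 1)) = (x ^ P) ^ j * x ^ (P * (p - 1 - j))"
      using j by (simp flip: power_mult power_add distrib_left)
    have "(c t * x ^ (r + i * stepE d a + k * p ^ a) * V ^ j * (poly H x ^ stepE d a) ^ i') ^ P * x ^ (P * (p - 1))
      = c t ^ P * x ^ (r * P) * ((x ^ stepE d a) ^ P) ^ i * ((x ^ (p ^ a)) ^ P) ^ k * (V ^ P * x ^ P) ^ j
        * ((poly H x ^ stepE d a) ^ P) ^ i' * x ^ (P * (p - 1 - j))"
      unfolding xp by (simp add: power_mult_distrib power_add mult_ac flip: power_mult)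
    also have "\<dots> = y t * x ^ (r * P) * (inverse z1 * x ^ f) ^ i * x ^ k * (x * W) ^ j
        * (inverse z2 * poly H x ^ f) ^ i' * x ^ (P * (p - 1 - j))"
      unfolding E3' using E1 E2 E4 y by (simp add: P_def)
    also have "\<dots> = poly (smult (y t) (step_aux H u v b d z1 z2 \<tau> t)) x"
      unfolding tt step_aux_def prod.case f_def[symmetric] unfolding P_def[symmetric] W_def
      by (simp add: poly_monom power_mult_distrib power_add mult_ac flip: power_mult)
    finally show "poly (case t of (x, xa) \<Rightarrow> (case x of (i, j, k) \<Rightarrow> \<lambda>(i', r). monom (c ((i, j, k), i', r)) (r + i * stepE d a + k * p ^ a) *
                 stepV u v a ^ j * (H ^ stepE d a) ^ i') xa) x ^ (p ^ b) * x ^ (p ^ b * (p - 1))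
      = poly (smult (y t) (step_aux H u v b d z1 z2 \<tau> t)) x"
      unfolding tt by (simp add: poly_monom P_def V_def)
  qed
qed

lemma degree_step_aux:
  assumes t: "t \<in> step_index d m l" and b: "b > 0" and d: "d > 0"
  shows "degree (step_aux H u v b d z1 z2 \<tau> t) + 1 \<le> l * p ^ b + (d + d * degree H + 4 * p) * p ^ b + m"
proof -
  obtain i j k i' r where tt: "t = ((i, j, k), i', r)" by (metis surj_pair)
  have bd: "i < d" "j < p" "k < m" "i' < d" "r < l" using t tt by (auto simp: step_index_def)
  define P where "P = p ^ b"
  have P1: "P > 1" unfolding P_def using b p1 by (metis one_less_power)
  define f where "f = 1 + (P - 1) div d"
  have f: "f \<le> P" unfolding f_def using P1 div_le_dividend[of "P - 1" d] by linarith
  have "degree (stepU u v \<tau> b) \<le> 2 * P"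
    unfolding stepU_def P_def by (intro degree_diff_le degree_stepV order.trans[OF degree_monom_le]) auto
  hence dU: "degree (stepU u v \<tau> b ^ j) \<le> (2 * P) * j"
    by (intro order.trans[OF degree_power_le]) auto
  have "degree (step_aux H u v b d z1 z2 \<tau> t) \<le> (r * P + i * f + k + j + P * (p - 1 - j)) + degree H * (i' * f) + (2 * P) * j"
    unfolding tt step_aux_def prod.case P_def[symmetric] f_def[symmetric]
    by (intro order.trans[OF degree_mult_le] add_mono degree_monom_le degree_power_le dU)
  moreover have "r * P \<le> (l - 1) * P" using bd by (intro mult_right_mono) auto
  moreover have "l * P = (l - 1) * P + P" using bd by (cases l) auto
  moreover have "i * f \<le> d * P" using bd f by (intro mult_mono) auto
  moreover have "P * (p - 1 - j) \<le> p * P" by (simp add: mult.commute)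
  moreover have "degree H * (i' * f) \<le> degree H * (d * P)" using bd f by (intro mult_left_mono mult_mono) auto
  moreover have "(2 * P) * j \<le> (2 * P) * p" using bd by (intro mult_left_mono) auto
  moreover have "j \<le> p * P" using bd P1 by (metis less_imp_le_nat le_trans mult.commute mult_le_mono1 nat_mult_1)
  moreover have "(d + d * degree H + 4 * p) * P = d * P + degree H * (d * P) + p * P + (2 * P) * p + p * P"
    by (simp add: algebra_simps)
  ultimately show ?thesis using bd P1 unfolding P_def[symmetric] by linarith
qed

text \<open>In the notation of the proof of \<open>step_good_card\<close> the summands are
  \<open>4 * c2\<close>, \<open>4 * D\<close> and \<open>2 * d * p * (d * h + 2)\<close>. What
  matters is that a and b do not occur.\<close>

definition step_const :: "nat \<Rightarrow> nat \<Rightarrow> nat" where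
  "step_const d h = 16 * (d + d * h + 4 * p + 3) + 4 * (d * d * p) + 2 * d * p * (d * h + 2)"

theorem step_good_card:
  assumes H: "poly H \<rho> = 0" "poly (pderiv H) \<rho> \<noteq> 0" "poly H 0 \<noteq> 0"
    and HF: "\<And>x. x \<in> FF (p ^ (a + b)) \<Longrightarrow> poly H x \<in> FF (p ^ (a + b))"
    and u: "u \<noteq> 0" and ab: "b > 0" "b \<le> a"
    and d: "d > 0" "\<not> p dvd d" "d dvd p ^ a - 1" "d dvd p ^ b - 1"
    and z: "z1 \<noteq> 0" "z2 \<noteq> 0"
    and big: "step_const d (degree H) \<le> p ^ b"
  shows "card (step_good H u v d (a + b) z1 z2 \<tau>) \<le> p ^ a * (p ^ b div (d * d * p) + step_const d (degree H))"
proof -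
  define h where "h = degree H"
  define c1 where "c1 = d + d * h + 4 * p"
  define c2 where "c2 = 4 * (c1 + 3)"
  define D where "D = d * d * p"
  define P where "P = p ^ b"
  define w where "w = p ^ a"
  \<comment> \<open>Nonvanishing allows \<open>l\<close> up to about half of w / D. Then the
    \<open>D * m * l\<close> unknowns exceed the roughly \<open>l * P\<close> coefficients once
    \<open>m\<close> is slightly above P / D, and the degree, about w * m, is close to w * P / D,
    the average size of a class.\<close>
  define l where "l = w div (2 * D)"
  define m where "m = P div D + c2 + 1"
  have D0: "D > 0" using d p1 by (simp add: D_def)
  have Pw: "P \<le> w" unfolding P_def w_def using ab p1 by (intro power_increasing) auto
  have big': "4 * c2 + 4 * D + 2 * d * p * (d * h + 2) \<le> P"
    using big by (simp add: step_const_def h_def c1_def c2_def D_def P_def)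
  have lw: "2 * D * l \<le> w" by (simp add: l_def)
  have lw': "w < 2 * D * l + 2 * D"
    unfolding l_def using D0 by (metis add.commute dividend_less_times_div mult_pos_pos zero_less_numeral)
  have "4 * D \<le> w" using big' Pw by linarith
  hence lw2: "w \<le> 4 * (D * l)" using lw' by linarith
  have "card (step_index d m l) = d * p * m * (d * l)"
    by (simp add: step_index_def)
  also have "\<dots> = D * m * l" by (simp add: D_def)
  finally have cardI: "card (step_index d m l) = D * m * l" .
  have m1: "P + D * c2 \<le> D * m"
  proof -
    have "P < D + D * (P div D)" using D0 by (metis dividend_less_times_div)
    thus ?thesis unfolding m_def by (simp add: algebra_simps)
  qed
  have mP: "m \<le> P + c2 + 1" unfolding m_def by (simp add: div_le_dividend)
  have key: "l * P + c1 * P + m < D * m * l"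
  proof -
    have "(P + D * c2) * l \<le> D * m * l" using m1 by (intro mult_right_mono) auto
    moreover have "(P + D * c2) * l = l * P + c2 * (D * l)" by (simp add: algebra_simps)
    moreover have "c2 * (D * l) = (c1 + 3) * (4 * (D * l))" by (simp add: c2_def)
    moreover have "(c1 + 3) * w \<le> (c1 + 3) * (4 * (D * l))" using lw2 by (intro mult_left_mono) auto
    moreover have "(c1 + 3) * P \<le> (c1 + 3) * w" using Pw by (intro mult_left_mono) auto
    moreover have "(c1 + 3) * P = c1 * P + 3 * P" by (simp add: algebra_simps)
    moreover have "c2 + 1 < 2 * P" using big' D0 by linarith
    ultimately show ?thesis using mP by linarith
  qed
  have fin: "finite (step_index d m l)" by (simp add: step_index_def)
  obtain y where y: "\<exists>t\<in>step_index d m l. y t \<noteq> 0"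
      "(\<Sum>t\<in>step_index d m l. smult (y t) (step_aux H u v b d z1 z2 \<tau> t)) = 0"
  proof (rule poly_family_dependent[OF fin, of "step_aux H u v b d z1 z2 \<tau>" "l * P + c1 * P + m - 1"])
    show "degree (step_aux H u v b d z1 z2 \<tau> t) \<le> l * P + c1 * P + m - 1" if "t \<in> step_index d m l" for t
      using degree_step_aux[OF that ab(1) d(1), of H u v z1 z2 \<tau>] unfolding c1_def h_def P_def by linarith
    show "l * P + c1 * P + m - 1 + 1 < card (step_index d m l)"
      unfolding cardI using key by (simp add: m_def)
  qed
  \<comment> \<open>The linear system determines the p ^ b-th powers \<open>y\<close> of the
    coefficients; Frobenius is surjective on K, so roots \<open>c\<close> exist.\<close>
  have "\<exists>c. \<forall>t. c t ^ (p ^ b) = y t" 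
    by (intro choice) (use frob_surj[of b] in blast)
  then obtain c where c: "\<And>t. c t ^ (p ^ b) = y t" by blast
  define S where "S = step_fun H u v a d m l c"
  have S0: "S \<noteq> 0"
    unfolding S_def
  proof (rule step_fun_nonzero[OF H u _ d(1-3)])
    show "a > 0" using ab by simp
    show "d * p * (d * (degree H + l) + 2) \<le> p ^ a"
    proof -
      have "d * p * (d * (degree H + l) + 2) = d * p * (d * h + 2) + D * l"
        by (simp add: h_def D_def algebra_simps)
      moreover have "2 * (d * p * (d * h + 2)) \<le> w" using big' Pw by (simp add: mult.assoc)
      ultimately show ?thesis using lw unfolding w_def[symmetric] by linarith
    qed
    show "\<exists>t\<in>step_index d m l. c t \<noteq> 0" using y(1) c p1 by (metis power_0_left power_eq_0_iff p1 not_one_less_zero)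
  qed
  have "step_good H u v d (a + b) z1 z2 \<tau> \<subseteq> {x. poly S x = 0}"
  proof
    fix x assume x: "x \<in> step_good H u v d (a + b) z1 z2 \<tau>"
    have "poly S x ^ (p ^ b) * x ^ (p ^ b * (p - 1))
      = poly (\<Sum>t\<in>step_index d m l. smult (y t) (step_aux H u v b d z1 z2 \<tau> t)) x"
      unfolding S_def by (rule step_fun_at_good[where y = y, OF d(3,4) _ z x]) (fact HF, fact c)
    hence "poly S x ^ (p ^ b) * x ^ (p ^ b * (p - 1)) = 0" unfolding y(2) poly_0 .
    moreover have "x \<noteq> 0" using x unfolding step_good_def by blast
    ultimately have "poly S x = 0" using power_not_zero no_zero_divisors by blast
    thus "x \<in> {x. poly S x = 0}" by blast
  qed
  hence "card (step_good H u v d (a + b) z1 z2 \<tau>) \<le> card {x. poly S x = 0}"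
    by (intro card_mono poly_roots_finite S0)
  also have "\<dots> \<le> degree S" by (rule card_poly_roots_bound[OF S0])
  also have "\<dots> \<le> p ^ a * (m + d + 2 * p + d * degree H)"
    unfolding S_def
  proof (rule degree_step_fun)
    show "l \<le> p ^ a" unfolding l_def w_def by (rule div_le_dividend)
  qed (use d in auto)
  also have "\<dots> \<le> p ^ a * (p ^ b div (d * d * p) + step_const d (degree H))"
    by (intro mult_left_mono) (auto simp: m_def c1_def c2_def P_def D_def h_def step_const_def)
  finally show ?thesis .
qed

end

section \<open>Characters and class sums\<close>

definition mult_char :: "nat \<Rightarrow> ('k::field \<Rightarrow> complex) \<Rightarrow> bool" where
  "mult_char Q ch \<longleftrightarrow> ch 1 = 1 \<and> (\<forall>x\<in>FF Q - {0}. \<forall>y\<in>FF Q - {0}. ch (x * y) = ch x * ch y)"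

definition add_char :: "nat \<Rightarrow> ('k::field \<Rightarrow> complex) \<Rightarrow> bool" where
  "add_char Q \<psi> \<longleftrightarrow> \<psi> 0 = 1 \<and> (\<forall>x\<in>FF Q. \<forall>y\<in>FF Q. \<psi> (x + y) = \<psi> x * \<psi> y)"

definition polyF :: "nat \<Rightarrow> 'k::field poly \<Rightarrow> bool" where
  "polyF Q H \<longleftrightarrow> (\<forall>i. coeff H i \<in> FF Q)"

lemma mult_char_power:
  "mult_char Q ch \<Longrightarrow> x \<in> FF Q - {0} \<Longrightarrow> ch (x ^ n) = ch x ^ n"
  by (induction n) (auto simp: mult_char_def FF_power)

lemma norm_root_of_unity: "z ^ n = 1 \<Longrightarrow> n > 0 \<Longrightarrow> norm (z :: complex) = 1"
  by (metis norm_one norm_power norm_ge_zero power_eq_1_iff less_irrefl)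

lemma norm_mult_char:
  assumes "mult_char Q ch" "x \<in> FF Q - {0}" "Q > 1"
  shows "norm (ch x) = 1"
proof -
  have "ch x ^ (Q - 1) = ch (x ^ (Q - 1))" using assms by (simp add: mult_char_power)
  also have "x ^ (Q - 1) = 1" using assms by (intro FF_power_minus_1) auto
  also have "ch 1 = 1" using assms by (simp add: mult_char_def)
  finally show ?thesis using assms by (intro norm_root_of_unity[of _ "Q - 1"]) auto
qed

lemma mult_char_sum_eq_0:
  assumes ch: "mult_char Q ch" and z: "z \<in> FF Q - {0}" "ch z \<noteq> 1"
  shows "(\<Sum>x\<in>FF Q - {0}. ch x) = 0"
proof -
  have "(\<Sum>x\<in>FF Q - {0}. ch x) = (\<Sum>x\<in>FF Q - {0}. ch (z * x))"
    by (rule sum.reindex_bij_witness[of _ "\<lambda>x. z * x" "\<lambda>x. x / z"])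
       (use z in \<open>auto intro: FF_mult FF_divide\<close>)
  also have "\<dots> = ch z * (\<Sum>x\<in>FF Q - {0}. ch x)"
    unfolding sum_distrib_left using ch z by (intro sum.cong) (auto simp: mult_char_def)
  finally show ?thesis using z(2) by (simp only: mult_cancel_right1) simp
qed

context pchar
begin

lemma norm_add_char:
  assumes \<psi>: "add_char (p ^ i) \<psi>" and x: "(x::'k) \<in> FF (p ^ i)"
  shows "norm (\<psi> x) = 1"
proof -
  have r: "p ^ i > 0" using p1 by simp
  have *: "of_nat n * x \<in> FF (p ^ i) \<and> \<psi> (of_nat n * x) = \<psi> x ^ n" for n
  proof (induction n)
    case (Suc n)
    thus ?case using \<psi> x by (auto simp: add_char_def distrib_right FF_add)
  qed (use \<psi> r in \<open>auto simp: add_char_def\<close>)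
  have "\<psi> x ^ p = \<psi> (of_nat p * x)" using *[of p] by (simp del: of_nat_p)
  also have "\<dots> = 1" using \<psi> by (simp add: add_char_def)
  finally show ?thesis using p1 by (intro norm_root_of_unity[of _ p]) auto
qed

lemma add_char_sum_eq_0:
  assumes \<psi>: "add_char (p ^ i) \<psi>" and z: "z \<in> FF (p ^ i)" "\<psi> (z::'k) \<noteq> 1"
  shows "(\<Sum>x\<in>FF (p ^ i). \<psi> x) = 0"
proof -
  have "(\<Sum>x\<in>FF (p ^ i). \<psi> x) = (\<Sum>x\<in>FF (p ^ i). \<psi> (z + x))"
    by (rule sum.reindex_bij_witness[of _ "\<lambda>x. z + x" "\<lambda>x. x - z"])
       (use z in \<open>auto intro: FF_add FF_diff\<close>)
  also have "\<dots> = \<psi> z * (\<Sum>x\<in>FF (p ^ i). \<psi> x)"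
    unfolding sum_distrib_left using \<psi> z by (intro sum.cong) (auto simp: add_char_def)
  finally show ?thesis using z(2) by (simp only: mult_cancel_right1) simp
qed

lemma polyF_poly:
  assumes "polyF (p ^ e) H" "x \<in> FF (p ^ (e * j))"
  shows "poly H x \<in> (FF (p ^ (e * j)) :: 'k set)"
proof -
  have "FF (p ^ e) \<subseteq> (FF (p ^ (e * j)) :: 'k set)" using FF_mono[of "p ^ e" j] by (simp add: power_mult)
  thus ?thesis
    unfolding poly_altdef using assms by (intro FF_sum FF_mult FF_power) (auto simp: polyF_def)
qed

text \<open>The norm and trace exponents: \<open>(p ^ (e * j) - 1) div (p ^ e - 1)\<close> is the exponent of the norm
  from \<open>FF (p ^ (e * j))\<close> to \<open>FF (p ^ e)\<close>, and \<open>abstr n\<close> is the trace to the prime field.\<close>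

definition nexp :: "nat \<Rightarrow> nat \<Rightarrow> nat" where
  "nexp e j = (p ^ (e * j) - 1) div (p ^ e - 1)"

definition abstr :: "nat \<Rightarrow> 'k \<Rightarrow> 'k" where
  "abstr n x = (\<Sum>i<n. x ^ (p ^ i))"

lemma minus_1_dvd: "p ^ e - 1 dvd p ^ (e * j) - 1"
proof -
  have "[(p ^ e) ^ j = 1 ^ j] (mod (p ^ e - 1))"
    using p1 by (intro cong_pow) (auto simp: cong_altdef_nat)
  thus ?thesis using p1 by (simp add: cong_altdef_nat power_mult)
qed

lemma nexp_mult: "nexp e j * (p ^ e - 1) = p ^ (e * j) - 1"
  unfolding nexp_def using minus_1_dvd by simp

lemma nexp_in_FF:
  assumes "x \<in> FF (p ^ (e * j))" "x \<noteq> 0"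
  shows "x ^ nexp e j \<in> (FF (p ^ e) - {0} :: 'k set)"
proof -
  have pe: "p ^ e > 0" using p1 by simp
  have "(x ^ nexp e j) ^ (p ^ e - 1) = x ^ (p ^ (e * j) - 1)"
    by (simp only: power_mult[symmetric] nexp_mult)
  also have "\<dots> = 1" using assms p1 by (intro FF_power_minus_1) auto
  finally have "(x ^ nexp e j) ^ (p ^ e - 1) = 1" .
  hence "(x ^ nexp e j) ^ Suc (p ^ e - 1) = x ^ nexp e j" by simp
  moreover have "Suc (p ^ e - 1) = p ^ e" using pe by simp
  ultimately have "(x ^ nexp e j) ^ (p ^ e) = x ^ nexp e j" by (simp only:)
  thus ?thesis using assms by (simp add: FF_def)
qed

lemma abstr_in_FF:
  assumes "x \<in> FF (p ^ n)" shows "abstr n x \<in> (FF p :: 'k set)"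
proof -
  have "abstr n x ^ p = (\<Sum>i<n. x ^ (p ^ Suc i))"
    unfolding abstr_def frob_sum[where i = 1, simplified] by (simp add: mult.commute flip: power_mult)
  also have "\<dots> + x = abstr n x + x ^ (p ^ n)"
    unfolding abstr_def by (induction n) (auto simp: algebra_simps)
  finally show ?thesis using assms by (simp add: FF_def)
qed

lemma abstr_add: "abstr n (x + y) = abstr n x + abstr n y"
  unfolding abstr_def by (simp add: frob_add sum.distrib)

lemma abstr_0 [simp]: "abstr n 0 = 0"
  unfolding abstr_def using p1 by (simp add: power_0_left)

section \<open>From class sizes to sums over all extensions\<close>

definition XH :: "nat \<Rightarrow> 'k poly \<Rightarrow> 'k set" where
  "XH N H = {x \<in> FF N. x \<noteq> 0 \<and> poly H x \<noteq> 0}"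

lemma p_coprime_minus_1: "e > 0 \<Longrightarrow> \<not> p dvd p ^ e - 1"
proof
  assume e: "e > 0" and dvd: "p dvd p ^ e - 1"
  have "p dvd p ^ e" using e by simp
  hence "p dvd p ^ e - (p ^ e - 1)" using dvd by (rule dvd_diff_nat)
  thus False using p1 by simp
qed

text \<open>As \<Phi> has mean zero, only the deviations of the class sizes from their average
  count. Upper bounds suffice, because the sizes add up to a known total.\<close>

lemma class_sum_bound:
  fixes \<Phi> :: "'k \<times> 'k \<times> 'k \<Rightarrow> complex"
  assumes e: "e > 0" and H: "poly H \<rho> = 0" "poly (pderiv H) \<rho> \<noteq> 0" "poly H 0 \<noteq> 0"
    and HF: "polyF (p ^ e) H" and u: "u \<in> FF (p ^ e)" "v \<in> FF (p ^ e)" "u \<noteq> 0"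
    and \<Phi>: "\<And>c. c \<in> (FF (p ^ e) - {0}) \<times> (FF (p ^ e) - {0}) \<times> FF p \<Longrightarrow> norm (\<Phi> c) \<le> 1"
    and \<Phi>0: "(\<Sum>c\<in>(FF (p ^ e) - {0}) \<times> (FF (p ^ e) - {0}) \<times> FF p. \<Phi> c) = 0"
  shows "\<exists>C. \<forall>j>0. norm (\<Sum>x\<in>XH (p ^ (e * j)) H.
     \<Phi> (x ^ nexp e j, poly H x ^ nexp e j, abstr (e * j) (u / x + v * x))) \<le> C * sqrt (p ^ e) ^ j"
proof -
  define Cl where "Cl = (FF (p ^ e) - {0} :: 'k set) \<times> (FF (p ^ e) - {0} :: 'k set) \<times> (FF p :: 'k set)"
  \<comment> \<open>With this \<open>d\<close> the exponent \<open>(p ^ (e * j) - 1) div d\<close>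
    is \<open>nexp e j\<close>: a class fixes the norms to \<open>FF (p ^ e)\<close> themselves, so
    the value of any multiplicative character at a norm is a function of the class.\<close>
  define d where "d = p ^ e - 1"
  define sc where "sc = step_const d (degree H)"
  have pe: "p ^ e > 1" using e p1 by (metis one_less_power)
  have d: "d > 0" "\<not> p dvd d" using pe p_coprime_minus_1[OF e] by (auto simp: d_def)
  have cardp: "card (FF p :: 'k set) = p" "finite (FF p :: 'k set)" using card_FF[of 1] finite_FF[of 1] by auto
  have fCl: "finite Cl" unfolding Cl_def using finite_FF[OF e] cardp by auto
  have cCl: "card Cl = d * d * p"
  proof -
    have "card (FF (p ^ e) - {0 :: 'k}) = d"
    proof -
      have "0 < p ^ e" using pe by linarith
      from card_Diff_singleton[OF FF_0[OF this, where 'a = 'k]] show ?thesis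
        unfolding card_FF[OF e] d_def .
    qed
    thus ?thesis unfolding Cl_def by (simp add: card_cartesian_product cardp)
  qed
  define B where "B = sqrt (p ^ e)"
  have B1: "B > 1" unfolding B_def using pe by (simp del: of_nat_power)
  have B2: "B ^ 2 = p ^ e" by (simp add: B_def)
  obtain r0 where r0: "sc \<le> r0" "r0 > 0" by (metis le_Suc_eq zero_less_Suc le_refl)
  have big: "sc \<le> p ^ (e * r)" if "r \<ge> r0" for r
  proof -
    have "sc \<le> r" using r0 that by simp
    also have "\<dots> \<le> e * r" using e by simp
    also have "e * r \<le> p ^ (e * r)" using power_gt_expt[of p "e * r"] p1 by simp
    finally show ?thesis .
  qed
  define cl where "cl = (\<lambda>j x. (x ^ nexp e j, poly H x ^ nexp e j, abstr (e * j) (u / x + v * x)))"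
  define XX where "XX = (\<lambda>j. XH (p ^ (e * j)) H)"
  have sub: "FF (p ^ e) \<subseteq> (FF (p ^ (e * j)) :: 'k set)" for j using FF_mono[of "p ^ e" j] by (simp add: power_mult)
  have clX: "cl j x \<in> Cl" if "x \<in> XX j" for j x
  proof -
    have x: "x \<in> FF (p ^ (e * j))" "x \<noteq> 0" "poly H x \<noteq> 0" using that by (auto simp: XX_def XH_def)
    have "u / x + v * x \<in> FF (p ^ (e * j))"
      using x u sub[of j] by (intro FF_add FF_divide FF_mult) auto
    thus ?thesis
      unfolding cl_def Cl_def using x nexp_in_FF polyF_poly[OF HF x(1)] abstr_in_FF by auto
  qed
  have finX: "finite (XX j)" if "j > 0" for j
    unfolding XX_def XH_def using finite_FF[of "e * j"] e that by auto
  have cX: "card (XX j) \<le> p ^ (e * j)" if "j > 0" for j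
    using card_mono[OF finite_FF[of "e * j"], of "XX j"] card_FF[of "e * j"] e that unfolding XX_def XH_def by auto
  have cX2: "p ^ (e * j) \<le> card (XX j) + 1 + degree H" if "j > 0" for j
  proof -
    have H0: "H \<noteq> 0" using H by auto
    have "FF (p ^ (e * j)) \<subseteq> XX j \<union> ({0} \<union> {x. poly H x = 0})" by (auto simp: XX_def XH_def)
    moreover have "finite (XX j \<union> ({0} \<union> {x. poly H x = 0}))" using finX[OF that] poly_roots_finite[OF H0] by auto
    ultimately have "card (FF (p ^ (e * j)) :: 'k set) \<le> card (XX j \<union> ({0} \<union> {x. poly H x = 0}))" by (intro card_mono)
    also have "\<dots> \<le> card (XX j) + card ({0} \<union> {x. poly H x = 0})" by (rule card_Un_le)
    also have "card ({0} \<union> {x. poly H x = 0}) \<le> card {0::'k} + card {x. poly H x = 0}" by (rule card_Un_le)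
    also have "card {x. poly H x = 0} \<le> degree H" by (rule card_poly_roots_bound[OF H0])
    finally show ?thesis using card_FF[of "e * j"] e that by simp
  qed
  define S where "S = (\<lambda>j. \<Sum>x\<in>XX j. \<Phi> (cl j x))"
  define C1 where "C1 = 2 * real (d * d * p) * sc * B + 1 + degree H"
  have main: "norm (S j) \<le> C1 * B ^ j" if j: "j \<ge> 2 * r0" for j
  proof -
    \<comment> \<open>The exponent e * j is split as evenly as possible into multiples of
      \<open>e\<close> with \<open>b \<le> a\<close>: multiples of \<open>e\<close> make
      \<open>d\<close> divide p ^ a - 1 and p ^ b - 1, and evenness keeps p ^ a below
      \<open>B ^ Suc j\<close>.\<close>
    define r where "r = j div 2"
    have r: "r \<ge> r0" "2 * r \<le> j" "j \<le> 2 * r + 1" using j by (auto simp: r_def)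
    define a where "a = e * (j - r)"
    define b where "b = e * r"
    have j0: "j > 0" using j r0 by simp
    have ab: "a + b = e * j" "b > 0" "b \<le> a" using r e r0 by (auto simp: a_def b_def simp flip: distrib_left)
    have dd: "d dvd p ^ a - 1" "d dvd p ^ b - 1" unfolding d_def a_def b_def by (rule minus_1_dvd)+
    have fib: "real (card {x \<in> XX j. cl j x = c}) \<le> p ^ (e * j) / (d * d * p) + sc * p ^ a" if c: "c \<in> Cl" for c
    proof -
      obtain z1 z2 \<tau> where cc: "c = (z1, z2, \<tau>)" by (metis prod_cases3)
      have z: "z1 \<noteq> 0" "z2 \<noteq> 0" using c cc by (auto simp: Cl_def)
      have "{x \<in> XX j. cl j x = c} \<subseteq> step_good H u v d (a + b) z1 z2 \<tau>"
        unfolding ab step_good_def XX_def XH_def cl_def cc nexp_def d_def abstr_def by auto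
      moreover have "finite (step_good H u v d (a + b) z1 z2 \<tau>)"
        by (rule finite_subset[OF _ finite_FF[of "a + b"]]) (use ab e j0 in \<open>auto simp: step_good_def\<close>)
      ultimately have "card {x \<in> XX j. cl j x = c} \<le> card (step_good H u v d (a + b) z1 z2 \<tau>)"
        by (intro card_mono)
      also have "\<dots> \<le> p ^ a * (p ^ b div (d * d * p) + sc)"
        unfolding sc_def
        by (rule step_good_card[OF H _ u(3) ab(2,3) d dd z])
           (use polyF_poly[OF HF] ab big[OF r(1)] in \<open>auto simp: sc_def b_def\<close>)
      finally have "real (card {x \<in> XX j. cl j x = c}) \<le> real (p ^ a * (p ^ b div (d * d * p) + sc))"
        by (rule of_nat_mono)
      also have "\<dots> = p ^ a * real (p ^ b div (d * d * p)) + sc * p ^ a" by (simp add: algebra_simps)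
      also have "\<dots> \<le> p ^ a * (real (p ^ b) / real (d * d * p)) + sc * p ^ a"
        by (intro add_mono mult_left_mono of_nat_div_le_of_nat) auto
      also have "p ^ a * (real (p ^ b) / real (d * d * p)) = p ^ (e * j) / (d * d * p)"
        unfolding ab(1)[symmetric] by (simp add: power_add)
      finally show ?thesis .
    qed
    define M where "M = real (p ^ (e * j)) / real (d * d * p)"
    define w where "w = real sc * p ^ a"
    have w0: "w \<ge> 0" by (simp add: w_def)
    have Dp: "real (d * d * p) > 0" using d p1 by simp
    have S: "S j = (\<Sum>c\<in>Cl. \<Phi> c * of_real (real (card {x \<in> XX j. cl j x = c}) - M))"
    proof -
      have "S j = (\<Sum>c\<in>Cl. \<Sum>x\<in>{x \<in> XX j. cl j x = c}. \<Phi> (cl j x))"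
        unfolding S_def using clX by (intro sum.group[symmetric] finX[OF j0] fCl) auto
      also have "\<dots> = (\<Sum>c\<in>Cl. \<Phi> c * of_nat (card {x \<in> XX j. cl j x = c}))"
        by (intro sum.cong) (auto simp: mult.commute)
      also have "\<dots> = (\<Sum>c\<in>Cl. \<Phi> c * of_nat (card {x \<in> XX j. cl j x = c})) - of_real M * (\<Sum>c\<in>Cl. \<Phi> c)"
        using \<Phi>0 by (simp add: Cl_def)
      also have "\<dots> = (\<Sum>c\<in>Cl. \<Phi> c * of_real (real (card {x \<in> XX j. cl j x = c}) - M))"
        unfolding sum_distrib_left sum_subtractf[symmetric] by (intro sum.cong) (auto simp: algebra_simps)
      finally show ?thesis .
    qed
    have "norm (S j) \<le> (\<Sum>c\<in>Cl. norm (\<Phi> c * of_real (real (card {x \<in> XX j. cl j x = c}) - M)))"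
      unfolding S by (rule norm_sum)
    \<comment> \<open>From \<open>y \<le> w\<close> and \<open>0 \<le> w\<close> follows
      \<bar>y\<bar> \<le> 2 * w - y, and the sum of all \<open>y\<close> is bounded below by -(1 +
      degree H).\<close>
    also have "\<dots> \<le> (\<Sum>c\<in>Cl. 2 * w - (real (card {x \<in> XX j. cl j x = c}) - M))"
    proof (rule sum_mono)
      fix c assume c: "c \<in> Cl"
      define y where "y = real (card {x \<in> XX j. cl j x = c}) - M"
      have "norm (\<Phi> c * of_real y) \<le> 1 * \<bar>y\<bar>"
        unfolding norm_mult norm_of_real using \<Phi> c by (intro mult_right_mono) (auto simp: Cl_def)
      moreover have "y \<le> w" using fib[OF c] by (simp add: y_def w_def M_def)
      ultimately show "norm (\<Phi> c * of_real (real (card {x \<in> XX j. cl j x = c}) - M)) \<le> 2 * w - (real (card {x \<in> XX j. cl j x = c}) - M)"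
        unfolding y_def[symmetric] using w0 by linarith
    qed
    also have "\<dots> = real (d * d * p) * (2 * w) - (real (card (XX j)) - real (d * d * p) * M)"
    proof -
      have "card (XX j) = (\<Sum>c\<in>Cl. card {x \<in> XX j. cl j x = c})"
        using sum.group[OF finX[OF j0] fCl, of "cl j" "\<lambda>_. 1::nat"] clX by (auto simp: image_subset_iff)
      thus ?thesis using cCl by (simp add: sum_subtractf algebra_simps)
    qed
    also have "\<dots> \<le> real (d * d * p) * (2 * w) + 1 + degree H"
    proof -
      have "real (d * d * p) * M = real (p ^ (e * j))" using Dp unfolding M_def by (simp del: of_nat_mult)
      moreover have "real (p ^ (e * j)) \<le> real (card (XX j) + 1 + degree H)"
        using cX2[OF j0] by (rule of_nat_mono)
      ultimately show ?thesis by simp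
    qed
    also have "\<dots> \<le> real (d * d * p) * (2 * (sc * (B * B ^ j))) + (1 + real (degree H)) * B ^ j"
    proof -
      have "real (p ^ a) = (B ^ 2) ^ (j - r)" unfolding B2 a_def by (simp add: power_mult)
      also have "\<dots> = B ^ (2 * (j - r))" by (simp add: power_mult)
      also have "\<dots> \<le> B ^ Suc j" using r B1 by (intro power_increasing) auto
      finally have "w \<le> sc * (B * B ^ j)" unfolding w_def by (intro mult_left_mono) auto
      hence le1: "real (d * d * p) * (2 * w) \<le> real (d * d * p) * (2 * (sc * (B * B ^ j)))"
        by (intro mult_left_mono) auto
      have le2: "(1 + real (degree H)) * 1 \<le> (1 + real (degree H)) * B ^ j"
        using B1 by (intro mult_left_mono one_le_power) auto
      show ?thesis using add_mono[OF le1 le2] by (simp only: mult_1_right add.assoc)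
    qed
    also have "\<dots> = C1 * B ^ j" by (simp add: C1_def algebra_simps)
    finally show ?thesis .
  qed
  define C2 where "C2 = real (p ^ (e * (2 * r0)))"
  have "norm (S j) \<le> max C1 C2 * B ^ j" if j0: "j > 0" for j
  proof (cases "j \<ge> 2 * r0")
    case True
    have "C1 * B ^ j \<le> max C1 C2 * B ^ j" using B1 by (intro mult_right_mono) auto
    thus ?thesis using main[OF True] by linarith
  next
    case False
    have "norm (S j) \<le> C2"
    proof -
      have "norm (S j) \<le> (\<Sum>x\<in>XX j. 1)"
        unfolding S_def using \<Phi> clX by (intro sum_norm_le) (auto simp: Cl_def)
      also have "\<dots> \<le> real (p ^ (e * j))" using cX j0 by simp
      also have "\<dots> \<le> C2" unfolding C2_def using False p1 by (intro of_nat_mono power_increasing) auto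
      finally show ?thesis .
    qed
    also have "C2 \<le> max C1 C2 * 1" by simp
    also have "\<dots> \<le> max C1 C2 * B ^ j" using B1 by (intro mult_left_mono one_le_power) (auto simp: C2_def le_max_iff_disj)
    finally show ?thesis .
  qed
  thus ?thesis unfolding S_def XX_def cl_def B_def by blast
qed

end

lemma sum_triple_product:
  fixes f g h :: "_ \<Rightarrow> complex"
  shows "(\<Sum>c\<in>A \<times> B \<times> C. f (fst c) * g (fst (snd c)) * h (snd (snd c)))
    = (\<Sum>x\<in>A. f x) * (\<Sum>x\<in>B. g x) * (\<Sum>x\<in>C. h x)"
proof -
  have "(\<Sum>c\<in>A \<times> B \<times> C. f (fst c) * g (fst (snd c)) * h (snd (snd c)))
    = (\<Sum>x\<in>A. \<Sum>y\<in>B. \<Sum>t\<in>C. f x * (g y * h t))"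
    by (simp add: sum.cartesian_product case_prod_unfold mult.assoc)
  thus ?thesis by (simp add: mult.assoc flip: sum_distrib_left sum_distrib_right)
qed

text \<open>For the substitution x -> 1/x, which turns \<open>H\<close> into its reciprocal
  polynomial up to a power of x.\<close>

lemma reflect_simple_root:
  fixes H :: "'k::field poly"
  assumes H: "poly H \<rho> = 0" "poly (pderiv H) \<rho> \<noteq> 0" "poly H 0 \<noteq> 0"
  shows "poly (reflect_poly H) (inverse \<rho>) = 0" "poly (pderiv (reflect_poly H)) (inverse \<rho>) \<noteq> 0"
proof -
  have \<rho>: "\<rho> \<noteq> 0" using H by auto
  show "poly (reflect_poly H) (inverse \<rho>) = 0" using H \<rho> by (simp add: poly_reflect_poly_nz)
  obtain G where G: "H = [:-\<rho>, 1:] * G" using H(1) poly_eq_0_iff_dvd by (metis dvdE)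
  have "poly G \<rho> \<noteq> 0" using H(2) unfolding G pderiv_mult by (simp add: pderiv_pCons)
  hence Gr: "poly (reflect_poly G) (inverse \<rho>) \<noteq> 0" using \<rho> by (simp add: poly_reflect_poly_nz)
  have r: "reflect_poly [:-\<rho>, 1:] = [:1, -\<rho>:]"
    using \<rho> by (simp add: reflect_poly_pCons Poly_snoc) 
  show "poly (pderiv (reflect_poly H)) (inverse \<rho>) \<noteq> 0"
    unfolding G reflect_poly_mult r pderiv_mult using Gr \<rho> by (simp add: pderiv_pCons flip: mult.assoc)
qed

context pchar
begin

text \<open>\<open>class_sum_bound\<close> needs a pole at 0. If u = 0 and v is nonzero, x -> 1/x
  exchanges them; if both vanish, the mean of the class function is zero by a nontrivial
  multiplicative character instead.\<close>

theorem extension_sum_bound: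
  assumes e: "e > 0" and H: "poly H \<rho> = 0" "poly (pderiv H) \<rho> \<noteq> 0" "poly H 0 \<noteq> 0"
    and HF: "polyF (p ^ e) H" and u: "u \<in> FF (p ^ e)" "v \<in> FF (p ^ e)"
    and ch: "mult_char (p ^ e) ch1" "mult_char (p ^ e) ch2"
    and \<psi>: "add_char p \<psi>" "z \<in> FF p" "\<psi> (z :: 'k) \<noteq> 1"
    and nontriv: "u \<noteq> 0 \<or> v \<noteq> 0 \<or> (\<exists>z\<in>FF (p ^ e) - {0}. ch1 z \<noteq> 1) \<or> (\<exists>z\<in>FF (p ^ e) - {0}. ch2 z \<noteq> 1)"
  shows "\<exists>C. \<forall>j>0. norm (\<Sum>x\<in>XH (p ^ (e * j)) H.
     ch1 (x ^ nexp e j) * ch2 (poly H x ^ nexp e j) * \<psi> (abstr (e * j) (u / x + v * x))) \<le> C * sqrt (p ^ e) ^ j"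
proof -
  let ?F = "FF (p ^ e) - {0 :: 'k}"
  have pe: "p ^ e > 1" using e p1 by (metis one_less_power)
  have n1: "norm (ch1 x) = 1" "norm (ch2 x) = 1" if "x \<in> ?F" for x
    using norm_mult_char[OF ch(1) that pe] norm_mult_char[OF ch(2) that pe] by auto
  have n2: "norm (\<psi> x) = 1" if "x \<in> FF p" for x
    using norm_add_char[of 1 \<psi> x] \<psi>(1) that by simp
  have \<psi>0: "(\<Sum>x\<in>FF p. \<psi> x) = 0" using add_char_sum_eq_0[of 1 \<psi> z] \<psi> by simp
  have inv: "inverse x \<in> ?F" if "x \<in> ?F" for x using that by (auto intro: FF_inverse)
  consider "u \<noteq> 0" | "u = 0" "v = 0" | "u = 0" "v \<noteq> 0" by blast
  thus ?thesis
  proof cases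
    case 1
    define \<Phi> where "\<Phi> = (\<lambda>c. ch1 (fst c) * ch2 (fst (snd c)) * \<psi> (snd (snd c)))"
    have "\<exists>C. \<forall>j>0. norm (\<Sum>x\<in>XH (p ^ (e * j)) H.
      \<Phi> (x ^ nexp e j, poly H x ^ nexp e j, abstr (e * j) (u / x + v * x))) \<le> C * sqrt (p ^ e) ^ j"
    proof (rule class_sum_bound[OF e H HF u 1])
      show "norm (\<Phi> c) \<le> 1" if "c \<in> ?F \<times> ?F \<times> FF p" for c
        using that n1(1)[of "fst c"] n1(2)[of "fst (snd c)"] n2[of "snd (snd c)"]
        by (simp add: \<Phi>_def norm_mult mem_Times_iff)
      show "(\<Sum>c\<in>?F \<times> ?F \<times> FF p. \<Phi> c) = 0"
        unfolding \<Phi>_def sum_triple_product \<psi>0 by simp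
    qed
    thus ?thesis by (simp add: \<Phi>_def)
  next
    case 2
    \<comment> \<open>No additive character occurs here, so the classes may be formed with u = 1 and
      v = 0, and \<Phi> is constant in the trace coordinate.\<close>
    define \<Phi> where "\<Phi> = (\<lambda>c :: 'k \<times> 'k \<times> 'k. ch1 (fst c) * ch2 (fst (snd c)) * 1)"
    have "\<exists>C. \<forall>j>0. norm (\<Sum>x\<in>XH (p ^ (e * j)) H.
      \<Phi> (x ^ nexp e j, poly H x ^ nexp e j, abstr (e * j) (1 / x + 0 * x))) \<le> C * sqrt (p ^ e) ^ j"
    proof (rule class_sum_bound[OF e H HF])
      show "norm (\<Phi> c) \<le> 1" if "c \<in> ?F \<times> ?F \<times> FF p" for c
        using that n1(1)[of "fst c"] n1(2)[of "fst (snd c)"]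
        by (simp add: \<Phi>_def norm_mult mem_Times_iff)
      have "(\<Sum>x\<in>?F. ch1 x) = 0 \<or> (\<Sum>x\<in>?F. ch2 x) = 0"
        using nontriv 2 mult_char_sum_eq_0[OF ch(1)] mult_char_sum_eq_0[OF ch(2)] by blast
      thus "(\<Sum>c\<in>?F \<times> ?F \<times> FF p. \<Phi> c) = 0"
        unfolding \<Phi>_def sum_triple_product[where h = "\<lambda>_. 1"] by auto
    qed (use p1 in auto)
    thus ?thesis using 2 \<psi>(1) by (simp add: \<Phi>_def add_char_def)
  next
    case 3
    define h where "h = degree H"
    define Hr where "Hr = reflect_poly H"
    have H0: "H \<noteq> 0" using H by auto
    have Hr: "poly Hr (inverse \<rho>) = 0" "poly (pderiv Hr) (inverse \<rho>) \<noteq> 0" "poly Hr 0 \<noteq> 0" "polyF (p ^ e) Hr"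
      using reflect_simple_root[OF H] H0 HF p1 unfolding Hr_def
      by (auto simp: polyF_def coeff_reflect_poly)
    \<comment> \<open>\<open>H\<close> at 1/x is the reciprocal polynomial divided by x ^ h. So
      besides inverting the first coordinate, the second is divided by its h-th power.\<close>
    define \<Phi> where "\<Phi> = (\<lambda>c. ch1 (inverse (fst c)) * ch2 (fst (snd c) * inverse (fst c) ^ h) * \<psi> (snd (snd c)))"
    have "\<exists>C. \<forall>j>0. norm (\<Sum>x\<in>XH (p ^ (e * j)) Hr.
      \<Phi> (x ^ nexp e j, poly Hr x ^ nexp e j, abstr (e * j) (v / x + u * x))) \<le> C * sqrt (p ^ e) ^ j"
    proof (rule class_sum_bound[OF e Hr u(2,1) 3(2)])
      show "norm (\<Phi> c) \<le> 1" if "c \<in> ?F \<times> ?F \<times> FF p" for c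
      proof -
        have "inverse (fst c) \<in> ?F" "fst (snd c) * inverse (fst c) ^ h \<in> ?F"
          using that by (auto intro!: FF_mult FF_power FF_inverse)
        from n1(1)[OF this(1)] n1(2)[OF this(2)] n2[of "snd (snd c)"] that show ?thesis
          by (simp add: \<Phi>_def norm_mult mem_Times_iff)
      qed
      have "(\<Sum>c\<in>?F \<times> ?F \<times> FF p. \<Phi> c) = (\<Sum>x\<in>?F. \<Sum>y\<in>?F. \<Sum>t\<in>FF p. ch1 (inverse x) * ch2 (y * inverse x ^ h) * \<psi> t)"
        by (simp add: sum.cartesian_product case_prod_unfold \<Phi>_def)
      also have "\<dots> = 0" by (simp add: sum_distrib_left[symmetric] \<psi>0)
      finally show "(\<Sum>c\<in>?F \<times> ?F \<times> FF p. \<Phi> c) = 0" .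
    qed
    moreover have "(\<Sum>x\<in>XH (p ^ (e * j)) Hr. \<Phi> (x ^ nexp e j, poly Hr x ^ nexp e j, abstr (e * j) (v / x + u * x)))
      = (\<Sum>x\<in>XH (p ^ (e * j)) H. ch1 (x ^ nexp e j) * ch2 (poly H x ^ nexp e j) * \<psi> (abstr (e * j) (u / x + v * x)))" for j
    proof (rule sum.reindex_bij_witness[of _ inverse inverse])
      fix x assume x: "x \<in> XH (p ^ (e * j)) Hr"
      hence x0: "x \<noteq> 0" by (simp add: XH_def)
      have eq: "poly H (inverse x) = poly Hr x * inverse x ^ h"
        unfolding Hr_def poly_reflect_poly_nz[OF x0] h_def using x0 by (simp add: field_simps)
      show "inverse x \<in> XH (p ^ (e * j)) H"
        using x x0 by (auto simp: XH_def eq FF_inverse)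
      have "poly H (inverse x) ^ nexp e j = poly Hr x ^ nexp e j * inverse (x ^ nexp e j) ^ h"
        unfolding eq by (simp add: power_mult_distrib power_inverse mult.commute flip: power_mult)
      thus "ch1 (inverse x ^ nexp e j) * ch2 (poly H (inverse x) ^ nexp e j) * \<psi> (abstr (e * j) (u / inverse x + v * inverse x))
        = \<Phi> (x ^ nexp e j, poly Hr x ^ nexp e j, abstr (e * j) (v / x + u * x))"
        unfolding \<Phi>_def by (simp add: power_inverse field_simps)
    next
      fix x assume x: "x \<in> XH (p ^ (e * j)) H"
      hence x0: "x \<noteq> 0" by (simp add: XH_def)
      have "poly Hr (inverse x) = inverse x ^ h * poly H x"
        unfolding Hr_def h_def using x0 by (simp add: poly_reflect_poly_nz)
      thus "inverse x \<in> XH (p ^ (e * j)) Hr" using x x0 by (auto simp: XH_def FF_inverse)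
    qed auto
    ultimately show ?thesis by simp
  qed
qed

end

section \<open>The $L$-function\<close>

lemma dvd_alg_closed_order:
  fixes A g :: "'k::alg_closed_field poly"
  assumes "A \<noteq> 0" "g \<noteq> 0" "\<And>x. order x A \<le> order x g"
  shows "A dvd g"
proof -
  have split: "\<exists>c. c \<noteq> 0 \<and> p = smult c (\<Prod>x\<in>#proots p. [:-x, 1:])" if p: "p \<noteq> 0" for p :: "'k poly"
  proof -
    obtain B where B: "size B = degree p" "p = smult (lead_coeff p) (\<Prod>x\<in>#B. [:-x, 1:])"
      using alg_closed_imp_factorization[OF p] by blast
    have "proots p = proots (\<Prod>x\<in>#B. [:-x, 1:])"
      by (subst B(2)) (use p in auto)
    also have "\<dots> = B"
      by (induction B) (simp_all add: proots_mult image_iff del: mult_pCons_left)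
    finally show ?thesis using B(2) p by (intro exI[of _ "lead_coeff p"]) auto
  qed
  obtain a where a: "a \<noteq> 0" "A = smult a (\<Prod>x\<in>#proots A. [:-x, 1:])" using split assms by blast
  obtain b where b: "b \<noteq> 0" "g = smult b (\<Prod>x\<in>#proots g. [:-x, 1:])" using split assms by blast
  have "proots A \<subseteq># proots g"
    using assms by (auto simp: subseteq_mset_def)
  hence "(\<Prod>x\<in>#proots A. [:-x, 1:]) dvd (\<Prod>x\<in>#proots g. [:-x, 1:])"
    by (intro prod_mset_subset_imp_dvd image_mset_subseteq_mono)
  hence "smult a (\<Prod>x\<in>#proots A. [:-x, 1:]) dvd smult b (\<Prod>x\<in>#proots g. [:-x, 1:])"
    using a(1) b(1) by (intro smult_dvd dvd_smult)
  thus ?thesis using a(2) b(2) by simp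
qed

lemma prod_lessThan_add:
  "(\<Prod>i<a + b. f i) = (\<Prod>i<a. f i) * (\<Prod>i<b. f (i + a) :: 'a::comm_monoid_mult)" for a b :: nat
  by (induction b) (simp_all add: ac_simps)

lemma sum_lessThan_add:
  "(\<Sum>i<a + b. f i) = (\<Sum>i<a. f i) + (\<Sum>i<b. f (i + a) :: 'a::comm_monoid_add)" for a b :: nat
  by (induction b) (simp_all add: ac_simps)

lemma coprime_no_common_root:
  fixes A g :: "'k::alg_closed_field poly"
  assumes "g \<noteq> 0" "\<And>x. poly A x = 0 \<Longrightarrow> poly g x \<noteq> 0"
  shows "coprime A g"
proof (rule coprimeI)
  fix c assume c: "c dvd A" "c dvd g"
  show "is_unit c"
  proof (cases "degree c = 0")
    case True
    then obtain a where "c = [:a:]" by (elim degree_eq_zeroE)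
    moreover have "c \<noteq> 0" using c assms by auto
    ultimately show ?thesis by (simp add: is_unit_const_poly_iff dvd_field_iff)
  next
    case False
    then obtain x where "poly c x = 0" using alg_closed_imp_poly_has_root[of c] by auto
    hence "poly A x = 0" "poly g x = 0" using c by (auto elim!: dvdE)
    thus ?thesis using assms(2) by blast
  qed
qed

lemma finite_bounded_polys:
  assumes "finite A"
  shows "finite {g :: 'k::zero poly. degree g \<le> n \<and> (\<forall>i. coeff g i \<in> A)}"
proof (rule finite_imageD)
  show "inj_on (\<lambda>g. map (coeff g) [0..<Suc n]) {g. degree g \<le> n \<and> (\<forall>i. coeff g i \<in> A)}"
  proof (rule inj_onI)
    fix g h assume gh: "g \<in> {g. degree g \<le> n \<and> (\<forall>i. coeff g i \<in> A)}" "h \<in> {g. degree g \<le> n \<and> (\<forall>i. coeff g i \<in> A)}"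
      "map (coeff g) [0..<Suc n] = map (coeff h) [0..<Suc n]"
    show "g = h"
    proof (rule poly_eqI)
      fix i
      show "coeff g i = coeff h i"
      proof (cases "i \<le> n")
        case True
        hence "i \<in> set [0..<Suc n]" by (simp del: upt_Suc)
        thus ?thesis using gh(3) unfolding map_eq_conv by blast
      next
        case False
        thus ?thesis using gh by (simp add: coeff_eq_0)
      qed
    qed
  qed
  have "(\<lambda>g. map (coeff g) [0..<Suc n]) ` {g. degree g \<le> n \<and> (\<forall>i. coeff g i \<in> A)}
      \<subseteq> {xs. set xs \<subseteq> A \<and> length xs = Suc n}" by auto
  thus "finite ((\<lambda>g. map (coeff g) [0..<Suc n]) ` {g. degree g \<le> n \<and> (\<forall>i. coeff g i \<in> A)})"
    using finite_lists_length_eq[OF assms] by (rule finite_subset)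
qed

section \<open>Frobenius on polynomials and characteristic polynomials of points\<close>

context pchar
begin

definition frobp :: "nat \<Rightarrow> 'k poly \<Rightarrow> 'k poly" where
  "frobp e = map_poly (\<lambda>c. c ^ (p ^ e))"

lemma coeff_frobp: "coeff (frobp e g) i = coeff g i ^ (p ^ e)"
  unfolding frobp_def using p1 by (intro coeff_map_poly) (simp add: power_0_left)

lemma polyF_iff_frobp: "polyF (p ^ e) g \<longleftrightarrow> frobp e g = g"
  unfolding polyF_def FF_def poly_eq_iff coeff_frobp by simp

lemma frobp_add: "frobp e (g + h) = frobp e g + frobp e h"
  by (rule poly_eqI) (simp add: coeff_frobp frob_add)

lemma frobp_mult: "frobp e (g * h) = frobp e g * frobp e h"
  by (rule poly_eqI) (simp add: coeff_frobp coeff_mult frob_sum power_mult_distrib)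

lemma frobp_1 [simp]: "frobp e 1 = 1"
  using p1 by (intro poly_eqI) (simp add: coeff_frobp power_0_left)

lemma frobp_prod: "frobp e (\<Prod>i\<in>A. f i) = (\<Prod>i\<in>A. frobp e (f i))"
  by (induction A rule: infinite_finite_induct) (auto simp: frobp_mult)

lemma frobp_power: "frobp e (g ^ n) = frobp e g ^ n"
  by (induction n) (auto simp: frobp_mult)

lemma degree_frobp: "degree (frobp e g) = degree g"
  unfolding frobp_def using p1 by (intro degree_map_poly) auto

lemma frobp_linear: "frobp e [:a, b:] = [:a ^ (p ^ e), b ^ (p ^ e):]"
  using p1 by (intro poly_eqI) (auto simp: coeff_frobp coeff_pCons power_0_left split: nat.splits)

lemma polyF_mult: "polyF (p ^ e) g \<Longrightarrow> polyF (p ^ e) h \<Longrightarrow> polyF (p ^ e) (g * h :: 'k poly)"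
  and polyF_add: "polyF (p ^ e) g \<Longrightarrow> polyF (p ^ e) h \<Longrightarrow> polyF (p ^ e) (g + h :: 'k poly)"
  and polyF_diff: "polyF (p ^ e) g \<Longrightarrow> polyF (p ^ e) h \<Longrightarrow> polyF (p ^ e) (g - h :: 'k poly)"
  and polyF_1: "polyF (p ^ e) (1 :: 'k poly)"
  and polyF_smult: "c \<in> FF (p ^ e) \<Longrightarrow> polyF (p ^ e) g \<Longrightarrow> polyF (p ^ e) (smult c g :: 'k poly)"
  and polyF_monom: "c \<in> FF (p ^ e) \<Longrightarrow> polyF (p ^ e) (monom c n :: 'k poly)"
  using p1 by (auto simp: polyF_iff_frobp frobp_mult frobp_add)
     (auto simp flip: polyF_iff_frobp simp: polyF_def FF_diff FF_mult coeff_monom)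

lemma polyF_pcoeff: "polyF (p ^ e) g \<Longrightarrow> coeff g i \<in> (FF (p ^ e) :: 'k set)"
  by (simp add: polyF_def)

lemma polyF_pderiv: "polyF (p ^ e) g \<Longrightarrow> polyF (p ^ e) (pderiv g :: 'k poly)"
proof -
  assume g: "polyF (p ^ e) g"
  have "(of_nat n :: 'k) \<in> FF (p ^ e)" for n
    by (induction n) (use p1 in \<open>auto intro: FF_add\<close>)
  from this[of "Suc n" for n] show ?thesis
    using g unfolding polyF_def coeff_pderiv by (intro allI FF_mult) auto
qed

lemma polyF_quotient:
  assumes "polyF (p ^ e) (A * h)" "polyF (p ^ e) A" "A \<noteq> 0"
  shows "polyF (p ^ e) (h :: 'k poly)"
proof -
  have "A * frobp e h = A * h" using assms(1,2) by (simp add: polyF_iff_frobp frobp_mult)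
  thus ?thesis using assms(3) by (simp add: polyF_iff_frobp)
qed

text \<open>Frobenius maps a division with remainder to one with the same dividend and divisor, and
  quotient and remainder are unique.\<close>

lemma polyF_div_mod:
  assumes g: "polyF (p ^ e) g" and m: "polyF (p ^ e) m" "m \<noteq> 0"
  shows "polyF (p ^ e) (g div m :: 'k poly)" "polyF (p ^ e) (g mod m :: 'k poly)"
proof -
  have eq: "g = frobp e (g div m) * m + frobp e (g mod m)"
    using arg_cong[OF div_mult_mod_eq[of g m], of "frobp e"] g m(1)
    unfolding polyF_iff_frobp frobp_add frobp_mult by simp
  have "frobp e (g mod m) = 0 \<or> degree (frobp e (g mod m)) < degree m"
  proof (cases "g mod m = 0")
    case True
    thus ?thesis by (simp add: frobp_def)
  next
    case False
    thus ?thesis using degree_mod_less[OF m(2), of g] by (simp add: degree_frobp)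
  qed
  hence "frobp e (g mod m) mod m = frobp e (g mod m)" by (auto simp: mod_poly_less)
  hence mod: "g mod m = frobp e (g mod m)" by (subst eq) simp
  moreover have "frobp e (g div m) * m = g div m * m"
    using eq mod div_mult_mod_eq[of g m] by (metis add_right_cancel)
  hence "frobp e (g div m) = g div m" using m(2) by simp
  ultimately show "polyF (p ^ e) (g div m)" "polyF (p ^ e) (g mod m)"
    unfolding polyF_iff_frobp by simp_all
qed

lemma pow_pow_frob: "(x ^ (p ^ (e * i))) ^ (p ^ e) = (x :: 'k) ^ (p ^ (e * Suc i))"
  by (simp add: power_add mult.commute flip: power_mult)

text \<open>For x in \<open>FF (p ^ (e * j))\<close> this is the characteristic polynomial of x over
  \<open>FF (p ^ e)\<close>; conjugates are repeated if x lies in a smaller field.\<close>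

definition cpoly :: "nat \<Rightarrow> nat \<Rightarrow> 'k \<Rightarrow> 'k poly" where
  "cpoly e j x = (\<Prod>i<j. [:- (x ^ (p ^ (e * i))), 1:])"

lemma cpoly_monic: "lead_coeff (cpoly e j x) = 1" "degree (cpoly e j x) = j" "cpoly e j x \<noteq> 0"
proof -
  show "lead_coeff (cpoly e j x) = 1" unfolding cpoly_def lead_coeff_prod by simp
  thus "cpoly e j x \<noteq> 0" by auto
  show "degree (cpoly e j x) = j" unfolding cpoly_def by (subst degree_prod_eq_sum_degree) auto
qed

lemma cpoly_polyF:
  assumes "x \<in> FF (p ^ (e * j))"
  shows "polyF (p ^ e) (cpoly e j x)"
proof -
  have eq: "frobp e (cpoly e j x) = (\<Prod>i<j. [:- (x ^ (p ^ (e * Suc i))), 1:])"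
    unfolding cpoly_def frobp_prod frobp_linear frob_minus pow_pow_frob by simp
  have "(\<Prod>i<j. [:- (x ^ (p ^ (e * Suc i))), 1:]) * [:- (x ^ (p ^ (e * 0))), 1:]
      = (\<Prod>i<Suc j. [:- (x ^ (p ^ (e * i))), 1:])"
    by (simp only: prod.lessThan_Suc_shift mult.commute)
  also have "\<dots> = cpoly e j x * [:- (x ^ (p ^ (e * j))), 1:]"
    unfolding cpoly_def by simp
  also have "x ^ (p ^ (e * j)) = x ^ (p ^ (e * 0))" using assms by (simp add: FF_def)
  finally have "frobp e (cpoly e j x) * [:- (x ^ (p ^ (e * 0))), 1:] = cpoly e j x * [:- (x ^ (p ^ (e * 0))), 1:]"
    unfolding eq .
  moreover have "[:- (x ^ (p ^ (e * 0))), 1:] \<noteq> 0" by simp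
  ultimately have "frobp e (cpoly e j x) = cpoly e j x" using mult_right_cancel by blast
  thus ?thesis by (simp add: polyF_iff_frobp)
qed

lemma order_frob_le:
  assumes g: "polyF (p ^ e) g" "g \<noteq> 0"
  shows "order x g \<le> order (x ^ (p ^ (e * i))) (g :: 'k poly)"
proof (induction i)
  case (Suc i)
  define y where "y = x ^ (p ^ (e * i))"
  obtain h where "g = [:-y, 1:] ^ order y g * h" using order_1[of y g] by (elim dvdE)
  hence "frobp e g = frobp e ([:-y, 1:] ^ order y g * h)" by simp
  hence "g = [:-(y ^ (p ^ e)), 1:] ^ order y g * frobp e h"
    using g by (simp add: frobp_mult frobp_power frobp_linear frob_minus polyF_iff_frobp)
  hence "[:-(y ^ (p ^ e)), 1:] ^ order y g dvd g" by (metis dvd_triv_left)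
  hence "order y g \<le> order (y ^ (p ^ e)) g" using g order_divides by blast
  thus ?case using Suc.IH unfolding y_def pow_pow_frob by simp
qed simp

text \<open>Let P be the minimal polynomial of a root x, of degree d. The point lies in the j-th
  extension iff j = k * d; there its characteristic polynomial is P ^ k, which divides
  \<open>g\<close> iff k is at most the order of \<open>g\<close> at x.\<close>

lemma card_cpoly_dvd:
  assumes g: "polyF (p ^ e) g" "g \<noteq> 0" and e: "e > 0" and n: "degree g \<le> n"
  shows "card {j. 0 < j \<and> j \<le> n \<and> x \<in> FF (p ^ (e * j)) \<and> cpoly e j x dvd g} = order x (g :: 'k poly)"
proof (cases "poly g x = 0")
  case False
  have "\<not> cpoly e j x dvd g" if "0 < j" for j
  proof
    assume "cpoly e j x dvd g"
    moreover have "poly (cpoly e j x) x = 0"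
      unfolding cpoly_def poly_prod using that by (intro prod_zero) (auto intro!: bexI[of _ 0])
    ultimately show False using False by (auto elim!: dvdE)
  qed
  hence "{j. 0 < j \<and> j \<le> n \<and> x \<in> FF (p ^ (e * j)) \<and> cpoly e j x dvd g} = {}" by blast
  thus ?thesis using False by (simp add: order_0I)
next
  case True
  let ?f = "\<lambda>i. x ^ (p ^ (e * i))"
  have shift: "x ^ (p ^ (e * (i + j))) = (?f i) ^ (p ^ (e * j))" for i j
    by (simp add: distrib_left power_add power_mult)
  \<comment> \<open>Conjugates of a root of \<open>g\<close> are roots, so they repeat. Injectivity
    of Frobenius makes the sequence purely periodic, and its period \<open>d\<close> is the degree
    of x.\<close>
  have "?f i \<in> {y. poly g y = 0}" for i
    using order_frob_le[OF g, of x i] True g by (auto simp: order_root)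
  hence "finite (range ?f)" using poly_roots_finite[OF g(2)] by (meson finite_subset image_subsetI)
  hence "\<not> inj ?f" using finite_imageD infinite_UNIV_nat by blast
  then obtain a b where ab: "a < b" "?f a = ?f b" unfolding inj_on_def by (metis linorder_neqE_nat)
  have "?f a = (?f (b - a)) ^ (p ^ (e * a))" using ab shift[of "b - a" a] by simp
  hence "?f (b - a) = x" using frob_inj by metis
  hence ex: "\<exists>d. 0 < d \<and> ?f d = x" using ab by (intro exI[of _ "b - a"]) auto
  define d where "d = (LEAST d. 0 < d \<and> ?f d = x)"
  have d: "0 < d" "?f d = x" using LeastI_ex[OF ex] unfolding d_def by blast+
  have dmin: "d \<le> d'" if "0 < d'" "?f d' = x" for d' unfolding d_def using that by (intro Least_le) auto
  have per: "?f (i + k * d) = ?f i" for i k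
  proof (induction k)
    case (Suc k)
    have "?f (i + Suc k * d) = (?f d) ^ (p ^ (e * (i + k * d)))"
      using shift[of d "i + k * d"] by (simp add: algebra_simps)
    thus ?case using d Suc by simp
  qed simp
  have mem: "x \<in> FF (p ^ (e * j)) \<longleftrightarrow> d dvd j" for j
  proof
    assume "x \<in> FF (p ^ (e * j))"
    hence "?f j = x" by (simp add: FF_def)
    moreover have "?f j = ?f (j mod d)" using per[of "j mod d" "j div d"] by simp
    ultimately have "?f (j mod d) = x" by simp
    hence "j mod d = 0" using dmin[of "j mod d"] d(1) by (metis mod_less_divisor not_gr0 leD)
    thus "d dvd j" by blast
  next
    assume "d dvd j"
    then obtain k where "j = k * d" by (metis dvdE mult.commute)
    thus "x \<in> FF (p ^ (e * j))" using per[of 0 k] by (simp add: FF_def)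
  qed
  have dist: "inj_on ?f {..<d}"
  proof (rule linorder_inj_onI)
    fix a b assume ab: "a < b" "a \<in> {..<d}" "b \<in> {..<d}"
    show "?f a \<noteq> ?f b"
    proof
      assume "?f a = ?f b"
      moreover have "?f b = (?f (b - a)) ^ (p ^ (e * a))" using ab shift[of "b - a" a] by simp
      ultimately have "?f (b - a) = x" using frob_inj by metis
      thus False using dmin[of "b - a"] ab by auto
    qed
  qed auto
  define P where "P = cpoly e d x"
  have P0: "P \<noteq> 0" unfolding P_def by (rule cpoly_monic)
  have pw: "cpoly e (k * d) x = P ^ k" for k
  proof (induction k)
    case (Suc k)
    have "cpoly e (Suc k * d) x = cpoly e (k * d + d) x" by (simp add: add.commute)
    also have "\<dots> = cpoly e (k * d) x * (\<Prod>i<d. [:- (?f (i + k * d)), 1:])"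
      unfolding cpoly_def by (rule prod_lessThan_add)
    finally show ?case unfolding per Suc P_def by (simp add: cpoly_def mult.commute)
  qed (simp add: cpoly_def)
  have ordP: "order y P \<le> (if y \<in> ?f ` {..<d} then 1 else 0)" for y
  proof -
    have "proots P = (\<Sum>i<d. {#?f i#})"
      unfolding P_def cpoly_def by (subst proots_prod) (auto simp: algebra_simps)
    hence "order y P = count (\<Sum>i<d. {#?f i#}) y" using P0 by (metis count_proots)
    also have "\<dots> = (\<Sum>i<d. if ?f i = y then 1 else 0)"
      unfolding count_sum by (intro sum.cong) auto
    also have "\<dots> = card {i \<in> {..<d}. ?f i = y}" by (simp add: sum.If_cases Int_def)
    also have "\<dots> \<le> (if y \<in> ?f ` {..<d} then 1 else 0)"
    proof (cases "y \<in> ?f ` {..<d}")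
      case True
      then obtain i where "i < d" "?f i = y" by auto
      hence "{i \<in> {..<d}. ?f i = y} \<subseteq> {i}" using dist by (auto simp: inj_on_def)
      hence "card {i \<in> {..<d}. ?f i = y} \<le> card {i}" by (intro card_mono) auto
      thus ?thesis using True by simp
    next
      case False
      hence "{i \<in> {..<d}. ?f i = y} = {}" by auto
      thus ?thesis using False by simp
    qed
    finally show ?thesis .
  qed
  have dvd: "P ^ k dvd g \<longleftrightarrow> k \<le> order x g" for k
  proof
    assume k: "k \<le> order x g"
    show "P ^ k dvd g"
    proof (rule dvd_alg_closed_order)
      fix y
      have "order y (P ^ k) = k * order y P" using P0 by (induction k) (auto simp: order_mult)
      also have "\<dots> \<le> order y g"
      proof (cases "y \<in> ?f ` {..<d}")
        case True
        then obtain i where i: "y = ?f i" by auto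
        have "k * order y P \<le> k * 1" using ordP[of y] True by (intro mult_left_mono) auto
        thus ?thesis using k order_frob_le[OF g, of x i] unfolding i by linarith
      next
        case False
        thus ?thesis using ordP[of y] by simp
      qed
      finally show "order y (P ^ k) \<le> order y g" .
    qed (use P0 g in auto)
  next
    assume "P ^ k dvd g"
    moreover have "[:-x, 1:] ^ k dvd P ^ k"
    proof (rule dvd_power_same)
      have "poly P x = 0" unfolding P_def cpoly_def poly_prod using d by (intro prod_zero) (auto intro!: bexI[of _ 0])
      thus "[:-x, 1:] dvd P" by (simp add: poly_eq_0_iff_dvd)
    qed
    ultimately have "[:-x, 1:] ^ k dvd g" using dvd_trans by blast
    thus "k \<le> order x g" using g order_divides by blast
  qed
  have "{j. 0 < j \<and> j \<le> n \<and> x \<in> FF (p ^ (e * j)) \<and> cpoly e j x dvd g} = (\<lambda>k. k * d) ` {0<..order x g}"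
  proof (intro equalityI subsetI)
    fix j assume "j \<in> {j. 0 < j \<and> j \<le> n \<and> x \<in> FF (p ^ (e * j)) \<and> cpoly e j x dvd g}"
    hence j: "0 < j" "d dvd j" "cpoly e j x dvd g" using mem by auto
    obtain k where k: "j = k * d" using j(2) by (metis dvdE mult.commute)
    have "k \<le> order x g" using j(3) unfolding k pw dvd .
    thus "j \<in> (\<lambda>k. k * d) ` {0<..order x g}" using j k by auto
  next
    fix j assume "j \<in> (\<lambda>k. k * d) ` {0<..order x g}"
    then obtain k where k0: "k \<in> {0<..order x g}" and k1: "j = k * d" by blast
    hence k: "j = k * d" "0 < k" "k \<le> order x g" by simp_all
    have dv: "cpoly e j x dvd g" unfolding k(1) pw using dvd k by simp
    hence "degree (cpoly e j x) \<le> degree g" using g(2) by (intro dvd_imp_degree_le)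
    hence "j \<le> n" using n cpoly_monic(2)[of e j x] by simp
    thus "j \<in> {j. 0 < j \<and> j \<le> n \<and> x \<in> FF (p ^ (e * j)) \<and> cpoly e j x dvd g}"
      using dv k d mem by auto
  qed
  moreover have "inj_on (\<lambda>k. k * d) {0<..order x g}" using d by (auto simp: inj_on_def)
  ultimately show ?thesis by (simp add: card_image)
qed

end

section \<open>Traces to the prime field and the multiplicative function behind the L-series\<close>

context pchar
begin

lemma psi_abstr_add:
  assumes "add_char p \<psi>" "x \<in> FF (p ^ e)" "y \<in> FF (p ^ e)"
  shows "\<psi> (abstr e (x + y)) = \<psi> (abstr e x) * \<psi> (abstr e y)"
  unfolding abstr_add using assms(1) abstr_in_FF[OF assms(2)] abstr_in_FF[OF assms(3)] by (simp add: add_char_def)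

lemma abstr_tower: "abstr e (\<Sum>i<j. g ^ (p ^ (e * i))) = abstr (e * j) g"
proof (induction j)
  case (Suc j)
  have "abstr e (g ^ (p ^ (e * j))) = (\<Sum>i<e. g ^ (p ^ (i + e * j)))"
    unfolding abstr_def by (simp add: power_add mult.commute flip: power_mult)
  moreover have "abstr (e * Suc j) g = abstr (e * j) g + (\<Sum>i<e. g ^ (p ^ (i + e * j)))"
    unfolding abstr_def mult_Suc_right add.commute[of e] by (rule sum_lessThan_add)
  ultimately show ?case using Suc by (simp add: abstr_add)
qed (simp add: abstr_def[of 0])

text \<open>The trace is a polynomial of degree at most p ^ (e - 1) and cannot vanish at p ^ e
  points; the integer multiples of one nonzero value \<open>t\<close> fill the prime field and reach
  \<open>z0\<close>.\<close>

lemma psi_abstr_nontrivial: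
  assumes e: "e > 0" and psi: "z0 \<in> FF p" "\<psi> z0 \<noteq> 1"
  shows "\<exists>y\<in>FF (p ^ e). \<psi> (abstr e y :: 'k) \<noteq> 1"
proof (rule ccontr)
  assume triv: "\<not> ?thesis"
  have "\<exists>y\<in>FF (p ^ e). abstr e y \<noteq> (0 :: 'k)"
  proof (rule ccontr)
    assume "\<not> ?thesis"
    hence all: "FF (p ^ e) \<subseteq> {y. poly (\<Sum>i<e. monom 1 (p ^ i)) y = (0 :: 'k)}"
      by (auto simp: abstr_def poly_sum poly_monom)
    have c: "coeff (\<Sum>i<e. monom 1 (p ^ i)) 1 = (1 :: 'k)"
    proof -
      have "coeff (\<Sum>i<e. monom 1 (p ^ i)) 1 = (\<Sum>i<e. if i = 0 then 1 else 0 :: 'k)"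
        unfolding coeff_sum
      proof (intro sum.cong refl)
        fix i
        have "p ^ i = 1 \<longleftrightarrow> i = 0" using p1 by auto
        thus "coeff (monom 1 (p ^ i)) 1 = (if i = 0 then 1 else 0 :: 'k)" by (simp add: coeff_monom)
      qed
      thus ?thesis using e by simp
    qed
    hence nz: "(\<Sum>i<e. monom 1 (p ^ i)) \<noteq> (0 :: 'k poly)" by (metis coeff_0 zero_neq_one)
    have "p ^ e = card (FF (p ^ e) :: 'k set)" using card_FF[OF e] by simp
    also have "\<dots> \<le> card {y. poly (\<Sum>i<e. monom 1 (p ^ i)) y = (0 :: 'k)}"
      using all nz by (intro card_mono poly_roots_finite)
    also have "\<dots> \<le> degree (\<Sum>i<e. monom 1 (p ^ i) :: 'k poly)" using nz by (rule card_poly_roots_bound)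
    also have "\<dots> \<le> p ^ (e - 1)"
      using p1 by (intro degree_sum_le) (auto simp: degree_monom_eq intro!: power_increasing)
    also have "\<dots> < p ^ e" using p1 e by (intro power_strict_increasing) auto
    finally show False by simp
  qed
  then obtain y where y: "y \<in> FF (p ^ e)" "abstr e y \<noteq> 0" by blast
  define t where "t = abstr e y"
  have tF: "t \<in> FF p" unfolding t_def by (rule abstr_in_FF[OF y(1)])
  have mult: "of_nat k * y \<in> FF (p ^ e) \<and> abstr e (of_nat k * y) = of_nat k * t" for k
    by (induction k) (use y p1 in \<open>auto simp: distrib_right abstr_add FF_add t_def\<close>)
  have inj: "inj_on (\<lambda>k. of_nat k * t) {..<p}"
  proof (rule linorder_inj_onI)
    fix a b :: nat assume ab: "a < b" "a \<in> {..<p}" "b \<in> {..<p}"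
    show "of_nat a * t \<noteq> of_nat b * t"
    proof
      assume "of_nat a * t = of_nat b * t"
      hence "of_nat (b - a) = (0 :: 'k)" using y ab by (simp add: t_def of_nat_diff)
      hence "p dvd b - a" by (simp add: of_nat_eq_0_iff_char_dvd CHAR)
      hence "p \<le> b - a" using ab by (intro dvd_imp_le) auto
      thus False using ab by auto
    qed
  qed auto
  have "(\<lambda>k. of_nat k * t) ` {..<p} = FF p"
  proof (rule card_subset_eq)
    show "finite (FF p :: 'k set)" using finite_FF[of 1] by simp
    show "(\<lambda>k. of_nat k * t) ` {..<p} \<subseteq> FF p"
    proof safe
      fix k
      show "of_nat k * t \<in> FF p" using mult[of k] abstr_in_FF by metis
    qed
    show "card ((\<lambda>k. of_nat k * t) ` {..<p}) = card (FF p :: 'k set)"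
      using card_image[OF inj] card_FF[of 1] by simp
  qed
  hence "z0 \<in> (\<lambda>k. of_nat k * t) ` {..<p}" using psi by simp
  then obtain k where "z0 = of_nat k * t" by blast
  hence "z0 = abstr e (of_nat k * y)" "of_nat k * y \<in> FF (p ^ e)" using mult[of k] by auto
  thus False using triv psi by auto
qed

end

text \<open>H is given by roots and exponents, since later it is a product over zeros and poles in
  which a pole may get a large exponent. Stability under Frobenius expresses that the coefficients
  are rational, and a root of exponent 1 serves the Eisenstein argument.\<close>

locale lfun = pchar p K for p and K :: "'k::alg_closed_field itself" +
  fixes e :: nat and R :: "'k set" and ex :: "'k \<Rightarrow> nat" and ch1 ch2 \<psi> :: "'k \<Rightarrow> complex" and u v \<rho>0 z0 :: 'k
  assumes e: "e > 0" and finR: "finite R" and R0: "0 \<notin> R"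
    and R_frob: "\<And>\<rho>. \<rho> \<in> R \<Longrightarrow> \<rho> ^ (p ^ e) \<in> R" and ex_frob: "\<And>\<rho>. \<rho> \<in> R \<Longrightarrow> ex (\<rho> ^ (p ^ e)) = ex \<rho>"
    and ex_pos: "\<And>\<rho>. \<rho> \<in> R \<Longrightarrow> ex \<rho> > 0" and \<rho>0: "\<rho>0 \<in> R" "ex \<rho>0 = 1"
    and uv: "u \<in> FF (p ^ e)" "v \<in> FF (p ^ e)"
    and ch: "mult_char (p ^ e) ch1" "mult_char (p ^ e) ch2"
    and psi: "add_char p \<psi>" "z0 \<in> FF p" "\<psi> z0 \<noteq> 1"
    and nontriv: "u \<noteq> 0 \<or> v \<noteq> 0 \<or> (\<exists>z\<in>FF (p ^ e) - {0}. ch1 z \<noteq> 1) \<or> (\<exists>z\<in>FF (p ^ e) - {0}. ch2 z \<noteq> 1)"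
begin

abbreviation "Q \<equiv> p ^ e"

lemma Q1: "Q > 1" using e p1 by (metis one_less_power)

lemma bij_frob_R: "bij_betw (\<lambda>\<rho>. \<rho> ^ Q) R R"
proof -
  have "inj_on (\<lambda>\<rho>. \<rho> ^ Q) R" by (intro inj_onI) (rule frob_inj)
  moreover have "(\<lambda>\<rho>. \<rho> ^ Q) ` R \<subseteq> R" using R_frob by auto
  ultimately show ?thesis using finR by (simp add: bij_betw_def endo_inj_surj)
qed

text \<open>Factors \<rho> - x rather than x - \<rho> make \<open>resR (cpoly e j x)\<close> the
  norm of \<open>poly HR x\<close> without a sign.\<close>

definition HR :: "'k poly" where "HR = (\<Prod>\<rho>\<in>R. [:\<rho>, -1:] ^ ex \<rho>)"

lemma poly_HR: "poly HR x = (\<Prod>\<rho>\<in>R. (\<rho> - x) ^ ex \<rho>)"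
  unfolding HR_def by (simp add: poly_prod)

lemma HR_polyF: "polyF Q HR"
proof -
  have "frobp e HR = (\<Prod>\<rho>\<in>R. [:\<rho> ^ Q, -1:] ^ ex (\<rho> ^ Q))"
    unfolding HR_def frobp_prod frobp_power frobp_linear using ex_frob by (intro prod.cong) (auto simp: frob_minus)
  also have "\<dots> = HR" unfolding HR_def using prod.reindex_bij_betw[OF bij_frob_R, of "\<lambda>\<rho>. [:\<rho>, -1:] ^ ex \<rho>"] .
  finally show ?thesis by (simp add: polyF_iff_frobp)
qed

lemma poly_HR_eq_0_iff: "poly HR x = 0 \<longleftrightarrow> x \<in> R"
  unfolding poly_HR using finR ex_pos by auto

lemma HR_simple_root: "poly HR \<rho>0 = 0" "poly (pderiv HR) \<rho>0 \<noteq> 0" "poly HR 0 \<noteq> 0"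
proof -
  show "poly HR \<rho>0 = 0" "poly HR 0 \<noteq> 0" using \<rho>0 R0 by (auto simp: poly_HR_eq_0_iff)
  define G where "G = (\<Prod>\<rho>\<in>R - {\<rho>0}. [:\<rho>, -1:] ^ ex \<rho>)"
  have "HR = [:\<rho>0, -1:] * G" unfolding HR_def G_def using \<rho>0 finR by (subst prod.remove[of R \<rho>0]) auto
  moreover have "poly G \<rho>0 \<noteq> 0" unfolding G_def poly_prod using finR by auto
  moreover have "poly (pderiv ([:\<rho>0, -1:] * G)) \<rho>0 = - poly G \<rho>0"
    unfolding pderiv_mult by (simp add: pderiv_pCons)
  ultimately show "poly (pderiv HR) \<rho>0 \<noteq> 0" by simp
qed

definition monics :: "nat \<Rightarrow> 'k poly set" where
  "monics n = {g. lead_coeff g = 1 \<and> degree g = n \<and> polyF Q g}"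

definition nzR :: "'k poly \<Rightarrow> bool" where
  "nzR g \<longleftrightarrow> poly g 0 \<noteq> 0 \<and> (\<forall>\<rho>\<in>R. poly g \<rho> \<noteq> 0)"

text \<open>For monic \<open>g\<close> this is the product of the values of \<open>HR\<close> at the
  roots of \<open>g\<close>, that is, a resultant up to sign.\<close>

definition resR :: "'k poly \<Rightarrow> 'k" where
  "resR g = (\<Prod>\<rho>\<in>R. poly g \<rho> ^ ex \<rho>)"

text \<open>For monic \<open>g\<close> with g(0) nonzero this is the sum of u / a + v * a over the
  roots a of \<open>g\<close>: the second highest coefficient gives the sum of the a, the
  logarithmic derivative at 0 that of the 1 / a.\<close>

definition trR :: "'k poly \<Rightarrow> 'k" where
  "trR g = - v * coeff (reflect_poly g) 1 - u * poly (pderiv g) 0 / poly g 0"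

text \<open>The analogue of a Dirichlet character, completely multiplicative on monic polynomials.
  At characteristic polynomials of degree j it takes the values of the summands of the character
  sum, up to the constant \<open>ch1 ((-1) ^ j)\<close>.\<close>

definition Lam :: "'k poly \<Rightarrow> complex" where
  "Lam g = (if nzR g then ch1 (poly g 0) * ch2 (resR g) * \<psi> (abstr e (trR g)) else 0)"

definition cL :: "nat \<Rightarrow> complex" where "cL n = (\<Sum>g\<in>monics n. Lam g)"

definition sL :: "nat \<Rightarrow> complex" where "sL j = (\<Sum>x\<in>FF (p ^ (e * j)). Lam (cpoly e j x))"

lemma finite_monics [simp]: "finite (monics n)"
proof -
  have "monics n \<subseteq> {g. degree g \<le> n \<and> (\<forall>i. coeff g i \<in> FF Q)}" by (auto simp: monics_def polyF_def)
  thus ?thesis using finite_bounded_polys[OF finite_FF[OF e]] by (rule finite_subset)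
qed

lemma monics_nz: "g \<in> monics n \<Longrightarrow> g \<noteq> 0" by (auto simp: monics_def)

lemma zero_FF [simp]: "0 \<in> FF Q"
  by (rule FF_0) (use Q1 in linarith)

lemma poly0_FF: "polyF Q g \<Longrightarrow> poly g (0 :: 'k) \<in> FF Q"
  by (simp add: poly_0_coeff_0 polyF_pcoeff)

lemma resR_FF:
  assumes "polyF Q g" shows "resR g \<in> FF Q"
proof -
  have "resR g ^ Q = (\<Prod>\<rho>\<in>R. poly g (\<rho> ^ Q) ^ ex (\<rho> ^ Q))"
    unfolding resR_def prod_power_distrib
  proof (intro prod.cong refl)
    fix \<rho> assume "\<rho> \<in> R"
    have "poly g \<rho> ^ Q = (\<Sum>i\<le>degree g. coeff g i ^ Q * (\<rho> ^ i) ^ Q)"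
      unfolding poly_altdef frob_sum by (simp add: power_mult_distrib)
    also have "\<dots> = poly g (\<rho> ^ Q)"
      using assms unfolding poly_altdef by (intro sum.cong) (auto simp: polyF_def FF_def mult.commute simp flip: power_mult)
    finally have "poly g \<rho> ^ Q = poly g (\<rho> ^ Q)" .
    moreover have "(poly g \<rho> ^ ex \<rho>) ^ Q = (poly g \<rho> ^ Q) ^ ex \<rho>"
      by (simp add: mult.commute flip: power_mult)
    ultimately show "(poly g \<rho> ^ ex \<rho>) ^ Q = poly g (\<rho> ^ Q) ^ ex (\<rho> ^ Q)"
      using ex_frob[OF \<open>\<rho> \<in> R\<close>] by simp
  qed
  also have "\<dots> = resR g" unfolding resR_def by (rule prod.reindex_bij_betw[OF bij_frob_R])
  finally show ?thesis by (simp add: FF_def)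
qed

lemma trR_FF: "polyF Q g \<Longrightarrow> trR g \<in> FF Q"
  unfolding trR_def using uv Q1
  by (intro FF_diff FF_mult FF_divide FF_uminus poly0_FF polyF_pderiv)
     (auto simp: coeff_reflect_poly polyF_pcoeff)

lemma resR_mult: "resR (g * h) = resR g * resR h"
  unfolding resR_def by (simp add: power_mult_distrib prod.distrib)

lemma resR_nz: "nzR g \<Longrightarrow> resR g \<noteq> 0"
  unfolding resR_def nzR_def using finR by auto

lemma nzR_mult: "nzR (g * h) \<longleftrightarrow> nzR g \<and> nzR h"
  by (auto simp: nzR_def)

lemma trR_mult:
  assumes "lead_coeff g = 1" "lead_coeff h = 1" "poly g 0 \<noteq> 0" "poly h 0 \<noteq> 0"
  shows "trR (g * h) = trR g + trR h"
proof -
  have "coeff (reflect_poly (g * h)) 1 = coeff (reflect_poly g) 1 + coeff (reflect_poly h) 1"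
    using assms unfolding reflect_poly_mult coeff_mult by (simp add: coeff_reflect_poly)
  moreover have "poly (pderiv (g * h)) 0 / poly (g * h) 0 = poly (pderiv g) 0 / poly g 0 + poly (pderiv h) 0 / poly h 0"
    using assms by (simp add: pderiv_mult field_simps)
  ultimately show ?thesis unfolding trR_def times_divide_eq_right[symmetric] by (simp add: algebra_simps)
qed

lemma Lam_mult:
  assumes "g \<in> monics n" "h \<in> monics m"
  shows "Lam (g * h) = Lam g * Lam h"
proof (cases "nzR g \<and> nzR h")
  case True
  have F: "poly g 0 \<in> FF Q - {0}" "poly h 0 \<in> FF Q - {0}" "resR g \<in> FF Q - {0}" "resR h \<in> FF Q - {0}"
    using True assms poly0_FF resR_FF resR_nz by (auto simp: nzR_def monics_def)
  have "trR (g * h) = trR g + trR h" using True assms by (intro trR_mult) (auto simp: monics_def nzR_def)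
  hence "\<psi> (abstr e (trR (g * h))) = \<psi> (abstr e (trR g)) * \<psi> (abstr e (trR h))"
    using trR_FF assms by (simp add: psi_abstr_add[OF psi(1)] monics_def)
  thus ?thesis
    using True F ch by (simp add: Lam_def nzR_mult resR_mult mult_char_def)
qed (auto simp: Lam_def nzR_mult)

lemma monics_mult: "g \<in> monics n \<Longrightarrow> h \<in> monics m \<Longrightarrow> g * h \<in> monics (n + m)"
  using monics_nz[of g n] monics_nz[of h m]
  by (auto simp: monics_def lead_coeff_mult polyF_mult degree_mult_eq)

lemma monics_0: "monics 0 = {1}"
proof
  show "monics 0 \<subseteq> {1}" by (auto simp: monics_def elim!: degree_eq_zeroE)
  show "{1} \<subseteq> monics 0" using polyF_1 by (auto simp: monics_def)
qed

lemma Lam_1: "Lam 1 = 1"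
  using ch psi by (simp add: Lam_def nzR_def resR_def trR_def mult_char_def add_char_def)

lemma cL_0: "cL 0 = 1" by (simp add: cL_def monics_0 Lam_1)

lemma cpoly_monics: "x \<in> FF (p ^ (e * j)) \<Longrightarrow> cpoly e j x \<in> monics j"
  using cpoly_monic[of e j x] cpoly_polyF by (simp add: monics_def)

lemma sum_multiples:
  assumes A: "A \<in> monics j" and j: "j \<le> n"
  shows "(\<Sum>g\<in>{g \<in> monics n. A dvd g}. Lam g) = Lam A * cL (n - j)"
proof -
  have A0: "A \<noteq> 0" using A by (rule monics_nz)
  have "(\<Sum>g\<in>{g \<in> monics n. A dvd g}. Lam g) = (\<Sum>h\<in>monics (n - j). Lam (A * h))"
  proof (rule sum.reindex_bij_betw[symmetric])
    show "bij_betw ((*) A) (monics (n - j)) {g \<in> monics n. A dvd g}"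
    proof (rule bij_betw_imageI)
      show "inj_on ((*) A) (monics (n - j))" using A0 by (auto simp: inj_on_def)
      show "(*) A ` monics (n - j) = {g \<in> monics n. A dvd g}"
      proof (intro equalityI subsetI)
        fix g assume "g \<in> (*) A ` monics (n - j)"
        thus "g \<in> {g \<in> monics n. A dvd g}" using monics_mult[OF A, of _ "n - j"] j by auto
      next
        fix g assume g: "g \<in> {g \<in> monics n. A dvd g}"
        then obtain h where h: "g = A * h" by blast
        have h0: "h \<noteq> 0" using g h monics_nz[of g n] by auto
        have "h \<in> monics (n - j)"
          using g A A0 h0 polyF_quotient[of e A h] unfolding h by (auto simp: monics_def degree_mult_eq coeff_mult_degree_sum)
        thus "g \<in> (*) A ` monics (n - j)" using h by blast
      qed
    qed
  qed
  also have "\<dots> = Lam A * cL (n - j)"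
    unfolding cL_def sum_distrib_left by (intro sum.cong refl Lam_mult[OF A])
  finally show ?thesis .
qed

text \<open>Double counting of pairs of a monic \<open>g\<close> of degree n and a point
  \<open>(j, x)\<close> whose characteristic polynomial divides \<open>g\<close>. Each
  \<open>g\<close> occurs n times, by \<open>card_cpoly_dvd\<close> and the number of its roots;
  each point contributes its value of \<open>Lam\<close> times a lower coefficient. This takes the
  place of the Euler product.\<close>

lemma newton_identity: "of_nat n * cL n = (\<Sum>j\<in>{1..n}. sL j * cL (n - j))"
proof -
  define T where "T = (SIGMA j:{1..n}. (FF (p ^ (e * j)) :: 'k set))"
  have fT: "finite T" unfolding T_def using finite_FF e by (intro finite_SigmaI) auto
  have count: "card {t \<in> T. cpoly e (fst t) (snd t) dvd g} = n" if g: "g \<in> monics n" for g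
  proof -
    have g': "polyF Q g" "g \<noteq> 0" "degree g \<le> n" using g monics_nz by (auto simp: monics_def)
    define J where "J = (\<lambda>x. {j. 0 < j \<and> j \<le> n \<and> x \<in> FF (p ^ (e * j)) \<and> cpoly e j x dvd g})"
    define Z where "Z = {x. poly g x = 0}"
    have fZ: "finite Z" unfolding Z_def using g' by (simp add: poly_roots_finite)
    have cJ: "card (J x) = order x g" for x unfolding J_def by (rule card_cpoly_dvd[OF g'(1,2) e g'(3)])
    have fJ: "finite (J x)" for x unfolding J_def by (rule finite_subset[of _ "{..n}"]) auto
    have "{t \<in> T. cpoly e (fst t) (snd t) dvd g} = prod.swap ` (SIGMA x:Z. J x)"
    proof -
      have JZ: "x \<in> Z" if "j \<in> J x" for x j
      proof -
        have "J x \<noteq> {}" using that by auto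
        hence "order x g \<noteq> 0" using cJ[of x] fJ[of x] by auto
        thus ?thesis unfolding Z_def using order_root by auto
      qed
      show ?thesis
      proof (intro equalityI subsetI)
        fix t assume t: "t \<in> {t \<in> T. cpoly e (fst t) (snd t) dvd g}"
        hence "fst t \<in> J (snd t)" by (auto simp: T_def J_def)
        moreover from this have "snd t \<in> Z" by (rule JZ)
        ultimately show "t \<in> prod.swap ` (SIGMA x:Z. J x)"
          by (intro image_eqI[of _ _ "(snd t, fst t)"]) auto
      qed (auto simp: T_def J_def)
    qed
    hence "card {t \<in> T. cpoly e (fst t) (snd t) dvd g} = card (SIGMA x:Z. J x)"
      by (simp add: card_image)
    also have "\<dots> = (\<Sum>x\<in>Z. order x g)" using fZ fJ cJ by simp
    also have "\<dots> = size (proots g)"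
      unfolding size_multiset_overloaded_eq Z_def using g' by (intro sum.cong) auto
    also have "\<dots> = n" using g by (simp add: size_proots_alg_closed monics_def)
    finally show ?thesis .
  qed
  have "of_nat n * cL n = (\<Sum>g\<in>monics n. \<Sum>t\<in>{t \<in> T. cpoly e (fst t) (snd t) dvd g}. Lam g)"
    unfolding cL_def sum_distrib_left using count by (intro sum.cong) auto
  also have "\<dots> = (\<Sum>t\<in>T. \<Sum>g\<in>{g \<in> monics n. cpoly e (fst t) (snd t) dvd g}. Lam g)"
    by (rule sum.swap_restrict[OF finite_monics fT])
  also have "\<dots> = (\<Sum>t\<in>T. Lam (cpoly e (fst t) (snd t)) * cL (n - fst t))"
    by (intro sum.cong refl sum_multiples cpoly_monics) (auto simp: T_def)
  also have "\<dots> = (\<Sum>j\<in>{1..n}. \<Sum>x\<in>FF (p ^ (e * j)). Lam (cpoly e j x) * cL (n - j))"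
    unfolding T_def using finite_FF e by (subst sum.Sigma) (auto simp: case_prod_unfold)
  finally show ?thesis by (simp add: sL_def sum_distrib_right)
qed

lemma sum_geom_nexp: "(\<Sum>i<j. p ^ (e * i)) = nexp e j"
proof -
  have "(\<Sum>i<j. p ^ (e * i)) * (Q - 1) = p ^ (e * j) - 1"
  proof (induction j)
    case (Suc j)
    have "p ^ (e * j) \<ge> 1" using p1 by simp
    moreover have "p ^ (e * Suc j) = p ^ (e * j) * Q" by (simp add: power_add)
    moreover have "p ^ (e * j) * (Q - 1) + p ^ (e * j) = p ^ (e * j) * Q" using Q1 by (simp add: algebra_simps)
    ultimately show ?case using Suc by (simp add: distrib_right)
  qed simp
  thus ?thesis unfolding nexp_def using Q1 by (metis div_mult_self_is_m zero_less_diff)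
qed

end

section \<open>Values at characteristic polynomials and vanishing of the high coefficients\<close>

context lfun
begin

lemma cpoly_nz: "poly (cpoly e j x) 0 = 0 \<longleftrightarrow> x = 0 \<and> j > 0"
  unfolding cpoly_def poly_prod by auto

lemma poly_cpoly: "poly (cpoly e j x) y = (\<Prod>i<j. y - x ^ (p ^ (e * i)))"
  unfolding cpoly_def poly_prod by simp

lemma poly_HR_frob: "poly HR (x ^ (p ^ (e * i))) = poly HR x ^ (p ^ (e * i))"
proof (induction i)
  case (Suc i)
  have "poly g x ^ Q = poly g (x ^ Q)" if "polyF Q g" for g :: "'k poly" and x
  proof -
    have "poly g x ^ Q = (\<Sum>i\<le>degree g. coeff g i ^ Q * (x ^ i) ^ Q)"
      unfolding poly_altdef frob_sum by (simp add: power_mult_distrib)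
    also have "\<dots> = poly g (x ^ Q)"
      using that unfolding poly_altdef by (intro sum.cong) (auto simp: polyF_def FF_def mult.commute simp flip: power_mult)
    finally show ?thesis .
  qed
  from this[OF HR_polyF, of "x ^ (p ^ (e * i))"] Suc show ?case by (simp only: pow_pow_frob)
qed simp

lemma trR_cpoly:
  assumes "x \<noteq> 0"
  shows "trR (cpoly e j x) = (\<Sum>i<j. (u / x + v * x) ^ (p ^ (e * i)))"
proof -
  have lin: "trR [:-a, 1:] = u / a + v * a" if "a \<noteq> 0" for a
  proof -
    have "coeff (reflect_poly [:-a, 1:]) 1 = -a" by (simp add: coeff_reflect_poly)
    thus ?thesis unfolding trR_def by (simp add: pderiv_pCons divide_simps that)
  qed
  show ?thesis
  proof (induction j)
    case 0
    show ?case by (simp add: cpoly_def trR_def)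
  next
    case (Suc j)
    define a where "a = x ^ (p ^ (e * j))"
    have a: "a \<noteq> 0" using assms by (simp add: a_def)
    have "cpoly e (Suc j) x = cpoly e j x * [:-a, 1:]" by (simp add: cpoly_def a_def)
    hence "trR (cpoly e (Suc j) x) = trR (cpoly e j x) + trR [:-a, 1:]"
      using assms a cpoly_monic[of e j x] by (simp only:) (intro trR_mult, auto simp: cpoly_nz)
    also have "trR [:-a, 1:] = (u / x + v * x) ^ (p ^ (e * j))"
    proof -
      have "u ^ (p ^ (e * j)) = u" "v ^ (p ^ (e * j)) = v"
        using uv FF_powD[of u Q j] FF_powD[of v Q j] by (simp_all add: power_mult)
      thus ?thesis unfolding lin[OF a] by (simp add: a_def frob_add power_divide power_mult_distrib)
    qed
    finally show ?case using Suc by simp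
  qed
qed

lemma Lam_cpoly:
  assumes x: "x \<in> FF (p ^ (e * j))" and j: "j > 0"
  shows "Lam (cpoly e j x) = (if x \<in> XH (p ^ (e * j)) HR then
     ch1 ((-1) ^ j) * (ch1 (x ^ nexp e j) * ch2 (poly HR x ^ nexp e j) * \<psi> (abstr (e * j) (u / x + v * x))) else 0)"
proof (cases "x \<noteq> 0 \<and> x \<notin> R")
  case True
  have frR: "x ^ (p ^ (e * i)) \<notin> R" for i
    using poly_HR_frob[of x i] True poly_HR_eq_0_iff by (metis power_not_zero)
  have nz: "nzR (cpoly e j x)"
    unfolding nzR_def using True frR by (auto simp: cpoly_nz poly_cpoly)
  have 0: "poly (cpoly e j x) 0 = (-1) ^ j * x ^ nexp e j"
  proof -
    have "poly (cpoly e j x) 0 = (\<Prod>i<j. (-1) * x ^ (p ^ (e * i)))" by (simp add: poly_cpoly)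
    also have "\<dots> = (-1) ^ j * (\<Prod>i<j. x ^ (p ^ (e * i)))" by (simp only: prod.distrib) simp
    also have "(\<Prod>i<j. x ^ (p ^ (e * i))) = x ^ nexp e j" by (simp add: sum_geom_nexp flip: power_sum)
    finally show ?thesis .
  qed
  have res: "resR (cpoly e j x) = poly HR x ^ nexp e j"
  proof -
    have "resR (cpoly e j x) = (\<Prod>\<rho>\<in>R. \<Prod>i<j. (\<rho> - x ^ (p ^ (e * i))) ^ ex \<rho>)"
      unfolding resR_def poly_cpoly by (simp add: prod_power_distrib)
    also have "\<dots> = (\<Prod>i<j. poly HR (x ^ (p ^ (e * i))))"
      unfolding poly_HR by (rule prod.swap)
    also have "\<dots> = poly HR x ^ nexp e j"
      unfolding poly_HR_frob by (simp add: sum_geom_nexp flip: power_sum)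
    finally show ?thesis .
  qed
  have tr: "abstr e (trR (cpoly e j x)) = abstr (e * j) (u / x + v * x)"
    using True by (simp add: trR_cpoly abstr_tower)
  have m1: "(-1) ^ j \<in> FF Q - {0 :: 'k}"
  proof -
    have "(-1 :: 'k) \<in> FF Q" by (intro FF_uminus) simp
    thus ?thesis by (auto intro: FF_power)
  qed
  have "x ^ nexp e j \<in> FF Q - {0}" using nexp_in_FF[OF x] True by blast
  hence "ch1 ((-1) ^ j * x ^ nexp e j) = ch1 ((-1) ^ j) * ch1 (x ^ nexp e j)"
    using ch(1) m1 by (auto simp: mult_char_def)
  moreover have "x \<in> XH (p ^ (e * j)) HR" using x True by (auto simp: XH_def poly_HR_eq_0_iff)
  ultimately show ?thesis using nz unfolding Lam_def 0 res tr by (simp add: mult.assoc)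
next
  case False
  have "\<not> nzR (cpoly e j x)"
  proof (cases "x = 0")
    case True
    thus ?thesis using j by (simp add: nzR_def cpoly_nz)
  next
    case nz: False
    have "poly (cpoly e j x) x = 0" unfolding poly_cpoly using j by (intro prod_zero) (auto intro!: bexI[of _ 0])
    thus ?thesis using False nz by (auto simp: nzR_def)
  qed
  thus ?thesis using False by (auto simp: Lam_def XH_def poly_HR_eq_0_iff)
qed

lemma sL_eq:
  assumes "j > 0"
  shows "sL j = ch1 ((-1) ^ j) * (\<Sum>x\<in>XH (p ^ (e * j)) HR.
     ch1 (x ^ nexp e j) * ch2 (poly HR x ^ nexp e j) * \<psi> (abstr (e * j) (u / x + v * x)))"
proof -
  have fin: "finite (FF (p ^ (e * j)) :: 'k set)" using finite_FF e assms by simp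
  have "sL j = (\<Sum>x\<in>FF (p ^ (e * j)). if x \<in> XH (p ^ (e * j)) HR then
     ch1 ((-1) ^ j) * (ch1 (x ^ nexp e j) * ch2 (poly HR x ^ nexp e j) * \<psi> (abstr (e * j) (u / x + v * x))) else 0)"
    unfolding sL_def using assms by (intro sum.cong refl Lam_cpoly)
  also have "\<dots> = (\<Sum>x\<in>FF (p ^ (e * j)) \<inter> XH (p ^ (e * j)) HR.
     ch1 ((-1) ^ j) * (ch1 (x ^ nexp e j) * ch2 (poly HR x ^ nexp e j) * \<psi> (abstr (e * j) (u / x + v * x))))"
    using fin by (simp add: sum.inter_restrict)
  also have "FF (p ^ (e * j)) \<inter> XH (p ^ (e * j)) HR = XH (p ^ (e * j)) HR" by (auto simp: XH_def)
  finally show ?thesis by (simp add: sum_distrib_left)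
qed

lemma sL_bound: "\<exists>C. \<forall>j>0. norm (sL j) \<le> C * sqrt Q ^ j"
proof -
  obtain C where C: "\<And>j. j > 0 \<Longrightarrow> norm (\<Sum>x\<in>XH (p ^ (e * j)) HR.
     ch1 (x ^ nexp e j) * ch2 (poly HR x ^ nexp e j) * \<psi> (abstr (e * j) (u / x + v * x))) \<le> C * sqrt Q ^ j"
    using extension_sum_bound[OF e HR_simple_root HR_polyF uv ch psi nontriv] by auto
  have "norm (ch1 ((-1) ^ j)) = 1" for j
  proof -
    have "(-1 :: 'k) \<in> FF Q" by (intro FF_uminus) simp
    hence "(-1) ^ j \<in> FF Q - {0 :: 'k}" by (auto intro: FF_power)
    thus ?thesis using norm_mult_char[OF ch(1) _ Q1] by blast
  qed
  hence "norm (sL j) \<le> C * sqrt Q ^ j" if "j > 0" for j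
    using C[OF that] unfolding sL_eq[OF that] norm_mult by simp
  thus ?thesis by blast
qed

text \<open>Congruence modulo this polynomial fixes the values of \<open>g\<close> on
  \<open>R\<close> and at 0 and, because x is squared, the derivative at 0. It determines everything
  in \<open>Lam\<close> except the part of \<open>trR\<close> with \<open>v\<close>, which sees the
  second highest coefficient.\<close>

definition modR :: "'k poly" where "modR = monom (1 :: 'k) 2 * (\<Prod>\<rho>\<in>R. [:-\<rho>, 1:])"

lemma modR: "lead_coeff modR = 1" "degree modR = card R + 2" "modR \<noteq> 0" "polyF Q modR"
proof -
  have lc: "lead_coeff (\<Prod>\<rho>\<in>R. [:-\<rho>, 1:]) = 1" unfolding lead_coeff_prod by simp
  hence nz: "(\<Prod>\<rho>\<in>R. [:-\<rho>, 1:]) \<noteq> 0" by auto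
  have deg: "degree (\<Prod>\<rho>\<in>R. [:-\<rho>, 1:]) = card R" by (subst degree_prod_eq_sum_degree) auto
  show "lead_coeff modR = 1" unfolding modR_def lead_coeff_mult lc by (simp add: degree_monom_eq)
  thus "modR \<noteq> 0" by auto
  show "degree modR = card R + 2" unfolding modR_def 
  proof -
    have "degree (monom (1 :: 'k) 2) = 2" by (rule degree_monom_eq) simp
    moreover have "monom (1 :: 'k) 2 \<noteq> 0" by simp
    ultimately show "degree (monom (1 :: 'k) 2 * (\<Prod>\<rho>\<in>R. [:-\<rho>, 1:])) = card R + 2"
      using nz deg degree_mult_eq[of "monom (1 :: 'k) 2"] by simp
  qed
  have "frobp e (\<Prod>\<rho>\<in>R. [:-\<rho>, 1:]) = (\<Prod>\<rho>\<in>R. [:-(\<rho> ^ Q), 1:])"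
    unfolding frobp_prod frobp_linear by (simp add: frob_minus)
  also have "\<dots> = (\<Prod>\<rho>\<in>R. [:-\<rho>, 1:])" by (rule prod.reindex_bij_betw[OF bij_frob_R])
  finally show "polyF Q modR" unfolding modR_def by (intro polyF_mult polyF_monom) (auto simp: polyF_iff_frobp)
qed

lemma modR_cong:
  assumes "modR dvd g - h"
  shows "poly g 0 = poly h 0" "poly (pderiv g) 0 = poly (pderiv h) 0" "\<rho> \<in> R \<Longrightarrow> poly g \<rho> = poly h \<rho>"
proof -
  obtain k where k: "g - h = modR * k" using assms by (elim dvdE)
  define B where "B = (\<Prod>\<rho>\<in>R. [:-\<rho>, 1:]) * k"
  have g: "g = h + monom 1 2 * B" using k by (simp add: B_def modR_def mult.assoc algebra_simps)
  show "poly g 0 = poly h 0" "poly (pderiv g) 0 = poly (pderiv h) 0"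
    unfolding g by (simp_all add: pderiv_add pderiv_mult pderiv_monom poly_monom)
  assume "\<rho> \<in> R"
  hence "poly modR \<rho> = 0" unfolding modR_def poly_mult poly_prod using finR by auto
  thus "poly g \<rho> = poly h \<rho>" using k by (metis poly_mult mult_zero_left poly_diff eq_iff_diff_eq_0)
qed

lemma modR_cong_vals:
  assumes "modR dvd g - h"
  shows "nzR g \<longleftrightarrow> nzR h" "resR g = resR h"
  unfolding nzR_def resR_def using modR_cong[OF assms] by (auto intro!: prod.cong)

text \<open>A permutation of \<open>monics n\<close> multiplies \<open>Lam\<close> by a constant
  other than 1, so the sum is 0. For v nonzero it adds a fixed multiple of \<open>modR\<close>; for
  v = 0 it multiplies residues modulo \<open>modR\<close> by a unit on which \<open>Lam\<close> is
  not 1.\<close>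

lemma cL_eq_0:
  assumes n: "n \<ge> card R + 3"
  shows "cL n = 0"
proof (cases "v = 0")
  case v: False
  obtain y where y: "y \<in> FF Q" "\<psi> (abstr e y) \<noteq> 1" using psi_abstr_nontrivial[of e z0 \<psi>, OF e psi(2,3)] by blast
  define c where "c = - y / v"
  have c: "c \<in> FF Q" unfolding c_def by (intro FF_divide FF_uminus y uv)
  \<comment> \<open>Its degree is n - 1: monic polynomials stay monic, all data modulo
    \<open>modR\<close> are kept, and the second highest coefficient moves by \<open>c\<close>,
    which shifts \<open>trR\<close> by \<open>y\<close>. This requires n - 1 to be at least
    \<open>card R + 2\<close>.\<close>
  define m where "m = smult c (monom 1 (n - 3 - card R)) * modR"
  have mF: "polyF Q m" unfolding m_def using modR c by (intro polyF_mult polyF_smult polyF_monom) auto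
  have degm: "degree m \<le> n - 1"
    using n modR degree_mult_le[of "smult c (monom 1 (n - 3 - card R))" modR]
      degree_smult_le[of c "monom 1 (n - 3 - card R)"] degree_monom_le[of "1 :: 'k" "n - 3 - card R"]
    unfolding m_def by linarith
  have cm: "coeff m (n - 1) = c"
  proof -
    have "m = smult c (monom 1 (n - 3 - card R) * modR)" by (simp add: m_def)
    hence "coeff m (n - 1) = c * coeff modR (n - 1 - (n - 3 - card R))"
      using n by (simp add: coeff_monom_mult)
    also have "n - 1 - (n - 3 - card R) = degree modR" using n modR by simp
    finally show ?thesis using modR by simp
  qed
  have mon: "g + m \<in> monics n" if "g \<in> monics n" for g
  proof -
    have "degree m < degree g" using degm that n by (auto simp: monics_def)
    thus ?thesis using that mF by (auto simp: monics_def polyF_add degree_add_eq_left lead_coeff_add_le coeff_eq_0)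
  qed
  have mon': "g - m \<in> monics n" if "g \<in> monics n" for g
  proof -
    have "degree m < degree g" using degm that n by (auto simp: monics_def)
    hence "degree (- m) < degree g" by simp
    hence "degree (g + - m) = degree g" by (rule degree_add_eq_left)
    thus ?thesis using that mF \<open>degree m < degree g\<close> by (auto simp: monics_def polyF_diff coeff_eq_0)
  qed
  have shift: "Lam (g + m) = Lam g * \<psi> (abstr e y)" if g: "g \<in> monics n" for g
  proof -
    have "modR dvd m" unfolding m_def by (rule dvd_triv_right)
    hence dvd: "modR dvd (g + m) - g" by simp
    have "coeff (reflect_poly g) 1 = coeff g (n - 1)" using g n by (auto simp: monics_def coeff_reflect_poly)
    moreover have "coeff (reflect_poly (g + m)) 1 = coeff g (n - 1) + c"
      using mon[OF g] n cm by (auto simp: monics_def coeff_reflect_poly)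
    moreover have "v * c = - y" using v by (simp add: c_def)
    ultimately have "trR (g + m) = trR g + y"
      unfolding trR_def modR_cong[OF dvd] by (simp add: algebra_simps)
    moreover have "trR g \<in> FF Q" using g by (intro trR_FF) (simp add: monics_def)
    ultimately have "\<psi> (abstr e (trR (g + m))) = \<psi> (abstr e (trR g)) * \<psi> (abstr e y)"
      using y by (simp add: psi_abstr_add[OF psi(1)])
    thus ?thesis unfolding Lam_def modR_cong_vals[OF dvd] modR_cong[OF dvd] by simp
  qed
  have "cL n = (\<Sum>g\<in>monics n. Lam (g + m))"
    unfolding cL_def by (rule sum.reindex_bij_witness[of _ "\<lambda>g. g + m" "\<lambda>g. g - m"]) (use mon mon' in auto)
  also have "\<dots> = \<psi> (abstr e y) * cL n"
    unfolding cL_def sum_distrib_left using shift by (intro sum.cong) auto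
  finally show ?thesis using y(2) by (simp only: mult_cancel_right1) simp
next
  case v: True
  \<comment> \<open>If \<open>Lam\<close> were 1 wherever \<open>nzR\<close> holds,
    \<open>sL j\<close> would be the number of points of the j-th extension apart from 0 and the
    roots. That grows like Q ^ j and contradicts \<open>sL_bound\<close>.\<close>
  have "\<exists>n0. \<exists>g0\<in>monics n0. nzR g0 \<and> Lam g0 \<noteq> 1"
  proof (rule ccontr)
    assume "\<not> ?thesis"
    hence triv: "Lam g = 1" if "g \<in> monics j" "nzR g" for g j using that by blast
    have S: "sL j = of_nat (card (XH (p ^ (e * j)) HR))" if j: "j > 0" for j
    proof -
      have fin: "finite (FF (p ^ (e * j)) :: 'k set)" using finite_FF e j by simp
      have "sL j = (\<Sum>x\<in>FF (p ^ (e * j)). if x \<in> XH (p ^ (e * j)) HR then 1 else 0)"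
        unfolding sL_def
      proof (intro sum.cong refl)
        fix x :: 'k assume x: "x \<in> FF (p ^ (e * j))"
        show "Lam (cpoly e j x) = (if x \<in> XH (p ^ (e * j)) HR then 1 else 0)"
        proof (cases "nzR (cpoly e j x)")
          case True
          have "Lam (cpoly e j x) = 1" using triv cpoly_monics[OF x] True by blast
          moreover have "x \<in> XH (p ^ (e * j)) HR" using Lam_cpoly[OF x j] calculation by (metis zero_neq_one)
          ultimately show ?thesis by simp
        next
          case False
          have "x \<notin> XH (p ^ (e * j)) HR"
          proof
            assume xX: "x \<in> XH (p ^ (e * j)) HR"
            hence xx: "x \<noteq> 0" "x \<notin> R" by (auto simp: XH_def poly_HR_eq_0_iff)
            have "x ^ (p ^ (e * i)) \<notin> R" for i
              using poly_HR_frob[of x i] xx poly_HR_eq_0_iff by (metis power_not_zero)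
            hence "nzR (cpoly e j x)"
              unfolding nzR_def using xx by (auto simp: cpoly_nz poly_cpoly)
            thus False using False by simp
          qed
          thus ?thesis using False by (simp add: Lam_def)
        qed
      qed
      also have "\<dots> = of_nat (card (FF (p ^ (e * j)) \<inter> XH (p ^ (e * j)) HR))"
        using fin by (simp add: sum.If_cases)
      also have "FF (p ^ (e * j)) \<inter> XH (p ^ (e * j)) HR = XH (p ^ (e * j)) HR" by (auto simp: XH_def)
      finally show ?thesis .
    qed
    obtain C where C: "\<And>j. j > 0 \<Longrightarrow> norm (sL j) \<le> C * sqrt Q ^ j" using sL_bound by blast
    define B where "B = sqrt Q"
    have B1: "B > 1" unfolding B_def using Q1 by (simp del: of_nat_power)
    have B2: "B ^ (2 * j) = p ^ (e * j)" for j
    proof -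
      have "B ^ 2 = Q" by (simp add: B_def)
      hence "(B ^ 2) ^ j = real Q ^ j" by simp
      thus ?thesis by (simp add: power_mult)
    qed
    define h where "h = real (card R + 1)"
    have low: "B ^ (2 * j) \<le> C * B ^ j + h" if j: "j > 0" for j
    proof -
      have fin: "finite (FF (p ^ (e * j)) :: 'k set)" using finite_FF e j by simp
      have "FF (p ^ (e * j)) \<subseteq> XH (p ^ (e * j)) HR \<union> insert 0 R"
        by (auto simp: XH_def poly_HR_eq_0_iff)
      hence "card (FF (p ^ (e * j)) :: 'k set) \<le> card (XH (p ^ (e * j)) HR \<union> insert 0 R)"
        using fin finR by (intro card_mono) (auto simp: XH_def)
      also have "\<dots> \<le> card (XH (p ^ (e * j)) HR) + card (insert 0 R)" by (rule card_Un_le)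
      also have "card (insert 0 R) = card R + 1" using finR R0 by simp
      finally have "real (p ^ (e * j)) \<le> real (card (XH (p ^ (e * j)) HR) + (card R + 1))"
        using card_FF[of "e * j"] e j by (intro of_nat_mono) simp
      moreover have "norm (sL j) = real (card (XH (p ^ (e * j)) HR))" unfolding S[OF j] by simp
      ultimately show ?thesis using C[OF j] unfolding B2 B_def[symmetric] h_def by simp
    qed
    obtain j where jB: "\<bar>C\<bar> + h < B ^ j" using real_arch_pow[OF B1] by blast
    have j0: "j > 0"
    proof (rule ccontr)
      assume "\<not> j > 0"
      thus False using jB by (simp add: h_def)
    qed
    have "(\<bar>C\<bar> + h) * B ^ j < B ^ j * B ^ j" using jB B1 by (intro mult_strict_right_mono) auto
    moreover have "C * B ^ j + h \<le> \<bar>C\<bar> * B ^ j + h * B ^ j"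
    proof (intro add_mono mult_right_mono)
      have "h * 1 \<le> h * B ^ j" using B1 by (intro mult_left_mono one_le_power) (auto simp: h_def)
      thus "h \<le> h * B ^ j" by simp
    qed (use B1 in auto)
    moreover have "B ^ (2 * j) = B ^ j * B ^ j" by (simp add: mult_2 power_add)
    ultimately show False using low[OF j0] by (simp add: distrib_right)
  qed
  then obtain n0 g0 where g0: "g0 \<in> monics n0" "nzR g0" "Lam g0 \<noteq> 1" by blast
  \<comment> \<open>Keeps the quotient by \<open>modR\<close> and multiplies the remainder by
    \<open>g0\<close>. This permutes \<open>monics n\<close>, because \<open>g0\<close> is
    invertible modulo \<open>modR\<close> and n exceeds the degree of \<open>modR\<close>.\<close>
  define f where "f = (\<lambda>g. (g div modR) * modR + (g * g0) mod modR)"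
  have delta: "degree modR < n" using modR n by simp
  have dmod: "degree (h mod modR) < degree modR" for h
    using degree_mod_less'[of modR h] modR by (cases "h mod modR = 0") auto
  have divf: "f g div modR = g div modR" "f g mod modR = (g * g0) mod modR" for g
  proof -
    show "f g mod modR = (g * g0) mod modR" unfolding f_def by simp
    have "f g div modR = g div modR + (g * g0) mod modR div modR" unfolding f_def using modR(3) by simp
    also have "(g * g0) mod modR div modR = 0" using dmod by (intro div_poly_less)
    finally show "f g div modR = g div modR" by simp
  qed
  have fmon: "f g \<in> monics n" if g: "g \<in> monics n" for g
  proof -
    have F: "polyF Q (f g)"
      unfolding f_def using g g0(1) modR by (intro polyF_add polyF_mult polyF_div_mod) (auto simp: monics_def)
    have "g = (g div modR) * modR + g mod modR" by simp
    have diff: "f g = g + ((g * g0) mod modR - g mod modR)"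
      unfolding f_def by (simp add: algebra_simps minus_mod_eq_div_mult[symmetric])
    define s where "s = (g * g0) mod modR - g mod modR"
    have "degree s < degree modR"
      unfolding s_def using dmod[of "g * g0"] dmod[of g] by (intro degree_diff_less)
    hence sn: "degree s < degree g" using delta g by (simp add: monics_def)
    show ?thesis using g F sn unfolding diff s_def[symmetric]
      by (auto simp: monics_def degree_add_eq_left coeff_eq_0)
  qed
  have cop: "coprime modR g0"
  proof (rule coprime_no_common_root)
    show "g0 \<noteq> 0" using g0 monics_nz by blast
    fix x assume "poly modR x = 0"
    hence "x = 0 \<or> x \<in> R" unfolding modR_def poly_mult poly_prod using finR by (auto simp: poly_monom)
    thus "poly g0 x \<noteq> 0" using g0(2) by (auto simp: nzR_def)
  qed
  have inj: "inj_on f (monics n)"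
  proof (rule inj_onI)
    fix g h assume gh: "g \<in> monics n" "h \<in> monics n" "f g = f h"
    have d: "g div modR = h div modR" using divf(1)[of g] divf(1)[of h] gh(3) by simp
    have "(g * g0) mod modR = (h * g0) mod modR" using divf(2)[of g] divf(2)[of h] gh(3) by simp
    hence "modR dvd g0 * (g - h)" by (simp add: mod_eq_dvd_iff algebra_simps)
    hence "modR dvd g - h" using coprime_poly_dvd_multD[OF cop] by blast
    hence "g mod modR = h mod modR" by (simp add: mod_eq_dvd_iff)
    thus "g = h" using d by (metis div_mult_mod_eq)
  qed
  have bij: "bij_betw f (monics n) (monics n)"
    using inj fmon by (simp add: bij_betw_def endo_inj_surj image_subset_iff)
  have Lf: "Lam (f g) = Lam g0 * Lam g" if g: "g \<in> monics n" for g
  proof -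
    have dvd: "modR dvd f g - g * g0"
    proof -
      have "f g mod modR = (g * g0) mod modR" by (rule divf)
      thus ?thesis by (simp add: mod_eq_dvd_iff)
    qed
    have "trR (f g) = trR (g * g0)" 
      unfolding trR_def using modR_cong[OF dvd] \<open>v = 0\<close> by simp
    hence "Lam (f g) = Lam (g * g0)" unfolding Lam_def modR_cong_vals[OF dvd] modR_cong[OF dvd] by simp
    thus ?thesis using Lam_mult[OF g g0(1)] by simp
  qed
  have "cL n = (\<Sum>g\<in>monics n. Lam (f g))" unfolding cL_def by (rule sum.reindex_bij_betw[OF bij, symmetric])
  also have "\<dots> = Lam g0 * cL n" unfolding cL_def sum_distrib_left using Lf by (intro sum.cong) auto
  finally show ?thesis using g0(3) by (simp only: mult_cancel_right1) simp
qed

end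

section \<open>Zeros of a polynomial from the growth of its power sums\<close>

lemma power_series_geometric_bound:
  fixes s :: "nat \<Rightarrow> complex" and B C :: real
  assumes "\<And>j. j > 0 \<Longrightarrow> norm (s j) \<le> C * B ^ j" "B > 0" "norm z < 1 / B"
  shows "summable (\<lambda>j. norm (s (Suc j) * z ^ Suc j))"
proof (rule summable_comparison_test)
  have "B * norm z < 1" using assms by (simp add: field_simps)
  hence "summable (\<lambda>j. (B * norm z) ^ j)" using assms by (intro summable_geometric) auto
  thus "summable (\<lambda>j. C * B * norm z * (B * norm z) ^ j)" by (rule summable_mult)
  show "\<exists>N. \<forall>n\<ge>N. norm (norm (s (Suc n) * z ^ Suc n)) \<le> C * B * norm z * (B * norm z) ^ n"
  proof (intro exI[of _ 0] allI impI)
    fix n :: nat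
    have "norm (norm (s (Suc n) * z ^ Suc n)) = norm (s (Suc n)) * norm z ^ Suc n" by (simp add: norm_mult norm_power)
    also have "\<dots> \<le> C * B ^ Suc n * norm z ^ Suc n" by (intro mult_right_mono assms) auto
    finally show "norm (norm (s (Suc n) * z ^ Suc n)) \<le> C * B * norm z * (B * norm z) ^ n"
      by (simp add: power_mult_distrib mult_ac)
  qed
qed

lemma poly_altdef_le: "degree q \<le> D \<Longrightarrow> poly q (x :: 'a::comm_semiring_1) = (\<Sum>n\<le>D. coeff q n * x ^ n)"
  unfolding poly_altdef by (rule sum.mono_neutral_left) (auto simp: coeff_eq_0)

text \<open>The generating function of the \<open>s j\<close> is the logarithmic derivative of the polynomial \<open>L\<close>
  (up to a factor \<open>z\<close>), so its disc of convergence contains no zero of \<open>L\<close>.\<close>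

lemma newton_zero_free:
  fixes L :: "complex poly" and s :: "nat \<Rightarrow> complex" and B C :: real
  assumes L0: "coeff L 0 = 1"
    and newton: "\<And>n. of_nat n * coeff L n = (\<Sum>j\<in>{1..n}. s j * coeff L (n - j))"
    and s: "\<And>j. j > 0 \<Longrightarrow> norm (s j) \<le> C * B ^ j" and B: "B > 0"
    and z: "poly L z = 0"
  shows "norm z \<ge> 1 / B"
proof (rule ccontr)
  assume "\<not> norm z \<ge> 1 / B"
  hence zB: "norm z < 1 / B" by simp
  define G where "G = (\<lambda>z. \<Sum>j. s (Suc j) * z ^ Suc j)"
  define a where "a = (\<lambda>j. if j = 0 then 0 else s j)"
  have suma: "summable (\<lambda>j. norm (a j * x ^ j))" if "norm x < 1 / B" for x
    using power_series_geometric_bound[OF s B that] by (subst summable_Suc_iff[symmetric]) (simp add: a_def)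
  have key: "x * poly (pderiv L) x = poly L x * (\<Sum>j. a j * x ^ j)" if x: "norm x < 1 / B" for x
  proof -
    have sL: "summable (\<lambda>k. norm (coeff L k * x ^ k))"
      by (rule summable_finite[of "{..degree L}"]) (auto simp: coeff_eq_0)
    have pL: "poly L x = (\<Sum>k. coeff L k * x ^ k)"
      unfolding poly_altdef by (rule suminf_finite[symmetric]) (auto simp: coeff_eq_0)
    have "poly L x * (\<Sum>j. a j * x ^ j) = (\<Sum>n. \<Sum>i\<le>n. (coeff L i * x ^ i) * (a (n - i) * x ^ (n - i)))"
      unfolding pL by (rule Cauchy_product[OF sL suma[OF x]])
    also have "\<dots> = (\<Sum>n. of_nat n * coeff L n * x ^ n)"
    proof (intro suminf_cong)
      fix n
      have "(\<Sum>i\<le>n. (coeff L i * x ^ i) * (a (n - i) * x ^ (n - i))) = (\<Sum>i\<le>n. coeff L i * a (n - i)) * x ^ n"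
        unfolding sum_distrib_right by (intro sum.cong refl) (simp add: mult_ac flip: power_add)
      also have "(\<Sum>i\<le>n. coeff L i * a (n - i)) = (\<Sum>j\<le>n. coeff L (n - j) * a j)"
        by (rule sum.reindex_bij_witness[of _ "\<lambda>i. n - i" "\<lambda>i. n - i"]) auto
      also have "\<dots> = (\<Sum>j\<in>{1..n}. coeff L (n - j) * a j)"
        by (rule sum.mono_neutral_right) (auto simp: a_def)
      also have "\<dots> = of_nat n * coeff L n"
        unfolding newton by (intro sum.cong) (auto simp: a_def)
      finally show "(\<Sum>i\<le>n. (coeff L i * x ^ i) * (a (n - i) * x ^ (n - i))) = of_nat n * coeff L n * x ^ n" .
    qed
    also have "\<dots> = (\<Sum>n\<le>degree L. of_nat n * coeff L n * x ^ n)"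
      by (rule suminf_finite) (auto simp: coeff_eq_0)
    also have "\<dots> = x * poly (pderiv L) x"
    proof -
      have "x * poly (pderiv L) x = poly (monom 1 1 * pderiv L) x" by (simp add: poly_monom)
      also have "\<dots> = (\<Sum>n\<le>degree L. coeff (monom 1 1 * pderiv L) n * x ^ n)"
      proof (rule poly_altdef_le)
        have "degree (monom 1 1 * pderiv L) \<le> 1 + degree (pderiv L)"
          by (intro order.trans[OF degree_mult_le]) (simp add: degree_monom_eq)
        thus "degree (monom 1 1 * pderiv L) \<le> degree L"
          using pderiv_eq_0_iff[of L] by (cases "degree L = 0") (auto simp: degree_pderiv)
      qed
      also have "\<dots> = (\<Sum>n\<le>degree L. of_nat n * coeff L n * x ^ n)"
        by (intro sum.cong refl) (auto simp: coeff_monom_mult coeff_pderiv simp flip: of_nat_Suc)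
      finally show ?thesis by simp
    qed
    finally show ?thesis by simp
  qed
  have Lnz: "L \<noteq> 0" using L0 by auto
  define m where "m = order z L"
  have m0: "m > 0" unfolding m_def using z Lnz order_root by auto
  obtain M where M: "L = [:-z, 1:] ^ m * M" "\<not> [:-z, 1:] dvd M"
    using order_decomp[OF Lnz, of z] unfolding m_def by blast
  have Mz: "poly M z \<noteq> 0" using M(2) poly_eq_0_iff_dvd by blast
  have z0: "z \<noteq> 0" using L0 z by (auto simp: poly_0_coeff_0)
  define A where "A = (\<lambda>x. \<Sum>j. a j * x ^ j)"
  obtain r where r1: "norm z < r" and r2: "r < 1 / B" using dense[OF zB] by blast
  have r: "r \<ge> 0" using order.trans[OF norm_ge_zero[of z] less_imp_le[OF r1]] .
  have "isCont A z"
    unfolding A_def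
  proof (rule isCont_powser)
    show "norm z < norm (complex_of_real r)" using r r1 by simp
    have "summable (\<lambda>j. norm (a j * (complex_of_real r) ^ j))" by (rule suma) (use r r2 in simp)
    thus "summable (\<lambda>n. a n * (complex_of_real r) ^ n)" by (rule summable_norm_cancel)
  qed
  \<comment> \<open>The identity \<open>key\<close> with (x - z) ^ (m - 1) divided out, for a zero z
    of order m. It makes F vanish near z off z, hence at z by continuity, although F(z) = z * m *
    M(z) is nonzero.\<close>
  define F where "F = (\<lambda>x. x * (of_nat m * poly M x + (x - z) * poly (pderiv M) x) - (x - z) * poly M x * A x)"
  have F0: "F x = 0" if x: "norm x < 1 / B" "x \<noteq> z" for x
  proof -
    have L': "poly L x = (x - z) ^ m * poly M x" unfolding M(1) by simp
    obtain m' where m': "m = Suc m'" using m0 by (cases m) auto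
    have "pderiv L = [:-z, 1:] ^ m * pderiv M + M * (smult (of_nat m) ([:-z, 1:] ^ m'))"
      unfolding M(1) pderiv_mult m' pderiv_power_Suc by (simp add: pderiv_pCons)
    hence "poly (pderiv L) x = (x - z) ^ m * poly (pderiv M) x + poly M x * (of_nat m * (x - z) ^ m')"
      by simp
    hence "x * ((x - z) ^ m * poly (pderiv M) x + poly M x * (of_nat m * (x - z) ^ m')) = (x - z) ^ m * poly M x * A x"
      using key[OF x(1)] unfolding L' A_def by simp
    hence "(x - z) ^ m' * F x = 0" unfolding F_def m' by (simp add: algebra_simps)
    thus ?thesis using x(2) by simp
  qed
  have "F \<midarrow>z\<rightarrow> F z" unfolding F_def using \<open>isCont A z\<close> by (intro isContD) (auto intro!: continuous_intros)
  moreover have "F \<midarrow>z\<rightarrow> 0"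
  proof (rule tendsto_eventually)
    have "\<forall>\<^sub>F x in at z. norm x < 1 / B"
      using order_tendstoD(2)[OF tendsto_norm[OF tendsto_ident_at] zB, of UNIV] by simp
    moreover have "\<forall>\<^sub>F x in at z. x \<noteq> z" by (simp add: eventually_at_filter)
    ultimately show "\<forall>\<^sub>F x in at z. F x = 0" by eventually_elim (rule F0)
  qed
  ultimately have "F z = 0" using tendsto_unique[of "at z" F] by simp
  moreover have "F z = z * (of_nat m * poly M z)" by (simp add: F_def)
  ultimately show False using z0 Mz m0 by simp
qed

text \<open>\<open>s 1\<close> is the linear coefficient of \<open>L\<close>, that is, minus the sum
  of the reciprocals of its zeros, each of absolute value at most \<open>B\<close>. The constant
  \<open>C\<close> has disappeared from the bound.\<close>

lemma newton_first_bound: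
  fixes L :: "complex poly" and s :: "nat \<Rightarrow> complex" and B C :: real
  assumes L0: "coeff L 0 = 1"
    and newton: "\<And>n. of_nat n * coeff L n = (\<Sum>j\<in>{1..n}. s j * coeff L (n - j))"
    and s: "\<And>j. j > 0 \<Longrightarrow> norm (s j) \<le> C * B ^ j" and B: "B > 0"
  shows "norm (s 1) \<le> degree L * B"
proof -
  define Lr where "Lr = reflect_poly L"
  have Lnz: "L \<noteq> 0" using L0 by auto
  obtain A where A: "size A = degree Lr" "Lr = smult (lead_coeff Lr) (\<Prod>x\<in>#A. [:-x, 1:])"
    using alg_closed_imp_factorization[of Lr] Lnz unfolding Lr_def by auto
  have deg: "degree Lr = degree L" unfolding Lr_def using L0 by simp
  have "lead_coeff Lr = coeff L 0" unfolding deg unfolding Lr_def coeff_reflect_poly by simp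
  hence lc: "lead_coeff Lr = 1" using L0 by simp
  have roots: "norm x \<le> B" if "x \<in># A" for x
  proof (cases "x = 0")
    case False
    have "poly Lr x = 0" by (subst A(2)) (use that in \<open>auto simp: poly_prod_mset prod_mset_zero_iff\<close>)
    hence "poly L (inverse x) = 0" unfolding Lr_def using False by (simp add: poly_reflect_poly_nz)
    from newton_zero_free[OF L0 newton s B this] have "1 / B \<le> inverse (norm x)" by (simp only: norm_inverse)
    thus ?thesis using B False by (simp add: field_simps)
  qed (use B in simp)
  have "coeff (\<Prod>x\<in>#A. [:-x, 1:]) (size A - 1) = - sum_mset A \<or> size A = 0" for A :: "complex multiset"
  proof (induction A)
    case (add x A)
    define g where "g = (\<Prod>x\<in>#A. [:-x, 1:])"
    have lg: "lead_coeff g = 1 \<and> degree g = size A" unfolding g_def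
    proof (induction A)
      case (add x A)
      have "(\<Prod>x\<in>#A. [:-x, 1:]) \<noteq> 0" using add by auto
      hence "lead_coeff ([:-x, 1:] * (\<Prod>x\<in>#A. [:-x, 1:])) = 1"
        unfolding lead_coeff_mult using conjunct1[OF add.IH] by simp
      moreover have "degree ([:-x, 1:] * (\<Prod>x\<in>#A. [:-x, 1:])) = Suc (size A)"
        using add \<open>(\<Prod>x\<in>#A. [:-x, 1:]) \<noteq> 0\<close> degree_mult_eq[of "[:-x, 1:]"] by simp
      ultimately show ?case by (simp del: mult_pCons_left)
    qed simp
    show ?case
    proof (cases "size A")
      case 0
      thus ?thesis by simp
    next
      case (Suc k)
      have "coeff ([:-x, 1:] * g) (Suc k) = - x * coeff g (Suc k) + coeff g k" by simp
      also have "coeff g (Suc k) = 1" using lg Suc by metis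
      also have "coeff g k = - sum_mset A" using add Suc by (simp add: g_def)
      finally show ?thesis using Suc by (simp add: g_def del: mult_pCons_left)
    qed
  qed simp
  from this[of A] have c: "coeff Lr (degree Lr - 1) = - sum_mset A \<or> degree Lr = 0"
    using A lc by (metis smult_1_left)
  have s1: "s 1 = coeff L 1" using newton[of 1] L0 by simp
  show ?thesis
  proof (cases "degree L = 0")
    case True
    thus ?thesis using s1 by (simp add: coeff_eq_0)
  next
    case False
    have "coeff Lr (degree Lr - 1) = coeff L 1" unfolding deg unfolding Lr_def coeff_reflect_poly using False by simp
    hence "s 1 = - sum_mset A" using c deg False s1 by simp
    moreover have "norm (sum_mset A) \<le> size A * B" using roots
    proof (induction A)
      case (add x A)
      have "norm (x + sum_mset A) \<le> norm x + norm (sum_mset A)" by (rule norm_triangle_ineq)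
      also have "\<dots> \<le> B + size A * B" using add by (intro add_mono) auto
      finally show ?case by (simp add: algebra_simps)
    qed simp
    ultimately show ?thesis using A(1) deg by simp
  qed
qed

context lfun
begin

theorem weil_bound:
  "norm (\<Sum>x\<in>XH Q HR. ch1 x * ch2 (poly HR x) * \<psi> (abstr e (u / x + v * x))) \<le> (card R + 2) * sqrt Q"
proof -
  obtain C where C: "\<And>j. j > 0 \<Longrightarrow> norm (sL j) \<le> C * sqrt Q ^ j" using sL_bound by blast
  define L where "L = (\<Sum>n<card R + 3. monom (cL n) n)"
  have L: "coeff L n = cL n" for n
  proof -
    have "coeff L n = (if n < card R + 3 then cL n else 0)" unfolding L_def coeff_sum by simp
    thus ?thesis using cL_eq_0[of n] by simp
  qed
  have "norm (sL 1) \<le> degree L * sqrt Q"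
    by (rule newton_first_bound[where C = C]) (use C Q1 p1 newton_identity cL_0 in \<open>auto simp: L\<close>)
  also have "degree L \<le> card R + 2"
    by (rule degree_le) (auto simp: L cL_eq_0)
  hence "degree L * sqrt Q \<le> (card R + 2) * sqrt Q" by (intro mult_right_mono) auto
  finally have "norm (sL 1) \<le> (card R + 2) * sqrt Q" .
  moreover have "sL 1 = ch1 (-1) * (\<Sum>x\<in>XH Q HR. ch1 x * ch2 (poly HR x) * \<psi> (abstr e (u / x + v * x)))"
  proof -
    have "nexp e 1 = 1" unfolding nexp_def using Q1 by simp
    thus ?thesis using sL_eq[of 1] by simp
  qed
  moreover have "norm (ch1 (-1)) = 1"
  proof -
    have "(-1 :: 'k) \<in> FF Q - {0}" using FF_uminus[of 1 e] by simp
    thus ?thesis using norm_mult_char[OF ch(1) _ Q1] by blast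
  qed
  ultimately show ?thesis by (simp add: norm_mult)
qed

end

section \<open>A weighted sieve\<close>

text \<open>Of an event it is only asked that its indicator be the average over
  \<open>\<Gamma> i\<close> of functions \<open>lam i \<gamma>\<close>, with the one at
  \<open>o0 i\<close> constant 1. The powers of a multiplicative character and the additive
  characters from an annihilator both fit. \<open>V\<close> detects \<open>T\<close> in the same
  way, with coefficients \<open>\<kappa>\<close>.\<close>

locale char_sieve =
  fixes XX :: "'x set" and II :: "'i set" and \<Gamma> :: "'i \<Rightarrow> 'c set" and o0 :: "'i \<Rightarrow> 'c"
    and lam :: "'i \<Rightarrow> 'c \<Rightarrow> 'x \<Rightarrow> complex" and V :: "'v set" and ov :: 'v
    and \<tau> :: "'v \<Rightarrow> 'x \<Rightarrow> complex" and \<kappa> :: "'v \<Rightarrow> complex" and M :: real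
    and E :: "'i \<Rightarrow> 'x \<Rightarrow> bool" and T :: "'x \<Rightarrow> bool"
  assumes finX: "finite XX" and finI: "finite II" and finG: "\<And>i. i \<in> II \<Longrightarrow> finite (\<Gamma> i)" and finV: "finite V"
    and o0: "\<And>i. i \<in> II \<Longrightarrow> o0 i \<in> \<Gamma> i" and cG: "\<And>i. i \<in> II \<Longrightarrow> card (\<Gamma> i) \<ge> 2" and ov: "ov \<in> V"
    and lam_o: "\<And>i x. i \<in> II \<Longrightarrow> x \<in> XX \<Longrightarrow> lam i (o0 i) x = 1"
    and tau_o: "\<And>x. x \<in> XX \<Longrightarrow> \<tau> ov x = 1" and kap_o: "\<kappa> ov = 1" and kap: "\<And>v. v \<in> V \<Longrightarrow> norm (\<kappa> v) \<le> 1"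
    and bound: "\<And>J g v. J \<subseteq> II \<Longrightarrow> g \<in> PiE J \<Gamma> \<Longrightarrow> v \<in> V \<Longrightarrow> (\<exists>i\<in>J. g i \<noteq> o0 i) \<or> v \<noteq> ov \<Longrightarrow>
        norm (\<Sum>x\<in>XX. (\<Prod>i\<in>J. lam i (g i) x) * \<tau> v x) \<le> M"
    and E: "\<And>i x. i \<in> II \<Longrightarrow> x \<in> XX \<Longrightarrow> (\<Sum>\<gamma>\<in>\<Gamma> i. lam i \<gamma> x) = of_nat (card (\<Gamma> i)) * of_bool (E i x)"
    and T: "\<And>x. x \<in> XX \<Longrightarrow> (\<Sum>v\<in>V. \<kappa> v * \<tau> v x) = of_nat (card V) * of_bool (T x)"
    and M0: "M \<ge> 0"
begin

definition \<theta> :: "'i \<Rightarrow> real" where "\<theta> i = 1 - 1 / card (\<Gamma> i)"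

definition c :: "'i \<Rightarrow> 'c \<Rightarrow> real" where "c i \<gamma> = (if \<gamma> = o0 i then \<theta> i else - 1 / card (\<Gamma> i))"

definition NN :: "'i set \<Rightarrow> nat" where "NN J = card {x \<in> XX. T x \<and> (\<forall>i\<in>J. \<not> E i x)}"

lemma theta_pos: "i \<in> II \<Longrightarrow> \<theta> i > 0"
  using cG[of i] by (simp add: \<theta>_def)

lemma prod_theta_pos: "J \<subseteq> II \<Longrightarrow> (\<Prod>i\<in>J. \<theta> i) > 0"
  using theta_pos by (intro prod_pos) auto

lemma not_E_expand:
  assumes i: "i \<in> II" and x: "x \<in> XX"
  shows "of_bool (\<not> E i x) = (\<Sum>\<gamma>\<in>\<Gamma> i. of_real (c i \<gamma>) * lam i \<gamma> x)"
proof -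
  have n: "complex_of_nat (card (\<Gamma> i)) \<noteq> 0" using cG[OF i] by auto
  have "(\<Sum>\<gamma>\<in>\<Gamma> i. of_real (c i \<gamma>) * lam i \<gamma> x)
     = (\<Sum>\<gamma>\<in>\<Gamma> i. (if \<gamma> = o0 i then 1 else 0) - lam i \<gamma> x / of_nat (card (\<Gamma> i)))"
    using lam_o[OF i x] by (intro sum.cong refl) (auto simp: c_def \<theta>_def)
  also have "\<dots> = 1 - (\<Sum>\<gamma>\<in>\<Gamma> i. lam i \<gamma> x) / of_nat (card (\<Gamma> i))"
    using finG[OF i] o0[OF i] by (simp add: sum_subtractf sum_divide_distrib)
  also have "\<dots> = of_bool (\<not> E i x)" unfolding E[OF i x] using n by simp
  finally show ?thesis by simp
qed

text \<open>The trivial coefficient contributes \<open>\<theta> i\<close>, and the other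
  \<open>card (\<Gamma> i) - 1\<close> together contribute \<open>\<theta> i\<close> again: every
  unsieved event costs a factor 2.\<close>

lemma sum_abs_c:
  assumes i: "i \<in> II"
  shows "(\<Sum>\<gamma>\<in>\<Gamma> i. \<bar>c i \<gamma>\<bar>) = 2 * \<theta> i"
proof -
  have n: "real (card (\<Gamma> i)) > 0" using cG[OF i] by simp
  have "(\<Sum>\<gamma>\<in>\<Gamma> i. \<bar>c i \<gamma>\<bar>) = \<bar>c i (o0 i)\<bar> + (\<Sum>\<gamma>\<in>\<Gamma> i - {o0 i}. \<bar>c i \<gamma>\<bar>)"
    using finG[OF i] o0[OF i] by (rule sum.remove)
  also have "(\<Sum>\<gamma>\<in>\<Gamma> i - {o0 i}. \<bar>c i \<gamma>\<bar>) = (\<Sum>\<gamma>\<in>\<Gamma> i - {o0 i}. 1 / card (\<Gamma> i))"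
    by (intro sum.cong refl) (auto simp: c_def)
  also have "\<dots> = \<theta> i"
    using cG[OF i] o0[OF i] finG[OF i] n by (auto simp: \<theta>_def card_Diff_singleton of_nat_diff diff_divide_distrib)
  finally show ?thesis using theta_pos[OF i] by (simp add: c_def)
qed

lemma prod_expand:
  assumes J: "J \<subseteq> II" and x: "x \<in> XX"
  shows "(\<Prod>i\<in>J. of_bool (\<not> E i x)) = (\<Sum>g\<in>PiE J \<Gamma>. of_real (\<Prod>i\<in>J. c i (g i)) * (\<Prod>i\<in>J. lam i (g i) x))"
proof -
  have fJ: "finite J" using J finI by (rule finite_subset)
  have "(\<Prod>i\<in>J. of_bool (\<not> E i x)) = (\<Prod>i\<in>J. \<Sum>\<gamma>\<in>\<Gamma> i. of_real (c i \<gamma>) * lam i \<gamma> x)"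
    using J x by (intro prod.cong refl not_E_expand) auto
  also have "\<dots> = (\<Sum>g\<in>PiE J \<Gamma>. \<Prod>i\<in>J. of_real (c i (g i)) * lam i (g i) x)"
    using fJ J finG by (intro prod_sum_PiE) auto
  finally show ?thesis by (simp add: prod.distrib)
qed

lemma sum_abs_prod_c:
  assumes J: "J \<subseteq> II"
  shows "(\<Sum>g\<in>PiE J \<Gamma>. \<bar>\<Prod>i\<in>J. c i (g i)\<bar>) = 2 ^ card J * (\<Prod>i\<in>J. \<theta> i)"
proof -
  have fJ: "finite J" using J finI by (rule finite_subset)
  have "(\<Sum>g\<in>PiE J \<Gamma>. \<bar>\<Prod>i\<in>J. c i (g i)\<bar>) = (\<Sum>g\<in>PiE J \<Gamma>. \<Prod>i\<in>J. \<bar>c i (g i)\<bar>)"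
    by (simp add: abs_prod)
  also have "\<dots> = (\<Prod>i\<in>J. \<Sum>\<gamma>\<in>\<Gamma> i. \<bar>c i \<gamma>\<bar>)"
    using fJ J finG by (intro prod_sum_PiE[symmetric]) auto
  also have "\<dots> = (\<Prod>i\<in>J. 2 * \<theta> i)" using J by (intro prod.cong refl sum_abs_c) auto
  finally show ?thesis by (simp add: prod.distrib)
qed

lemma weighted_bound:
  assumes J: "J \<subseteq> II"
    and b: "\<And>g. g \<in> PiE J \<Gamma> \<Longrightarrow> norm (\<Sum>x\<in>XX. (\<Prod>i\<in>J. lam i (g i) x) * t x) \<le> M"
  shows "norm (\<Sum>x\<in>XX. (\<Prod>i\<in>J. of_bool (\<not> E i x)) * t x) \<le> 2 ^ card J * (\<Prod>i\<in>J. \<theta> i) * M"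
proof -
  have "(\<Sum>x\<in>XX. (\<Prod>i\<in>J. of_bool (\<not> E i x)) * t x)
      = (\<Sum>x\<in>XX. \<Sum>g\<in>PiE J \<Gamma>. of_real (\<Prod>i\<in>J. c i (g i)) * ((\<Prod>i\<in>J. lam i (g i) x) * t x))"
    using J by (intro sum.cong refl) (simp add: prod_expand sum_distrib_right mult.assoc)
  also have "\<dots> = (\<Sum>g\<in>PiE J \<Gamma>. of_real (\<Prod>i\<in>J. c i (g i)) * (\<Sum>x\<in>XX. (\<Prod>i\<in>J. lam i (g i) x) * t x))"
    unfolding sum_distrib_left by (rule sum.swap)
  finally have "norm (\<Sum>x\<in>XX. (\<Prod>i\<in>J. of_bool (\<not> E i x)) * t x)
     \<le> (\<Sum>g\<in>PiE J \<Gamma>. norm (of_real (\<Prod>i\<in>J. c i (g i)) * (\<Sum>x\<in>XX. (\<Prod>i\<in>J. lam i (g i) x) * t x)))"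
    by (simp only: norm_sum)
  also have "\<dots> \<le> (\<Sum>g\<in>PiE J \<Gamma>. \<bar>\<Prod>i\<in>J. c i (g i)\<bar> * M)"
    unfolding norm_mult norm_of_real by (intro sum_mono mult_left_mono b) auto
  also have "\<dots> = 2 ^ card J * (\<Prod>i\<in>J. \<theta> i) * M"
    unfolding sum_distrib_right[symmetric] sum_abs_prod_c[OF J] by simp
  finally show ?thesis .
qed

text \<open>The tuple of trivial characters gives the main term exactly, so its weight is taken off
  the error, which leaves \<open>2 ^ card J - 1\<close>.\<close>

lemma trivial_bound:
  assumes J: "J \<subseteq> II"
  shows "norm ((\<Sum>x\<in>XX. \<Prod>i\<in>J. of_bool (\<not> E i x) :: complex) - of_real ((\<Prod>i\<in>J. \<theta> i) * card XX))
     \<le> (2 ^ card J - 1) * (\<Prod>i\<in>J. \<theta> i) * M"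
proof -
  have fJ: "finite J" using J finI by (rule finite_subset)
  define g0 where "g0 = restrict o0 J"
  have g0: "g0 \<in> PiE J \<Gamma>" using o0 J by (auto simp: g0_def)
  have fP: "finite (PiE J \<Gamma>)" using fJ J finG by (intro finite_PiE) auto
  define W where "W = (\<lambda>g. \<Sum>x\<in>XX. \<Prod>i\<in>J. lam i (g i) x)"
  have "(\<Sum>x\<in>XX. \<Prod>i\<in>J. of_bool (\<not> E i x))
      = (\<Sum>x\<in>XX. \<Sum>g\<in>PiE J \<Gamma>. of_real (\<Prod>i\<in>J. c i (g i)) * (\<Prod>i\<in>J. lam i (g i) x))"
    using J by (intro sum.cong refl) (simp add: prod_expand)
  also have "\<dots> = (\<Sum>g\<in>PiE J \<Gamma>. of_real (\<Prod>i\<in>J. c i (g i)) * W g)"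
    unfolding sum_distrib_left W_def by (rule sum.swap)
  also have "\<dots> = of_real (\<Prod>i\<in>J. c i (g0 i)) * W g0 + (\<Sum>g\<in>PiE J \<Gamma> - {g0}. of_real (\<Prod>i\<in>J. c i (g i)) * W g)"
    using fP g0 by (rule sum.remove)
  also have "(\<Prod>i\<in>J. c i (g0 i)) = (\<Prod>i\<in>J. \<theta> i)" by (intro prod.cong) (auto simp: g0_def c_def)
  also have "W g0 = of_nat (card XX)"
  proof -
    have "W g0 = (\<Sum>x\<in>XX. 1)"
      unfolding W_def
    proof (intro sum.cong refl)
      fix x assume "x \<in> XX"
      thus "(\<Prod>i\<in>J. lam i (g0 i) x) = 1" using J lam_o by (intro prod.neutral) (auto simp: g0_def)
    qed
    thus ?thesis by simp
  qed
  finally have eq: "(\<Sum>x\<in>XX. \<Prod>i\<in>J. of_bool (\<not> E i x)) - of_real ((\<Prod>i\<in>J. \<theta> i) * card XX)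
     = (\<Sum>g\<in>PiE J \<Gamma> - {g0}. of_real (\<Prod>i\<in>J. c i (g i)) * W g)" by simp
  have "norm (\<Sum>g\<in>PiE J \<Gamma> - {g0}. of_real (\<Prod>i\<in>J. c i (g i)) * W g)
     \<le> (\<Sum>g\<in>PiE J \<Gamma> - {g0}. norm (of_real (\<Prod>i\<in>J. c i (g i)) * W g))"
    by (rule norm_sum)
  also have "\<dots> \<le> (\<Sum>g\<in>PiE J \<Gamma> - {g0}. \<bar>\<Prod>i\<in>J. c i (g i)\<bar> * M)"
  proof (rule sum_mono)
    fix g assume g: "g \<in> PiE J \<Gamma> - {g0}"
    have "\<exists>i\<in>J. g i \<noteq> o0 i"
    proof (rule ccontr)
      assume "\<not> ?thesis"
      hence "g = g0" using g unfolding g0_def by (intro PiE_ext[of g J \<Gamma>]) (use o0 J in auto)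
      thus False using g by simp
    qed
    hence "norm (\<Sum>x\<in>XX. (\<Prod>i\<in>J. lam i (g i) x) * \<tau> ov x) \<le> M" using bound[OF J _ ov] g by blast
    moreover have "(\<Sum>x\<in>XX. (\<Prod>i\<in>J. lam i (g i) x) * \<tau> ov x) = W g"
      unfolding W_def by (intro sum.cong refl) (simp add: tau_o)
    ultimately show "norm (of_real (\<Prod>i\<in>J. c i (g i)) * W g) \<le> \<bar>\<Prod>i\<in>J. c i (g i)\<bar> * M"
      unfolding norm_mult norm_of_real by (intro mult_left_mono) auto
  qed
  also have "\<dots> = ((\<Sum>g\<in>PiE J \<Gamma>. \<bar>\<Prod>i\<in>J. c i (g i)\<bar>) - \<bar>\<Prod>i\<in>J. c i (g0 i)\<bar>) * M"
    using fP g0 by (simp add: sum_diff1 sum_distrib_right[symmetric])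
  also have "\<dots> = (2 ^ card J - 1) * (\<Prod>i\<in>J. \<theta> i) * M"
    unfolding sum_abs_prod_c[OF J] \<open>(\<Prod>i\<in>J. c i (g0 i)) = (\<Prod>i\<in>J. \<theta> i)\<close>
    using prod_theta_pos[OF J] by (simp add: algebra_simps)
  finally show ?thesis unfolding eq .
qed

lemma NN_eq:
  assumes J: "J \<subseteq> II"
  shows "complex_of_nat (card V) * of_nat (NN J) = (\<Sum>v\<in>V. \<kappa> v * (\<Sum>x\<in>XX. (\<Prod>i\<in>J. of_bool (\<not> E i x)) * \<tau> v x))"
proof -
  have fJ: "finite J" using J finI by (rule finite_subset)
  have "complex_of_nat (card V) * of_nat (NN J) = (\<Sum>x\<in>XX. of_nat (card V) * of_bool (T x \<and> (\<forall>i\<in>J. \<not> E i x)))"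
    unfolding NN_def sum_distrib_left[symmetric] using finX by (simp add: sum_of_bool_eq Int_def)
  also have "\<dots> = (\<Sum>x\<in>XX. (\<Prod>i\<in>J. of_bool (\<not> E i x)) * (\<Sum>v\<in>V. \<kappa> v * \<tau> v x))"
  proof (intro sum.cong refl)
    fix x assume x: "x \<in> XX"
    have "(\<Prod>i\<in>J. of_bool (\<not> E i x) :: complex) = of_bool (\<forall>i\<in>J. \<not> E i x)"
      using fJ by (induction J rule: finite_induct) auto
    thus "of_nat (card V) * of_bool (T x \<and> (\<forall>i\<in>J. \<not> E i x)) = (\<Prod>i\<in>J. of_bool (\<not> E i x)) * (\<Sum>v\<in>V. \<kappa> v * \<tau> v x)"
      unfolding T[OF x] by auto
  qed
  also have "\<dots> = (\<Sum>v\<in>V. \<kappa> v * (\<Sum>x\<in>XX. (\<Prod>i\<in>J. of_bool (\<not> E i x)) * \<tau> v x))"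
    unfolding sum_distrib_left by (subst sum.swap) (simp add: mult_ac)
  finally show ?thesis .
qed

lemma NN_lower:
  assumes J: "J \<subseteq> II"
  shows "card V * real (NN J) \<ge> (\<Prod>i\<in>J. \<theta> i) * (card XX + M - M * card V * 2 ^ card J)"
proof -
  define \<Theta> where "\<Theta> = (\<Prod>i\<in>J. \<theta> i)"
  have \<Theta>: "\<Theta> > 0" unfolding \<Theta>_def by (rule prod_theta_pos[OF J])
  define A where "A = (\<lambda>v. \<Sum>x\<in>XX. (\<Prod>i\<in>J. of_bool (\<not> E i x)) * \<tau> v x)"
  have Av: "norm (A v) \<le> 2 ^ card J * \<Theta> * M" if "v \<in> V" "v \<noteq> ov" for v
    unfolding A_def \<Theta>_def using bound[OF J _ that(1)] that by (intro weighted_bound[OF J]) auto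
  have A0: "norm (A ov - of_real (\<Theta> * card XX)) \<le> (2 ^ card J - 1) * \<Theta> * M"
  proof -
    have "A ov = (\<Sum>x\<in>XX. \<Prod>i\<in>J. of_bool (\<not> E i x))"
      unfolding A_def using tau_o by (intro sum.cong) auto
    thus ?thesis unfolding \<Theta>_def using trivial_bound[OF J] by simp
  qed
  have cV: "card V \<ge> 1" using ov finV by (metis One_nat_def Suc_leI card_gt_0_iff empty_iff)
  have "complex_of_nat (card V) * of_nat (NN J) - of_real (\<Theta> * card XX)
      = (A ov - of_real (\<Theta> * card XX)) + (\<Sum>v\<in>V - {ov}. \<kappa> v * A v)"
  proof -
    have e1: "complex_of_nat (card V) * of_nat (NN J) = (\<Sum>v\<in>V. \<kappa> v * A v)"
      unfolding A_def by (rule NN_eq[OF J])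
    have e2: "(\<Sum>v\<in>V. \<kappa> v * A v) = \<kappa> ov * A ov + (\<Sum>v\<in>V - {ov}. \<kappa> v * A v)"
      by (rule sum.remove[OF finV ov])
    show ?thesis unfolding e1 e2 kap_o by simp
  qed
  also have "norm \<dots> \<le> norm (A ov - of_real (\<Theta> * card XX)) + (\<Sum>v\<in>V - {ov}. norm (\<kappa> v * A v))"
    by (intro norm_triangle_mono order.refl norm_sum)
  also have "\<dots> \<le> (2 ^ card J - 1) * \<Theta> * M + (\<Sum>v\<in>V - {ov}. 2 ^ card J * \<Theta> * M)"
  proof (intro add_mono A0 sum_mono)
    fix v assume v: "v \<in> V - {ov}"
    have "norm (\<kappa> v * A v) \<le> 1 * (2 ^ card J * \<Theta> * M)"
      unfolding norm_mult using v by (intro mult_mono kap Av) auto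
    thus "norm (\<kappa> v * A v) \<le> 2 ^ card J * \<Theta> * M" by simp
  qed
  also have "\<dots> = \<Theta> * (M * card V * 2 ^ card J - M)"
    using ov finV cV by (simp add: card_Diff_singleton of_nat_diff algebra_simps)
  finally have "norm (complex_of_nat (card V) * of_nat (NN J) - of_real (\<Theta> * card XX)) \<le> \<Theta> * (M * card V * 2 ^ card J - M)" .
  moreover have "complex_of_nat (card V) * of_nat (NN J) - of_real (\<Theta> * card XX)
      = of_real (card V * real (NN J) - \<Theta> * card XX)" by simp
  ultimately have "\<bar>card V * real (NN J) - \<Theta> * card XX\<bar> \<le> \<Theta> * (M * card V * 2 ^ card J - M)"
    by (metis norm_of_real)
  hence "card V * real (NN J) \<ge> \<Theta> * card XX - \<Theta> * (M * card V * 2 ^ card J - M)" by linarith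
  thus ?thesis unfolding \<Theta>_def[symmetric] by (simp add: algebra_simps)
qed

text \<open>In \<theta> s minus the indicator of the complement of \<open>E s\<close> the trivial
  function cancels. Every remaining sum contains a nontrivial \<open>lam s \<gamma>\<close>, so
  there is no main term.\<close>

lemma NN_diff:
  assumes J: "J \<subseteq> II" and s: "s \<in> II" "s \<notin> J"
  shows "card V * (\<theta> s * real (NN J) - real (NN (insert s J))) \<le> card V * (\<theta> s * 2 ^ card J * (\<Prod>i\<in>J. \<theta> i) * M)"
proof -
  define \<Theta> where "\<Theta> = (\<Prod>i\<in>J. \<theta> i)"
  have fJ: "finite J" using J finI by (rule finite_subset)
  define n where "n = card (\<Gamma> s)"
  have n: "n \<ge> 2" using cG s by (simp add: n_def)
  have Js: "insert s J \<subseteq> II" using J s by simp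
  have "complex_of_nat (card V) * (of_real (\<theta> s) * of_nat (NN J) - of_nat (NN (insert s J)))
     = (\<Sum>v\<in>V. \<kappa> v * (\<Sum>x\<in>XX. (\<Prod>i\<in>J. of_bool (\<not> E i x)) * \<tau> v x * (of_real (\<theta> s) - of_bool (\<not> E s x))))"
  proof -
    have "complex_of_nat (card V) * (of_real (\<theta> s) * of_nat (NN J) - of_nat (NN (insert s J)))
      = of_real (\<theta> s) * (of_nat (card V) * of_nat (NN J)) - of_nat (card V) * of_nat (NN (insert s J))"
      by (simp add: algebra_simps)
    also have "\<dots> = (\<Sum>v\<in>V. \<kappa> v * (\<Sum>x\<in>XX. (\<Prod>i\<in>J. of_bool (\<not> E i x)) * \<tau> v x * (of_real (\<theta> s) - of_bool (\<not> E s x))))"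
      unfolding NN_eq[OF J] NN_eq[OF Js] sum_distrib_left sum_subtractf[symmetric] using fJ s(2)
      by (intro sum.cong refl) (simp add: algebra_simps)
    finally show ?thesis .
  qed
  also have "\<dots> = (\<Sum>v\<in>V. \<kappa> v * (\<Sum>\<gamma>\<in>\<Gamma> s - {o0 s}. (\<Sum>x\<in>XX. (\<Prod>i\<in>J. of_bool (\<not> E i x)) * (lam s \<gamma> x * \<tau> v x)) / of_nat n))"
  proof (intro sum.cong refl arg_cong2[where f = "(*)"])
    fix v
    have e: "of_real (\<theta> s) - of_bool (\<not> E s x) = (\<Sum>\<gamma>\<in>\<Gamma> s - {o0 s}. lam s \<gamma> x / of_nat n)" if x: "x \<in> XX" for x
    proof -
      have "of_bool (\<not> E s x) = of_real (c s (o0 s)) * lam s (o0 s) x + (\<Sum>\<gamma>\<in>\<Gamma> s - {o0 s}. of_real (c s \<gamma>) * lam s \<gamma> x)"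
        unfolding not_E_expand[OF s(1) x] using finG s(1) o0 by (intro sum.remove) auto
      also have "(\<Sum>\<gamma>\<in>\<Gamma> s - {o0 s}. of_real (c s \<gamma>) * lam s \<gamma> x) = (\<Sum>\<gamma>\<in>\<Gamma> s - {o0 s}. - (lam s \<gamma> x / of_nat n))"
        by (intro sum.cong refl) (auto simp: c_def n_def)
      finally show ?thesis using lam_o[OF s(1) x] by (simp add: c_def sum_negf)
    qed
    have "(\<Sum>x\<in>XX. (\<Prod>i\<in>J. of_bool (\<not> E i x)) * \<tau> v x * (of_real (\<theta> s) - of_bool (\<not> E s x)))
      = (\<Sum>x\<in>XX. \<Sum>\<gamma>\<in>\<Gamma> s - {o0 s}. (\<Prod>i\<in>J. of_bool (\<not> E i x)) * (lam s \<gamma> x * \<tau> v x) / of_nat n)"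
      by (intro sum.cong refl) (simp add: e sum_distrib_left mult_ac)
    also have "\<dots> = (\<Sum>\<gamma>\<in>\<Gamma> s - {o0 s}. (\<Sum>x\<in>XX. (\<Prod>i\<in>J. of_bool (\<not> E i x)) * (lam s \<gamma> x * \<tau> v x)) / of_nat n)"
      unfolding sum_divide_distrib by (rule sum.swap)
    finally show "(\<Sum>x\<in>XX. (\<Prod>i\<in>J. of_bool (\<not> E i x)) * \<tau> v x * (of_real (\<theta> s) - of_bool (\<not> E s x)))
      = (\<Sum>\<gamma>\<in>\<Gamma> s - {o0 s}. (\<Sum>x\<in>XX. (\<Prod>i\<in>J. of_bool (\<not> E i x)) * (lam s \<gamma> x * \<tau> v x)) / of_nat n)" .
  qed
  finally have eq: "complex_of_nat (card V) * (of_real (\<theta> s) * of_nat (NN J) - of_nat (NN (insert s J)))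
    = (\<Sum>v\<in>V. \<kappa> v * (\<Sum>\<gamma>\<in>\<Gamma> s - {o0 s}. (\<Sum>x\<in>XX. (\<Prod>i\<in>J. of_bool (\<not> E i x)) * (lam s \<gamma> x * \<tau> v x)) / of_nat n))" .
  have "norm (\<Sum>v\<in>V. \<kappa> v * (\<Sum>\<gamma>\<in>\<Gamma> s - {o0 s}. (\<Sum>x\<in>XX. (\<Prod>i\<in>J. of_bool (\<not> E i x)) * (lam s \<gamma> x * \<tau> v x)) / of_nat n))
    \<le> (\<Sum>v\<in>V. 1 * (\<Sum>\<gamma>\<in>\<Gamma> s - {o0 s}. (2 ^ card J * \<Theta> * M) / n))"
  proof (intro sum_norm_le)
    fix v assume v: "v \<in> V"
    have "norm (\<Sum>\<gamma>\<in>\<Gamma> s - {o0 s}. (\<Sum>x\<in>XX. (\<Prod>i\<in>J. of_bool (\<not> E i x)) * (lam s \<gamma> x * \<tau> v x)) / of_nat n)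
        \<le> (\<Sum>\<gamma>\<in>\<Gamma> s - {o0 s}. (2 ^ card J * \<Theta> * M) / n)"
    proof (intro sum_norm_le)
      fix \<gamma> assume \<gamma>: "\<gamma> \<in> \<Gamma> s - {o0 s}"
      have "norm (\<Sum>x\<in>XX. (\<Prod>i\<in>J. of_bool (\<not> E i x)) * (lam s \<gamma> x * \<tau> v x)) \<le> 2 ^ card J * \<Theta> * M"
        unfolding \<Theta>_def
      proof (rule weighted_bound[OF J])
        fix g assume g: "g \<in> PiE J \<Gamma>"
        define g' where "g' = g(s := \<gamma>)"
        have g': "g' \<in> PiE (insert s J) \<Gamma>" using g \<gamma> by (auto simp: g'_def PiE_def extensional_def)
        have "norm (\<Sum>x\<in>XX. (\<Prod>i\<in>insert s J. lam i (g' i) x) * \<tau> v x) \<le> M"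
          using \<gamma> by (intro bound[OF Js g' v]) (auto simp: g'_def)
        moreover have "(\<Prod>i\<in>insert s J. lam i (g' i) x) = (\<Prod>i\<in>J. lam i (g i) x) * lam s \<gamma> x" for x
        proof -
          have "(\<Prod>i\<in>J. lam i (g' i) x) = (\<Prod>i\<in>J. lam i (g i) x)" using s(2) by (intro prod.cong) (auto simp: g'_def)
          thus ?thesis using fJ s(2) by (simp add: g'_def)
        qed
        ultimately show "norm (\<Sum>x\<in>XX. (\<Prod>i\<in>J. lam i (g i) x) * (lam s \<gamma> x * \<tau> v x)) \<le> M"
          by (simp add: mult.assoc)
      qed
      thus "norm ((\<Sum>x\<in>XX. (\<Prod>i\<in>J. of_bool (\<not> E i x)) * (lam s \<gamma> x * \<tau> v x)) / of_nat n) \<le> (2 ^ card J * \<Theta> * M) / n"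
        by (simp add: norm_divide divide_right_mono)
    qed
    thus "norm (\<kappa> v * (\<Sum>\<gamma>\<in>\<Gamma> s - {o0 s}. (\<Sum>x\<in>XX. (\<Prod>i\<in>J. of_bool (\<not> E i x)) * (lam s \<gamma> x * \<tau> v x)) / of_nat n))
      \<le> 1 * (\<Sum>\<gamma>\<in>\<Gamma> s - {o0 s}. (2 ^ card J * \<Theta> * M) / n)"
      unfolding norm_mult using kap[OF v] by (intro mult_mono) auto
  qed
  also have "\<dots> = card V * (\<theta> s * 2 ^ card J * \<Theta> * M)"
    using n o0[OF s(1)] finG[OF s(1)]
    by (simp add: \<theta>_def n_def[symmetric] card_Diff_singleton of_nat_diff field_simps)
  finally have "norm (complex_of_nat (card V) * (of_real (\<theta> s) * of_nat (NN J) - of_nat (NN (insert s J))))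
      \<le> card V * (\<theta> s * 2 ^ card J * \<Theta> * M)" unfolding eq .
  moreover have "complex_of_nat (card V) * (of_real (\<theta> s) * of_nat (NN J) - of_nat (NN (insert s J)))
     = of_real (card V * (\<theta> s * real (NN J) - real (NN (insert s J))))" by simp
  ultimately have "\<bar>card V * (\<theta> s * real (NN J) - real (NN (insert s J)))\<bar> \<le> card V * (\<theta> s * 2 ^ card J * \<Theta> * M)"
    by (metis norm_of_real)
  thus ?thesis unfolding \<Theta>_def by linarith
qed

text \<open>An element counted for \<open>J\<close> but not for \<open>J \<union> S\<close> is lost
  at some s, and one s loses \<open>NN J / card (\<Gamma> s)\<close> up to the error of
  \<open>NN_diff\<close>. What remains is at least \<delta> * \<open>NN J\<close> minus these
  errors, so a lower bound for \<open>J\<close> alone suffices.\<close>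

theorem sieve:
  fixes \<delta> :: real
  assumes JS: "J \<union> S = II" "J \<inter> S = {}"
    and \<delta>: "\<delta> = 1 - (\<Sum>s\<in>S. 1 / card (\<Gamma> s))" "\<delta> > 0"
    and big: "(card XX + M) * \<delta> > M * card V * 2 ^ card J * (2 * \<delta> + card S - 1)"
  shows "\<exists>x\<in>XX. T x \<and> (\<forall>i\<in>II. \<not> E i x)"
proof -
  have J: "J \<subseteq> II" and S: "S \<subseteq> II" using JS by auto
  have fJ: "finite J" and fS: "finite S" using finite_subset finI J S by auto
  define \<Theta> where "\<Theta> = (\<Prod>i\<in>J. \<theta> i)"
  have \<Theta>: "\<Theta> > 0" unfolding \<Theta>_def by (rule prod_theta_pos[OF J])
  have cV: "real (card V) > 0" using ov finV by (metis card_gt_0_iff empty_iff of_nat_0_less_iff)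
  define W where "W = (2::real) ^ card J"
  have union: "real (NN J) \<le> real (NN (J \<union> S)) + (\<Sum>s\<in>S. real (NN J) - real (NN (insert s J)))"
  proof -
    define B where "B = (\<lambda>J. {x \<in> XX. T x \<and> (\<forall>i\<in>J. \<not> E i x)})"
    have fB: "finite (B J)" for J unfolding B_def using finX by simp
    have "B J \<subseteq> B (J \<union> S) \<union> (\<Union>s\<in>S. B J - B (insert s J))" by (auto simp: B_def)
    hence "card (B J) \<le> card (B (J \<union> S) \<union> (\<Union>s\<in>S. B J - B (insert s J)))"
      using fB fS by (intro card_mono) auto
    also have "\<dots> \<le> card (B (J \<union> S)) + card (\<Union>s\<in>S. B J - B (insert s J))" by (rule card_Un_le)
    also have "card (\<Union>s\<in>S. B J - B (insert s J)) \<le> (\<Sum>s\<in>S. card (B J - B (insert s J)))"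
      using fS by (rule card_UN_le)
    finally have "real (card (B J)) \<le> real (card (B (J \<union> S)) + (\<Sum>s\<in>S. card (B J - B (insert s J))))"
      by (intro of_nat_mono) simp
    also have "\<dots> = real (card (B (J \<union> S))) + (\<Sum>s\<in>S. real (card (B J)) - real (card (B (insert s J))))"
    proof -
      have "real (card (B J - B (insert s J))) = real (card (B J)) - real (card (B (insert s J)))" for s
      proof -
        have sub: "B (insert s J) \<subseteq> B J" by (auto simp: B_def)
        have "card (B J - B (insert s J)) = card (B J) - card (B (insert s J))"
          using fB sub by (intro card_Diff_subset)
        thus ?thesis using card_mono[OF fB sub] by (simp add: of_nat_diff)
      qed
      thus ?thesis by simp
    qed
    finally show ?thesis unfolding NN_def B_def .
  qed
  have "(\<Sum>s\<in>S. \<theta> s) = real (card S) - 1 + \<delta>" unfolding \<theta>_def \<delta> by (simp add: sum_subtractf)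
  have diff: "real (NN J) - real (NN (insert s J)) \<le> (1 / card (\<Gamma> s)) * NN J + \<theta> s * W * \<Theta> * M" if s: "s \<in> S" for s
  proof -
    have "card V * (\<theta> s * real (NN J) - real (NN (insert s J))) \<le> card V * (\<theta> s * W * \<Theta> * M)"
      unfolding W_def \<Theta>_def by (rule NN_diff[OF J]) (use s JS in auto)
    hence "\<theta> s * real (NN J) - real (NN (insert s J)) \<le> \<theta> s * W * \<Theta> * M"
      using cV by (metis mult_le_cancel_left_pos)
    thus ?thesis unfolding \<theta>_def by (simp add: algebra_simps)
  qed
  have "(\<Sum>s\<in>S. real (NN J) - real (NN (insert s J))) \<le> (\<Sum>s\<in>S. (1 / card (\<Gamma> s)) * NN J + \<theta> s * W * \<Theta> * M)"
    by (intro sum_mono diff)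
  also have "\<dots> = (\<Sum>s\<in>S. 1 / card (\<Gamma> s)) * NN J + (\<Sum>s\<in>S. \<theta> s) * (W * \<Theta> * M)"
    by (simp add: sum.distrib sum_distrib_right mult.assoc)
  also have "\<dots> = (1 - \<delta>) * NN J + (real (card S) - 1 + \<delta>) * (W * \<Theta> * M)"
    unfolding \<open>(\<Sum>s\<in>S. \<theta> s) = real (card S) - 1 + \<delta>\<close> using \<delta> by simp
  finally have "real (NN (J \<union> S)) \<ge> \<delta> * NN J - (real (card S) - 1 + \<delta>) * (W * \<Theta> * M)"
    using union by (simp add: algebra_simps)
  hence "card V * real (NN (J \<union> S)) \<ge> card V * (\<delta> * NN J - (real (card S) - 1 + \<delta>) * (W * \<Theta> * M))"
    using cV by (intro mult_left_mono) auto
  moreover have "\<delta> * (card V * real (NN J)) \<ge> \<delta> * (\<Theta> * (card XX + M - M * card V * W))"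
    unfolding \<Theta>_def W_def using \<delta>(2) NN_lower[OF J] by (intro mult_left_mono) auto
  ultimately have "card V * real (NN (J \<union> S)) \<ge> \<Theta> * ((card XX + M) * \<delta> - M * card V * W * (2 * \<delta> + card S - 1))"
    by (simp add: algebra_simps)
  moreover have "\<Theta> * ((card XX + M) * \<delta> - M * card V * W * (2 * \<delta> + card S - 1)) > 0"
    using \<Theta> big unfolding W_def by (intro mult_pos_pos) auto
  ultimately have "card V * real (NN (J \<union> S)) > 0" by linarith
  hence "NN (J \<union> S) > 0" by (metis of_nat_0 mult_zero_right less_irrefl not_gr_zero)
  hence "{x \<in> XX. T x \<and> (\<forall>i\<in>J \<union> S. \<not> E i x)} \<noteq> {}" unfolding NN_def by (metis card.empty less_irrefl)
  thus ?thesis using JS by blast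
qed

end

section \<open>Explicit characters and annihilators\<close>

lemma root_of_unity_exists:
  assumes n: "n > 0"
  obtains w :: complex where "\<And>j :: nat. w ^ j = 1 \<longleftrightarrow> n dvd j"
proof -
  have "exp (2 * of_real pi * \<i> * of_nat j / of_nat n) = exp (2 * of_real pi * \<i> / of_nat n) ^ j" for j
    by (simp add: exp_of_nat_mult[symmetric] mult_ac)
  moreover have "exp (2 * of_real pi * \<i> * of_nat j / of_nat n) = 1 \<longleftrightarrow> n dvd j" for j
    using n by (intro complex_root_unity_eq_1) simp
  ultimately show ?thesis using that by metis
qed

lemma power_eq_1_coprime:
  fixes x :: "'a::field"
  assumes "x ^ a = 1" "x ^ b = 1" "coprime a b" "a > 0"
  shows "x = 1"
proof -
  obtain u v where "a * u = b * v + 1"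
    using bezout_nat[of a b] assms by auto
  hence "x ^ (a * u) = x ^ (b * v + 1)" by simp
  thus ?thesis using assms by (simp add: power_mult power_add)
qed

lemma sum_powers_root_of_unity:
  fixes w :: complex
  assumes "w ^ n = 1"
  shows "(\<Sum>i<n. w ^ i) = (if w = 1 then of_nat n else 0)"
proof (cases "w = 1")
  case False
  have "(w - 1) * (\<Sum>i<n. w ^ i) = w ^ n - 1" by (rule power_diff_1_eq[symmetric])
  thus ?thesis using False assms by simp
qed simp

lemma root_of_unity_pow_cong:
  fixes w :: complex
  assumes w: "\<And>j :: nat. w ^ j = 1 \<longleftrightarrow> n dvd j" and "[i = j] (mod n)"
  shows "w ^ i = w ^ j"
proof -
  have "w ^ i = w ^ j" if "i \<le> j" "[i = j] (mod n)" for i j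
  proof -
    have "n dvd j - i" using cong_altdef_nat[OF that(1), of n] cong_sym[OF that(2)] by simp
    hence "w ^ (i + (j - i)) = w ^ i" using w by (simp only: power_add) simp
    thus ?thesis using that by simp
  qed
  thus ?thesis using assms(2) by (metis cong_sym nat_le_linear)
qed

section \<open>Characters of prime order and an additive character\<close>

context pchar
begin

text \<open>As l differs from p there are l roots of unity; they form a group of prime order, so any
  z other than 1 generates it. \<eta> sends z ^ i to w ^ i for a primitive complex root w.\<close>

lemma prime_character_exists:
  assumes l: "prime l" "l \<noteq> p"
  obtains \<eta> :: "'k \<Rightarrow> complex" where
    "\<And>y y'. y ^ l = 1 \<Longrightarrow> y' ^ l = 1 \<Longrightarrow> \<eta> (y * y') = \<eta> y * \<eta> y'"
    "\<And>y. y ^ l = 1 \<Longrightarrow> (\<Sum>i<l. \<eta> y ^ i) = of_nat l * of_bool (y = 1)"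
    "\<And>i. \<not> l dvd i \<Longrightarrow> \<exists>y. y ^ l = 1 \<and> \<eta> y ^ i \<noteq> 1"
    "\<And>y. y ^ l = 1 \<Longrightarrow> \<eta> y ^ l = 1" "\<eta> 1 = 1"
proof -
  have l1: "l > 1" using l prime_gt_1_nat by blast
  have npl: "\<not> p dvd l" using l p by (metis primes_dvd_imp_eq)
  define U where "U = {y :: 'k. y ^ l = 1}"
  have cU: "card U = l" unfolding U_def using l1 npl by (intro card_roots_of_unity) auto
  have fU: "finite U" using cU l1 by (metis card.infinite not_one_less_zero)
  have "\<not> U \<subseteq> {1}" using card_mono[of "{1}" U] cU l1 by auto
  then obtain z where z: "z \<in> U" "z \<noteq> 1" by blast
  have zl: "z ^ l = 1" using z by (simp add: U_def)
  have inj: "[i = j] (mod l)" if eq: "z ^ i = z ^ j" for i j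
  proof -
    have *: "l dvd b - a" if "z ^ a = z ^ b" "a \<le> b" for a b
    proof (rule ccontr)
      assume "\<not> l dvd b - a"
      hence "coprime l (b - a)" using l by (simp add: prime_imp_coprime)
      moreover have "z \<noteq> 0" using zl l1 by (auto simp: power_0_left)
      moreover have "z ^ a * z ^ (b - a) = z ^ b" using that(2) by (simp flip: power_add)
      ultimately have "coprime l (b - a)" "z ^ (b - a) = 1" using that(1) by auto
      thus False using power_eq_1_coprime[OF zl, of "b - a"] l1 z by auto
    qed
    show ?thesis
    proof (cases "i \<le> j")
      case True
      thus ?thesis using *[OF eq True] cong_altdef_nat[OF True, of l] cong_sym by blast
    next
      case False
      thus ?thesis using *[OF eq[symmetric]] by (simp add: cong_altdef_nat)
    qed
  qed
  have "(\<lambda>i. z ^ i) ` {..<l} = U"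
  proof (rule card_subset_eq[OF fU])
    show "(\<lambda>i. z ^ i) ` {..<l} \<subseteq> U"
      using zl by (auto simp: U_def simp flip: power_mult) (metis mult.commute power_mult power_one)
    have "inj_on (\<lambda>i. z ^ i) {..<l}"
    proof (rule inj_onI)
      fix i j assume "i \<in> {..<l}" "j \<in> {..<l}" "z ^ i = z ^ j"
      thus "i = j" using inj[of i j] cong_less_modulus_unique_nat by auto
    qed
    thus "card ((\<lambda>i. z ^ i) ` {..<l}) = card U" using cU by (simp add: card_image)
  qed
  hence "U \<subseteq> range (\<lambda>i. z ^ i)" by blast
  hence surj: "\<exists>i. y = z ^ i" if "y ^ l = 1" for y using that unfolding U_def by blast
  obtain w :: complex where w: "\<And>j :: nat. w ^ j = 1 \<longleftrightarrow> l dvd j"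
    using root_of_unity_exists[of l] l1 by auto
  define \<eta> where "\<eta> = (\<lambda>y. w ^ (SOME i. z ^ i = y))"
  have eta: "\<eta> (z ^ i) = w ^ i" for i
  proof -
    have "z ^ (SOME j. z ^ j = z ^ i) = z ^ i" by (rule someI[of "\<lambda>j. z ^ j = z ^ i" i]) simp
    hence "[(SOME j. z ^ j = z ^ i) = i] (mod l)" by (rule inj)
    thus ?thesis unfolding \<eta>_def by (rule root_of_unity_pow_cong[OF w])
  qed
  have wl: "w ^ l = 1" using w by simp
  show ?thesis
  proof (rule that[of \<eta>])
    show "\<eta> (y * y') = \<eta> y * \<eta> y'" if yy: "y ^ l = 1" "y' ^ l = 1" for y y'
    proof -
      obtain i j where ij: "y = z ^ i" "y' = z ^ j" using surj[OF yy(1)] surj[OF yy(2)] by metis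
      have "\<eta> (z ^ (i + j)) = w ^ (i + j)" by (rule eta)
      thus ?thesis unfolding ij eta power_add .
    qed
    show pw: "\<eta> y ^ l = 1" if y: "y ^ l = 1" for y
    proof -
      obtain i where i: "y = z ^ i" using surj[OF y] by metis
      show ?thesis unfolding i eta using wl by (metis power_mult mult.commute power_one)
    qed
    show "(\<Sum>i<l. \<eta> y ^ i) = of_nat l * of_bool (y = 1)" if y: "y ^ l = 1" for y
    proof -
      obtain i where i: "y = z ^ i" using surj[OF y] by metis
      have "\<eta> y = 1 \<longleftrightarrow> l dvd i" unfolding i eta by (rule w)
      also have "\<dots> \<longleftrightarrow> y = 1"
      proof
        assume "l dvd i"
        thus "y = 1" unfolding i using zl by (auto elim!: dvdE simp: power_mult)
      next
        assume "y = 1"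
        hence "z ^ i = z ^ 0" using i by simp
        from inj[OF this] show "l dvd i" by (simp add: cong_0_iff)
      qed
      finally show ?thesis using sum_powers_root_of_unity[OF pw[OF y]] by auto
    qed
    show "\<exists>y. y ^ l = 1 \<and> \<eta> y ^ i \<noteq> 1" if "\<not> l dvd i" for i
      using zl that w eta[of 1] by (intro exI[of _ z]) auto
    show "\<eta> 1 = 1" using eta[of 0] by simp
  qed
qed

lemma add_character_exists:
  obtains \<psi> :: "'k \<Rightarrow> complex" and z where "add_char p \<psi>" "z \<in> FF p" "\<psi> z \<noteq> 1"
proof -
  obtain w :: complex where w: "\<And>j :: nat. w ^ j = 1 \<longleftrightarrow> p dvd j"
    using root_of_unity_exists[of p] p1 by auto
  define \<psi> where "\<psi> = (\<lambda>y :: 'k. w ^ (SOME i. of_nat i = y))"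
  have inj: "[i = j] (mod p)" if eq: "of_nat i = (of_nat j :: 'k)" for i j
    using eq by (simp add: of_nat_eq_iff_cong_CHAR CHAR)
  have psi: "\<psi> (of_nat i) = w ^ i" for i
  proof -
    have "of_nat (SOME j. of_nat j = (of_nat i :: 'k)) = (of_nat i :: 'k)"
      by (rule someI[of "\<lambda>j. of_nat j = (of_nat i :: 'k)" i]) simp
    hence "[(SOME j. of_nat j = (of_nat i :: 'k)) = i] (mod p)" by (rule inj)
    thus ?thesis unfolding \<psi>_def by (rule root_of_unity_pow_cong[OF w])
  qed
  have ofF: "of_nat n \<in> (FF p :: 'k set)" for n
    by (induction n) (use p1 FF_add[of _ 1] in auto)
  have "of_nat ` {..<p} = (FF p :: 'k set)"
  proof (rule card_subset_eq)
    show "finite (FF p :: 'k set)" using finite_FF[of 1] by simp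
    show "of_nat ` {..<p} \<subseteq> (FF p :: 'k set)" using ofF by auto
    have "inj_on (of_nat :: nat \<Rightarrow> 'k) {..<p}"
    proof (rule inj_onI)
      fix i j assume "i \<in> {..<p}" "j \<in> {..<p}" "of_nat i = (of_nat j :: 'k)"
      thus "i = j" using inj[of i j] cong_less_modulus_unique_nat by auto
    qed
    thus "card ((of_nat :: nat \<Rightarrow> 'k) ` {..<p}) = card (FF p :: 'k set)"
      using card_FF[of 1] by (simp add: card_image)
  qed
  hence surj: "\<exists>i. y = of_nat i" if "y \<in> FF p" for y :: 'k using that by blast
  show ?thesis
  proof (rule that[of \<psi> 1])
    show "add_char p \<psi>"
      unfolding add_char_def
    proof (intro conjI ballI)
      show "\<psi> 0 = 1" using psi[of 0] by simp
      fix x y :: 'k assume xy: "x \<in> FF p" "y \<in> FF p"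
      obtain i j where ij: "x = of_nat i" "y = of_nat j" using surj[OF xy(1)] surj[OF xy(2)] by blast
      have "\<psi> (of_nat (i + j)) = w ^ (i + j)" by (rule psi)
      thus "\<psi> (x + y) = \<psi> x * \<psi> y" unfolding ij psi of_nat_add power_add .
    qed
    show "\<psi> 1 \<noteq> 1" using psi[of 1] w[of 1] p1 by auto
  qed simp
qed

end

section \<open>Annihilators under the trace pairing\<close>

locale pchar_psi = pchar p K for p and K :: "'k::alg_closed_field itself" +
  fixes \<psi> :: "'k \<Rightarrow> complex" and z0 :: 'k
  assumes psi: "add_char p \<psi>" "z0 \<in> FF p" "\<psi> z0 \<noteq> 1"
begin

definition ps :: "nat \<Rightarrow> 'k \<Rightarrow> complex" where "ps e x = \<psi> (abstr e x)"

lemma ps_add: "x \<in> FF (p ^ e) \<Longrightarrow> y \<in> FF (p ^ e) \<Longrightarrow> ps e (x + y) = ps e x * ps e y"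
  unfolding ps_def by (rule psi_abstr_add[OF psi(1)])

lemma ps_0 [simp]: "ps e 0 = 1"
  using psi by (simp add: ps_def add_char_def)

lemma ps_char: "add_char (p ^ e) (ps e)"
  by (simp add: add_char_def ps_add)

lemma ps_norm: "x \<in> FF (p ^ e) \<Longrightarrow> norm (ps e x) = 1"
  using norm_add_char[OF ps_char] .

lemma ps_uminus: "x \<in> FF (p ^ e) \<Longrightarrow> ps e (- x) * ps e x = 1"
  using ps_add[of "-x" e x] by (simp add: FF_uminus)

lemma ps_nontrivial:
  assumes "e > 0" "u \<in> FF (p ^ e)" "u \<noteq> 0"
  shows "\<exists>x\<in>FF (p ^ e). ps e (u * x) \<noteq> 1"
proof -
  obtain y where y: "y \<in> FF (p ^ e)" "\<psi> (abstr e y) \<noteq> 1" using psi_abstr_nontrivial[of e z0 \<psi>, OF assms(1) psi(2,3)] by blast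
  show ?thesis using y assms by (intro bexI[of _ "y / u"]) (auto simp: ps_def FF_divide)
qed

lemma ps_sum:
  assumes e: "e > 0" and u: "u \<in> FF (p ^ e)"
  shows "(\<Sum>x\<in>FF (p ^ e). ps e (u * x)) = of_nat (p ^ e) * of_bool (u = 0)"
proof (cases "u = 0")
  case True
  thus ?thesis using card_FF[OF e] by simp
next
  case False
  obtain z where z: "z \<in> FF (p ^ e)" "ps e (u * z) \<noteq> 1" using ps_nontrivial[OF e u False] by blast
  have "add_char (p ^ e) (\<lambda>x. ps e (u * x))" using u by (simp add: add_char_def distrib_left ps_add FF_mult)
  from add_char_sum_eq_0[OF this z] show ?thesis using False by simp
qed

text \<open>The orthogonal complement for the pairing of u and x by \<open>ps e (u * x)\<close>; it
  indexes the additive characters that are trivial on \<open>U\<close>.\<close>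

definition ann :: "nat \<Rightarrow> 'k set \<Rightarrow> 'k set" where
  "ann e U = {u \<in> FF (p ^ e). \<forall>x\<in>U. ps e (u * x) = 1}"

definition addsub :: "nat \<Rightarrow> 'k set \<Rightarrow> bool" where
  "addsub e U \<longleftrightarrow> U \<subseteq> FF (p ^ e) \<and> 0 \<in> U \<and> (\<forall>x\<in>U. \<forall>y\<in>U. x - y \<in> U)"

lemma addsub_add: "addsub e U \<Longrightarrow> x \<in> U \<Longrightarrow> y \<in> U \<Longrightarrow> x + y \<in> U"
  unfolding addsub_def by (metis diff_minus_eq_add diff_0)

lemma addsub_sum:
  assumes e: "e > 0" and U: "addsub e U" and u: "u \<in> FF (p ^ e)"
  shows "(\<Sum>x\<in>U. ps e (u * x)) = of_nat (card U) * of_bool (u \<in> ann e U)"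
proof (cases "u \<in> ann e U")
  case True
  thus ?thesis by (simp add: ann_def)
next
  case False
  then obtain z where z: "z \<in> U" "ps e (u * z) \<noteq> 1" using u by (auto simp: ann_def)
  have UF: "U \<subseteq> FF (p ^ e)" using U by (simp add: addsub_def)
  have "(\<Sum>x\<in>U. ps e (u * x)) = (\<Sum>x\<in>U. ps e (u * (z + x)))"
    by (rule sum.reindex_bij_witness[of _ "\<lambda>x. z + x" "\<lambda>x. x - z"])
       (use z U addsub_add in \<open>auto simp: addsub_def\<close>)
  also have "\<dots> = ps e (u * z) * (\<Sum>x\<in>U. ps e (u * x))"
    unfolding sum_distrib_left using UF z u by (intro sum.cong refl) (auto simp: distrib_left ps_add FF_mult subset_iff)
  finally have "(\<Sum>x\<in>U. ps e (u * x)) = 0" using z(2) by (simp only: mult_cancel_right1) simp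
  thus ?thesis using False by simp
qed

lemma ann_addsub: "addsub e (ann e U)" if "U \<subseteq> FF (p ^ e)" for U
proof -
  have "ps e ((x - y) * z) = 1" if "x \<in> ann e U" "y \<in> ann e U" "z \<in> U" for x y z
  proof -
    have F: "x * z \<in> FF (p ^ e)" "y * z \<in> FF (p ^ e)" using that \<open>U \<subseteq> _\<close> by (auto simp: ann_def intro: FF_mult)
    have "ps e (x * z + - (y * z)) = ps e (x * z) * ps e (- (y * z))" using F by (intro ps_add FF_uminus)
    moreover have "ps e (- (y * z)) * ps e (y * z) = 1" using ps_uminus F by blast
    ultimately show ?thesis using that by (simp add: ann_def left_diff_distrib)
  qed
  thus ?thesis using p1 by (auto simp: addsub_def ann_def FF_diff)
qed

lemma finite_addsub: "e > 0 \<Longrightarrow> addsub e U \<Longrightarrow> finite U"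
  using finite_FF by (auto simp: addsub_def intro: finite_subset)

text \<open>The sum of \<open>ps e (u * x)\<close> over all u and over x in \<open>U\<close>,
  evaluated in both orders.\<close>

lemma card_ann:
  assumes e: "e > 0" and U: "addsub e U"
  shows "card (ann e U) * card U = p ^ e"
proof -
  have UF: "U \<subseteq> FF (p ^ e)" and U0: "0 \<in> U" using U by (auto simp: addsub_def)
  have fU: "finite U" using finite_addsub[OF e U] .
  have "complex_of_nat (card (ann e U) * card U) = (\<Sum>u\<in>FF (p ^ e). of_nat (card U) * of_bool (u \<in> ann e U))"
  proof -
    have "FF (p ^ e) \<inter> ann e U = ann e U" by (auto simp: ann_def)
    thus ?thesis using finite_FF[OF e] by (simp add: sum_distrib_left[symmetric] sum_of_bool_eq Int_def[symmetric] mult.commute)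
  qed
  also have "\<dots> = (\<Sum>u\<in>FF (p ^ e). \<Sum>x\<in>U. ps e (u * x))"
    by (intro sum.cong refl addsub_sum[OF e U, symmetric])
  also have "\<dots> = (\<Sum>x\<in>U. \<Sum>u\<in>FF (p ^ e). ps e (x * u))"
    by (subst sum.swap) (simp add: mult.commute)
  also have "\<dots> = (\<Sum>x\<in>U. of_nat (p ^ e) * of_bool (x = 0))"
    using UF by (intro sum.cong refl ps_sum[OF e]) auto
  also have "\<dots> = of_nat (p ^ e)" using U0 fU by (simp add: sum_distrib_left[symmetric] of_bool_def)
  finally show ?thesis by (simp only: of_nat_eq_iff)
qed

lemma ann_ann:
  assumes e: "e > 0" and U: "addsub e U"
  shows "ann e (ann e U) = U"
proof -
  have UF: "U \<subseteq> FF (p ^ e)" using U by (auto simp: addsub_def)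
  have A: "addsub e (ann e U)" by (rule ann_addsub[OF UF])
  have AF: "ann e U \<subseteq> FF (p ^ e)" by (auto simp: ann_def)
  have AA: "addsub e (ann e (ann e U))" by (rule ann_addsub[OF AF])
  have "U \<subseteq> ann e (ann e U)" using UF by (auto simp: ann_def mult.commute)
  moreover have "card U = card (ann e (ann e U))"
  proof -
    have "card (ann e U) * card U = card (ann e U) * card (ann e (ann e U))"
      using card_ann[OF e U] card_ann[OF e A] by (simp add: mult.commute)
    moreover have "card (ann e U) > 0" using finite_addsub[OF e A] A by (auto simp: addsub_def card_gt_0_iff)
    ultimately show ?thesis by simp
  qed
  ultimately show ?thesis using card_subset_eq[OF finite_addsub[OF e AA]] by metis
qed

lemma ann_indicator:
  assumes e: "e > 0" and U: "addsub e U" and x: "x \<in> FF (p ^ e)"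
  shows "(\<Sum>u\<in>ann e U. ps e (u * x)) = of_nat (card (ann e U)) * of_bool (x \<in> U)"
proof -
  have UF: "U \<subseteq> FF (p ^ e)" using U by (auto simp: addsub_def)
  have "(\<Sum>u\<in>ann e U. ps e (u * x)) = (\<Sum>u\<in>ann e U. ps e (x * u))" by (simp add: mult.commute)
  thus ?thesis using addsub_sum[OF e ann_addsub[OF UF] x] ann_ann[OF e U] by simp
qed

end

section \<open>Normal elements\<close>

context pchar
begin

text \<open>\<open>lin k g x\<close> is the value at \<open>x\<close> of the linearized polynomial attached to \<open>g\<close>: the Frobenius
  automorphism \<open>x \<mapsto> x ^ (p ^ k)\<close> is substituted for the variable of \<open>g\<close>.\<close>

definition lin :: "nat \<Rightarrow> 'k poly \<Rightarrow> 'k \<Rightarrow> 'k" where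
  "lin k g x = (\<Sum>i\<le>degree g. coeff g i * x ^ (p ^ (k * i)))"

lemma lin_le: "degree g \<le> n \<Longrightarrow> lin k g x = (\<Sum>i\<le>n. coeff g i * x ^ (p ^ (k * i)))"
  unfolding lin_def by (rule sum.mono_neutral_left) (auto simp: coeff_eq_0)

lemma lin_add: "lin k (g + h) x = lin k g x + lin k h x"
proof -
  define n where "n = max (degree g) (degree h)"
  have "degree (g + h) \<le> n" "degree g \<le> n" "degree h \<le> n" by (auto simp: n_def degree_add_le)
  thus ?thesis by (simp add: lin_le[of _ n] distrib_right sum.distrib)
qed

lemma lin_diff_arg: "lin k g (x - y) = lin k g x - lin k g y"
  unfolding lin_def by (simp add: frob_diff right_diff_distrib sum_subtractf)

lemma lin_0 [simp]: "lin k g 0 = 0"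
  unfolding lin_def using p1 by (simp add: power_0_left)

lemma lin_1 [simp]: "lin k 1 x = x"
  unfolding lin_def by simp

lemma lin_zero_poly [simp]: "lin k 0 x = 0"
  unfolding lin_def by simp

lemma lin_sum: "lin k (\<Sum>i\<in>A. f i) x = (\<Sum>i\<in>A. lin k (f i) x)"
  by (induction A rule: infinite_finite_induct) (auto simp: lin_add)

text \<open>The coefficients of \<open>h\<close> are fixed by the Frobenius map that is substituted,
  so substitution turns products into compositions. This is why all factors below are kept over
  \<open>FF (p ^ k)\<close>.\<close>

lemma lin_monom_mult:
  assumes h: "polyF (p ^ k) h"
  shows "lin k (monom c i * h) x = c * (lin k h x) ^ (p ^ (k * i))"
proof -
  have "lin k (monom c i * h) x = (\<Sum>j\<le>i + degree h. coeff (monom c i * h) j * x ^ (p ^ (k * j)))"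
    by (rule lin_le) (intro order.trans[OF degree_mult_le] add_mono degree_monom_le order.refl)
  also have "\<dots> = (\<Sum>j\<in>{i..i + degree h}. c * coeff h (j - i) * x ^ (p ^ (k * j)))"
    by (rule sum.mono_neutral_cong_right) (auto simp: coeff_monom_mult)
  also have "\<dots> = (\<Sum>j\<le>degree h. c * coeff h j * x ^ (p ^ (k * (i + j))))"
    by (rule sum.reindex_bij_witness[of _ "\<lambda>j. i + j" "\<lambda>j. j - i"]) auto
  also have "\<dots> = c * (lin k h x) ^ (p ^ (k * i))"
    unfolding lin_def frob_sum sum_distrib_left
  proof (intro sum.cong refl)
    fix j
    have "coeff h j ^ (p ^ (k * i)) = coeff h j"
      using FF_powD[of "coeff h j" "p ^ k" i] h by (simp add: polyF_def power_mult)
    thus "c * coeff h j * x ^ (p ^ (k * (i + j))) = c * (coeff h j * x ^ (p ^ (k * j))) ^ (p ^ (k * i))"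
      by (simp add: power_mult_distrib distrib_left power_add mult_ac flip: power_mult)
  qed
  finally show ?thesis .
qed

lemma lin_mult:
  assumes h: "polyF (p ^ k) h"
  shows "lin k (g * h) x = lin k g (lin k h x)"
proof -
  have "g * h = (\<Sum>i\<le>degree g. monom (coeff g i) i * h)"
    by (subst poly_as_sum_of_monoms[of g, symmetric]) (simp add: sum_distrib_right)
  hence "lin k (g * h) x = (\<Sum>i\<le>degree g. lin k (monom (coeff g i) i * h) x)" by (simp only: lin_sum)
  thus ?thesis unfolding lin_monom_mult[OF h] by (simp add: lin_def[of k g])
qed

lemma lin_FF:
  assumes "polyF (p ^ k) g" "x \<in> FF (p ^ (k * m))"
  shows "lin k g x \<in> FF (p ^ (k * m))"
proof -
  have "FF (p ^ k) \<subseteq> (FF (p ^ (k * m)) :: 'k set)" using FF_mono[of "p ^ k" m] by (simp add: power_mult)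
  thus ?thesis
    unfolding lin_def using assms by (intro FF_sum FF_mult FF_power) (auto simp: polyF_def)
qed

lemma card_lin_kernel:
  assumes g: "g \<noteq> 0" and k: "k > 0"
  shows "card {x. lin k g x = 0} \<le> p ^ (k * degree g)" "finite {x. lin k g x = 0}"
proof -
  define G where "G = (\<Sum>i\<le>degree g. monom (coeff g i) (p ^ (k * i)))"
  have eq: "{x. lin k g x = 0} = {x. poly G x = 0}"
    by (simp add: lin_def G_def poly_sum poly_monom)
  have inj: "p ^ (k * i) = p ^ (k * j) \<longleftrightarrow> i = j" for i j
    using p1 k by (simp add: power_inject_exp)
  have "coeff G (p ^ (k * degree g)) = (\<Sum>i\<le>degree g. if i = degree g then coeff g i else 0)"
    unfolding G_def coeff_sum by (intro sum.cong refl) (auto simp: coeff_monom inj)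
  also have "\<dots> = lead_coeff g" by simp
  finally have "coeff G (p ^ (k * degree g)) \<noteq> 0" using g by simp
  hence G0: "G \<noteq> 0" by auto
  have "degree G \<le> p ^ (k * degree g)"
    unfolding G_def using p1 by (intro degree_sum_le) (auto intro!: order.trans[OF degree_monom_le] power_increasing)
  thus "card {x. lin k g x = 0} \<le> p ^ (k * degree g)" "finite {x. lin k g x = 0}"
    unfolding eq using card_poly_roots_bound[OF G0] poly_roots_finite[OF G0] by auto
qed

section \<open>Frobenius orbits of roots of unity and cofactors of x ^ m - 1\<close>

definition orb :: "nat \<Rightarrow> 'k \<Rightarrow> 'k set" where
  "orb k x = range (\<lambda>i. x ^ (p ^ (k * i)))"

definition orbits :: "nat \<Rightarrow> nat \<Rightarrow> 'k set set" where
  "orbits k m = orb k ` {x. x ^ m = 1}"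

definition orbpoly :: "'k set \<Rightarrow> 'k poly" where
  "orbpoly A = (\<Prod>x\<in>A. [:-x, 1:])"

definition xm1 :: "nat \<Rightarrow> 'k poly" where
  "xm1 m = monom 1 m - 1"

lemma poly_xm1: "poly (xm1 m) x = 0 \<longleftrightarrow> x ^ m = 1"
  by (simp add: xm1_def poly_monom)

lemma xm1: assumes "m > 0" shows "xm1 m \<noteq> 0" "degree (xm1 m) = m" "polyF (p ^ k) (xm1 m)"
proof -
  have c: "coeff (xm1 m) m = 1" using assms by (simp add: xm1_def coeff_1)
  show "xm1 m \<noteq> 0" using c by (metis coeff_0 zero_neq_one)
  show "degree (xm1 m) = m"
  proof (rule antisym)
    show "degree (xm1 m) \<le> m" unfolding xm1_def by (intro degree_diff_le) (auto simp: degree_monom_eq)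
    show "m \<le> degree (xm1 m)" using c by (intro le_degree) auto
  qed
  show "polyF (p ^ k) (xm1 m)" unfolding xm1_def using p1 by (intro polyF_diff polyF_monom polyF_1) simp
qed

lemma lin_xm1:
  assumes "m > 0" "x \<in> FF (p ^ (k * m))"
  shows "lin k (xm1 m) x = 0"
proof -
  have "lin k (monom 1 m) x = x ^ (p ^ (k * m))"
    using lin_monom_mult[OF polyF_1, of k 1 m x] by simp
  moreover have "lin k (xm1 m) x + lin k 1 x = lin k (monom 1 m) x"
    unfolding lin_add[symmetric] by (simp add: xm1_def)
  ultimately show ?thesis using assms by (simp add: FF_def)
qed

lemma finite_roots_unity: "m > 0 \<Longrightarrow> finite {x :: 'k. x ^ m = 1}"
  using poly_roots_finite[OF xm1(1)[of m]] by (simp add: poly_xm1)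

lemma orb_roots: "x ^ m = 1 \<Longrightarrow> orb k x \<subseteq> {x. x ^ m = 1}"
  by (auto simp: orb_def simp flip: power_mult) (metis mult.commute power_mult power_one)

lemma orb_self: "x \<in> orb k x"
  unfolding orb_def by (rule range_eqI[of _ _ 0]) simp

lemma orb_frob: "(\<lambda>y. y ^ (p ^ k)) ` orb k x \<subseteq> orb k x"
proof (rule image_subsetI)
  fix y assume "y \<in> orb k x"
  then obtain i where "y = x ^ (p ^ (k * i))" unfolding orb_def by blast
  hence "y ^ (p ^ k) = x ^ (p ^ (k * Suc i))" by (simp add: pow_pow_frob add.commute)
  thus "y ^ (p ^ k) \<in> orb k x" unfolding orb_def by blast
qed

lemma orb_frob_eq:
  assumes "finite (orb k x)"
  shows "bij_betw (\<lambda>y. y ^ (p ^ k)) (orb k x) (orb k x)"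
proof -
  have "inj_on (\<lambda>y. y ^ (p ^ k)) (orb k x)" by (intro inj_onI) (rule frob_inj)
  thus ?thesis using assms orb_frob by (simp add: bij_betw_def endo_inj_surj)
qed

text \<open>Orbits are defined by forward iteration; on a finite orbit Frobenius is a permutation,
  so x is reached again from y.\<close>

lemma orb_eq:
  assumes fin: "finite (orb k x)" and y: "y \<in> orb k x"
  shows "orb k y = orb k x"
proof
  have shift: "x ^ (p ^ (k * (i + j))) = (x ^ (p ^ (k * i))) ^ (p ^ (k * j))" for x :: 'k and i j
    by (simp add: distrib_left power_add power_mult)
  obtain i where i: "y = x ^ (p ^ (k * i))" using y by (auto simp: orb_def)
  show "orb k y \<subseteq> orb k x" unfolding i orb_def by (auto simp flip: shift)
  have "(\<lambda>z. z ^ (p ^ (k * n))) ` orb k x = orb k x" for n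
  proof (induction n)
    case (Suc n)
    have "(\<lambda>z. z ^ (p ^ (k * Suc n))) ` orb k x = (\<lambda>z. z ^ (p ^ k)) ` ((\<lambda>z. z ^ (p ^ (k * n))) ` orb k x)"
      by (simp add: image_image pow_pow_frob)
    thus ?case unfolding Suc using orb_frob_eq[OF fin] by (simp add: bij_betw_def)
  qed simp
  hence "x \<in> (\<lambda>z. z ^ (p ^ (k * i))) ` orb k x" using orb_self by blast
  then obtain z where z: "z \<in> orb k x" "x = z ^ (p ^ (k * i))" by blast
  then obtain j where "z = x ^ (p ^ (k * j))" unfolding orb_def by blast
  with z(2) have "x = (x ^ (p ^ (k * j))) ^ (p ^ (k * i))" by simp
  hence "x = y ^ (p ^ (k * j))" unfolding i by (simp only: shift[symmetric] add.commute)
  thus "orb k x \<subseteq> orb k y" unfolding orb_def using shift[of y] by (auto simp: orb_def) (metis rangeI)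
qed

lemma orbits_finite:
  assumes "m > 0" shows "finite (orbits k m)" "\<And>A. A \<in> orbits k m \<Longrightarrow> finite A \<and> A \<noteq> {} \<and> A \<subseteq> {x. x ^ m = 1}"
proof -
  show "finite (orbits k m)" unfolding orbits_def using finite_roots_unity[OF assms] by simp
  fix A assume "A \<in> orbits k m"
  then obtain x where x: "x ^ m = 1" "A = orb k x" by (auto simp: orbits_def)
  thus "finite A \<and> A \<noteq> {} \<and> A \<subseteq> {x. x ^ m = 1}"
    using finite_subset[OF orb_roots finite_roots_unity[OF assms]] orb_roots orb_self by blast
qed

lemma orbits_disjoint:
  assumes m: "m > 0" and A: "A \<in> orbits k m" "B \<in> orbits k m" "A \<noteq> B"
  shows "A \<inter> B = {}"
proof (rule ccontr)
  assume "A \<inter> B \<noteq> {}"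
  then obtain z where z: "z \<in> A" "z \<in> B" by blast
  obtain x y where xy: "A = orb k x" "B = orb k y" using A by (auto simp: orbits_def)
  have "orb k z = A" "orb k z = B" using orb_eq z orbits_finite(2)[OF m] A unfolding xy by metis+
  thus False using A by simp
qed

lemma orbpoly_props:
  assumes m: "m > 0" and A: "A \<in> orbits k m"
  shows "polyF (p ^ k) (orbpoly A)" "degree (orbpoly A) = card A" "orbpoly A \<noteq> 0" "lead_coeff (orbpoly A) = 1"
    "poly (orbpoly A) x = 0 \<longleftrightarrow> x \<in> A"
proof -
  have fA: "finite A" using orbits_finite(2)[OF m A] by blast
  obtain y where y: "A = orb k y" using A by (auto simp: orbits_def)
  have "frobp k (orbpoly A) = (\<Prod>x\<in>A. [:-(x ^ (p ^ k)), 1:])"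
    unfolding orbpoly_def frobp_prod frobp_linear by (simp add: frob_minus)
  also have "\<dots> = orbpoly A"
    unfolding orbpoly_def using prod.reindex_bij_betw[OF orb_frob_eq[of k y], of "\<lambda>x. [:-x, 1:]"] fA y by simp
  finally show "polyF (p ^ k) (orbpoly A)" by (simp add: polyF_iff_frobp)
  show lc: "lead_coeff (orbpoly A) = 1" unfolding orbpoly_def lead_coeff_prod by simp
  thus "orbpoly A \<noteq> 0" by auto
  show "degree (orbpoly A) = card A" unfolding orbpoly_def by (subst degree_prod_eq_sum_degree) auto
  show "poly (orbpoly A) x = 0 \<longleftrightarrow> x \<in> A" unfolding orbpoly_def poly_prod using fA by auto
qed

lemma orbpoly_dvd:
  assumes m: "m > 0" and A: "A \<in> orbits k m" and g: "polyF (p ^ k) g" "g \<noteq> 0" and z: "z \<in> A" "poly g z = 0"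
  shows "orbpoly A dvd g"
proof (rule dvd_alg_closed_order)
  have fA: "finite A" using orbits_finite(2)[OF m A] by blast
  show "orbpoly A \<noteq> 0" "g \<noteq> 0" using orbpoly_props[OF m A] g by auto
  obtain y where y: "A = orb k y" using A by (auto simp: orbits_def)
  have Az: "A = orb k z" using orb_eq[of k y z] fA z y by simp
  have root: "poly g x = 0" if "x \<in> A" for x
  proof -
    obtain i where i: "x = z ^ (p ^ (k * i))" using \<open>x \<in> A\<close> unfolding Az by (auto simp: orb_def)
    have "order z g \<le> order x g" unfolding i by (rule order_frob_le[OF g])
    moreover have "order z g > 0" using z g order_gt_0_iff by blast
    ultimately have "order x g \<noteq> 0" by linarith
    thus ?thesis by (simp add: order_root)
  qed
  fix x
  have "order x (orbpoly A) = count (proots (orbpoly A)) x" using orbpoly_props[OF m A] by simp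
  also have "proots (orbpoly A) = (\<Sum>x\<in>A. {#x#})" unfolding orbpoly_def by (subst proots_prod) auto
  also have "count (\<Sum>x\<in>A. {#x#}) x = (\<Sum>y\<in>A. if y = x then 1 else 0)" unfolding count_sum by (intro sum.cong) auto
  also have "\<dots> = (if x \<in> A then 1 else 0)" using fA by simp
  also have "\<dots> \<le> order x g"
  proof (cases "x \<in> A")
    case True
    hence "order x g > 0" using root g order_gt_0_iff by blast
    thus ?thesis using True by simp
  qed simp
  finally show "order x (orbpoly A) \<le> order x g" .
qed

text \<open>Only one factor \<open>orbpoly A\<close> is removed even if p divides m and it occurs
  repeatedly. So the cofactors are the maximal proper divisors of x ^ m - 1 over
  \<open>FF (p ^ k)\<close> in this case too.\<close>

definition cofac :: "nat \<Rightarrow> 'k set \<Rightarrow> 'k poly" where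
  "cofac m A = xm1 m div orbpoly A"

lemma cofac:
  assumes m: "m > 0" and A: "A \<in> orbits k m"
  shows "xm1 m = orbpoly A * cofac m A" "polyF (p ^ k) (cofac m A)" "cofac m A \<noteq> 0" "degree (cofac m A) = m - card A"
    "card A \<le> m"
proof -
  obtain z where z: "z \<in> A" "z ^ m = 1" using orbits_finite(2)[OF m A] by blast
  have "orbpoly A dvd xm1 m"
    by (rule orbpoly_dvd[OF m A xm1(3)[OF m] xm1(1)[OF m] z(1)]) (simp add: poly_xm1 z)
  thus eq: "xm1 m = orbpoly A * cofac m A" by (simp add: cofac_def)
  thus nz: "cofac m A \<noteq> 0" using xm1(1)[OF m] by auto
  show "polyF (p ^ k) (cofac m A)"
    using polyF_quotient[of k "orbpoly A" "cofac m A"] eq xm1(3)[OF m, of k] orbpoly_props[OF m A] by simp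
  have "m = card A + degree (cofac m A)"
    using arg_cong[OF eq, of degree] orbpoly_props[OF m A] nz by (simp add: degree_mult_eq xm1(2)[OF m])
  thus "degree (cofac m A) = m - card A" "card A \<le> m" by simp_all
qed

definition UA :: "nat \<Rightarrow> nat \<Rightarrow> 'k set \<Rightarrow> 'k set" where
  "UA k m A = {x \<in> FF (p ^ (k * m)). lin k (cofac m A) x = 0}"

lemma card_UA:
  assumes m: "m > 0" and k: "k > 0" and A: "A \<in> orbits k m"
  shows "card (UA k m A) \<le> p ^ (k * (m - card A))"
proof -
  have "card (UA k m A) \<le> card {x. lin k (cofac m A) x = 0}"
    using card_lin_kernel(2)[OF cofac(3)[OF m A] k] by (intro card_mono) (auto simp: UA_def)
  also have "\<dots> \<le> p ^ (k * degree (cofac m A))"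
    by (rule card_lin_kernel(1)[OF cofac(3)[OF m A] k])
  finally show ?thesis by (simp add: cofac(4)[OF m A])
qed

text \<open>An element is normal if the annihilator of \<open>x\<close> in the group ring contains no proper divisor of
  $X^m - 1$; every such divisor divides one of the cofactors.\<close>

lemma normal_criterion:
  assumes m: "m > 0" and x: "x \<in> FF (p ^ (k * m))" and nU: "\<And>A. A \<in> orbits k m \<Longrightarrow> x \<notin> UA k m A"
    and g: "polyF (p ^ k) g" "g \<noteq> 0" "degree g < m"
  shows "lin k g x \<noteq> 0"
proof
  assume lg: "lin k g x = 0"
  define P where "P = (\<lambda>h. polyF (p ^ k) h \<and> h \<noteq> 0 \<and> lin k h x = 0)"
  have "P g" using g lg by (simp add: P_def)
  \<comment> \<open>The polynomials over the subfield that annihilate x form an ideal, so one of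
    least degree divides x ^ m - 1. Its degree being below m, it lacks some orbit factor and divides
    the corresponding cofactor.\<close>
  then obtain h where h: "P h" and min: "\<And>h'. P h' \<Longrightarrow> degree h \<le> degree h'"
    using ex_has_least_nat[of P g degree] by blast
  have hm: "degree h < m" using min[OF \<open>P g\<close>] g by simp
  have "h dvd xm1 m"
  proof -
    define r where "r = xm1 m mod h"
    have F: "polyF (p ^ k) (xm1 m div h)" "polyF (p ^ k) r"
      using polyF_div_mod[OF xm1(3)[OF m], of k h] h by (auto simp: P_def r_def)
    have "xm1 m = (xm1 m div h) * h + r" by (simp add: r_def)
    hence "lin k (xm1 m) x = lin k ((xm1 m div h) * h) x + lin k r x" by (simp only: lin_add[symmetric])
    moreover have "lin k ((xm1 m div h) * h) x = 0" using h by (simp add: lin_mult P_def)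
    ultimately have "lin k r x = 0" using lin_xm1[OF m x] by simp
    have "r = 0"
    proof (rule ccontr)
      assume "r \<noteq> 0"
      hence "P r" using F \<open>lin k r x = 0\<close> by (simp add: P_def)
      moreover have "degree r < degree h" using \<open>r \<noteq> 0\<close> h degree_mod_less'[of h "xm1 m"] by (simp add: P_def r_def)
      ultimately show False using min by fastforce
    qed
    thus ?thesis by (simp add: r_def dvd_eq_mod_eq_0)
  qed
  then obtain s where s: "xm1 m = h * s" by (elim dvdE)
  have s0: "s \<noteq> 0" using s xm1(1)[OF m] by auto
  have sF: "polyF (p ^ k) s" using polyF_quotient[of k h s] s xm1(3)[OF m, of k] h by (simp add: P_def)
  have "m = degree h + degree s" using arg_cong[OF s, of degree] h s0 by (simp add: degree_mult_eq xm1(2)[OF m] P_def)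
  hence "degree s > 0" using hm by simp
  then obtain z where z: "poly s z = 0" using alg_closed_imp_poly_has_root by blast
  have zm: "z ^ m = 1" using arg_cong[OF s, of "\<lambda>g. poly g z"] z poly_xm1[of m z] by simp
  define A where "A = orb k z"
  have A: "A \<in> orbits k m" using zm by (auto simp: A_def orbits_def)
  have "orbpoly A dvd s" by (rule orbpoly_dvd[OF m A sF s0 _ z]) (simp add: A_def orb_self)
  then obtain t where t: "s = orbpoly A * t" by (elim dvdE)
  have "orbpoly A * cofac m A = orbpoly A * (t * h)"
    using cofac(1)[OF m A, symmetric] unfolding s t by (simp only: mult_ac)
  hence "cofac m A = t * h" using orbpoly_props(3)[OF m A] mult_left_cancel by blast
  hence "lin k (cofac m A) x = 0" using h by (simp add: lin_mult P_def)
  thus False using nU[OF A] x by (simp add: UA_def)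
qed

text \<open>The argument by least degree runs inside the polynomials over \<open>FF (p ^ k)\<close>,
  because the two products will be handed to \<open>lin_mult\<close>.\<close>

lemma coprime_bezout_polyF:
  fixes A B :: "'k poly"
  assumes F: "polyF (p ^ k) A" "polyF (p ^ k) B" and A0: "A \<noteq> 0" and B0: "B \<noteq> 0"
    and cop: "\<And>x. poly A x = 0 \<Longrightarrow> poly B x \<noteq> 0"
  obtains C D where "polyF (p ^ k) C" "polyF (p ^ k) D" "C * A + D * B = 1"
proof -
  define I where "I = (\<lambda>g. g \<noteq> 0 \<and> (\<exists>C D. polyF (p ^ k) C \<and> polyF (p ^ k) D \<and> g = C * A + D * B))"
  have pF0: "polyF (p ^ k) (0 :: 'k poly)" using p1 by (simp add: polyF_def)
  have IA: "I A" unfolding I_def using A0 polyF_1 pF0 by (intro conjI exI[of _ 1] exI[of _ 0]) auto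
  have IB: "I B" unfolding I_def using B0 polyF_1 pF0 by (intro conjI exI[of _ 0] exI[of _ 1]) auto
  obtain g where g: "I g" and min: "\<And>h. I h \<Longrightarrow> degree g \<le> degree h"
    using ex_has_least_nat[of I A degree] IA by blast
  obtain C D where CD: "polyF (p ^ k) C" "polyF (p ^ k) D" "g = C * A + D * B" using g by (auto simp: I_def)
  have gF: "polyF (p ^ k) g" unfolding CD(3) using CD F by (intro polyF_add polyF_mult)
  have dvd: "g dvd h" if h: "I h" for h
  proof -
    obtain C' D' where CD': "polyF (p ^ k) C'" "polyF (p ^ k) D'" "h = C' * A + D' * B" using h by (auto simp: I_def)
    have hF: "polyF (p ^ k) h" unfolding CD'(3) using CD' F by (intro polyF_add polyF_mult)
    define q where "q = h div g"
    have qF: "polyF (p ^ k) q" unfolding q_def using g by (intro polyF_div_mod(1)[OF hF gF]) (simp add: I_def)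
    have "h mod g = h - q * g" by (simp add: q_def minus_div_mult_eq_mod)
    also have "\<dots> = (C' - q * C) * A + (D' - q * D) * B"
      unfolding CD'(3) by (subst CD(3)) (simp add: algebra_simps)
    finally have r: "h mod g = (C' - q * C) * A + (D' - q * D) * B" .
    have "h mod g = 0"
    proof (rule ccontr)
      assume nz: "h mod g \<noteq> 0"
      have "I (h mod g)"
        unfolding I_def using nz r CD CD' qF by (intro conjI exI[of _ "C' - q * C"] exI[of _ "D' - q * D"] polyF_diff polyF_mult)
      moreover have "degree (h mod g) < degree g" using nz g degree_mod_less'[of g h] by (simp add: I_def)
      ultimately show False using min by fastforce
    qed
    thus ?thesis by (simp add: dvd_eq_mod_eq_0)
  qed
  have "degree g = 0"
  proof (rule ccontr)
    assume "degree g \<noteq> 0"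
    then obtain x where "poly g x = 0" using alg_closed_imp_poly_has_root[of g] by auto
    hence "poly A x = 0" "poly B x = 0" using dvd[OF IA] dvd[OF IB] by (auto elim!: dvdE)
    thus False using cop by blast
  qed
  then obtain a where a: "g = [:a:]" by (elim degree_eq_zeroE)
  have a0: "a \<noteq> 0" using g a by (auto simp: I_def)
  have aF: "inverse a \<in> FF (p ^ k)" using gF a by (intro FF_inverse) (metis coeff_pCons_0 polyF_def)
  have "smult (inverse a) C * A + smult (inverse a) D * B = smult (inverse a) g"
    unfolding CD(3) by (simp add: smult_add_right)
  also have "\<dots> = 1" using a a0 by (simp add: one_pCons)
  finally show ?thesis using that[of "smult (inverse a) C" "smult (inverse a) D"] CD aF polyF_smult by blast
qed

text \<open>\<open>C * orbpoly A + D * G = 1\<close> splits x into b and c. The cofactor of A times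
  \<open>orbpoly A\<close> is x ^ m - 1, which kills x; the same happens with each B in J, since
  \<open>orbpoly B\<close> divides \<open>G\<close>.\<close>

lemma UA_complement:
  assumes m: "m > 0" and J: "J \<subseteq> orbits k m" and A: "A \<in> orbits k m" "A \<notin> J" and x: "x \<in> FF (p ^ (k * m))"
  obtains b c where "x = b + c" "b \<in> UA k m A" "\<And>B. B \<in> J \<Longrightarrow> c \<in> UA k m B"
proof -
  have fJ: "finite J" using J orbits_finite(1)[OF m] by (rule finite_subset)
  define G where "G = (\<Prod>B\<in>J. orbpoly B)"
  have GF: "polyF (p ^ k) G"
  proof -
    have "frobp k G = G"
      unfolding G_def frobp_prod using J orbpoly_props(1)[OF m] by (intro prod.cong) (auto simp: polyF_iff_frobp)
    thus ?thesis by (simp add: polyF_iff_frobp)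
  qed
  have G0: "G \<noteq> 0" unfolding G_def using fJ J orbpoly_props(3)[OF m] by auto
  have cop: "poly G y \<noteq> 0" if "poly (orbpoly A) y = 0" for y
  proof -
    have "y \<in> A" using that orbpoly_props(5)[OF m A(1)] by simp
    hence "y \<notin> B" if "B \<in> J" for B using orbits_disjoint[OF m A(1), of B] that J A(2) by blast
    thus ?thesis unfolding G_def poly_prod using fJ J orbpoly_props(5)[OF m] by auto
  qed
  obtain C D where CD: "polyF (p ^ k) C" "polyF (p ^ k) D" "C * orbpoly A + D * G = 1"
    using coprime_bezout_polyF[OF orbpoly_props(1)[OF m A(1)] GF orbpoly_props(3)[OF m A(1)] G0 cop] by blast
  define b where "b = lin k (C * orbpoly A) x"
  define c where "c = lin k (D * G) x"
  have "x = b + c" unfolding b_def c_def lin_add[symmetric] CD(3) by simp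
  moreover have "b \<in> UA k m A"
  proof -
    have F: "polyF (p ^ k) (C * orbpoly A)" using CD orbpoly_props(1)[OF m A(1)] by (intro polyF_mult)
    have "lin k (cofac m A) b = lin k (cofac m A * (C * orbpoly A)) x" unfolding b_def by (rule lin_mult[OF F, symmetric])
    also have "cofac m A * (C * orbpoly A) = C * xm1 m" unfolding cofac(1)[OF m A(1)] by (simp add: mult_ac)
    also have "lin k (C * xm1 m) x = 0" using lin_mult[OF xm1(3)[OF m]] lin_xm1[OF m x] by simp
    finally show ?thesis unfolding UA_def using lin_FF[OF F x] by (simp add: b_def)
  qed
  moreover have "c \<in> UA k m B" if B: "B \<in> J" for B
  proof -
    have BO: "B \<in> orbits k m" using B J by blast
    have F: "polyF (p ^ k) (D * G)" using CD GF by (intro polyF_mult)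
    have "G = orbpoly B * (\<Prod>B'\<in>J - {B}. orbpoly B')" unfolding G_def using fJ B by (rule prod.remove)
    hence e: "cofac m B * (D * G) = (D * (\<Prod>B'\<in>J - {B}. orbpoly B')) * xm1 m"
      unfolding cofac(1)[OF m BO] by (simp add: mult_ac)
    have "lin k (cofac m B) c = lin k (cofac m B * (D * G)) x" unfolding c_def by (rule lin_mult[OF F, symmetric])
    also have "\<dots> = 0" unfolding e using lin_mult[OF xm1(3)[OF m]] lin_xm1[OF m x] by simp
    finally show ?thesis unfolding UA_def using lin_FF[OF F x] by (simp add: c_def)
  qed
  ultimately show ?thesis using that by blast
qed

end

section \<open>Independence of the annihilators\<close>

context pchar_psi
begin

lemma UA_addsub:
  assumes "m > 0" "A \<in> orbits k m" shows "addsub (k * m) (UA k m A)"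
  using p1 by (auto simp: addsub_def UA_def lin_diff_arg FF_diff)

text \<open>Dual to \<open>UA_complement\<close>: \<open>u A\<close>, being minus the sum of the
  others, is trivial both on \<open>UA k m A\<close> and on the intersection of the other kernels,
  and these two span the field. So characters of several orbits multiply to the trivial one only if
  all are trivial.\<close>

lemma ann_UA_independent:
  assumes m: "m > 0" and k: "k > 0" and J: "J \<subseteq> orbits k m" and u: "\<And>A. A \<in> J \<Longrightarrow> u A \<in> ann (k * m) (UA k m A)"
    and sum: "(\<Sum>A\<in>J. u A) = 0" and A: "A \<in> J"
  shows "u A = 0"
proof (rule ccontr)
  assume nz: "u A \<noteq> 0"
  have fJ: "finite J" using J orbits_finite(1)[OF m] by (rule finite_subset)
  have uF: "u B \<in> FF (p ^ (k * m))" if "B \<in> J" for B using u[OF that] by (simp add: ann_def)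
  have km: "k * m > 0" using m k by simp
  obtain x where x: "x \<in> FF (p ^ (k * m))" "ps (k * m) (u A * x) \<noteq> 1" using ps_nontrivial[OF km uF[OF A] nz] by blast
  have "J - {A} \<subseteq> orbits k m" "A \<in> orbits k m" "A \<notin> J - {A}" using J A by auto
  then obtain b c where bc: "x = b + c" "b \<in> UA k m A" "\<And>B. B \<in> J - {A} \<Longrightarrow> c \<in> UA k m B"
    using UA_complement[OF m _ _ _ x(1), of "J - {A}" A] by blast
  have bF: "b \<in> FF (p ^ (k * m))" using bc(2) by (simp add: UA_def)
  have cF: "c \<in> FF (p ^ (k * m))" using x(1) bF bc(1) FF_diff[of x "k * m" b] by simp
  have "ps (k * m) (u A * x) = ps (k * m) (u A * b) * ps (k * m) (u A * c)"
    unfolding bc(1) distrib_left using uF[OF A] bF cF by (intro ps_add FF_mult)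
  also have "ps (k * m) (u A * b) = 1" using u[OF A] bc(2) by (simp add: ann_def)
  also have "ps (k * m) (u A * c) = 1"
  proof -
    have one: "ps (k * m) (\<Sum>B\<in>S. u B * c) = 1" if "S \<subseteq> J - {A}" for S
    proof -
      have "finite S" using that fJ by (meson finite_Diff finite_subset)
      thus ?thesis using that
      proof (induction S rule: finite_induct)
        case (insert B S)
        have "ps (k * m) (u B * c + (\<Sum>B\<in>S. u B * c)) = ps (k * m) (u B * c) * ps (k * m) (\<Sum>B\<in>S. u B * c)"
          using insert.prems uF cF by (intro ps_add FF_mult FF_sum) auto
        moreover have "ps (k * m) (u B * c) = 1" using u[of B] bc(3)[of B] insert.prems by (simp add: ann_def)
        ultimately show ?case using insert by simp
      qed simp
    qed
    have "u A = - (\<Sum>B\<in>J - {A}. u B)" using sum fJ A by (simp add: sum.remove add_eq_0_iff2)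
    hence e: "u A * c = - (\<Sum>B\<in>J - {A}. u B * c)" by (simp add: sum_distrib_right)
    have "(\<Sum>B\<in>J - {A}. u B * c) \<in> FF (p ^ (k * m))" using uF cF by (intro FF_sum FF_mult) auto
    from ps_uminus[OF this] show ?thesis unfolding e one[OF order.refl] by simp
  qed
  finally show False using x(2) by simp
qed

end

section \<open>Existence of primitive pairs in a finite subfield of an algebraically closed field\<close>

text \<open>The events to be avoided: x is an l-th power, f(x) is an l-th power, x is annihilated by
  the cofactor of an orbit.\<close>

datatype 'k event = EA nat | EB nat | EC "'k set"

text \<open>The function is \<open>cc * x ^ ii * Hf x ^ ss\<close> with natural exponents; poles are
  covered by the exponent Q - 2, which inverts nonzero elements. Since no prime divisor of Q - 1
  divides \<open>ss\<close>, a nontrivial character of the value stays nontrivial on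
  \<open>Hf x\<close>.\<close>

locale pair_sieve = pchar_psi p K \<psi> z0 for p and K :: "'k::alg_closed_field itself" and \<psi> :: "'k \<Rightarrow> complex" and z0 +
  fixes k m :: nat and R :: "'k set" and ex :: "'k \<Rightarrow> nat" and \<rho>0 cc :: 'k and ii ss :: nat and a :: 'k
    and \<eta> :: "nat \<Rightarrow> 'k \<Rightarrow> complex"
  assumes k0: "k > 0" and m0: "m > 0"
    and finR: "finite R" "card R \<le> 2" and R0: "0 \<notin> R"
    and R_frob: "\<And>\<rho>. \<rho> \<in> R \<Longrightarrow> \<rho> ^ (p ^ (k * m)) \<in> R" and ex_frob: "\<And>\<rho>. \<rho> \<in> R \<Longrightarrow> ex (\<rho> ^ (p ^ (k * m))) = ex \<rho>"
    and ex_pos: "\<And>\<rho>. \<rho> \<in> R \<Longrightarrow> ex \<rho> > 0" and \<rho>0: "\<rho>0 \<in> R" "ex \<rho>0 = 1"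
    and cc: "cc \<in> FF (p ^ (k * m))" "cc \<noteq> 0"
    and ss: "\<And>l. prime l \<Longrightarrow> l dvd p ^ (k * m) - 1 \<Longrightarrow> \<not> l dvd ss"
    and a: "a \<in> FF (p ^ k)"
    and eta_mult: "\<And>l y y'. prime l \<Longrightarrow> l \<noteq> p \<Longrightarrow> y ^ l = 1 \<Longrightarrow> y' ^ l = 1 \<Longrightarrow> \<eta> l (y * y') = \<eta> l y * \<eta> l y'"
    and eta_sum: "\<And>l y. prime l \<Longrightarrow> l \<noteq> p \<Longrightarrow> y ^ l = 1 \<Longrightarrow> (\<Sum>i<l. \<eta> l y ^ i) = of_nat l * of_bool (y = 1)"
    and eta_nontriv: "\<And>l i. prime l \<Longrightarrow> l \<noteq> p \<Longrightarrow> \<not> l dvd i \<Longrightarrow> \<exists>y. y ^ l = 1 \<and> \<eta> l y ^ i \<noteq> 1"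
    and eta_pow: "\<And>l y. prime l \<Longrightarrow> l \<noteq> p \<Longrightarrow> y ^ l = 1 \<Longrightarrow> \<eta> l y ^ l = 1"
    and eta_1: "\<And>l. prime l \<Longrightarrow> l \<noteq> p \<Longrightarrow> \<eta> l 1 = 1"
begin

abbreviation "Q \<equiv> p ^ (k * m)"

definition "LL = {l. prime l \<and> l dvd Q - 1}"

lemma km0: "k * m > 0" using k0 m0 by simp

lemma Q1: "Q > 1" using km0 p1 by (metis one_less_power)

lemma LL: assumes "l \<in> LL" shows "prime l" "l \<noteq> p" "l dvd Q - 1" "l > 1"
  using assms p_coprime_minus_1[OF km0] by (auto simp: LL_def prime_gt_Suc_0_nat)

lemma finite_LL: "finite LL"
  using Q1 by (auto simp: LL_def intro!: finite_subset[OF _ finite_divisors_nat[of "Q - 1"]])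

definition "chi l x = \<eta> l (x ^ ((Q - 1) div l))"

lemma pow_chi: assumes "l \<in> LL" "x \<in> FF Q - {0}" shows "(x ^ ((Q - 1) div l)) ^ l = 1"
proof -
  have "(x ^ ((Q - 1) div l)) ^ l = x ^ (Q - 1)" using LL(3)[OF assms(1)] by (simp flip: power_mult)
  also have "\<dots> = 1" using assms p1 by (intro FF_power_minus_1) auto
  finally show ?thesis .
qed

lemma chi_mult: "l \<in> LL \<Longrightarrow> x \<in> FF Q - {0} \<Longrightarrow> y \<in> FF Q - {0} \<Longrightarrow> chi l (x * y) = chi l x * chi l y"
  unfolding chi_def power_mult_distrib by (intro eta_mult LL pow_chi)

lemma chi_1: "l \<in> LL \<Longrightarrow> chi l 1 = 1"
  unfolding chi_def using eta_1 LL by simp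

lemma mult_char_chi: "l \<in> LL \<Longrightarrow> mult_char Q (chi l)"
  by (simp add: mult_char_def chi_mult chi_1)

lemma chi_pow: "l \<in> LL \<Longrightarrow> x \<in> FF Q - {0} \<Longrightarrow> chi l x ^ l = 1"
  unfolding chi_def by (intro eta_pow LL pow_chi)

lemma chi_nontriv:
  assumes l: "l \<in> LL" and i: "\<not> l dvd i"
  shows "\<exists>x\<in>FF Q - {0}. chi l x ^ i \<noteq> 1"
proof -
  obtain y where y: "y ^ l = 1" "\<eta> l y ^ i \<noteq> 1" using eta_nontriv[OF LL(1,2)[OF l] i] by blast
  have "(Q - 1) div l > 0" 
    using dvd_imp_le[OF LL(3)[OF l]] LL(4)[OF l] Q1 by (simp add: div_greater_zero_iff)
  then obtain x where x: "x ^ ((Q - 1) div l) = y" using nth_root_exists by blast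
  have "x ^ (Q - 1) = 1" using LL(3)[OF l] y x by (metis dvd_div_mult_self power_mult)
  hence "x ^ Q = x" using Q1 by (cases Q) auto
  moreover have "x \<noteq> 0" using \<open>x ^ (Q - 1) = 1\<close> Q1 by (auto simp: power_0_left)
  ultimately show ?thesis using y x by (auto simp: FF_def chi_def)
qed

definition "chP P e x = (\<Prod>l\<in>P. chi l x ^ e l)"

lemma mult_char_chP: "P \<subseteq> LL \<Longrightarrow> mult_char Q (chP P e)"
  unfolding mult_char_def chP_def
  by (auto simp: subset_iff chi_mult chi_1 power_mult_distrib prod.distrib[symmetric] intro!: prod.cong)

text \<open>Tested on N-th powers with N the product of the other primes in \<open>P\<close>: there
  every other \<open>chi l'\<close> is trivial, while N is prime to l.\<close>

lemma chP_trivial: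
  assumes P: "P \<subseteq> LL" and triv: "\<And>x. x \<in> FF Q - {0} \<Longrightarrow> chP P e x = 1" and l: "l \<in> P"
  shows "l dvd e l"
proof (rule ccontr)
  assume nd: "\<not> l dvd e l"
  have fP: "finite P" using P finite_LL by (rule finite_subset)
  define N where "N = \<Prod>(P - {l})"
  have pr: "prime l" using LL(1) l P by blast
  have "\<not> l dvd N"
  proof
    assume "l dvd N"
    then obtain l' where "l' \<in> P - {l}" "l dvd l'"
      unfolding N_def using pr fP by (metis finite_Diff prime_dvd_prod_iff)
    thus False using LL(1) P pr primes_dvd_imp_eq by blast
  qed
  hence nd': "\<not> l dvd N * e l" using nd pr by (simp add: prime_dvd_mult_iff)
  then obtain x where x: "x \<in> FF Q - {0}" "chi l x ^ (N * e l) \<noteq> 1" using chi_nontriv l P by blast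
  have xN: "x ^ N \<in> FF Q - {0}" using x by (auto intro: FF_power)
  have chN: "chi l' (x ^ N) = chi l' x ^ N" if "l' \<in> P" for l'
    using mult_char_power[OF mult_char_chi x(1)] that P by blast
  have "1 = chP P e (x ^ N)" using triv[OF xN] by simp
  also have "\<dots> = chi l (x ^ N) ^ e l * (\<Prod>l'\<in>P - {l}. chi l' (x ^ N) ^ e l')"
    unfolding chP_def using fP l by (rule prod.remove)
  also have "(\<Prod>l'\<in>P - {l}. chi l' (x ^ N) ^ e l') = 1"
  proof (intro prod.neutral ballI)
    fix l' assume l': "l' \<in> P - {l}"
    have "l' dvd N" unfolding N_def using l' fP by (intro dvd_prodI[of _ _ "\<lambda>x. x", simplified]) auto
    then obtain j where j: "N = l' * j" by (elim dvdE)
    have "chi l' x ^ N = 1" unfolding j power_mult using chi_pow[of l' x] l' P x(1) by auto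
    thus "chi l' (x ^ N) ^ e l' = 1" using chN l' by simp
  qed
  finally have "chi l x ^ (N * e l) = 1" using chN[OF l] by (simp add: power_mult)
  thus False using x(2) by simp
qed

definition "Hf x = (\<Prod>\<rho>\<in>R. (\<rho> - x) ^ ex \<rho>)"

definition "fv x = cc * x ^ ii * Hf x ^ ss"

definition "XX = {x \<in> FF Q. x \<noteq> 0 \<and> x \<notin> R}"

lemma Hf_FF: "x \<in> XX \<Longrightarrow> Hf x \<in> FF Q - {0}"
proof -
  assume x: "x \<in> XX"
  have inj: "inj_on (\<lambda>\<rho>. \<rho> ^ Q) R" by (intro inj_onI) (rule frob_inj)
  have "(\<lambda>\<rho>. \<rho> ^ Q) ` R \<subseteq> R" using R_frob by auto
  hence bij: "bij_betw (\<lambda>\<rho>. \<rho> ^ Q) R R" using inj finR by (simp add: bij_betw_def endo_inj_surj)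
  have "Hf x ^ Q = (\<Prod>\<rho>\<in>R. (\<rho> ^ Q - x) ^ ex (\<rho> ^ Q))"
    unfolding Hf_def prod_power_distrib
  proof (intro prod.cong refl)
    fix \<rho> assume r: "\<rho> \<in> R"
    have "((\<rho> - x) ^ ex \<rho>) ^ Q = ((\<rho> - x) ^ Q) ^ ex \<rho>" by (simp add: mult.commute flip: power_mult)
    thus "((\<rho> - x) ^ ex \<rho>) ^ Q = (\<rho> ^ Q - x) ^ ex (\<rho> ^ Q)"
      using x r by (simp add: frob_diff ex_frob XX_def FF_def)
  qed
  also have "\<dots> = Hf x" unfolding Hf_def using prod.reindex_bij_betw[OF bij, of "\<lambda>\<rho>. (\<rho> - x) ^ ex \<rho>"] .
  finally have "Hf x \<in> FF Q" by (simp add: FF_def)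
  moreover have "Hf x \<noteq> 0" unfolding Hf_def using x finR by (auto simp: XX_def)
  ultimately show ?thesis by simp
qed

lemma fv_FF: "x \<in> XX \<Longrightarrow> fv x \<in> FF Q - {0}"
  using Hf_FF[of x] cc by (auto simp: fv_def XX_def intro!: FF_mult FF_power)

lemma chP_fv:
  assumes P: "P \<subseteq> LL" and x: "x \<in> XX"
  shows "chP P e (fv x) = chP P e cc * chP P e x ^ ii * chP P (\<lambda>l. e l * ss) (Hf x)"
proof -
  have c: "cc \<in> FF Q - {0}" "x \<in> FF Q - {0}" "Hf x \<in> FF Q - {0}" using cc x Hf_FF[OF x] by (auto simp: XX_def)
  have c': "x ^ ii \<in> FF Q - {0}" "Hf x ^ ss \<in> FF Q - {0}" using c by (auto intro: FF_power)
  hence c'': "cc * x ^ ii \<in> FF Q - {0}" using c by (auto intro: FF_mult)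
  note mc = mult_char_chP[OF P, of e]
  have mm: "chP P e (y * y') = chP P e y * chP P e y'" if "y \<in> FF Q - {0}" "y' \<in> FF Q - {0}" for y y'
    using mc that by (simp add: mult_char_def)
  have "chP P e (fv x) = chP P e cc * chP P e (x ^ ii) * chP P e (Hf x ^ ss)"
    unfolding fv_def mm[OF c'' c'(2)] mm[OF c(1) c'(1)] ..
  also have "chP P e (Hf x ^ ss) = chP P (\<lambda>l. e l * ss) (Hf x)"
    unfolding mult_char_power[OF mc c(3)] by (simp add: chP_def prod_power_distrib power_mult)
  finally show ?thesis unfolding mult_char_power[OF mc c(2)] .
qed

definition "II = EA ` LL \<union> EB ` LL \<union> EC ` orbits k m"

text \<open>\<open>Inl i\<close> stands for the i-th power of a character of order l,
  \<open>Inr u\<close> for the additive character with multiplier u.\<close>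

fun Gam :: "'k event \<Rightarrow> (nat + 'k) set" where
  "Gam (EA l) = Inl ` {..<l}"
| "Gam (EB l) = Inl ` {..<l}"
| "Gam (EC A) = Inr ` ann (k * m) (UA k m A)"

fun orig :: "'k event \<Rightarrow> nat + 'k" where
  "orig (EA l) = Inl 0"
| "orig (EB l) = Inl 0"
| "orig (EC A) = Inr 0"

fun lam :: "'k event \<Rightarrow> nat + 'k \<Rightarrow> 'k \<Rightarrow> complex" where
  "lam (EA l) c x = chi l x ^ projl c"
| "lam (EB l) c x = chi l (fv x) ^ projl c"
| "lam (EC A) c x = ps (k * m) (projr c * x)"

fun bad :: "'k event \<Rightarrow> 'k \<Rightarrow> bool" where
  "bad (EA l) x \<longleftrightarrow> x ^ ((Q - 1) div l) = 1"
| "bad (EB l) x \<longleftrightarrow> fv x ^ ((Q - 1) div l) = 1"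
| "bad (EC A) x \<longleftrightarrow> x \<in> UA k m A"

lemma q_sub: "FF (p ^ k) \<subseteq> (FF Q :: 'k set)"
  using FF_mono[of "p ^ k" m] by (simp add: power_mult)

text \<open>The kernel of the cofactor is small, so its annihilator is large by
  \<open>card_ann\<close>. Hence sieving an orbit costs at most 1 / p ^ (k * card A) of
  \<delta>.\<close>

lemma card_ann_UA:
  assumes A: "A \<in> orbits k m"
  shows "card (ann (k * m) (UA k m A)) \<ge> p ^ (k * card A)" "card A \<ge> 1"
proof -
  have ad: "addsub (k * m) (UA k m A)" using UA_addsub[OF m0 A] .
  have "card A \<noteq> 0" using orbits_finite(2)[OF m0 A] by simp
  thus "card A \<ge> 1" by simp
  have pos: "card (UA k m A) > 0"
    using finite_addsub[OF km0 ad] ad by (auto simp: addsub_def card_gt_0_iff)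
  have "p ^ (k * card A) * card (UA k m A) \<le> p ^ (k * card A) * p ^ (k * (m - card A))"
    using card_UA[OF m0 k0 A] by simp
  also have "\<dots> = p ^ (k * m)" using cofac(5)[OF m0 A] by (simp flip: power_add distrib_left)
  also have "\<dots> = card (ann (k * m) (UA k m A)) * card (UA k m A)" using card_ann[OF km0 ad] by simp
  finally show "card (ann (k * m) (UA k m A)) \<ge> p ^ (k * card A)" using pos by simp
qed

lemma card_II: "finite II"
  unfolding II_def using finite_LL orbits_finite(1)[OF m0] by simp

text \<open>All characters merge into a single sum covered by \<open>weil_bound\<close>: powers of x
  go into \<open>ch1\<close>, powers of \<open>Hf\<close> into \<open>ch2\<close>, the orbits into
  \<open>v\<close>, the trace condition into \<open>b\<close>.\<close>

lemma char_sum_bound: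
  assumes J: "J \<subseteq> II" and g: "g \<in> PiE J Gam" and b: "b \<in> FF (p ^ k)"
    and nt: "(\<exists>i\<in>J. g i \<noteq> orig i) \<or> b \<noteq> 0"
  shows "norm (\<Sum>x\<in>XX. (\<Prod>i\<in>J. lam i (g i) x) * ps (k * m) (b / x)) \<le> 4 * sqrt Q"
proof -
  define JA where "JA = {l. EA l \<in> J}"
  define JB where "JB = {l. EB l \<in> J}"
  define JC where "JC = {A. EC A \<in> J}"
  have sub: "JA \<subseteq> LL" "JB \<subseteq> LL" "JC \<subseteq> orbits k m" using J by (auto simp: JA_def JB_def JC_def II_def)
  have fin: "finite JA" "finite JB" "finite JC"
    using sub finite_LL orbits_finite(1)[OF m0] by (meson finite_subset)+
  have Jeq: "J = EA ` JA \<union> (EB ` JB \<union> EC ` JC)"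
  proof
    show "J \<subseteq> EA ` JA \<union> (EB ` JB \<union> EC ` JC)"
    proof
      fix i assume "i \<in> J"
      thus "i \<in> EA ` JA \<union> (EB ` JB \<union> EC ` JC)" by (cases i) (auto simp: JA_def JB_def JC_def)
    qed
  qed (auto simp: JA_def JB_def JC_def)
  define jA where "jA = (\<lambda>l. projl (g (EA l)))"
  define jB where "jB = (\<lambda>l. projl (g (EB l)))"
  define uC where "uC = (\<lambda>A. projr (g (EC A)))"
  have gA: "g (EA l) = Inl (jA l)" "jA l < l" if "l \<in> JA" for l
    using PiE_mem[OF g, of "EA l"] that by (auto simp: JA_def jA_def)
  have gB: "g (EB l) = Inl (jB l)" "jB l < l" if "l \<in> JB" for l
    using PiE_mem[OF g, of "EB l"] that by (auto simp: JB_def jB_def)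
  have gC: "g (EC A) = Inr (uC A)" "uC A \<in> ann (k * m) (UA k m A)" if "A \<in> JC" for A
    using PiE_mem[OF g, of "EC A"] that by (auto simp: JC_def uC_def)
  have uF: "uC A \<in> FF Q" if "A \<in> JC" for A using gC(2)[OF that] by (simp add: ann_def)
  define v where "v = (\<Sum>A\<in>JC. uC A)"
  have vF: "v \<in> FF Q" unfolding v_def using uF by (intro FF_sum)
  define ch1 where "ch1 = (\<lambda>x. chP JA jA x * chP JB jB x ^ ii)"
  define ch2 where "ch2 = chP JB (\<lambda>l. jB l * ss)"
  have mc: "mult_char Q ch1" "mult_char Q ch2"
    using mult_char_chP[OF sub(1), of jA] mult_char_chP[OF sub(2), of jB] mult_char_chP[OF sub(2)]
    by (auto simp: ch1_def ch2_def mult_char_def power_mult_distrib)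
  \<comment> \<open>First v = 0 forces all \<open>uC\<close> to vanish by independence. Triviality
    of \<open>ch2\<close> gives \<open>jB = 0\<close>, as no l divides \<open>ss\<close>; only then
    does \<open>ch1\<close> reduce to the characters of x alone, whence
    \<open>jA = 0\<close>.\<close>
  have nontriv: "b \<noteq> 0 \<or> v \<noteq> 0 \<or> (\<exists>z\<in>FF Q - {0}. ch1 z \<noteq> 1) \<or> (\<exists>z\<in>FF Q - {0}. ch2 z \<noteq> 1)"
  proof (rule ccontr)
    assume "\<not> ?thesis"
    hence b0: "b = 0" and v0: "v = 0" and t1: "\<And>z. z \<in> FF Q - {0} \<Longrightarrow> ch1 z = 1" and t2: "\<And>z. z \<in> FF Q - {0} \<Longrightarrow> ch2 z = 1"
      by auto
    have uC0: "uC A = 0" if "A \<in> JC" for A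
      by (rule ann_UA_independent[OF m0 k0 sub(3) gC(2) v0[unfolded v_def] that])
    have jB0: "jB l = 0" if l: "l \<in> JB" for l
    proof -
      have "l dvd jB l * ss" using chP_trivial[OF sub(2) t2[unfolded ch2_def] l] .
      moreover have "prime l" "\<not> l dvd ss" using ss LL l sub(2) by blast+
      ultimately have "l dvd jB l" by (simp add: prime_dvd_mult_iff)
      thus ?thesis using gB(2)[OF l] by (metis dvd_imp_le gr0I leD)
    qed
    have chB: "chP JB jB z = 1" for z unfolding chP_def using jB0 by (intro prod.neutral) simp
    have "chP JA jA z = 1" if "z \<in> FF Q - {0}" for z using t1[OF that] by (simp add: ch1_def chB)
    hence "l dvd jA l" if "l \<in> JA" for l using chP_trivial[OF sub(1)] that by blast
    hence jA0: "jA l = 0" if "l \<in> JA" for l using gA(2)[OF that] that by (metis dvd_imp_le gr0I leD)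
    have "g i = orig i" if "i \<in> J" for i
      using that unfolding Jeq using gA gB gC jA0 jB0 uC0 by auto
    thus False using nt b0 by auto
  qed
  have bQ: "b \<in> FF Q" using b q_sub by blast
  interpret lf: lfun p K "k * m" R ex ch1 ch2 \<psi> b v \<rho>0 z0
    by unfold_locales (use km0 finR R0 R_frob ex_frob ex_pos \<rho>0 bQ vF mc psi nontriv in auto)
  have XXeq: "XH Q lf.HR = XX" unfolding XH_def XX_def by (simp add: lf.poly_HR_eq_0_iff)
  have "(\<Prod>i\<in>J. lam i (g i) x) * ps (k * m) (b / x)
      = chP JB jB cc * (ch1 x * ch2 (poly lf.HR x) * \<psi> (abstr (k * m) (b / x + v * x)))" if x: "x \<in> XX" for x
  proof -
    have xF: "x \<in> FF Q" using x by (simp add: XX_def)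
    have pA: "(\<Prod>i\<in>EA ` JA. lam i (g i) x) = chP JA jA x"
      unfolding chP_def by (subst prod.reindex) (auto simp: inj_on_def gA intro!: prod.cong)
    have pB: "(\<Prod>i\<in>EB ` JB. lam i (g i) x) = chP JB jB (fv x)"
      unfolding chP_def by (subst prod.reindex) (auto simp: inj_on_def gB intro!: prod.cong)
    have ps_sum': "ps (k * m) (\<Sum>A\<in>S. uC A * x) = (\<Prod>A\<in>S. ps (k * m) (uC A * x))" if "S \<subseteq> JC" for S
    proof -
      have "finite S" using that fin(3) by (rule finite_subset)
      thus ?thesis using that
      proof (induction S rule: finite_induct)
        case (insert A S)
        have "ps (k * m) (uC A * x + (\<Sum>A\<in>S. uC A * x)) = ps (k * m) (uC A * x) * ps (k * m) (\<Sum>A\<in>S. uC A * x)"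
          using insert.prems uF xF by (intro ps_add FF_mult FF_sum) auto
        thus ?case using insert by simp
      qed simp
    qed
    have pC: "(\<Prod>i\<in>EC ` JC. lam i (g i) x) = ps (k * m) (v * x)"
      unfolding v_def sum_distrib_right ps_sum'[OF order.refl]
      by (subst prod.reindex) (auto simp: inj_on_def gC intro!: prod.cong)
    have "(\<Prod>i\<in>J. lam i (g i) x) = chP JA jA x * (chP JB jB (fv x) * ps (k * m) (v * x))"
    proof -
      have "(\<Prod>i\<in>EB ` JB \<union> EC ` JC. lam i (g i) x) = chP JB jB (fv x) * ps (k * m) (v * x)"
        using fin by (subst prod.union_disjoint) (auto simp: pB pC)
      moreover have "(\<Prod>i\<in>J. lam i (g i) x) = (\<Prod>i\<in>EA ` JA. lam i (g i) x) * (\<Prod>i\<in>EB ` JB \<union> EC ` JC. lam i (g i) x)"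
        unfolding Jeq using fin by (intro prod.union_disjoint) auto
      ultimately show ?thesis by (simp only: pA)
    qed
    moreover have "ps (k * m) (b / x + v * x) = ps (k * m) (b / x) * ps (k * m) (v * x)"
      using bQ vF xF by (intro ps_add FF_mult FF_divide)
    moreover have "poly lf.HR x = Hf x" unfolding lf.poly_HR Hf_def ..
    ultimately show ?thesis
      unfolding ch1_def ch2_def chP_fv[OF sub(2) x] by (simp add: mult_ac ps_def)
  qed
  hence "(\<Sum>x\<in>XX. (\<Prod>i\<in>J. lam i (g i) x) * ps (k * m) (b / x))
      = chP JB jB cc * (\<Sum>x\<in>XH Q lf.HR. ch1 x * ch2 (poly lf.HR x) * \<psi> (abstr (k * m) (b / x + v * x)))"
    unfolding sum_distrib_left XXeq by (intro sum.cong refl)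
  hence "norm (\<Sum>x\<in>XX. (\<Prod>i\<in>J. lam i (g i) x) * ps (k * m) (b / x))
      = norm (\<Sum>x\<in>XH Q lf.HR. ch1 x * ch2 (poly lf.HR x) * \<psi> (abstr (k * m) (b / x + v * x)))"
    using norm_mult_char[OF mult_char_chP[OF sub(2), of jB], of cc] cc Q1 by (simp add: norm_mult)
  also have "\<dots> \<le> (card R + 2) * sqrt Q" by (rule lf.weil_bound)
  also have "\<dots> \<le> 4 * sqrt Q" using finR(2) by (intro mult_right_mono) auto
  finally show ?thesis .
qed

lemma char_sieve_pair:
  "char_sieve XX II Gam orig lam (FF (p ^ k)) 0 (\<lambda>b x. ps (k * m) (b / x)) (\<lambda>b. ps k (- (b * a))) (4 * sqrt Q)
     bad (\<lambda>x. (\<Sum>i<m. (1 / x) ^ (p ^ (k * i))) = a)"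
proof
  show "finite XX" using finite_FF[OF km0] by (auto simp: XX_def intro: finite_subset)
  show "finite II" by (rule card_II)
  have q0: "p ^ k > 0" using p1 by simp
  show "finite (FF (p ^ k) :: 'k set)" by (rule finite_FF[OF k0])
  show "0 \<in> (FF (p ^ k) :: 'k set)" using q0 by simp
  show "ps k (- (0 * a)) = 1" "\<And>x. ps (k * m) (0 / x) = 1" by simp_all
  show "norm (ps k (- (v * a))) \<le> 1" if "v \<in> FF (p ^ k)" for v
    using ps_norm[of "- (v * a)" k] a that by (simp add: FF_uminus FF_mult)
  show "4 * sqrt (real Q) \<ge> 0" by simp
  fix i :: "'k event" assume i: "i \<in> II"
  show fG: "finite (Gam i)" using i finite_FF[OF km0] by (cases i) (auto simp: ann_def intro: finite_subset)
  show "orig i \<in> Gam i" 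
  proof (cases i)
    case (EA l)
    thus ?thesis using LL(4)[of l] i by (force simp: II_def)
  next
    case (EB l)
    thus ?thesis using LL(4)[of l] i by (force simp: II_def)
  qed (use p1 in \<open>auto simp: ann_def\<close>)
  show "card (Gam i) \<ge> 2"
  proof (cases i)
    case (EC A)
    hence A: "A \<in> orbits k m" using i by (auto simp: II_def)
    have "2 \<le> p" using p1 by simp
    also have "p \<le> p ^ (k * card A)" using k0 card_ann_UA(2)[OF A] p1 by (intro self_le_power) auto
    also have "\<dots> \<le> card (Gam i)" using card_ann_UA(1)[OF A] by (simp add: EC card_image)
    finally show ?thesis .
  qed (use i in \<open>auto simp: II_def card_image dest: LL(4)\<close>)
next
  fix i x assume i: "i \<in> II" and x: "x \<in> XX"
  have xF: "x \<in> FF Q - {0}" using x by (simp add: XX_def)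
  show "lam i (orig i) x = 1" by (cases i) auto
  show "(\<Sum>\<gamma>\<in>Gam i. lam i \<gamma> x) = of_nat (card (Gam i)) * of_bool (bad i x)"
  proof (cases i)
    case (EA l)
    hence l: "l \<in> LL" using i by (auto simp: II_def)
    show ?thesis
      using eta_sum[OF LL(1,2)[OF l] pow_chi[OF l xF]]
      by (simp add: EA sum.reindex card_image chi_def)
  next
    case (EB l)
    hence l: "l \<in> LL" using i by (auto simp: II_def)
    show ?thesis
      using eta_sum[OF LL(1,2)[OF l] pow_chi[OF l fv_FF[OF x]]]
      by (simp add: EB sum.reindex card_image chi_def)
  next
    case (EC A)
    hence A: "A \<in> orbits k m" using i by (auto simp: II_def)
    show ?thesis
      using ann_indicator[OF km0 UA_addsub[OF m0 A], of x] xF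
      by (simp add: EC sum.reindex card_image)
  qed
next
  fix J and g :: "'k event \<Rightarrow> nat + 'k" and v :: 'k assume "J \<subseteq> II" "g \<in> PiE J Gam" "v \<in> FF (p ^ k)" "(\<exists>i\<in>J. g i \<noteq> orig i) \<or> v \<noteq> 0"
  thus "norm (\<Sum>x\<in>XX. (\<Prod>i\<in>J. lam i (g i) x) * ps (k * m) (v / x)) \<le> 4 * sqrt (real Q)"
    by (rule char_sum_bound)
next
  fix x assume x: "x \<in> XX"
  have xF: "x \<in> FF Q" using x by (simp add: XX_def)
  define t where "t = (\<Sum>i<m. (1 / x) ^ (p ^ (k * i)))"
  have tF: "t \<in> FF (p ^ k)"
  proof -
    have "t ^ (p ^ k) = (\<Sum>i<m. (1 / x) ^ (p ^ (k * Suc i)))"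
      unfolding t_def frob_sum by (intro sum.cong refl) (simp add: pow_pow_frob add.commute)
    also have "\<dots> = (\<Sum>i<Suc m. (1 / x) ^ (p ^ (k * i))) - 1 / x"
      by (subst sum.lessThan_Suc_shift) simp
    also have "\<dots> = t + (1 / x) ^ Q - 1 / x" by (simp add: t_def)
    also have "(1 / x) ^ Q = 1 / x" using xF by (simp add: FF_def power_divide)
    finally show ?thesis by (simp add: FF_def)
  qed
  \<comment> \<open>As b lies in the small field, the absolute trace of b / x is that of b times the
    relative trace \<open>t\<close> of 1 / x. Summation over b then detects
    \<open>t = a\<close>.\<close>
  have "ps k (- (b * a)) * ps (k * m) (b / x) = ps k ((t - a) * b)" if b: "b \<in> FF (p ^ k)" for b
  proof -
    have "(\<Sum>i<m. (b / x) ^ (p ^ (k * i))) = b * t"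
      unfolding t_def sum_distrib_left
    proof (intro sum.cong refl)
      fix i
      have "b ^ (p ^ (k * i)) = b" using FF_powD[OF b, of i] by (simp add: power_mult)
      thus "(b / x) ^ (p ^ (k * i)) = b * (1 / x) ^ (p ^ (k * i))" by (simp add: power_divide)
    qed
    hence "ps (k * m) (b / x) = ps k (b * t)" unfolding ps_def abstr_tower[symmetric] by simp
    moreover have "ps k (- (b * a) + b * t) = ps k (- (b * a)) * ps k (b * t)"
      using a b tF by (intro ps_add FF_uminus FF_mult)
    ultimately show ?thesis by (simp add: algebra_simps)
  qed
  hence "(\<Sum>b\<in>FF (p ^ k). ps k (- (b * a)) * ps (k * m) (b / x)) = (\<Sum>b\<in>FF (p ^ k). ps k ((t - a) * b))"
    by (intro sum.cong refl)
  also have "\<dots> = of_nat (p ^ k) * of_bool (t - a = 0)" using a tF by (intro ps_sum[OF k0] FF_diff)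
  finally show "(\<Sum>b\<in>FF (p ^ k). ps k (- (b * a)) * ps (k * m) (b / x)) =
      of_nat (card (FF (p ^ k) :: 'k set)) * of_bool ((\<Sum>i<m. (1 / x) ^ (p ^ (k * i))) = a)"
    using card_FF[OF k0] by (simp add: t_def)
qed

theorem pair_exists:
  fixes \<delta> :: real
  assumes L: "L0 \<union> L1 = LL" "L0 \<inter> L1 = {}" and O: "O0 \<union> O1 = orbits k m" "O0 \<inter> O1 = {}"
    and \<delta>: "\<delta> > 0" "\<delta> \<le> 1 - 2 * (\<Sum>l\<in>L1. 1 / l) - (\<Sum>A\<in>O1. 1 / p ^ (k * card A))"
    and s: "2 * card L1 + card O1 \<le> s" "s \<ge> 1"
    and big: "sqrt Q \<ge> 4 * p ^ k * 2 ^ (2 * card L0 + card O0) * ((real s - 1) / \<delta> + 2)"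
  shows "\<exists>x\<in>XX. (\<Sum>i<m. (1 / x) ^ (p ^ (k * i))) = a \<and> (\<forall>l\<in>LL. x ^ ((Q - 1) div l) \<noteq> 1 \<and> fv x ^ ((Q - 1) div l) \<noteq> 1)
     \<and> (\<forall>A\<in>orbits k m. x \<notin> UA k m A)"
proof -
  interpret char_sieve XX II Gam orig lam "FF (p ^ k)" 0 "\<lambda>b x. ps (k * m) (b / x)" "\<lambda>b. ps k (- (b * a))" "4 * sqrt Q"
     bad "\<lambda>x. (\<Sum>i<m. (1 / x) ^ (p ^ (k * i))) = a"
    by (rule char_sieve_pair)
  define J where "J = EA ` L0 \<union> (EB ` L0 \<union> EC ` O0)"
  define S where "S = EA ` L1 \<union> (EB ` L1 \<union> EC ` O1)"
  have fin: "finite L0" "finite L1" "finite O0" "finite O1"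
    using L O finite_LL orbits_finite(1)[OF m0, of k] by (metis finite_Un)+
  have JS: "J \<union> S = II" "J \<inter> S = {}"
    using L O unfolding J_def S_def II_def by (auto simp flip: L(1) O(1))
  have cJ: "card J = 2 * card L0 + card O0"
    unfolding J_def using fin
    by (subst card_Un_disjoint; (subst card_Un_disjoint)?) (auto simp: card_image inj_on_def)
  have cS: "card S = 2 * card L1 + card O1"
    unfolding S_def using fin
    by (subst card_Un_disjoint; (subst card_Un_disjoint)?) (auto simp: card_image inj_on_def)
  define d where "d = 1 - (\<Sum>s\<in>S. 1 / card (Gam s))"
  have "(\<Sum>s\<in>S. 1 / card (Gam s)) = (\<Sum>l\<in>L1. 1 / l) + ((\<Sum>l\<in>L1. 1 / l) + (\<Sum>A\<in>O1. 1 / card (ann (k * m) (UA k m A))))"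
    unfolding S_def using fin
    by (subst sum.union_disjoint; (subst sum.union_disjoint)?) (auto simp: card_image inj_on_def sum.reindex)
  also have "(\<Sum>A\<in>O1. 1 / real (card (ann (k * m) (UA k m A)))) \<le> (\<Sum>A\<in>O1. 1 / p ^ (k * card A))"
  proof (rule sum_mono)
    fix A assume "A \<in> O1"
    hence "card (ann (k * m) (UA k m A)) \<ge> p ^ (k * card A)" using card_ann_UA(1)[of A] O by blast
    hence "real (card (ann (k * m) (UA k m A))) \<ge> real (p ^ (k * card A))" by (simp only: of_nat_le_iff)
    moreover have "real (p ^ (k * card A)) > 0" using p1 by simp
    ultimately show "1 / real (card (ann (k * m) (UA k m A))) \<le> 1 / p ^ (k * card A)"
      by (intro frac_le) simp_all
  qed
  finally have d: "\<delta> \<le> d" "d > 0" using \<delta> by (auto simp: d_def)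
  define M where "M = 4 * sqrt Q"
  have "real Q > real 1" using Q1 by (simp only: of_nat_less_iff)
  hence Mp: "M > 4" by (simp add: M_def)
  \<comment> \<open>At most three elements of the field are missing from \<open>XX\<close>, which is
    less than M.\<close>
  have cX: "card XX + M > Q"
  proof -
    have "FF Q \<subseteq> XX \<union> insert 0 R" by (auto simp: XX_def)
    hence "card (FF Q :: 'k set) \<le> card (XX \<union> insert 0 R)" using finX finR by (intro card_mono) auto
    also have "\<dots> \<le> card XX + card (insert 0 R)" by (rule card_Un_le)
    also have "\<dots> \<le> card XX + 3" using finR R0 by simp
    finally have "Q \<le> card XX + 3" using card_FF[OF km0] by simp
    hence "real Q \<le> real (card XX + 3)" by (simp only: of_nat_le_iff)
    thus ?thesis using Mp by simp
  qed
  define W where "W = real (p ^ k * 2 ^ card J)"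
  have W: "W > 0" using p1 by (simp add: W_def)
  \<comment> \<open>Replacing the true \<open>card S\<close> and \<open>d\<close> by the bounds
    \<open>s\<close> and \<delta> only enlarges the quotient, as \<open>s \<ge> 1\<close>.\<close>
  have "M * W * ((real (card S) - 1) / d + 2) \<le> M * W * ((real s - 1) / \<delta> + 2)"
  proof -
    have "(real (card S) - 1) / d \<le> (real s - 1) / d" using s d by (intro divide_right_mono) (auto simp: cS)
    also have "\<dots> \<le> (real s - 1) / \<delta>" using s d \<delta> by (intro divide_left_mono) auto
    finally show ?thesis using W Mp by (intro mult_left_mono) auto
  qed
  also have "\<dots> = sqrt Q * (4 * p ^ k * 2 ^ (2 * card L0 + card O0) * ((real s - 1) / \<delta> + 2))"
    by (simp add: M_def W_def cJ mult_ac)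
  also have "\<dots> \<le> sqrt Q * sqrt Q" using big by (intro mult_left_mono) auto
  also have "\<dots> < card XX + M" using cX by simp
  finally have "M * W * ((real (card S) - 1) / d + 2) * d < (card XX + M) * d" using d by (intro mult_strict_right_mono)
  moreover have e: "((real (card S) - 1) / d + 2) * d = 2 * d + real (card S) - 1" using d by (simp add: field_simps)
  ultimately have "M * W * (2 * d + real (card S) - 1) < (card XX + M) * d" by (simp only: mult.assoc e)
  hence "(card XX + M) * d > M * card (FF (p ^ k) :: 'k set) * 2 ^ card J * (2 * d + real (card S) - 1)"
    using card_FF[OF k0] by (simp add: W_def mult.assoc)
  from sieve[OF JS d_def d(2), folded M_def, OF this]
  obtain x where x: "x \<in> XX" "(\<Sum>i<m. (1 / x) ^ (p ^ (k * i))) = a" "\<And>i. i \<in> II \<Longrightarrow> \<not> bad i x" by blast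
  have "\<not> bad (EA l) x" "\<not> bad (EB l) x" if "l \<in> LL" for l using x(3) that unfolding II_def by blast+
  moreover have "\<not> bad (EC A) x" if "A \<in> orbits k m" for A using x(3) that unfolding II_def by blast
  ultimately show ?thesis using x(1,2) by auto
qed

end

section \<open>The arithmetic condition and rational functions with given zeros and poles\<close>

context pchar
begin

text \<open>Isolates the arithmetic: neither the function nor the trace value occurs, so one check
  serves a whole pair (k, m). Index 0 marks what stays unsieved, index 1 what is sieved; bounds may
  stand in for the exact values of \<open>s\<close> and \<delta>.\<close>

definition sieve_ok :: "nat \<Rightarrow> nat \<Rightarrow> bool" where
  "sieve_ok k m \<longleftrightarrow> k > 0 \<and> m > 0 \<and> (\<exists>L0 L1 O0 O1 \<delta> s.
     L0 \<union> L1 = {l. prime l \<and> l dvd p ^ (k * m) - 1} \<and> L0 \<inter> L1 = {} \<and>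
     O0 \<union> O1 = (orbits k m :: 'k set set) \<and> O0 \<inter> O1 = {} \<and>
     \<delta> > 0 \<and> \<delta> \<le> 1 - 2 * (\<Sum>l\<in>L1. 1 / real l) - (\<Sum>A\<in>O1. 1 / real p ^ (k * card A)) \<and>
     2 * card L1 + card O1 \<le> s \<and> s \<ge> 1 \<and>
     sqrt (real p ^ (k * m)) \<ge> 4 * real p ^ k * 2 ^ (2 * card L0 + card O0) * ((real s - 1) / \<delta> + 2))"

lemma prod_frob_stable:
  fixes R :: "'k set"
  assumes R: "finite R" "\<And>\<rho>. \<rho> \<in> R \<Longrightarrow> \<rho> ^ (p ^ e) \<in> R" and x: "x \<in> FF (p ^ e)"
  shows "(\<Prod>\<rho>\<in>R. \<rho> - x) \<in> FF (p ^ e)"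
proof -
  have inj: "inj_on (\<lambda>\<rho>. \<rho> ^ (p ^ e)) R" by (intro inj_onI) (rule frob_inj)
  have "(\<lambda>\<rho>. \<rho> ^ (p ^ e)) ` R \<subseteq> R" using R by auto
  hence bij: "bij_betw (\<lambda>\<rho>. \<rho> ^ (p ^ e)) R R" using inj R by (simp add: bij_betw_def endo_inj_surj)
  have "(\<Prod>\<rho>\<in>R. \<rho> - x) ^ (p ^ e) = (\<Prod>\<rho>\<in>R. \<rho> ^ (p ^ e) - x)"
    unfolding prod_power_distrib frob_diff using x by (simp add: FF_def)
  also have "\<dots> = (\<Prod>\<rho>\<in>R. \<rho> - x)" using prod.reindex_bij_betw[OF bij, of "\<lambda>\<rho>. \<rho> - x"] .
  finally show ?thesis by (simp add: FF_def)
qed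

lemma inverse_eq_power:
  assumes "x \<in> FF r" "x \<noteq> (0 :: 'k)" "r \<ge> 2"
  shows "inverse x = x ^ (r - 2)"
proof -
  have "Suc (r - 2) = r - 1" using assms by simp
  hence "x * x ^ (r - 2) = x ^ (r - 1)" by (metis power_Suc)
  also have "\<dots> = 1" using assms by (intro FF_power_minus_1) auto
  finally show ?thesis by (rule inverse_unique)
qed

lemma pair_exists_rational:
  assumes ok: "sieve_ok k m" and Q2: "p ^ (k * m) > 2"
    and fin: "finite R1" "finite R2" and dj: "R1 \<inter> R2 = {}" and cR: "card (R1 \<union> R2) \<le> 2" and ne: "R1 \<union> R2 \<noteq> {}"
    and R0: "0 \<notin> R1" "0 \<notin> R2" and frob: "\<And>\<rho>. \<rho> \<in> R1 \<Longrightarrow> \<rho> ^ (p ^ (k * m)) \<in> R1" "\<And>\<rho>. \<rho> \<in> R2 \<Longrightarrow> \<rho> ^ (p ^ (k * m)) \<in> R2"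
    and cc: "cc \<in> FF (p ^ (k * m))" "cc \<noteq> (0 :: 'k)" and a: "a \<in> FF (p ^ k)"
  shows "\<exists>x\<in>FF (p ^ (k * m)). x \<noteq> 0 \<and> x \<notin> R1 \<union> R2 \<and> (\<Sum>i<m. (1 / x) ^ (p ^ (k * i))) = a \<and>
     (\<forall>l. prime l \<longrightarrow> l dvd p ^ (k * m) - 1 \<longrightarrow> x ^ ((p ^ (k * m) - 1) div l) \<noteq> 1 \<and>
        (cc * x ^ ii * (\<Prod>\<rho>\<in>R1. \<rho> - x) / (\<Prod>\<rho>\<in>R2. \<rho> - x)) ^ ((p ^ (k * m) - 1) div l) \<noteq> 1) \<and>
     (\<forall>A\<in>orbits k m. x \<notin> UA k m A)"
proof -
  define Q where "Q = p ^ (k * m)"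
  \<comment> \<open>Some root must have exponent 1. Zeros get exponent 1 and poles Q - 2, which
    inverts; if there are no zeros, the poles get exponent 1 and the inversion moves to the outer
    exponent \<open>ss\<close>, where it is admissible because Q - 2 and Q - 1 are coprime.\<close>
  define ex where "ex = (\<lambda>\<rho>. if R1 = {} \<or> \<rho> \<in> R1 then 1 else Q - 2)"
  define ss where "ss = (if R1 = {} then Q - 2 else 1)"
  obtain \<rho>0 where \<rho>0: "\<rho>0 \<in> R1 \<union> R2" "ex \<rho>0 = 1"
  proof (cases "R1 = {}")
    case True
    then obtain r where "r \<in> R2" using ne by blast
    thus ?thesis using that[of r] True by (simp add: ex_def)
  next
    case False
    then obtain r where "r \<in> R1" by blast
    thus ?thesis using that[of r] by (simp add: ex_def)
  qed
  obtain \<psi> :: "'k \<Rightarrow> complex" and z0 where psi: "add_char p \<psi>" "z0 \<in> FF p" "\<psi> z0 \<noteq> 1"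
    using add_character_exists by blast
  have "\<exists>\<eta> :: 'k \<Rightarrow> complex. prime l \<and> l \<noteq> p \<longrightarrow>
      (\<forall>y y'. y ^ l = 1 \<longrightarrow> y' ^ l = 1 \<longrightarrow> \<eta> (y * y') = \<eta> y * \<eta> y') \<and>
      (\<forall>y. y ^ l = 1 \<longrightarrow> (\<Sum>i<l. \<eta> y ^ i) = of_nat l * of_bool (y = 1)) \<and>
      (\<forall>i. \<not> l dvd i \<longrightarrow> (\<exists>y. y ^ l = 1 \<and> \<eta> y ^ i \<noteq> 1)) \<and>
      (\<forall>y. y ^ l = 1 \<longrightarrow> \<eta> y ^ l = 1) \<and> \<eta> 1 = 1" for l
  proof (cases "prime l \<and> l \<noteq> p")
    case True
    then show ?thesis using prime_character_exists[of l] by metis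
  qed auto
  then obtain \<eta> :: "nat \<Rightarrow> 'k \<Rightarrow> complex" where \<eta>: "\<And>l. prime l \<and> l \<noteq> p \<longrightarrow>
      (\<forall>y y'. y ^ l = 1 \<longrightarrow> y' ^ l = 1 \<longrightarrow> \<eta> l (y * y') = \<eta> l y * \<eta> l y') \<and>
      (\<forall>y. y ^ l = 1 \<longrightarrow> (\<Sum>i<l. \<eta> l y ^ i) = of_nat l * of_bool (y = 1)) \<and>
      (\<forall>i. \<not> l dvd i \<longrightarrow> (\<exists>y. y ^ l = 1 \<and> \<eta> l y ^ i \<noteq> 1)) \<and>
      (\<forall>y. y ^ l = 1 \<longrightarrow> \<eta> l y ^ l = 1) \<and> \<eta> l 1 = 1" by metis
  have ss: "\<not> l dvd ss" if l: "prime l" "l dvd Q - 1" for l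
  proof
    assume "l dvd ss"
    have "l dvd 1"
    proof (cases "R1 = {}")
      case True
      hence "l dvd Q - 2" using \<open>l dvd ss\<close> by (simp add: ss_def)
      hence "l dvd (Q - 1) - (Q - 2)" by (rule dvd_diff_nat[OF l(2)])
      moreover have "(Q - 1) - (Q - 2) = 1" using Q2 unfolding Q_def by linarith
      ultimately show ?thesis by simp
    qed (use \<open>l dvd ss\<close> in \<open>simp add: ss_def\<close>)
    thus False using l by auto
  qed
  have ok': "k > 0" "m > 0" using ok by (auto simp: sieve_ok_def)
  interpret pair_sieve p K \<psi> z0 k m "R1 \<union> R2" ex \<rho>0 cc ii ss a \<eta>
  proof
    show "add_char p \<psi>" "z0 \<in> FF p" "\<psi> z0 \<noteq> 1" by fact+
    show "ex (\<rho> ^ p ^ (k * m)) = ex \<rho>" if "\<rho> \<in> R1 \<union> R2" for \<rho>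
      using that frob dj by (auto simp: ex_def)
    show "ex \<rho> > 0" for \<rho> using Q2 by (simp add: ex_def Q_def)
    show "\<not> l dvd ss" if "prime l" "l dvd p ^ (k * m) - 1" for l using ss that by (simp add: Q_def)
  qed (use ok' fin cR R0 frob cc a \<rho>0 \<eta> in \<open>auto\<close>)
  have LL: "LL = {l. prime l \<and> l dvd p ^ (k * m) - 1}" by (simp add: LL_def)
  obtain L0 L1 O0 O1 \<delta> s where *: "L0 \<union> L1 = LL" "L0 \<inter> L1 = {}" "O0 \<union> O1 = (orbits k m :: 'k set set)" "O0 \<inter> O1 = {}"
    "\<delta> > 0" "\<delta> \<le> 1 - 2 * (\<Sum>l\<in>L1. 1 / real l) - (\<Sum>A\<in>O1. 1 / real p ^ (k * card A))"
    "2 * card L1 + card O1 \<le> s" "s \<ge> 1"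
    "sqrt (real p ^ (k * m)) \<ge> 4 * real p ^ k * 2 ^ (2 * card L0 + card O0) * ((real s - 1) / \<delta> + 2)"
    using ok unfolding sieve_ok_def LL by (elim conjE exE)
  have "\<exists>x\<in>XX. (\<Sum>i<m. (1 / x) ^ (p ^ (k * i))) = a \<and> (\<forall>l\<in>LL. x ^ ((p ^ (k * m) - 1) div l) \<noteq> 1 \<and> fv x ^ ((p ^ (k * m) - 1) div l) \<noteq> 1)
     \<and> (\<forall>A\<in>orbits k m. x \<notin> UA k m A)"
    by (rule pair_exists[of L0 L1 O0 O1 \<delta> s]) (use * in \<open>simp_all\<close>)
  then obtain x where x: "x \<in> XX" "(\<Sum>i<m. (1 / x) ^ (p ^ (k * i))) = a"
      "\<forall>l\<in>LL. x ^ ((p ^ (k * m) - 1) div l) \<noteq> 1 \<and> fv x ^ ((p ^ (k * m) - 1) div l) \<noteq> 1"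
      "\<forall>A\<in>orbits k m. x \<notin> UA k m A" by blast
  have xF: "x \<in> FF Q" "x \<noteq> 0" "x \<notin> R1 \<union> R2" using x(1) by (auto simp: XX_def Q_def)
  define P1 where "P1 = (\<Prod>\<rho>\<in>R1. \<rho> - x)"
  define P2 where "P2 = (\<Prod>\<rho>\<in>R2. \<rho> - x)"
  have P2: "P2 \<in> FF Q" "P2 \<noteq> 0"
    using prod_frob_stable[of R2 "k * m" x] fin frob xF unfolding P2_def Q_def by auto
  have inv: "inverse P2 = P2 ^ (Q - 2)" using P2 Q2 by (intro inverse_eq_power) (auto simp: Q_def)
  have "fv x = cc * x ^ ii * P1 / P2"
  proof (cases "R1 = {}")
    case True
    thus ?thesis unfolding fv_def Hf_def by (simp add: ex_def ss_def P1_def inv divide_inverse flip: P2_def)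
  next
    case False
    have "(\<Prod>\<rho>\<in>R1. (\<rho> - x) ^ ex \<rho>) = P1" unfolding P1_def by (intro prod.cong) (auto simp: ex_def)
    moreover have "(\<Prod>\<rho>\<in>R2. (\<rho> - x) ^ ex \<rho>) = P2 ^ (Q - 2)"
      unfolding P2_def prod_power_distrib using dj False by (intro prod.cong) (auto simp: ex_def)
    ultimately show ?thesis
      unfolding fv_def Hf_def using fin dj False by (simp add: ss_def prod.union_disjoint inv divide_inverse)
  qed
  thus ?thesis using x xF unfolding LL P1_def P2_def Q_def by auto
qed

end

section \<open>Transfer to an abstract finite field\<close>

lemma poly_map_to_ac: "poly (map_poly to_ac f) (to_ac x) = to_ac (poly f x)"
  by (induction f) (auto simp: map_poly_pCons)

lemma degree_map_to_ac: "degree (map_poly to_ac f) = degree f"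
  by (rule degree_map_poly) simp

lemma primitive_elemI:
  fixes \<alpha> :: "'a::finite_field"
  assumes nz: "\<alpha> \<noteq> 0" and pr: "\<And>l. prime l \<Longrightarrow> l dvd CARD('a) - 1 \<Longrightarrow> \<alpha> ^ ((CARD('a) - 1) div l) \<noteq> 1"
  shows "primitive_elem \<alpha>"
proof -
  define N where "N = CARD('a) - 1"
  have N0: "N > 0" using card_finite_field_gt_1[where 'a='a] by (simp add: N_def)
  have aN: "\<alpha> ^ N = 1"
    using finite_field_subset_power_eq_1[of UNIV \<alpha>] nz by (simp add: is_subfield_def N_def)
  have no: "\<alpha> ^ j \<noteq> 1" if j: "0 < j" "j < N" for j
  proof
    assume aj: "\<alpha> ^ j = 1"
    define g where "g = gcd j N"
    obtain u v where uv: "j * u = N * v + g" using bezout_nat[of j N] j by (auto simp: g_def)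
    have "\<alpha> ^ (j * u) = \<alpha> ^ (N * v + g)" by (simp only: uv)
    hence ag: "\<alpha> ^ g = 1" by (simp add: power_mult power_add aj aN)
    have "g dvd N" "g \<le> j" using j by (auto simp: g_def intro: dvd_imp_le)
    then obtain h where h: "N = g * h" by (elim dvdE)
    have "h \<noteq> 1" using h \<open>g \<le> j\<close> j by auto
    then obtain l where l: "prime l" "l dvd h" using prime_factor_nat by blast
    then obtain h' where h': "h = l * h'" by (elim dvdE)
    have "l > 0" using l prime_gt_0_nat by blast
    hence "N div l = g * h'" unfolding h h' by (simp add: mult.left_commute)
    hence "\<alpha> ^ (N div l) = 1" by (simp add: power_mult ag)
    moreover have "l dvd N" unfolding h h' by simp
    ultimately show False using pr l(1) by (simp add: N_def)
  qed
  have "inj_on (\<lambda>i. \<alpha> ^ i) {..<N}"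
  proof (rule linorder_inj_onI')
    fix i j assume ij: "i \<in> {..<N}" "j \<in> {..<N}" "i < j"
    have "\<alpha> ^ j = \<alpha> ^ i * \<alpha> ^ (j - i)" using ij by (simp flip: power_add)
    moreover have "\<alpha> ^ (j - i) \<noteq> 1" using ij by (intro no) auto
    ultimately show "\<alpha> ^ i \<noteq> \<alpha> ^ j" using nz by auto
  qed
  hence "card ((\<lambda>i. \<alpha> ^ i) ` {..<N}) = card (UNIV - {0 :: 'a})"
    by (simp add: card_image N_def card_Diff_singleton)
  moreover have "(\<lambda>i. \<alpha> ^ i) ` {..<N} \<subseteq> UNIV - {0}" using nz by auto
  ultimately have "(\<lambda>i. \<alpha> ^ i) ` {..<N} = UNIV - {0}" by (intro card_subset_eq) auto
  moreover have "(\<lambda>i. \<alpha> ^ i) ` {..<N} \<subseteq> range (\<lambda>i::int. \<alpha> powi i)"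
    by (auto simp flip: power_int_of_nat)
  moreover have "range (\<lambda>i::int. \<alpha> powi i) \<subseteq> UNIV - {0}" using nz by auto
  ultimately show ?thesis unfolding primitive_elem_def by blast
qed

text \<open>Independence makes the q ^ m linear combinations distinct, so they fill the
  field.\<close>

lemma basis_overI:
  fixes v :: "nat \<Rightarrow> 'a::finite_field"
  assumes F: "is_subfield F" "card F = q" and card: "CARD('a) = q ^ m"
    and ind: "\<And>c. (\<And>i. i < m \<Longrightarrow> c i \<in> F) \<Longrightarrow> (\<Sum>i<m. c i * v i) = 0 \<Longrightarrow> \<forall>i<m. c i = 0"
  shows "basis_over F m v"
proof -
  define \<Phi> where "\<Phi> = (\<lambda>c. \<Sum>i<m. c i * v i)"
  have "inj_on \<Phi> (PiE {..<m} (\<lambda>_. F))"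
  proof (rule inj_onI)
    fix c d assume cd: "c \<in> PiE {..<m} (\<lambda>_. F)" "d \<in> PiE {..<m} (\<lambda>_. F)" "\<Phi> c = \<Phi> d"
    have "c i - d i \<in> F" if "i < m" for i
    proof -
      have "c i \<in> F" "d i \<in> F" using cd that by auto
      hence "c i + - d i \<in> F" using F unfolding is_subfield_def by blast
      thus ?thesis by simp
    qed
    moreover have "(\<Sum>i<m. (c i - d i) * v i) = 0"
      using cd(3) by (simp add: \<Phi>_def left_diff_distrib sum_subtractf)
    ultimately have "\<forall>i<m. c i - d i = 0" by (rule ind)
    thus "c = d" using cd by (intro PiE_ext[of c "{..<m}" "\<lambda>_. F" d]) auto
  qed
  hence "card (\<Phi> ` PiE {..<m} (\<lambda>_. F)) = CARD('a)" by (simp add: card_image card_PiE F card)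
  hence "\<Phi> ` PiE {..<m} (\<lambda>_. F) = UNIV" by (intro card_subset_eq) auto
  hence "\<exists>c. (\<forall>i<m. c i \<in> F) \<and> \<beta> = (\<Sum>i<m. c i * v i)" for \<beta>
  proof -
    assume "\<Phi> ` PiE {..<m} (\<lambda>_. F) = UNIV"
    then obtain c where "c \<in> PiE {..<m} (\<lambda>_. F)" "\<beta> = \<Phi> c" by blast
    thus ?thesis by (intro exI[of _ c]) (auto simp: \<Phi>_def)
  qed
  thus ?thesis using ind unfolding basis_over_def by blast
qed

lemma range_to_ac_FF:
  fixes T :: "'a::finite_field itself"
  assumes "prime p" "CARD('a) = p ^ e" "e > 0"
  shows "range (to_ac :: 'a \<Rightarrow> _) = FF (p ^ e)"
proof -
  interpret pchar p "TYPE('a alg_closure)"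
    using assms CHAR_finite_field[where 'a='a, of p e] by unfold_locales auto
  have "x ^ CARD('a) = x" for x :: 'a
  proof (cases "x = 0")
    case False
    have "x ^ (CARD('a) - 1) = 1"
      using finite_field_subset_power_eq_1[of UNIV x] False by (simp add: is_subfield_def)
    thus ?thesis using card_finite_field_gt_1[where 'a='a] power_minus_mult[of "CARD('a)" x] by simp
  qed (use card_finite_field_gt_1[where 'a='a] in auto)
  hence "range (to_ac :: 'a \<Rightarrow> _) \<subseteq> FF (p ^ e)" by (auto simp: FF_def assms simp flip: to_ac_power)
  moreover have "card (range (to_ac :: 'a \<Rightarrow> _)) = card (FF (p ^ e) :: 'a alg_closure set)"
    using card_FF[OF assms(3)] assms(2) by (simp add: card_image inj_to_ac)
  ultimately show ?thesis using card_subset_eq[OF finite_FF[OF assms(3)]] by blast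
qed

lemma normal_elemI:
  fixes \<alpha> :: "'a::finite_field"
  assumes p: "prime p" and card: "CARD('a) = p ^ (k * m)" and km: "k > 0" "m > 0"
    and nU: "\<And>A. A \<in> pchar.orbits p k m \<Longrightarrow> to_ac \<alpha> \<notin> pchar.UA p k m A"
  shows "normal_elem (p ^ k) m \<alpha>"
proof -
  interpret pchar p "TYPE('a alg_closure)"
    using p CHAR_finite_field[where 'a='a, OF p card] by unfold_locales auto
  have km0: "k * m > 0" using km by simp
  have pp: "primepow (p ^ k)" using p km by (auto simp: primepow_def)
  have card': "CARD('a) = (p ^ k) ^ m" using card by (simp add: power_mult)
  have F: "GF_sub (p ^ k) = {x :: 'a. x ^ (p ^ k) = x}" by (rule GF_sub_eq[OF pp card'])
  have xF: "to_ac \<alpha> \<in> FF (p ^ (k * m))" using range_to_ac_FF[OF p card km0] by blast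
  show ?thesis unfolding normal_elem_def
  proof (rule basis_overI[of _ "p ^ k"])
    show "is_subfield (GF_sub (p ^ k) :: 'a set)" "card (GF_sub (p ^ k) :: 'a set) = p ^ k"
      using is_subfield_Frobenius[OF pp card'] unfolding F by auto
    fix c :: "nat \<Rightarrow> 'a" assume c: "\<And>i. i < m \<Longrightarrow> c i \<in> GF_sub (p ^ k)" and s: "(\<Sum>i<m. c i * \<alpha> ^ (p ^ k) ^ i) = 0"
    define g where "g = (\<Sum>i<m. monom (to_ac (c i)) i)"
    have cg: "coeff g i = (if i < m then to_ac (c i) else 0)" for i
      unfolding g_def coeff_sum by simp
    have gF: "polyF (p ^ k) g"
      unfolding polyF_def cg using c p1 by (auto simp: F FF_def simp flip: to_ac_power)
    have dg: "degree g < m"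
    proof -
      have "degree g \<le> m - 1" by (rule degree_le) (auto simp: cg)
      thus ?thesis using km by simp
    qed
    have "lin k g (to_ac \<alpha>) = (\<Sum>i\<le>m - 1. coeff g i * to_ac \<alpha> ^ (p ^ (k * i)))"
      using dg by (intro lin_le) simp
    also have "{..m - 1} = {..<m}" using km by auto
    also have "(\<Sum>i<m. coeff g i * to_ac \<alpha> ^ (p ^ (k * i))) = to_ac (\<Sum>i<m. c i * \<alpha> ^ (p ^ k) ^ i)"
      by (simp add: cg to_ac_sum power_mult)
    finally have "lin k g (to_ac \<alpha>) = 0" using s by simp
    hence "g = 0" using normal_criterion[OF km(2) xF nU gF _ dg] by blast
    thus "\<forall>i<m. c i = 0" using cg by (metis coeff_0 to_ac_eq_0_iff)
  qed (rule card')
qed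

lemma map_to_ac_inj: "map_poly to_ac f = map_poly to_ac g \<Longrightarrow> f = g"
  by (rule poly_eqI) (metis coeff_map_poly to_ac_0 to_ac_eq_iff)

lemma poly_alg_closed_product:
  fixes g :: "'k::alg_closed_field poly"
  assumes "g \<noteq> 0"
  shows "g = smult (lead_coeff g) (\<Prod>x\<in>#proots g. [:-x, 1:])"
proof -
  obtain A where A: "g = smult (lead_coeff g) (\<Prod>x\<in>#A. [:-x, 1:])"
    using alg_closed_imp_factorization[OF assms] by blast
  have "proots g = proots (\<Prod>x\<in>#A. [:-x, 1:])" by (subst A) (use assms in auto)
  also have "\<dots> = A" by (induction A) (simp_all add: proots_mult image_iff del: mult_pCons_left)
  finally show ?thesis using A by simp
qed

lemma monom_if_no_root:
  fixes f :: "'a::field poly"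
  assumes f: "f \<noteq> 0" and nr: "\<And>x. poly (map_poly to_ac f) x = 0 \<Longrightarrow> x = 0"
  shows "f = monom (lead_coeff f) (degree f)"
proof (rule map_to_ac_inj)
  let ?g = "map_poly to_ac f"
  have g0: "?g \<noteq> 0" using map_to_ac_inj[of f 0] f by auto
  have "(\<Prod>x\<in>#proots ?g. [:-x, 1:]) = (\<Prod>x\<in>#proots ?g. [:0, 1:])"
  proof (intro arg_cong[of _ _ prod_mset] image_mset_cong)
    fix x assume "x \<in># proots ?g"
    hence "x = 0" using nr g0 by simp
    thus "[:-x, 1:] = [:0, 1:]" by simp
  qed
  also have "\<dots> = [:0, 1:] ^ degree f"
    by (simp add: size_proots_alg_closed degree_map_to_ac)
  finally have "?g = smult (to_ac (lead_coeff f)) ([:0, 1:] ^ degree f)"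
    using poly_alg_closed_product[OF g0] by (simp add: degree_map_to_ac coeff_map_poly)
  also have "\<dots> = map_poly to_ac (monom (lead_coeff f) (degree f))"
  proof -
    have "[:0, 1:] ^ degree f = (monom 1 (degree f) :: 'a alg_closure poly)" by (simp add: monom_altdef)
    thus ?thesis by (simp add: map_poly_monom smult_monom)
  qed
  finally show "?g = map_poly to_ac (monom (lead_coeff f) (degree f))" .
qed

lemma poly_eq_prod_simple_roots:
  fixes g :: "'k::alg_closed_field poly"
  assumes g: "g \<noteq> 0" and simple: "\<And>\<rho>. \<rho> \<noteq> 0 \<Longrightarrow> poly g \<rho> = 0 \<Longrightarrow> order \<rho> g = 1"
  shows "poly g x = lead_coeff g * (-1) ^ card {\<rho>. \<rho> \<noteq> 0 \<and> poly g \<rho> = 0} * x ^ order 0 g *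
    (\<Prod>\<rho> | \<rho> \<noteq> 0 \<and> poly g \<rho> = 0. \<rho> - x)"
proof -
  let ?R = "{\<rho>. \<rho> \<noteq> 0 \<and> poly g \<rho> = 0}"
  have fin: "finite ?R" using poly_roots_finite[OF g] by (rule rev_finite_subset) auto
  have "poly g x = lead_coeff g * (\<Prod>\<rho>\<in>#proots g. x - \<rho>)"
    by (subst poly_alg_closed_product[OF g]) (simp add: poly_prod_mset image_mset.compositionality o_def)
  also have "(\<Prod>\<rho>\<in>#proots g. x - \<rho>) = (\<Prod>\<rho>\<in>{\<rho>. poly g \<rho> = 0}. (x - \<rho>) ^ order \<rho> g)"
    using g by (simp add: image_prod_mset_multiplicity)
  also have "\<dots> = (\<Prod>\<rho>\<in>insert 0 ?R. (x - \<rho>) ^ order \<rho> g)"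
    using g fin by (intro prod.mono_neutral_left) (auto simp: order_root)
  also have "\<dots> = x ^ order 0 g * (\<Prod>\<rho>\<in>?R. (x - \<rho>) ^ order \<rho> g)"
    using fin by (subst prod.insert) auto
  also have "(\<Prod>\<rho>\<in>?R. (x - \<rho>) ^ order \<rho> g) = (\<Prod>\<rho>\<in>?R. (-1) * (\<rho> - x))"
    by (intro prod.cong refl) (simp add: simple)
  also have "\<dots> = (-1) ^ card ?R * (\<Prod>\<rho>\<in>?R. \<rho> - x)" unfolding prod.distrib by simp
  finally show ?thesis by (simp add: mult_ac)
qed

text \<open>A quadratic with a double root has no other root, so Frobenius fixes it and it lies in
  the base field. As numerator or denominator over a constant partner it makes the function
  exceptional with d = 2.\<close>

lemma (in pchar) double_root_square:
  fixes f :: "'a::field poly"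
  assumes f: "f \<noteq> 0" "degree f \<le> 2" and F: "range (to_ac :: 'a \<Rightarrow> _) = FF (p ^ e)" and K: "CHAR('a alg_closure) = p"
    and root: "poly (map_poly to_ac f) \<rho> = 0" "order \<rho> (map_poly to_ac f) \<noteq> 1"
  obtains r where "f = smult (lead_coeff f) ([:-r, 1:] ^ 2)" "degree f = 2"
proof -
  interpret pc: pchar p "TYPE('a alg_closure)" using p K by unfold_locales auto
  let ?g = "map_poly to_ac f"
  have g0: "?g \<noteq> 0" using map_to_ac_inj[of f 0] f by auto
  have "order \<rho> ?g \<noteq> 0" using root(1) g0 by (simp add: order_root)
  hence o2: "order \<rho> ?g \<ge> 2" using root(2) by linarith
  have df: "degree f = 2" using o2 order_degree[OF g0, of \<rho>] f(2) by (simp add: degree_map_to_ac)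
  have "[:-\<rho>, 1:] ^ 2 dvd ?g" using o2 by (simp add: order_divides)
  then obtain h where h: "?g = [:-\<rho>, 1:] ^ 2 * h" by (elim dvdE)
  have "h \<noteq> 0" using h g0 by auto
  hence "degree ?g = 2 + degree h" unfolding h by (subst degree_mult_eq) (auto simp: degree_linear_power)
  hence "degree h = 0" using df by (simp add: degree_map_to_ac)
  then obtain c where c: "h = [:c:]" by (elim degree_eq_zeroE)
  have ge: "?g = smult c ([:-\<rho>, 1:] ^ 2)" using h c by simp
  have "c = lead_coeff ?g" unfolding ge by (simp add: lead_coeff_power)
  also have "\<dots> = to_ac (lead_coeff f)" by (simp add: degree_map_to_ac coeff_map_poly)
  finally have c': "c = to_ac (lead_coeff f)" .
  have gF: "polyF (p ^ e) ?g" unfolding polyF_def using F by (auto simp: coeff_map_poly)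
  have "order (\<rho> ^ (p ^ e)) ?g \<noteq> 0" using pc.order_frob_le[OF gF g0, of \<rho> 1] o2 by simp
  hence "poly ?g (\<rho> ^ (p ^ e)) = 0" by (simp add: order_root)
  moreover have "c \<noteq> 0" using ge g0 by auto
  ultimately have "\<rho> ^ (p ^ e) = \<rho>" unfolding ge by simp
  hence "\<rho> \<in> FF (p ^ e)" by (simp add: FF_def)
  then obtain r where r: "\<rho> = to_ac r" using F by blast
  have "f = smult (lead_coeff f) ([:-r, 1:] ^ 2)"
    by (rule map_to_ac_inj, subst ge) (simp add: c' r power2_eq_square map_poly_pCons map_poly_smult)
  thus ?thesis using that df by blast
qed

section \<open>Exceptional functions of low degree and the passage to rational functions\<close>

lemma ratfun_X_power: "ratfun_X ^ i = Fract (monom 1 i) 1"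
  by (induction i) (simp_all add: ratfun_X_def One_fract_def monom_Suc monom_0 one_pCons mult.commute)

text \<open>With g = 1 the exponent d is free; \<open>CARD('a) - 1\<close> exceeds 1 by
  assumption.\<close>

lemma exceptional_monom:
  fixes c :: "'a::finite_field"
  assumes "CARD('a) > 2"
  shows "exceptional (Fract (monom c i) (monom 1 j))"
proof -
  have X0: "ratfun_X \<noteq> (0 :: 'a poly fract)" by (simp add: ratfun_X_def Zero_fract_def eq_fract)
  have "Fract (monom c i) (monom 1 j) = ratfun_const c * (ratfun_X ^ i / ratfun_X ^ j)"
    unfolding ratfun_X_power ratfun_const_def divide_inverse by (simp add: smult_monom)
  also have "\<dots> = ratfun_const c * ratfun_X powi (int i - int j) * 1 ^ (CARD('a) - 1)"
    using X0 by (simp add: power_int_diff)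
  finally show ?thesis unfolding exceptional_def using assms
    by (intro disjI1 exI[of _ c] exI[of _ "int i - int j"] exI[of _ 1] exI[of _ "CARD('a) - 1"]) auto
qed

lemma exceptional_square:
  fixes c :: "'a::finite_field"
  assumes "odd CARD('a)"
  shows "exceptional (ratfun_const c * g ^ 2)"
  unfolding exceptional_def using assms
  by (intro disjI1 exI[of _ c] exI[of _ 0] exI[of _ g] exI[of _ 2]) auto

text \<open>In total degree 2, excluding exceptional functions leaves exactly what
  \<open>pair_exists_rational\<close> asks for: nonzero zeros and poles are simple and disjoint, and
  there is at least one.\<close>

theorem sieve_ok_imp_T_total:
  assumes pr: "prime p" "odd p" and card: "CARD('a::finite_field) = p ^ (k * m)"
    and ok: "pchar.sieve_ok TYPE('a alg_closure) p k m"
  shows "(p ^ k, m) \<in> T_total TYPE('a) 2"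
proof -
  interpret pchar p "TYPE('a alg_closure)"
    using pr CHAR_finite_field[where 'a='a, OF pr(1) card] by unfold_locales auto
  have km: "k > 0" "m > 0" using ok by (auto simp: sieve_ok_def)
  define e where "e = k * m"
  have e: "e > 0" using km by (simp add: e_def)
  have cardQ: "CARD('a) = p ^ e" using card by (simp add: e_def)
  have oddc: "odd CARD('a)" using pr(2) cardQ by simp
  have c2: "CARD('a) > 2" using oddc card_finite_field_gt_1[where 'a='a] by (cases "CARD('a) = 2") auto
  have F: "range (to_ac :: 'a \<Rightarrow> _) = FF (p ^ e)" by (rule range_to_ac_FF[OF pr(1) cardQ e])
  have pp: "primepow (p ^ k)" using pr km by (auto simp: primepow_def)
  have card': "CARD('a) = (p ^ k) ^ m" using card by (simp add: power_mult)
  have sub: "GF_sub (p ^ k) = {x :: 'a. x ^ (p ^ k) = x}" by (rule GF_sub_eq[OF pp card'])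
  have "(p ^ k, m) \<in> T_set TYPE('a) n1 n2" if n: "n1 + n2 = 2" for n1 n2
  proof -
    have "\<exists>\<alpha>. normal_elem (p ^ k) m \<alpha> \<and> primitive_pair \<alpha> f \<and> field_trace (p ^ k) m (inverse \<alpha>) = a"
      if f: "f \<in> S_set n1 n2" and a: "a \<in> GF_sub (p ^ k)" for f :: "'a poly fract" and a
    proof -
      obtain f1 f2 where rf: "reduced_form f f1 f2" and deg: "degree f1 \<le> n1" "degree f2 \<le> n2" and ne: "\<not> exceptional f"
        using f by (auto simp: S_set_def)
      have ff: "f = Fract f1 f2" "f1 \<noteq> 0" "f2 \<noteq> 0" "coprime f1 f2" "lead_coeff f2 = 1"
        using rf by (auto simp: reduced_form_def)
      define g1 where "g1 = map_poly to_ac f1"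
      define g2 where "g2 = map_poly to_ac f2"
      have g0: "g1 \<noteq> 0" "g2 \<noteq> 0" using map_to_ac_inj[of _ 0] ff by (auto simp: g1_def g2_def)
      have gF: "polyF (p ^ e) g1" "polyF (p ^ e) g2"
        unfolding polyF_def g1_def g2_def using F by (auto simp: coeff_map_poly)
      define R1 where "R1 = {\<rho>. \<rho> \<noteq> 0 \<and> poly g1 \<rho> = 0}"
      define R2 where "R2 = {\<rho>. \<rho> \<noteq> 0 \<and> poly g2 \<rho> = 0}"
      have deg2: "degree f1 + degree f2 \<le> 2" using deg n by linarith
      have simple1: "order \<rho> g1 = 1" if rt: "\<rho> \<noteq> 0" "poly g1 \<rho> = 0" for \<rho>
      proof (rule ccontr)
        assume od: "order \<rho> g1 \<noteq> 1"
        have d: "degree f1 \<le> 2" using deg2 by linarith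
        then obtain r where r: "f1 = smult (lead_coeff f1) ([:-r, 1:] ^ 2)" "degree f1 = 2"
          using double_root_square[OF ff(2) d F _ rt(2)[unfolded g1_def] od[unfolded g1_def]] CHAR by auto
        have "degree f2 = 0" using r deg2 by simp
        then obtain b where "f2 = [:b:]" by (elim degree_eq_zeroE)
        hence f2: "f2 = 1" using ff(5) by (simp add: one_pCons)
        have "f = ratfun_const (lead_coeff f1) * Fract [:-r, 1:] 1 ^ 2"
          unfolding ff(1) f2 ratfun_const_def power2_eq_square by (subst r(1)) (simp add: power2_eq_square mult_ac)
        thus False using exceptional_square[OF oddc] ne by simp
      qed
      have simple2: "order \<rho> g2 = 1" if rt: "\<rho> \<noteq> 0" "poly g2 \<rho> = 0" for \<rho>
      proof (rule ccontr)
        assume od: "order \<rho> g2 \<noteq> 1"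
        have d: "degree f2 \<le> 2" using deg2 by linarith
        then obtain r where r: "f2 = smult (lead_coeff f2) ([:-r, 1:] ^ 2)" "degree f2 = 2"
          using double_root_square[OF ff(3) d F _ rt(2)[unfolded g2_def] od[unfolded g2_def]] CHAR by auto
        have "degree f1 = 0" using r deg2 by simp
        then obtain b where f1: "f1 = [:b:]" by (elim degree_eq_zeroE)
        have f2: "f2 = [:-r, 1:] ^ 2" using r(1) ff(5) by simp
        have "f = ratfun_const b * Fract 1 [:-r, 1:] ^ 2"
          unfolding ff(1) f1 f2 ratfun_const_def power2_eq_square by simp
        thus False using exceptional_square[OF oddc] ne by simp
      qed
      \<comment> \<open>Coprimality is known over the base field only. A common root forces both
        degrees to be 1, so it lies in the base field and gives a common linear factor
        there.\<close>
      have dj: "\<not> (poly g1 \<rho> = 0 \<and> poly g2 \<rho> = 0)" for \<rho>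
      proof
        assume *: "poly g1 \<rho> = 0 \<and> poly g2 \<rho> = 0"
        have "degree g \<noteq> 0" if "poly g \<rho> = 0" "g \<noteq> 0" for g :: "'a alg_closure poly"
        proof
          assume "degree g = 0"
          then obtain b where "g = [:b:]" by (elim degree_eq_zeroE)
          thus False using that by simp
        qed
        hence "degree g1 \<noteq> 0" "degree g2 \<noteq> 0" using * g0 by auto
        hence d1: "degree f1 = 1" "degree f2 = 1" using deg2 by (auto simp: g1_def g2_def degree_map_to_ac)
        obtain b1 c1 where f1: "f1 = [:b1, c1:]" "c1 \<noteq> 0" by (rule degree1_coeffs[OF d1(1)])
        obtain b2 c2 where f2: "f2 = [:b2, c2:]" "c2 \<noteq> 0" by (rule degree1_coeffs[OF d1(2)])
        have "to_ac b1 + \<rho> * to_ac c1 = 0" "to_ac b2 + \<rho> * to_ac c2 = 0"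
          using * by (simp_all add: g1_def g2_def f1 f2 map_poly_pCons)
        hence "\<rho> = to_ac (- b1 / c1)" "\<rho> = to_ac (- b2 / c2)"
          using f1 f2 by (auto simp: field_simps eq_neg_iff_add_eq_0 add.commute)
        hence "poly f1 (- b1 / c1) = 0" "poly f2 (- b1 / c1) = 0"
          using * by (auto simp: g1_def g2_def poly_map_to_ac simp del: to_ac_divide to_ac_minus)
        hence "[:b1 / c1, 1:] dvd f1" "[:b1 / c1, 1:] dvd f2" by (auto simp: poly_eq_0_iff_dvd)
        hence "is_unit [:b1 / c1, 1:]" using ff(4) by (rule coprime_common_divisor[rotated])
        thus False by (auto simp: is_unit_poly_iff)
      qed
      \<comment> \<open>Without nonzero roots f would be c * x ^ i, which is exceptional.\<close>
      have neR: "R1 \<union> R2 \<noteq> {}"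
      proof
        assume "R1 \<union> R2 = {}"
        hence "f1 = monom (lead_coeff f1) (degree f1)" "f2 = monom (lead_coeff f2) (degree f2)"
          by (intro monom_if_no_root ff; force simp: R1_def R2_def g1_def g2_def)+
        hence "f = Fract (monom (lead_coeff f1) (degree f1)) (monom 1 (degree f2))" using ff by metis
        thus False using exceptional_monom[OF c2] ne by metis
      qed
      have fin: "finite R1" "finite R2"
        using poly_roots_finite g0 unfolding R1_def R2_def by (auto intro: finite_subset[rotated])
      have cR: "card (R1 \<union> R2) \<le> 2"
      proof -
        have sub: "R1 \<subseteq> {x. poly g1 x = 0}" "R2 \<subseteq> {x. poly g2 x = 0}" by (auto simp: R1_def R2_def)
        have "card R1 \<le> degree g1" "card R2 \<le> degree g2"
          using card_mono[OF poly_roots_finite[OF g0(1)] sub(1)] card_mono[OF poly_roots_finite[OF g0(2)] sub(2)]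
            card_poly_roots_bound[OF g0(1)] card_poly_roots_bound[OF g0(2)] by linarith+
        hence "card R1 \<le> degree f1" "card R2 \<le> degree f2" by (simp_all add: g1_def g2_def degree_map_to_ac)
        thus ?thesis using card_Un_le[of R1 R2] deg2 by linarith
      qed
      have frob: "\<rho> ^ (p ^ e) \<in> {\<rho>. \<rho> \<noteq> 0 \<and> poly g \<rho> = 0}"
        if "\<rho> \<in> {\<rho>. \<rho> \<noteq> 0 \<and> poly g \<rho> = 0}" "polyF (p ^ e) g" "g \<noteq> 0" for \<rho> and g :: "'a alg_closure poly"
        using order_frob_le[OF that(2,3), of \<rho> 1] that(1,3) by (auto simp: order_root)
      define l1 where "l1 = lead_coeff g1 * (-1) ^ card R1"
      define l2 where "l2 = lead_coeff g2 * (-1) ^ card R2"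
      have l12: "l1 \<in> FF (p ^ e)" "l2 \<in> FF (p ^ e)" "l1 \<noteq> 0" "l2 \<noteq> 0"
        using gF g0 p1 unfolding l1_def l2_def by (auto simp: polyF_def intro!: FF_mult FF_power FF_uminus)
      have aF: "to_ac a \<in> FF (p ^ k)" using a by (simp add: sub FF_def flip: to_ac_power)
      \<comment> \<open>Collects the powers of x in numerator and denominator; the exponent p ^ e -
        2 inverts the latter.\<close>
      define ii where "ii = order 0 g1 + order 0 g2 * (p ^ e - 2)"
      have "\<exists>x\<in>FF (p ^ e). x \<noteq> 0 \<and> x \<notin> R1 \<union> R2 \<and> (\<Sum>i<m. (1 / x) ^ (p ^ (k * i))) = to_ac a \<and>
         (\<forall>l. prime l \<longrightarrow> l dvd p ^ e - 1 \<longrightarrow> x ^ ((p ^ e - 1) div l) \<noteq> 1 \<and>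
            (l1 / l2 * x ^ ii * (\<Prod>\<rho>\<in>R1. \<rho> - x) / (\<Prod>\<rho>\<in>R2. \<rho> - x)) ^ ((p ^ e - 1) div l) \<noteq> 1) \<and>
         (\<forall>A\<in>orbits k m. x \<notin> UA k m A)"
        unfolding e_def
      proof (rule pair_exists_rational[OF ok _ fin _ cR neR])
        show "R1 \<inter> R2 = {}" using dj by (auto simp: R1_def R2_def)
        show "0 \<notin> R1" "0 \<notin> R2" by (simp_all add: R1_def R2_def)
        show "2 < p ^ (k * m)" using c2 card by simp
        show "l1 / l2 \<in> FF (p ^ (k * m))" "l1 / l2 \<noteq> 0" using l12 by (auto simp: e_def intro: FF_divide)
        show "\<And>\<rho>. \<rho> \<in> R1 \<Longrightarrow> \<rho> ^ p ^ (k * m) \<in> R1" "\<And>\<rho>. \<rho> \<in> R2 \<Longrightarrow> \<rho> ^ p ^ (k * m) \<in> R2"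
          using frob gF g0 unfolding R1_def R2_def e_def by blast+
      qed (rule aF)
      then obtain x where x: "x \<in> FF (p ^ e)" "x \<noteq> 0" "x \<notin> R1 \<union> R2" "(\<Sum>i<m. (1 / x) ^ (p ^ (k * i))) = to_ac a"
        "\<And>l. prime l \<Longrightarrow> l dvd p ^ e - 1 \<Longrightarrow> x ^ ((p ^ e - 1) div l) \<noteq> 1"
        "\<And>l. prime l \<Longrightarrow> l dvd p ^ e - 1 \<Longrightarrow> (l1 / l2 * x ^ ii * (\<Prod>\<rho>\<in>R1. \<rho> - x) / (\<Prod>\<rho>\<in>R2. \<rho> - x)) ^ ((p ^ e - 1) div l) \<noteq> 1"
        "\<And>A. A \<in> orbits k m \<Longrightarrow> x \<notin> UA k m A" by blast
      obtain \<alpha> :: 'a where \<alpha>: "x = to_ac \<alpha>" using x(1) F by blast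
      define \<beta> where "\<beta> = poly f1 \<alpha> / poly f2 \<alpha>"
      have nz1: "poly g1 x \<noteq> 0" and nz2: "poly g2 x \<noteq> 0" using x(2,3) by (auto simp: R1_def R2_def)
      hence nz: "poly f1 \<alpha> \<noteq> 0" "poly f2 \<alpha> \<noteq> 0" by (auto simp: g1_def g2_def \<alpha> poly_map_to_ac)
      have pg: "poly g1 x = l1 * x ^ order 0 g1 * (\<Prod>\<rho>\<in>R1. \<rho> - x)" "poly g2 x = l2 * x ^ order 0 g2 * (\<Prod>\<rho>\<in>R2. \<rho> - x)"
        unfolding l1_def l2_def R1_def R2_def
        using poly_eq_prod_simple_roots[OF g0(1) simple1] poly_eq_prod_simple_roots[OF g0(2) simple2] by blast+
      have inv: "inverse x = x ^ (p ^ e - 2)" using x c2 cardQ by (intro inverse_eq_power) auto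
      have xii: "x ^ ii = x ^ order 0 g1 / x ^ order 0 g2"
        unfolding ii_def divide_inverse power_inverse[symmetric] inv by (simp add: power_add mult.commute flip: power_mult)
      have "to_ac \<beta> = poly g1 x / poly g2 x" by (simp add: \<beta>_def g1_def g2_def \<alpha> poly_map_to_ac)
      hence \<beta>: "to_ac \<beta> = l1 / l2 * x ^ ii * (\<Prod>\<rho>\<in>R1. \<rho> - x) / (\<Prod>\<rho>\<in>R2. \<rho> - x)"
        unfolding pg xii by simp
      have "primitive_elem \<alpha>"
      proof (rule primitive_elemI)
        show "\<alpha> \<noteq> 0" using x(2) \<alpha> by auto
        fix l assume "prime l" "l dvd CARD('a) - 1"
        hence "to_ac (\<alpha> ^ ((CARD('a) - 1) div l)) \<noteq> 1" using x(5)[of l] by (simp add: \<alpha> cardQ)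
        thus "\<alpha> ^ ((CARD('a) - 1) div l) \<noteq> 1" by (metis to_ac_1)
      qed
      moreover have "primitive_elem \<beta>"
      proof (rule primitive_elemI)
        show "\<beta> \<noteq> 0" using nz by (simp add: \<beta>_def)
        fix l assume "prime l" "l dvd CARD('a) - 1"
        hence "to_ac (\<beta> ^ ((CARD('a) - 1) div l)) \<noteq> 1" using x(6)[of l] unfolding \<beta>[symmetric] by (simp add: cardQ)
        thus "\<beta> ^ ((CARD('a) - 1) div l) \<noteq> 1" by (metis to_ac_1)
      qed
      moreover have "ratfun_value f \<alpha> \<beta>" unfolding ratfun_value_def \<beta>_def using rf nz by blast
      moreover have "normal_elem (p ^ k) m \<alpha>" using normal_elemI[OF pr(1) card km] x(7) \<alpha> by blast
      moreover have "field_trace (p ^ k) m (inverse \<alpha>) = a"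
      proof -
        have "to_ac (field_trace (p ^ k) m (inverse \<alpha>)) = to_ac a"
          unfolding x(4)[symmetric] field_trace_def \<alpha> by (simp add: to_ac_sum power_mult divide_inverse)
        thus ?thesis by simp
      qed
      ultimately show ?thesis unfolding primitive_pair_def by blast
    qed
    thus ?thesis unfolding T_set_def using pp card' by blast
  qed
  thus ?thesis unfolding T_total_def by blast
qed

section \<open>Numerical criteria\<close>

lemma prod_primes_dvd:
  assumes "finite A" "\<And>l. l \<in> A \<Longrightarrow> prime l \<and> l dvd (N :: nat)"
  shows "\<Prod>A dvd N"
  using assms
proof (induction A rule: finite_induct)
  case (insert l A)
  have "coprime l (\<Prod>A)"
    using insert by (intro prod_coprime_right primes_coprime) auto
  thus ?case using insert by (simp add: divides_mult)
qed simp

text \<open>Distinct primes dividing \<open>c\<close> have a product of at most \<open>c\<close>. A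
  known factor \<open>D\<close> without large primes can be split off first, which may lower
  \<open>u\<close>.\<close>

lemma card_large_prime_divisors:
  fixes D c B u :: nat
  assumes N: "D * c > 0" "c < B ^ (u + 1)" and B: "B > 0" and D: "\<And>l. prime l \<Longrightarrow> l dvd D \<Longrightarrow> l < B"
  shows "card {l. prime l \<and> l dvd D * c \<and> l \<ge> B} \<le> u"
proof -
  let ?A = "{l. prime l \<and> l dvd D * c \<and> l \<ge> B}"
  have A: "prime l \<and> l dvd c" if "l \<in> ?A" for l
    using that D[of l] by (auto simp: prime_dvd_mult_iff not_less)
  have fin: "finite ?A" using N by (auto intro: finite_subset[OF _ finite_divisors_nat[of "D * c"]])
  have "B ^ card ?A \<le> \<Prod>?A" using prod_mono[of ?A "\<lambda>_. B" "\<lambda>l. l"] by simp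
  also have "\<dots> \<le> c" using prod_primes_dvd[OF fin A] N by (intro dvd_imp_le) auto
  also have "\<dots> < B ^ (u + 1)" by fact
  finally have *: "B ^ card ?A < B ^ (u + 1)" .
  show ?thesis
  proof (rule ccontr)
    assume "\<not> ?thesis"
    hence "B ^ (u + 1) \<le> B ^ card ?A" using B by (intro power_increasing) auto
    thus False using * by simp
  qed
qed

section \<open>Reciprocal sums over large primes\<close>

lemma sum_inverse_primes_le:
  fixes A :: "nat set" and B u :: nat
  assumes "finite A" "\<And>l. l \<in> A \<Longrightarrow> prime l \<and> l \<ge> B" "card A \<le> u" and B: "B > 0"
  shows "(\<Sum>l\<in>A. 1 / real l) \<le> u / B"
proof -
  have "(\<Sum>l\<in>A. 1 / real l) \<le> (\<Sum>l\<in>A. 1 / real B)"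
    using assms by (intro sum_mono frac_le) auto
  also have "\<dots> \<le> u / B" using assms by (simp add: divide_right_mono)
  finally show ?thesis .
qed

lemma card_rough_block: "card {x. 30 * b \<le> x \<and> x < 30 * b + 30 \<and> \<not> 2 dvd x \<and> \<not> 3 dvd x \<and> \<not> 5 dvd (x :: nat)} \<le> 8"
proof -
  let ?R = "{1, 7, 11, 13, 17, 19, 23, 29} :: nat set"
  have small: "\<forall>r\<in>set [2..<30]. 2 dvd r \<or> 3 dvd r \<or> 5 dvd r \<or> r \<in> ?R" by (simp add: upt_rec_numeral)
  have R: "r \<in> ?R" if "r < 30" "\<not> 2 dvd r" "\<not> 3 dvd r" "\<not> 5 dvd r" for r
  proof (cases "r = 0 \<or> r = 1")
    case False
    hence "r \<in> set [2..<30]" using that(1) unfolding set_upt atLeastLessThan_iff by linarith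
    thus ?thesis using small that(2-4) by blast
  qed (use that in auto)
  have "{x. 30 * b \<le> x \<and> x < 30 * b + 30 \<and> \<not> 2 dvd x \<and> \<not> 3 dvd x \<and> \<not> 5 dvd x} \<subseteq> (\<lambda>r. 30 * b + r) ` ?R"
  proof
    fix x assume x: "x \<in> {x. 30 * b \<le> x \<and> x < 30 * b + 30 \<and> \<not> 2 dvd x \<and> \<not> 3 dvd x \<and> \<not> 5 dvd x}"
    then obtain r where r: "x = 30 * b + r" using le_Suc_ex by blast
    have "\<not> d dvd r" if "d dvd 30 * b" "\<not> d dvd x" for d
      using that unfolding r by (simp only: dvd_add_right_iff) simp
    moreover have "2 dvd 30 * b" "3 dvd 30 * b" "5 dvd 30 * b" by (simp_all add: dvd_mult2)
    moreover have "\<not> 2 dvd x" "\<not> 3 dvd x" "\<not> 5 dvd x" using x by blast+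
    ultimately have "\<not> 2 dvd r" "\<not> 3 dvd r" "\<not> 5 dvd r" by blast+
    moreover have "r < 30" using x r by simp
    ultimately show "x \<in> (\<lambda>r. 30 * b + r) ` ?R" using R r by blast
  qed
  hence "card {x. 30 * b \<le> x \<and> x < 30 * b + 30 \<and> \<not> 2 dvd x \<and> \<not> 3 dvd x \<and> \<not> 5 dvd x} \<le> card ((\<lambda>r. 30 * b + r) ` ?R)"
    by (intro card_mono) auto
  also have "\<dots> \<le> card ?R" by (rule card_image_le) simp
  finally show ?thesis by simp
qed

lemma prime_not_dvd:
  assumes "prime l" "prime r" "r < (l :: nat)" shows "\<not> r dvd l"
  using assms primes_dvd_imp_eq by blast

text \<open>An interval of length 30 contains at most eight primes.\<close>

lemma sum_inverse_primes_blocks: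
  fixes A :: "nat set" and b u J :: nat
  assumes "finite A" "\<And>l. l \<in> A \<Longrightarrow> prime l \<and> l \<ge> 30 * b" "card A \<le> u" "b > 0" "8 * J \<le> u"
  shows "(\<Sum>l\<in>A. 1 / real l) \<le> (\<Sum>j<J. 8 / (30 * real (b + j))) + (real u - 8 * real J) / (30 * real (b + J))"
  using assms
proof (induction J arbitrary: A b u)
  case 0
  have "(\<Sum>l\<in>A. 1 / real l) \<le> u / (30 * b)" by (rule sum_inverse_primes_le) (use 0 in auto)
  thus ?case by simp
next
  case (Suc J)
  define A1 where "A1 = {l \<in> A. l < 30 * b + 30}"
  define A2 where "A2 = {l \<in> A. l \<ge> 30 * b + 30}"
  have fin: "finite A1" "finite A2" using Suc.prems(1) by (auto simp: A1_def A2_def)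
  have un: "A = A1 \<union> A2" "A1 \<inter> A2 = {}" by (auto simp: A1_def A2_def)
  define c where "c = card A1"
  have nd: "\<not> r dvd l" if "l \<in> A" "r \<in> {2, 3, 5}" for l r
    using Suc.prems(2)[OF that(1)] Suc.prems(4) that(2) by (intro prime_not_dvd) auto
  have "c \<le> card {x. 30 * b \<le> x \<and> x < 30 * b + 30 \<and> \<not> 2 dvd x \<and> \<not> 3 dvd x \<and> \<not> 5 dvd x}"
    unfolding c_def using nd Suc.prems(2) by (intro card_mono) (auto simp: A1_def)
  hence c: "c \<le> 8" using card_rough_block[of b] by linarith
  have cA: "card A = c + card A2" unfolding c_def using un fin by (metis card_Un_disjoint)
  have "(\<Sum>l\<in>A2. 1 / real l) \<le> (\<Sum>j<J. 8 / (30 * real (Suc b + j))) + (real (u - c) - 8 * real J) / (30 * real (Suc b + J))"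
    using fin cA c Suc.prems by (intro Suc.IH) (auto simp: A2_def)
  moreover have "(\<Sum>l\<in>A1. 1 / real l) \<le> c / (30 * b)"
    using sum_inverse_primes_le[of A1 "30 * b" c] fin Suc.prems by (auto simp: A1_def c_def)
  ultimately have "(\<Sum>l\<in>A. 1 / real l) \<le> c / (30 * real b) + ((\<Sum>j<J. 8 / (30 * real (Suc b + j))) + (real (u - c) - 8 * real J) / (30 * real (Suc b + J)))"
    unfolding un(1) sum.union_disjoint[OF fin un(2)] by simp
  also have "real (u - c) = real u - real c" using c Suc.prems by (simp add: of_nat_diff)
  \<comment> \<open>The estimate is largest when the first block is full: \<open>8 - c\<close>
    primes charged to the last block are exchanged for primes of the first, where the bound for the
    reciprocal is larger.\<close>
  also have "c / (30 * real b) + ((\<Sum>j<J. 8 / (30 * real (Suc b + j))) + (real u - real c - 8 * real J) / (30 * real (Suc b + J)))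
      \<le> 8 / (30 * real b) + ((\<Sum>j<J. 8 / (30 * real (Suc b + j))) + (real u - 8 - 8 * real J) / (30 * real (Suc b + J)))"
  proof -
    have "(8 - real c) / (30 * real (Suc b + J)) \<le> (8 - real c) / (30 * real b)"
      using c Suc.prems(4) by (intro divide_left_mono) auto
    thus ?thesis by (simp add: diff_divide_distrib)
  qed
  also have "\<dots> = (\<Sum>j<Suc J. 8 / (30 * real (b + j))) + (real u - 8 * real (Suc J)) / (30 * real (b + Suc J))"
    unfolding sum.lessThan_Suc_shift by (simp add: algebra_simps)
  finally show ?case .
qed

section \<open>The sieve condition from explicit parameters\<close>

context pchar
begin

text \<open>An orbit has one element iff its root of unity lies in \<open>FF (p ^ k)\<close>, that
  is, iff its order divides both m and p ^ k - 1. The other orbits have at least two elements each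
  and share the rest of the at most m roots.\<close>

lemma orbits_by_size:
  fixes k m :: nat
  assumes k: "k > 0" and m: "m > 0"
  defines "S1 \<equiv> {A \<in> orbits k m :: 'k set set. card A = 1}" and "S2 \<equiv> {A \<in> orbits k m :: 'k set set. card A \<noteq> 1}"
  shows "card S1 = gcd m (p ^ k - 1)" "2 * card S2 + gcd m (p ^ k - 1) \<le> m" "\<And>A. A \<in> S2 \<Longrightarrow> card A \<ge> 2"
    "S1 \<union> S2 = orbits k m" "S1 \<inter> S2 = {}" "finite S1" "finite S2"
    "(\<Sum>A\<in>S2. card A) + gcd m (p ^ k - 1) \<le> m"
proof -
  define g where "g = gcd m (p ^ k - 1)"
  have fin: "finite S1" "finite S2" using orbits_finite(1)[OF m] by (auto simp: S1_def S2_def)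
  thus "finite S1" "finite S2" .
  show un: "S1 \<union> S2 = orbits k m" and dj: "S1 \<inter> S2 = {}" by (auto simp: S1_def S2_def)
  have pos: "card A \<ge> 1" if "A \<in> orbits k m" for A :: "'k set"
    using orbits_finite(2)[OF m that] by (simp add: Suc_le_eq card_gt_0_iff)
  show s2: "card A \<ge> 2" if "A \<in> S2" for A using pos[of A] that by (auto simp: S2_def)
  have q1: "p ^ k > 1" using p1 k by (metis one_less_power)
  have "S1 = (\<lambda>x. {x}) ` {x :: 'k. x ^ g = 1}"
  proof (intro equalityI subsetI)
    fix A assume "A \<in> S1"
    then obtain x where x: "x ^ m = 1" "A = orb k x" "card A = 1" by (auto simp: S1_def orbits_def)
    obtain y where "A = {y}" using x(3) by (rule card_1_singletonE)
    moreover have "x \<in> A" using orb_self x by simp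
    ultimately have Ax: "A = {x}" by simp
    have "x ^ (p ^ (k * 1)) \<in> A" unfolding x(2) orb_def by (rule rangeI)
    hence "x \<in> FF (p ^ k)" using Ax by (simp add: FF_def)
    moreover have "x \<noteq> 0" using x(1) m by (auto simp: power_0_left)
    ultimately have xq: "x ^ (p ^ k - 1) = 1" using q1 p1 by (intro FF_power_minus_1) auto
    obtain u v where "m * u = (p ^ k - 1) * v + g" using bezout_nat[of m "p ^ k - 1"] m by (auto simp: g_def)
    hence "x ^ (m * u) = x ^ ((p ^ k - 1) * v + g)" by simp
    hence "x ^ g = 1" using x(1) xq by (simp only: power_add power_mult) simp
    thus "A \<in> (\<lambda>x. {x}) ` {x. x ^ g = 1}" using Ax by blast
  next
    fix A assume "A \<in> (\<lambda>x. {x}) ` {x :: 'k. x ^ g = 1}"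
    then obtain x :: 'k where x: "A = {x}" "x ^ g = 1" by blast
    have pw: "x ^ j = 1" if "g dvd j" for j using that x(2) by (auto elim!: dvdE simp: power_mult)
    have "x ^ (p ^ k - 1) = 1" by (rule pw) (simp add: g_def)
    hence "x * x ^ (p ^ k - 1) = x" by simp
    moreover have "x ^ (p ^ k) = x * x ^ (p ^ k - 1)" using power_minus_mult[of "p ^ k" x] p1 by (simp add: mult.commute)
    ultimately have "x ^ (p ^ k) = x" by simp
    hence "x \<in> FF (p ^ k)" by (simp add: FF_def)
    hence "x ^ (p ^ (k * i)) = x" for i using FF_powD[of x "p ^ k" i] by (simp add: power_mult)
    hence "orb k x = {x}" by (auto simp: orb_def)
    moreover have "x ^ m = 1" by (rule pw) (simp add: g_def)
    ultimately show "A \<in> S1" unfolding S1_def orbits_def using x by force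
  qed
  moreover have "card {x :: 'k. x ^ g = 1} = g"
  proof (rule card_roots_of_unity)
    show "g > 0" using m by (simp add: g_def)
    show "\<not> p dvd g"
    proof
      assume "p dvd g"
      hence "p dvd p ^ k - 1" unfolding g_def by (meson dvd_trans gcd_dvd2)
      thus False using p_coprime_minus_1[OF k] by simp
    qed
  qed
  ultimately show c1: "card S1 = gcd m (p ^ k - 1)" by (simp add: card_image g_def)
  have "(\<Sum>A\<in>orbits k m. card A) = card (\<Union>(orbits k m :: 'k set set))"
    using orbits_finite(2)[OF m] orbits_disjoint[OF m] by (intro card_Union_disjoint[symmetric]) (auto simp: pairwise_def disjnt_def)
  also have "\<dots> \<le> card {x :: 'k. x ^ m = 1}"
    using orbits_finite(2)[OF m] finite_roots_unity[OF m] by (intro card_mono) auto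
  also have "\<dots> \<le> m"
    using card_poly_roots_bound[OF xm1(1)[OF m]] by (simp add: poly_xm1 xm1(2)[OF m])
  finally have "(\<Sum>A\<in>S1. card A) + (\<Sum>A\<in>S2. card A) \<le> m"
    unfolding un[symmetric] by (simp add: sum.union_disjoint fin dj)
  moreover have "(\<Sum>A\<in>S1. card A) = card S1" by (simp add: S1_def)
  ultimately show le: "(\<Sum>A\<in>S2. card A) + gcd m (p ^ k - 1) \<le> m" using c1 by simp
  have "2 * card S2 = (\<Sum>A\<in>S2. 2)" by simp
  also have "\<dots> \<le> (\<Sum>A\<in>S2. card A)" using s2 by (intro sum_mono)
  finally show "2 * card S2 + gcd m (p ^ k - 1) \<le> m" using le by linarith
qed

text \<open>\<open>C\<close> and \<open>S\<close> contain the prime divisors of \<open>p ^ (k * m) - 1\<close> below \<open>B\<close>; only those in \<open>S\<close> and the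
  primes from \<open>B\<close> on (at most \<open>u\<close>) are sieved.\<close>

lemma sieve_okI:
  fixes C S :: "nat set" and Z loss h :: real and g sO u B :: nat
  assumes k: "k > 0" and m: "m > 0" and B: "B > 0" and fin: "finite C" "finite S"
    and known: "\<And>l. prime l \<Longrightarrow> l dvd p ^ (k * m) - 1 \<Longrightarrow> l < B \<Longrightarrow> l \<in> C \<union> S"
    and u: "D * c = p ^ (k * m) - 1" "c < B ^ (u + 1)" "\<And>l. prime l \<Longrightarrow> l dvd D \<Longrightarrow> l < B"
    and h: "\<And>A. finite A \<Longrightarrow> (\<And>l. l \<in> A \<Longrightarrow> prime l \<and> l \<ge> B) \<Longrightarrow> card A \<le> u \<Longrightarrow> (\<Sum>l\<in>A. 1 / real l) \<le> h"
    and O: "O0 \<union> O1 = (orbits k m :: 'k set set)" "O0 \<inter> O1 = {}"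
    and g: "card O0 \<le> g" and sO: "card O1 \<le> sO" and loss: "(\<Sum>A\<in>O1. 1 / real p ^ (k * card A)) \<le> loss"
    and s: "s = 2 * (card S + u) + sO" "s \<ge> 2" and Z: "Z > 2" "real s - 1 \<le> (Z - 2) * (1 - 2 * (\<Sum>l\<in>S. 1 / real l) - 2 * h - loss)"
    and big: "(4 * real p ^ k * 2 ^ (2 * card C + g) * Z)\<^sup>2 \<le> real p ^ (k * m)"
  shows "sieve_ok k m"
proof -
  define N where "N = p ^ (k * m) - 1"
  have "p ^ (k * m) > 1" using p1 k m by (intro one_less_power) auto
  hence N: "N > 0" by (simp add: N_def)
  have DN: "D * c = N" using u by (simp add: N_def)
  define LL where "LL = {l. prime l \<and> l dvd N}"
  have fL: "finite LL" using N by (auto simp: LL_def intro: finite_subset[OF _ finite_divisors_nat[of N]])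
  define L0 where "L0 = LL \<inter> C"
  define L1 where "L1 = LL - C"
  define H where "H = {l. prime l \<and> l dvd N \<and> l \<ge> B}"
  have fH: "finite H" using fL by (rule rev_finite_subset) (auto simp: H_def LL_def)
  have cH: "card H \<le> u" 
  proof -
    have "D * c > 0" using N DN by simp
    from card_large_prime_divisors[OF this u(2) B u(3)] show ?thesis by (simp add: H_def DN)
  qed
  have L1: "L1 \<subseteq> S \<union> H" 
  proof
    fix l assume "l \<in> L1"
    hence l: "prime l" "l dvd N" "l \<notin> C" by (auto simp: L1_def LL_def)
    show "l \<in> S \<union> H"
    proof (cases "l < B")
      case True
      thus ?thesis using known[OF l(1) l(2)[unfolded N_def] True] l(3) by simp
    qed (use l in \<open>simp add: H_def\<close>)
  qed
  have c1: "card L1 \<le> card S + u"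
  proof -
    have "card L1 \<le> card (S \<union> H)" using fin fH L1 by (intro card_mono) auto
    thus ?thesis using card_Un_le[of S H] cH by linarith
  qed
  have c0: "card L0 \<le> card C" unfolding L0_def using fin by (intro card_mono) auto
  have "(\<Sum>l\<in>L1. 1 / real l) \<le> (\<Sum>l\<in>S \<union> H. 1 / real l)"
    using L1 fin fH by (intro sum_mono2) auto
  also have "\<dots> \<le> (\<Sum>l\<in>S. 1 / real l) + (\<Sum>l\<in>H. 1 / real l)"
    using fin fH by (simp add: sum_Un sum_nonneg)
  also have "(\<Sum>l\<in>H. 1 / real l) \<le> h" using fH cH by (intro h) (auto simp: H_def)
  finally have sum1: "(\<Sum>l\<in>L1. 1 / real l) \<le> (\<Sum>l\<in>S. 1 / real l) + h" by simp
  \<comment> \<open>\<open>Z\<close> is a prescribed upper bound for (s - 1) / \<delta> + 2, which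
    frees the numerical checks from dividing by \<delta>; the condition on \<open>Z\<close> also
    yields that \<delta> is positive.\<close>
  define \<delta> where "\<delta> = 1 - 2 * (\<Sum>l\<in>S. 1 / real l) - 2 * h - loss"
  have s1: "real s - 1 > 0" using s by simp
  hence "(Z - 2) * \<delta> > 0" using Z(2) unfolding \<delta>_def by linarith
  hence d: "\<delta> > 0" using Z(1) by (simp add: zero_less_mult_iff)
  have dd: "\<delta> \<le> 1 - 2 * (\<Sum>l\<in>L1. 1 / real l) - (\<Sum>A\<in>O1. 1 / real p ^ (k * card A))"
    using sum1 loss by (simp add: \<delta>_def)
  have "(real s - 1) / \<delta> \<le> Z - 2" using Z(2) \<delta>_def d by (simp add: divide_le_eq)
  hence ZZ: "(real s - 1) / \<delta> + 2 \<le> Z" by simp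
  have "2 * card L0 + card O0 \<le> 2 * card C + g" using c0 g by linarith
  hence "4 * real p ^ k * 2 ^ (2 * card L0 + card O0) * ((real s - 1) / \<delta> + 2)
      \<le> 4 * real p ^ k * 2 ^ (2 * card C + g) * Z"
    using ZZ s1 d p1 by (intro mult_mono power_increasing) auto
  also have "\<dots> \<le> sqrt (real p ^ (k * m))" using big by (rule real_le_rsqrt)
  finally have fin': "4 * real p ^ k * 2 ^ (2 * card L0 + card O0) * ((real s - 1) / \<delta> + 2) \<le> sqrt (real p ^ (k * m))" .
  have "L0 \<union> L1 = {l. prime l \<and> l dvd p ^ (k * m) - 1} \<and> L0 \<inter> L1 = {} \<and>
     O0 \<union> O1 = (orbits k m :: 'k set set) \<and> O0 \<inter> O1 = {} \<and>
     \<delta> > 0 \<and> \<delta> \<le> 1 - 2 * (\<Sum>l\<in>L1. 1 / real l) - (\<Sum>A\<in>O1. 1 / real p ^ (k * card A)) \<and>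
     2 * card L1 + card O1 \<le> s \<and> s \<ge> 1 \<and>
     sqrt (real p ^ (k * m)) \<ge> 4 * real p ^ k * 2 ^ (2 * card L0 + card O0) * ((real s - 1) / \<delta> + 2)"
    using O d dd c1 sO s fin' by (auto simp: L0_def L1_def LL_def N_def)
  note ex = this
  show ?thesis unfolding sieve_ok_def by (rule conjI[OF k conjI[OF m]]) (intro exI, rule ex)
qed

text \<open>The orbits of size one are sieved if \<open>b1\<close>, the others if \<open>b2\<close>.\<close>

lemma sieve_ok_orbitsI:
  fixes C S :: "nat set" and Z :: real and u B g1 o2 s :: nat and b1 b2 :: bool
  assumes k: "k > 0" and m: "m > 0" and B: "B > 0" and fin: "finite C" "finite S"
    and known: "\<And>l. prime l \<Longrightarrow> l dvd p ^ (k * m) - 1 \<Longrightarrow> l < B \<Longrightarrow> l \<in> C \<union> S"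
    and u: "D * c = p ^ (k * m) - 1" "c < B ^ (u + 1)" "\<And>l. prime l \<Longrightarrow> l dvd D \<Longrightarrow> l < B"
    and g1: "g1 = gcd m (p ^ k - 1)" "o2 = (m - g1) div 2"
    and s: "s = 2 * (card S + u) + g1 * of_bool b1 + o2 * of_bool b2" "s \<ge> 2"
    and Z: "Z > 2" "real s - 1 \<le> (Z - 2) * (1 - 2 * (\<Sum>l\<in>S. 1 / real l) - 2 * u / B - (g1 * of_bool b1 / p ^ k + o2 * of_bool b2 / p ^ (2 * k)))"
    and big: "(4 * real p ^ k * 2 ^ (2 * card C + (g1 * of_bool (\<not> b1) + o2 * of_bool (\<not> b2))) * Z)\<^sup>2 \<le> real p ^ (k * m)"
  shows "sieve_ok k m"
proof -
  define S1 where "S1 = {A \<in> orbits k m :: 'k set set. card A = 1}"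
  define S2 where "S2 = {A \<in> orbits k m :: 'k set set. card A \<noteq> 1}"
  note ob = orbits_by_size[OF k m, folded S1_def S2_def]
  define T1 where "T1 = (\<lambda>b. if b then S1 else {})"
  define T2 where "T2 = (\<lambda>b. if b then S2 else {})"
  have c: "card (T1 b) = g1 * of_bool b" "card (T2 b) \<le> o2 * of_bool b" for b
    using ob(1,2) g1 by (auto simp: T1_def T2_def)
  have fT: "finite (T1 b)" "finite (T2 b)" for b using ob(6,7) by (auto simp: T1_def T2_def)
  have cT: "card (T1 b \<union> T2 b') \<le> g1 * of_bool b + o2 * of_bool b'" for b b'
    using card_Un_le[of "T1 b" "T2 b'"] c[of b] c(2)[of b'] by linarith
  have dT: "T1 b \<inter> T2 b' = {}" for b b' using ob(5) by (auto simp: T1_def T2_def)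
  have "(\<Sum>A\<in>T1 b1. 1 / real p ^ (k * card A)) = g1 * of_bool b1 / p ^ k"
  proof -
    have "(\<Sum>A\<in>T1 b1. 1 / real p ^ (k * card A)) = (\<Sum>A\<in>T1 b1. 1 / real p ^ k)"
      by (intro sum.cong refl) (auto simp: T1_def S1_def split: if_splits)
    thus ?thesis using c(1)[of b1] by simp
  qed
  moreover have "(\<Sum>A\<in>T2 b2. 1 / real p ^ (k * card A)) \<le> o2 * of_bool b2 / p ^ (2 * k)"
  proof -
    have "(\<Sum>A\<in>T2 b2. 1 / real p ^ (k * card A)) \<le> (\<Sum>A\<in>T2 b2. 1 / real p ^ (2 * k))"
    proof (intro sum_mono frac_le power_increasing)
      fix A assume "A \<in> T2 b2"
      hence "card A \<ge> 2" using ob(3) by (auto simp: T2_def split: if_splits)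
      thus "2 * k \<le> k * card A" by simp
    qed (use p1 in auto)
    also have "\<dots> \<le> (o2 * of_bool b2) / real p ^ (2 * k)"
      using c(2)[of b2] p1 by (auto simp flip: of_nat_mult intro!: divide_right_mono)
    finally show ?thesis by simp
  qed
  ultimately have l: "(\<Sum>A\<in>T1 b1 \<union> T2 b2. 1 / real p ^ (k * card A)) \<le> g1 * of_bool b1 / p ^ k + o2 * of_bool b2 / p ^ (2 * k)"
    using fT dT by (simp add: sum.union_disjoint)
  show ?thesis
  proof (rule sieve_okI[OF k m B fin known u sum_inverse_primes_le[OF _ _ _ B] _ _ cT cT l])
    show "(T1 (\<not> b1) \<union> T2 (\<not> b2)) \<union> (T1 b1 \<union> T2 b2) = orbits k m"
      "(T1 (\<not> b1) \<union> T2 (\<not> b2)) \<inter> (T1 b1 \<union> T2 b2) = {}"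
      using ob(4,5) by (auto simp: T1_def T2_def)
    show "s = 2 * (card S + u) + (g1 * of_bool b1 + o2 * of_bool b2)" using s(1) by simp
  qed (use s(2) Z big in auto)
qed

end

text \<open>The primes \<open>l \<noteq> 5\<close> below 150, each with the order of 5 modulo \<open>l\<close> and its prime factors.\<close>

definition order_table :: "(nat \<times> nat \<times> nat list) list" where
  "order_table = [(2, 1, []), (3, 2, [2]), (7, 6, [2, 3]), (11, 5, [5]), (13, 4, [2, 2]), (17, 16, [2, 2, 2, 2]), (19, 9, [3, 3]), (23, 22, [2, 11]), (29, 14, [2, 7]), (31, 3, [3]), (37, 36, [2, 2, 3, 3]), (41, 20, [2, 2, 5]), (43, 42, [2, 3, 7]), (47, 46, [2, 23]), (53, 52, [2, 2, 13]), (59, 29, [29]), (61, 30, [2, 3, 5]), (67, 22, [2, 11]), (71, 5, [5]), (73, 72, [2, 2, 2, 3, 3]), (79, 39, [3, 13]), (83, 82, [2, 41]), (89, 44, [2, 2, 11]), (97, 96, [2, 2, 2, 2, 2, 3]), (101, 25, [5, 5]), (103, 102, [2, 3, 17]), (107, 106, [2, 53]), (109, 27, [3, 3, 3]), (113, 112, [2, 2, 2, 2, 7]), (127, 42, [2, 3, 7]), (131, 65, [5, 13]), (137, 136, [2, 2, 2, 17]), (139, 69, [3, 23]), (149, 37, [37])]"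

text \<open>Selects by the order, so that no power 5 ^ n has to be evaluated for the individual
  n.\<close>

definition known :: "nat \<Rightarrow> nat \<Rightarrow> nat list" where
  "known n B = map fst (filter (\<lambda>(l, d, _). l < B \<and> d dvd n) order_table)"

text \<open>The hypotheses make \<open>d\<close> the exact order of 5 modulo l. By Bezout 5 ^ gcd d
  n = 1, and if the gcd were a proper divisor of \<open>d\<close>, some 5 ^ (d div r) with r in
  \<open>rs\<close> would be 1.\<close>

lemma order_dvd:
  fixes l d n :: nat
  assumes l: "5 ^ d mod l = 1 mod l" "l dvd 5 ^ n - 1" and d: "prod_list rs = d" "d > 0" "\<forall>r\<in>set rs. prime r"
    and min: "\<forall>r\<in>set rs. 5 ^ (d div r) mod l \<noteq> 1 mod l"
  shows "d dvd n"
proof -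
  define g where "g = gcd d n"
  have c1: "[5 ^ d = 1] (mod l)" using l(1) by (simp only: unique_euclidean_semiring_class.cong_def)
  have c2: "[5 ^ n = 1] (mod l)" using l(2) by (simp add: cong_altdef_nat)
  obtain u v where uv: "d * u = n * v + g" using bezout_nat[of d n] d by (auto simp: g_def)
  have "[5 ^ (d * u) = 1] (mod l)" using cong_pow[OF c1, of u] by (simp add: power_mult)
  moreover have "[5 ^ (n * v) * 5 ^ g = 1 * 5 ^ g] (mod l)" using cong_pow[OF c2, of v] by (intro cong_scalar_right) (simp add: power_mult)
  ultimately have c3: "[5 ^ g = 1] (mod l)" unfolding uv power_add by (metis cong_sym cong_trans mult_1)
  have "g dvd d" by (simp add: g_def)
  then obtain h where h: "d = g * h" by (elim dvdE)
  have "h = 1"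
  proof (rule ccontr)
    assume "h \<noteq> 1"
    then obtain r where r: "prime r" "r dvd h" using prime_factor_nat by blast
    hence "r dvd prod_list rs" using d h by simp
    then obtain r' where "r' \<in> set rs" "r dvd r'" using r(1) by (induction rs) (auto simp: prime_dvd_mult_iff)
    hence rs: "r \<in> set rs" using d(3) r(1) primes_dvd_imp_eq by blast
    obtain h' where h': "h = r * h'" using r(2) by (elim dvdE)
    have "d div r = g * h'" using h h' prime_gt_0_nat[OF r(1)] by (simp add: mult.left_commute)
    hence "[5 ^ (d div r) = 1] (mod l)" using cong_pow[OF c3, of h'] by (simp add: power_mult)
    thus False using min rs by (simp only: unique_euclidean_semiring_class.cong_def)
  qed
  thus ?thesis using h by (metis g_def gcd_dvd2 mult.right_neutral)
qed

text \<open>The prime factors of all orders in the table, collected so that each is proved prime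
  once.\<close>

definition table_primes :: "nat set" where
  "table_primes = {2, 3, 5, 7, 11, 13, 17, 23, 29, 37, 41, 53}"

lemma table_primes: "r \<in> table_primes \<Longrightarrow> prime r"
  by (auto simp: table_primes_def)

lemma order_table_valid:
  "\<forall>(l, d, rs)\<in>set order_table. prod_list rs = d \<and> 0 < d \<and> 5 ^ d mod l = 1 mod l \<and>
     (\<forall>r\<in>set rs. r \<in> table_primes \<and> 5 ^ (d div r) mod l \<noteq> 1 mod l)"
  by (simp add: order_table_def table_primes_def)

text \<open>Trial division by primes up to 11 suffices, as 13 ^ 2 = 169 exceeds 150.\<close>

lemma order_table_complete:
  "\<forall>l\<in>set [2..<150]. l = 5 \<or> l \<in> fst ` set order_table \<or> (\<exists>r\<in>{2, 3, 5, 7, 11}. r dvd l \<and> r < l)"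
  by (simp add: order_table_def upt_rec_numeral)

lemma known:
  assumes l: "prime l" "l dvd 5 ^ n - 1" "l < 150" "l < B" and n: "n > 0"
  shows "l \<in> set (known n B)"
proof -
  have "l \<noteq> 5"
  proof
    assume "l = 5"
    hence "5 dvd (5 ^ n - 1 :: nat)" using l by simp
    moreover have "5 dvd (5 ^ n :: nat)" using n by simp
    ultimately have "5 dvd (5 ^ n - (5 ^ n - 1) :: nat)" by (rule dvd_diff_nat[rotated])
    thus False by simp
  qed
  moreover have "\<not> (r dvd l \<and> r < l)" if "r > 1" for r
    using l(1) that by (auto simp: prime_nat_iff)
  moreover have "l \<in> set [2..<150]" using l prime_ge_2_nat[of l] by (simp only: set_upt atLeastLessThan_iff)
  ultimately have "l \<in> fst ` set order_table" using order_table_complete by fastforce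
  then obtain d rs where d: "(l, d, rs) \<in> set order_table" by force
  have v: "prod_list rs = d \<and> 0 < d \<and> 5 ^ d mod l = 1 mod l \<and> (\<forall>r\<in>set rs. r \<in> table_primes \<and> 5 ^ (d div r) mod l \<noteq> 1 mod l)"
    using bspec[OF order_table_valid d, unfolded split_conv] .
  have "d dvd n"
  proof (rule order_dvd)
    show "5 ^ d mod l = 1 mod l" "prod_list rs = d" "0 < d" using v by blast+
    show "\<forall>r\<in>set rs. prime r" "\<forall>r\<in>set rs. 5 ^ (d div r) mod l \<noteq> 1 mod l" using v table_primes by blast+
  qed (rule l(2))
  thus ?thesis unfolding known_def set_map set_filter using d l(4) by (intro image_eqI[of _ _ "(l, d, rs)"]) simp_all
qed

section \<open>Criteria for single pairs, for ranges and for large k * m\<close>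

locale pchar5 = pchar 5 K for K :: "'k::alg_closed_field itself"
begin

lemma row:
  fixes C S :: "nat set" and Z :: real and u B g1 o2 s :: nat and b1 b2 :: bool
  assumes k: "k > 0" "m > 0" and B: "B > 0" "B \<le> 150" and fin: "finite C" "finite S"
    and known: "set (known (k * m) B) \<subseteq> C \<union> S" and u: "5 ^ (k * m) \<le> (B ^ (u + 1) :: nat)"
    and g1: "g1 = gcd m (5 ^ k - 1)" "o2 = (m - g1) div 2"
    and s: "s = 2 * (card S + u) + g1 * of_bool b1 + o2 * of_bool b2" "s \<ge> 2"
    and Z: "Z > 2" "real s - 1 \<le> (Z - 2) * (1 - 2 * (\<Sum>l\<in>S. 1 / real l) - 2 * u / B - (g1 * of_bool b1 / 5 ^ k + o2 * of_bool b2 / 5 ^ (2 * k)))"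
    and big: "(4 * 5 ^ k * 2 ^ (2 * card C + (g1 * of_bool (\<not> b1) + o2 * of_bool (\<not> b2))) * Z)\<^sup>2 \<le> 5 ^ (k * m)"
  shows "sieve_ok k m"
proof (rule sieve_ok_orbitsI[OF k B(1) fin, where D = 1 and c = "5 ^ (k * m) - 1"])
  show "l \<in> C \<union> S" if "prime l" "l dvd 5 ^ (k * m) - 1" "l < B" for l
    using Submission.known[OF that(1,2) _ that(3)] that(3) B known k by force
  have "5 ^ (k * m) > (0 :: nat)" by simp
  thus "5 ^ (k * m) - 1 < B ^ (u + 1)" using u by linarith
qed (use g1 s Z big in auto)

text \<open>If \<open>8 * m \<le> 5 ^ k\<close>, then all orbits are sieved, otherwise none.\<close>

lemma large_n:
  fixes C S :: "nat set" and Z h :: real and u B J n :: nat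
  assumes n: "n = k * m" "n \<ge> 25" and m: "m \<ge> 3" and B: "B > 0" and fin: "finite C" "finite S"
    and known: "\<And>l. prime l \<Longrightarrow> l dvd 5 ^ n - 1 \<Longrightarrow> l < B \<Longrightarrow> l \<in> C \<union> S"
    and u: "5 ^ n \<le> B ^ (u + 1)" "u > 0"
    and h: "\<And>A. finite A \<Longrightarrow> (\<And>l. l \<in> A \<Longrightarrow> prime l \<and> l \<ge> B) \<Longrightarrow> card A \<le> u \<Longrightarrow> (\<Sum>l\<in>A. 1 / real l) \<le> h"
    and Z: "Z > 2" "real (2 * (card S + u) + n) - 1 \<le> (Z - 2) * (7 / 8 - 2 * (\<Sum>l\<in>S. 1 / real l) - 2 * h)"
    and J: "5 * J \<le> 2 * n" "3 dvd n \<Longrightarrow> 3 * J \<le> n" and big: "(4 * 4 ^ card C * Z)\<^sup>2 \<le> 5 ^ J"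
  shows "sieve_ok k m"
proof -
  have k: "k > 0" using n by (cases k) auto
  have m0: "m > 0" using m by simp
  have known': "l \<in> C \<union> S" if "prime l" "l dvd 5 ^ (k * m) - 1" "l < B" for l
    using known that n by simp
  have "5 ^ (k * m) > (0 :: nat)" by simp
  hence "5 ^ (k * m) - 1 < B ^ (u + 1)" using u(1)[unfolded n(1)] by linarith
  hence u': "1 * (5 ^ (k * m) - 1) = 5 ^ (k * m) - (1 :: nat)" "5 ^ (k * m) - 1 < B ^ (u + 1)" by simp_all
  have D: "l < B" if "prime l" "l dvd 1" for l :: nat using that by auto
  have mn: "m \<le> n" using n k by simp
  define gg where "gg = gcd m (5 ^ k - 1)"
  define S1 where "S1 = {A \<in> orbits k m :: 'k set set. card A = 1}"
  define S2 where "S2 = {A \<in> orbits k m :: 'k set set. card A \<noteq> 1}"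
  note ob = orbits_by_size[OF k m0, folded S1_def S2_def gg_def]
  have cO: "card (orbits k m :: 'k set set) = card S1 + card S2"
    unfolding ob(4)[symmetric] by (rule card_Un_disjoint[OF ob(6,7,5)])
  have g: "2 * card (orbits k m :: 'k set set) \<le> m + gg" "card (orbits k m :: 'k set set) \<le> m" using ob(1,2) cO by linarith+
  have k3: "3 * k \<le> n" using n m by simp
  have k4: "m = 3 \<or> 4 * k \<le> n" using n m by (cases "m = 3") auto
  \<comment> \<open>The budget 5 ^ n is shared out: 5 ^ (2 * k) for q, 5 ^ J for the small primes
    and \<open>Z\<close>, the rest for x unsieved orbits, which cost 4 ^ x. The conversion uses 4 ^
    8 = 65536 \<le> 5 ^ 7 = 78125.\<close>
  have bigX: "(4 * 5 ^ k * 2 ^ (2 * card C + x) * Z)\<^sup>2 \<le> (5 :: real) ^ (k * m)"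
    if x: "7 * x + 16 * k + 8 * J \<le> 8 * n" for x
  proof -
    have "7 * x \<le> 8 * (n - 2 * k - J)" and le: "2 * k + J \<le> n" using x by linarith+
    have "(4 :: real) ^ (8 * x) \<le> 5 ^ (7 * x)"
      unfolding power_mult by (intro power_mono) auto
    also have "\<dots> \<le> 5 ^ (8 * (n - 2 * k - J))" using \<open>7 * x \<le> _\<close> by (intro power_increasing) auto
    finally have "((4 :: real) ^ x) ^ 8 \<le> (5 ^ (n - 2 * k - J)) ^ 8"
      by (simp only: power_mult[symmetric] mult.commute)
    hence 4: "(4 :: real) ^ x \<le> 5 ^ (n - 2 * k - J)" by (rule power_le_imp_le_base[of _ 7, simplified]) simp
    have "(4 * 5 ^ k * 2 ^ (2 * card C + x) * Z)\<^sup>2 = (4 * 4 ^ card C * Z)\<^sup>2 * 4 ^ x * (5 :: real) ^ (2 * k)"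
    proof -
      have "(2 :: real) ^ (2 * card C) = 4 ^ card C" by (simp add: power_mult)
      moreover have "((2 :: real) ^ x)\<^sup>2 = 4 ^ x" by (simp add: power2_eq_square flip: power_mult_distrib)
      moreover have "((5 :: real) ^ k)\<^sup>2 = 5 ^ (2 * k)" by (simp add: mult.commute flip: power_mult)
      ultimately show ?thesis by (simp add: power_add power_mult_distrib)
    qed
    also have "\<dots> \<le> 5 ^ J * 5 ^ (n - 2 * k - J) * 5 ^ (2 * k)"
      using big 4 by (intro mult_mono) auto
    also have "\<dots> = 5 ^ (k * m)" unfolding power_add[symmetric] using le n by simp
    finally show ?thesis .
  qed
  show ?thesis
  proof (cases "8 * m \<le> 5 ^ k")
    case True
    have "real (8 * m) \<le> real (5 ^ k)" using True by (simp only: of_nat_le_iff)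
    \<comment> \<open>Sieving at most m orbits, each at a cost of at most 1 / 5 ^ k, loses at most 1
      / 8; this is the origin of 7 / 8 in the hypothesis on \<open>Z\<close>.\<close>
    hence mq: "real m / 5 ^ k \<le> 1 / 8" by (simp add: field_simps)
    have "(\<Sum>A\<in>orbits k m. 1 / (5 :: real) ^ (k * card (A :: 'k set))) \<le> (\<Sum>A\<in>(orbits k m :: 'k set set). 1 / 5 ^ k)"
    proof (intro sum_mono frac_le power_increasing)
      fix A :: "'k set" assume "A \<in> orbits k m"
      hence "card A \<noteq> 0" using orbits_finite(2)[OF m0] by simp
      thus "k \<le> k * card A" by simp
    qed auto
    also have "\<dots> \<le> m / 5 ^ k" using g(2) by (simp add: divide_right_mono)
    also note mq
    finally have loss: "(\<Sum>A\<in>orbits k m. 1 / real 5 ^ (k * card (A :: 'k set))) \<le> 1 / 8" by simp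
    show ?thesis
    proof (rule sieve_okI[OF k m0 B fin known' u' D h, where ?O0.0 = "{}" and ?O1.0 = "orbits k m" and g = 0 and sO = m and loss = "1 / 8" and Z = Z])
      show "card (orbits k m :: 'k set set) \<le> m" by (rule g(2))
      show "2 * (card S + u) + m = 2 * (card S + u) + m" ..
      have "real (2 * (card S + u) + m) - 1 \<le> real (2 * (card S + u) + n) - 1" using mn by simp
      also have "\<dots> \<le> (Z - 2) * (7 / 8 - 2 * (\<Sum>l\<in>S. 1 / real l) - 2 * h)" by (rule Z(2))
      also have "7 / 8 - 2 * (\<Sum>l\<in>S. 1 / real l) - 2 * h = 1 - 2 * (\<Sum>l\<in>S. 1 / real l) - 2 * h - 1 / 8" by simp
      finally show "real (2 * (card S + u) + m) - 1 \<le> (Z - 2) * (1 - 2 * (\<Sum>l\<in>S. 1 / real l) - 2 * h - 1 / 8)" by simp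
      \<comment> \<open>For m = 3 this amounts to J \<le> n / 3, the reason for the second condition
        on J. Otherwise 4 * k \<le> n and J \<le> 2 * n / 5 leave room.\<close>
      have "16 * k + 8 * J \<le> 8 * n"
      proof (cases "m = 3")
        case True
        thus ?thesis using J(2) n by simp
      next
        case False
        thus ?thesis using J(1) k4 by linarith
      qed
      hence "7 * 0 + 16 * k + 8 * J \<le> 8 * n" by simp
      from bigX[OF this] show "(4 * real 5 ^ k * 2 ^ (2 * card C + 0) * Z)\<^sup>2 \<le> real 5 ^ (k * m)" by simp
    qed (use loss m Z(1) in auto)
  next
    case False
    have gg: "gg \<le> m" "gg \<le> 5 ^ k - 1"
    proof -
      have "(5 :: nat) ^ k > 1" using k by (intro one_less_power) auto
      hence "5 ^ k - 1 \<noteq> (0 :: nat)" by linarith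
      thus "gg \<le> 5 ^ k - 1" unfolding gg_def by (rule gcd_le2_nat)
      show "gg \<le> m" unfolding gg_def using m0 by (intro gcd_le1_nat) simp
    qed
    define x where "x = card (orbits k m :: 'k set set)"
    have x: "2 * x \<le> m + gg" "x \<le> m" using g by (auto simp: x_def)
    \<comment> \<open>For k = 1 there are at most (m + 4) / 2 orbits, because at most 4 of them have
      one element; k = 1 and k = 2 rely on \<open>n \<ge> 25\<close>. From k = 3 on, 8 * m > 5 ^ k
      makes m so large that x \<le> m is enough.\<close>
    have cond: "7 * x + 16 * k + 8 * J \<le> 8 * n"
    proof -
      consider "k = 1" | "k = 2" "m \<le> 24" | "k = 2" "m > 24" | "k = 3" | "k \<ge> 4" using k by linarith
      thus ?thesis
      proof cases
        case 1
        thus ?thesis using x gg J n by simp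
      next
        case 2
        thus ?thesis using x gg J n by simp
      next
        case 3
        thus ?thesis using x gg J n by simp
      next
        case 4
        thus ?thesis using x False J n by simp
      next
        case 5
        have "(5 :: nat) ^ 4 \<le> 5 ^ k" using 5 by (intro power_increasing) auto
        hence "m \<ge> 79" using False by simp
        hence "79 * k \<le> n" "4 * m \<le> n" using n 5 by (auto simp: mult.commute[of k])
        thus ?thesis using x J by linarith
      qed
    qed
    have Bp: "real B > 0" using B by simp
    show ?thesis
    proof (rule sieve_okI[OF k m0 B fin known' u' D h, where ?O0.0 = "orbits k m" and ?O1.0 = "{}" and g = x and sO = 0 and loss = 0 and Z = Z])
      show "2 * (card S + u) + 0 = 2 * (card S + u) + 0" ..
      show "2 \<le> 2 * (card S + u) + 0" using u by simp
      have "real (2 * (card S + u) + 0) - 1 \<le> real (2 * (card S + u) + n) - 1" by simp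
      also have "\<dots> \<le> (Z - 2) * (7 / 8 - 2 * (\<Sum>l\<in>S. 1 / real l) - 2 * h)" by (rule Z(2))
      also have "\<dots> \<le> (Z - 2) * (1 - 2 * (\<Sum>l\<in>S. 1 / real l) - 2 * h - 0)" using Z(1) by (intro mult_left_mono) auto
      finally show "real (2 * (card S + u) + 0) - 1 \<le> (Z - 2) * (1 - 2 * (\<Sum>l\<in>S. 1 / real l) - 2 * h - 0)" .
      show "(4 * real 5 ^ k * 2 ^ (2 * card C + x) * Z)\<^sup>2 \<le> real 5 ^ (k * m)" using bigX[OF cond] by simp
    qed (use Z(1) in \<open>auto simp: x_def\<close>)
  qed
qed

text \<open>One check for all n from a to c: each power is taken at the end of the range where it is
  worst, no prime below \<open>30 * b\<close> is sieved, and \<open>a div 3\<close> meets both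
  conditions on J at once.\<close>

lemma interval:
  fixes Z :: real and u a b c J T :: nat
  assumes n: "n = k * m" "a \<le> n" "n \<le> c" and a: "a \<ge> 25" and m: "m \<ge> 3" and b: "b > 0" "b \<le> 5"
    and T: "length (known n (30 * b)) \<le> T"
    and u: "5 ^ c \<le> (30 * b) ^ (u + 1)" "u > 0" "8 * J \<le> u"
    and Z: "Z > 2" "real (2 * u + c) - 1
      \<le> (Z - 2) * (7 / 8 - 2 * ((\<Sum>j<J. 8 / (30 * real (b + j))) + (real u - 8 * real J) / (30 * real (b + J))))"
    and big: "(4 * 4 ^ T * Z)\<^sup>2 \<le> 5 ^ (a div 3)"
  shows "sieve_ok k m"
proof (rule large_n[where C = "set (known n (30 * b))" and S = "{}" and n = n and B = "30 * b" and J = "a div 3" and Z = Z and u = u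
      and h = "(\<Sum>j<J. 8 / (30 * real (b + j))) + (real u - 8 * real J) / (30 * real (b + J))"])
  let ?C = "set (known n (30 * b))"
  have n0: "n > 0" using n(2) a by linarith
  show "l \<in> ?C \<union> {}" if "prime l" "l dvd 5 ^ n - 1" "l < 30 * b" for l
    using known[OF that(1,2) _ that(3) n0] that(3) b by auto
  show "(\<Sum>l\<in>A. 1 / real l) \<le> (\<Sum>j<J. 8 / (30 * real (b + j))) + (real u - 8 * real J) / (30 * real (b + J))"
    if "finite A" "\<And>l. l \<in> A \<Longrightarrow> prime l \<and> l \<ge> 30 * b" "card A \<le> u" for A
    using sum_inverse_primes_blocks[OF that b(1) u(3)] .
  have "(5 :: nat) ^ n \<le> 5 ^ c" using n by (intro power_increasing) auto
  thus "5 ^ n \<le> (30 * b) ^ (u + 1)" using u by linarith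
  have "card ?C \<le> T" using T card_length[of "known n (30 * b)"] by linarith
  hence "(4 * 4 ^ card ?C * Z)\<^sup>2 \<le> (4 * 4 ^ T * Z)\<^sup>2"
    using Z(1) by (intro power_mono mult_mono power_increasing) auto
  thus "(4 * 4 ^ card ?C * Z)\<^sup>2 \<le> 5 ^ (a div 3)" using big by linarith
  have nc: "real n \<le> real c" using n(3) by (simp only: of_nat_le_iff)
  have "real (2 * (card ({} :: nat set) + u) + n) - 1 \<le> real (2 * u + c) - 1" using nc by simp
  also note Z(2)
  finally show "real (2 * (card ({} :: nat set) + u) + n) - 1
      \<le> (Z - 2) * (7 / 8 - 2 * (\<Sum>l\<in>{}. 1 / real l) - 2 * ((\<Sum>j<J. 8 / (30 * real (b + j))) + (real u - 8 * real J) / (30 * real (b + J))))"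
    by simp
  show "5 * (a div 3) \<le> 2 * n" "3 * (a div 3) \<le> n" using n by linarith+
qed (use n a m b u Z in auto)

lemma card_rough: "card {x. x < 30 * b \<and> \<not> 2 dvd x \<and> \<not> 3 dvd x \<and> \<not> 5 dvd (x :: nat)} \<le> 8 * b"
proof (induction b)
  case (Suc b)
  have "{x. x < 30 * Suc b \<and> \<not> 2 dvd x \<and> \<not> 3 dvd x \<and> \<not> 5 dvd x}
      = {x. x < 30 * b \<and> \<not> 2 dvd x \<and> \<not> 3 dvd x \<and> \<not> 5 dvd x}
      \<union> {x. 30 * b \<le> x \<and> x < 30 * b + 30 \<and> \<not> 2 dvd x \<and> \<not> 3 dvd x \<and> \<not> 5 dvd x}"
    by auto
  thus ?case
    using card_Un_le[of "{x. x < 30 * b \<and> \<not> 2 dvd x \<and> \<not> 3 dvd x \<and> \<not> 5 dvd x}"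
        "{x. 30 * b \<le> x \<and> x < 30 * b + 30 \<and> \<not> 2 dvd x \<and> \<not> 3 dvd x \<and> \<not> 5 dvd x}"] Suc card_rough_block[of b]
    by simp
qed simp

text \<open>At most 8 * b + 3 primes lie below 30 * b, and at most 16 * b from there on divide 5 ^ n
  - 1. As (5 / 4) ^ 16 > 35, a factor 35 ^ b is left for the quadratic growth of Z ^ 2; J = 16 * b
  meets 3 * J \<le> n because 48 = 3 * 16.\<close>

lemma asymptotic:
  assumes n: "n = k * m" "n \<ge> 432" and m: "m \<ge> 3"
  shows "sieve_ok k m"
proof -
  define b where "b = n div 48"
  have b: "48 * b \<le> n" "n \<le> 48 * b + 47" "b \<ge> 9" using n(2) unfolding b_def by linarith+
  define C where "C = {2, 3, 5} \<union> {x. x < 30 * b \<and> \<not> 2 dvd x \<and> \<not> 3 dvd x \<and> \<not> 5 dvd (x :: nat)}"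
  have "card C \<le> card {2, 3, 5 :: nat} + card {x. x < 30 * b \<and> \<not> 2 dvd x \<and> \<not> 3 dvd x \<and> \<not> 5 dvd (x :: nat)}"
    unfolding C_def by (rule card_Un_le)
  hence cC: "card C \<le> 8 * b + 3" using card_rough[of b] by simp
  \<comment> \<open>The reciprocal sum is at most 2 / 5, so 7 / 8 - 4 / 5 = 3 / 40 remains. From b =
    9 on, (80 * b + 46) * 40 / 3 + 2 is below 1148 * b.\<close>
  define Z where "Z = 1148 * real b"
  have nb: "real n \<le> 48 * real b + 47" "real b \<ge> 9" using b by linarith+
  show ?thesis
  proof (rule large_n[where C = C and S = "{}" and n = n and B = "30 * b" and J = "16 * b" and Z = Z and u = "16 * b" and h = "2 / 5"])
    show "l \<in> C \<union> {}" if "prime l" "l dvd 5 ^ n - 1" "l < 30 * b" for l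
    proof (cases "l \<in> {2, 3, 5}")
      case False
      have "r = l" if "prime r" "r dvd l" for r :: nat using that \<open>prime l\<close> primes_dvd_imp_eq by blast
      from this[of 2] this[of 3] this[of 5] have "\<not> 2 dvd l" "\<not> 3 dvd l" "\<not> 5 dvd l" using False by auto
      thus ?thesis using that by (simp add: C_def)
    next
      case True
      thus ?thesis by (auto simp: C_def)
    qed
    \<comment> \<open>From b \<ge> 9 follow 30 * b \<ge> 240 and 5 * n \<le> 17 * (16 * b + 1), and
      5 ^ 17 is just below 240 ^ 5.\<close>
    have "((5 :: nat) ^ n) ^ 5 \<le> 5 ^ (17 * (16 * b + 1))"
      unfolding power_mult[symmetric] using b by (intro power_increasing) auto
    also have "\<dots> = (5 ^ 17) ^ (16 * b + 1)" by (simp only: power_mult)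
    also have "\<dots> \<le> (240 ^ 5) ^ (16 * b + 1)" by (intro power_mono) auto
    also have "\<dots> \<le> ((30 * b) ^ 5) ^ (16 * b + 1)" using b by (intro power_mono) auto
    also have "\<dots> = ((30 * b) ^ (16 * b + 1)) ^ 5" by (simp only: power_mult[symmetric] mult.commute)
    finally show "5 ^ n \<le> (30 * b) ^ (16 * b + 1)" by (rule power_le_imp_le_base[of _ 4, simplified]) simp
    show "(\<Sum>l\<in>A. 1 / real l) \<le> 2 / 5"
      if A: "finite A" "\<And>l. l \<in> A \<Longrightarrow> prime l \<and> l \<ge> 30 * b" "card A \<le> 16 * b" for A
    proof -
      have "(\<Sum>l\<in>A. 1 / real l) \<le> (\<Sum>j<b. 8 / (30 * real (b + j))) + (real (16 * b) - 8 * real b) / (30 * real (b + b))"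
        using b by (intro sum_inverse_primes_blocks[OF A]) auto
      also have "(\<Sum>j<b. 8 / (30 * real (b + j))) \<le> (\<Sum>j<b. 8 / (30 * real b))"
        using b by (intro sum_mono divide_left_mono) auto
      also have "(\<Sum>j<b. 8 / (30 * real b)) + (real (16 * b) - 8 * real b) / (30 * real (b + b)) = 2 / 5"
        using b by (simp add: field_simps)
      finally show ?thesis by simp
    qed
    have "real (2 * (card ({} :: nat set) + 16 * b) + n) - 1 \<le> (1147 * real b) * (3 / 40)" using nb by simp
    also have "\<dots> \<le> (Z - 2) * (3 / 40)" using nb by (simp add: Z_def)
    finally show "real (2 * (card ({} :: nat set) + 16 * b) + n) - 1
        \<le> (Z - 2) * (7 / 8 - 2 * (\<Sum>l\<in>{}. 1 / real l) - 2 * (2 / 5))" by simp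
    \<comment> \<open>293888 = 4 * 4 ^ 3 * 1148 collects the constants of 4 * 4 ^ (8 * b + 3) *
      Z.\<close>
    have poly: "(293888 * real c)\<^sup>2 \<le> 35 ^ c" if "c \<ge> 9" for c :: nat
      using that
    proof (induction c rule: dec_induct)
      case (step c)
      have "(real (Suc c))\<^sup>2 \<le> 35 * (real c)\<^sup>2"
      proof -
        have "real (Suc c) \<le> 2 * real c" using step by simp
        hence "(real (Suc c))\<^sup>2 \<le> (2 * real c)\<^sup>2" by (intro power_mono) auto
        also have "\<dots> = 4 * (real c)\<^sup>2" by (simp add: power_mult_distrib)
        also have "\<dots> \<le> 35 * (real c)\<^sup>2" by (intro mult_right_mono) auto
        finally show ?thesis .
      qed
      hence "(293888 * real (Suc c))\<^sup>2 \<le> 35 * (293888 * real c)\<^sup>2"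
        unfolding power_mult_distrib mult.left_commute[of 35] by (intro mult_left_mono) auto
      thus ?case using step by simp
    qed simp
    have "(4 * 4 ^ card C * Z)\<^sup>2 \<le> (4 * 4 ^ (8 * b + 3) * Z)\<^sup>2"
      using cC nb by (intro power_mono mult_mono power_increasing) (auto simp: Z_def)
    also have "\<dots> = (293888 * real b)\<^sup>2 * 4 ^ (16 * b)"
      by (simp add: Z_def power_add power_mult_distrib mult.commute flip: power_mult)
    also have "\<dots> \<le> 35 ^ b * (4 ^ 16) ^ b" unfolding power_mult using poly[OF b(3)] by (intro mult_right_mono) auto
    also have "\<dots> = (35 * 4 ^ 16) ^ b" by (simp only: power_mult_distrib)
    also have "\<dots> \<le> (5 ^ 16) ^ b" by (intro power_mono) auto
    finally show "(4 * 4 ^ card C * Z)\<^sup>2 \<le> 5 ^ (16 * b)" by (simp add: power_mult)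
    show "5 * (16 * b) \<le> 2 * n" "3 * (16 * b) \<le> n" "30 * b > 0" "16 * b > 0" using b by linarith+
    show "Z > 2" using nb by (simp add: Z_def)
  qed (use n m in \<open>auto simp: C_def\<close>)
qed

end

text \<open>The orders alone, with repetitions: the number of known primes for n is the number of
  entries dividing n, which is cheap to evaluate over a whole range.\<close>

definition orders :: "nat \<Rightarrow> nat list" where
  "orders B = map (\<lambda>(l, d, _). d) (filter (\<lambda>(l, d, _). l < B) order_table)"

lemma length_known: "length (known n B) = length (filter (\<lambda>d. d dvd n) (orders B))"
  by (simp add: known_def orders_def filter_map o_def case_prod_unfold conj_commute)

lemma length_known_le: "length (known n B) \<le> length (orders B)"
  unfolding length_known by simp

lemma orders_60: "orders 60 = [1, 2, 6, 5, 4, 16, 9, 22, 14, 3, 36, 20, 42, 46, 52, 29]"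
  by (simp add: orders_def order_table_def)

lemma orders_90: "orders 90 = [1, 2, 6, 5, 4, 16, 9, 22, 14, 3, 36, 20, 42, 46, 52, 29, 30, 22, 5, 72, 39, 82, 44]"
  by (simp add: orders_def order_table_def)

lemma orders_150: "orders 150 = [1, 2, 6, 5, 4, 16, 9, 22, 14, 3, 36, 20, 42, 46, 52, 29, 30, 22, 5, 72, 39, 82, 44, 96, 25, 102, 106, 27, 112, 42, 65, 136, 69, 37]"
  by (simp add: orders_def order_table_def)

lemma length_known_61: "\<forall>n\<in>set [61..<72]. length (known n 60) \<le> 5"
  by (simp add: length_known orders_60 upt_rec_numeral)

lemma length_known_72: "\<forall>n\<in>set [72..<120]. length (known n 90) \<le> 8"
  by (simp add: length_known orders_90 upt_rec_numeral)

lemma length_known_120: "\<forall>n\<in>set [120..<160]. length (known n 90) \<le> 9"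
  by (simp add: length_known orders_90 upt_rec_numeral)

section \<open>Explicit parameters for k * m up to 60\<close>

context pchar5
begin

lemma large_row:
  fixes C S :: "nat set" and Z :: real and u B J n :: nat
  assumes n: "n = k * m" "n \<ge> 25" and m: "m \<ge> 3" and B: "B > 0" "B \<le> 150" and fin: "finite C" "finite S"
    and known: "set (known n B) \<subseteq> C \<union> S" and u: "5 ^ n \<le> B ^ (u + 1)" "u > 0"
    and Z: "Z > 2" "real (2 * (card S + u) + n) - 1 \<le> (Z - 2) * (7 / 8 - 2 * (\<Sum>l\<in>S. 1 / real l) - 2 * u / B)"
    and J: "5 * J \<le> 2 * n" "3 dvd n \<longrightarrow> 3 * J \<le> n" and big: "(4 * 4 ^ card C * Z)\<^sup>2 \<le> 5 ^ J"
  shows "sieve_ok k m"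
proof (rule large_n[OF n m B(1) fin _ u sum_inverse_primes_le[OF _ _ _ B(1)] Z(1) _ J(1) _ big])
  have n0: "n > 0" using n(2) by linarith
  show "l \<in> C \<union> S" if "prime l" "l dvd 5 ^ n - 1" "l < B" for l
    using Submission.known[OF that(1,2) _ that(3) n0] that(3) B known by force
qed (use Z(2) J in simp_all)

text \<open>In these rows \<open>C\<close> holds the unsieved primes, \<open>S\<close> the sieved
  ones below \<open>B\<close>, and \<open>u\<close> bounds the number of larger ones.
  \<open>J\<close> is always the largest value allowed: \<open>2 * n div 5\<close>, or
  \<open>n div 3\<close> if 3 divides n.\<close>

lemma large_25: "25 = k * m \<Longrightarrow> m \<ge> 3 \<Longrightarrow> sieve_ok k m"
  by (rule large_row[where n = 25 and B = 44 and u = 10 and C = "{2}" and S = "{11}" and Z = 195 and J = 10]) (simp_all add: known_def order_table_def)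

lemma large_27: "27 = k * m \<Longrightarrow> m \<ge> 3 \<Longrightarrow> sieve_ok k m"
  by (rule large_row[where n = 27 and B = 132 and u = 8 and C = "{2}" and S = "{19, 31, 109}" and Z = 87 and J = 9]) (simp_all add: known_def order_table_def)

lemma large_28: "28 = k * m \<Longrightarrow> m \<ge> 3 \<Longrightarrow> sieve_ok k m"
  by (rule large_row[where n = 28 and B = 94 and u = 9 and C = "{2, 3}" and S = "{13, 29}" and Z = 109 and J = 11]) (simp_all add: known_def order_table_def)

lemma large_29: "29 = k * m \<Longrightarrow> m \<ge> 3 \<Longrightarrow> sieve_ok k m"
  by (rule large_row[where n = 29 and B = 36 and u = 13 and C = "{2}" and S = "{}" and Z = 356 and J = 11]) (simp_all add: known_def order_table_def)

lemma large_31: "31 = k * m \<Longrightarrow> m \<ge> 3 \<Longrightarrow> sieve_ok k m"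
  by (rule large_row[where n = 31 and B = 36 and u = 13 and C = "{2}" and S = "{}" and Z = 369 and J = 12]) (simp_all add: known_def order_table_def)

lemma large_32: "32 = k * m \<Longrightarrow> m \<ge> 3 \<Longrightarrow> sieve_ok k m"
  by (rule large_row[where n = 32 and B = 68 and u = 12 and C = "{2, 3}" and S = "{13, 17}" and Z = 238 and J = 12]) (simp_all add: known_def order_table_def)

lemma large_33: "33 = k * m \<Longrightarrow> m \<ge> 3 \<Longrightarrow> sieve_ok k m"
  by (rule large_row[where n = 33 and B = 42 and u = 14 and C = "{2}" and S = "{31}" and Z = 434 and J = 11]) (simp_all add: known_def order_table_def)

lemma large_34: "34 = k * m \<Longrightarrow> m \<ge> 3 \<Longrightarrow> sieve_ok k m"
  by (rule large_row[where n = 34 and B = 40 and u = 14 and C = "{2, 3}" and S = "{}" and Z = 351 and J = 13]) (simp_all add: known_def order_table_def)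

lemma large_35: "35 = k * m \<Longrightarrow> m \<ge> 3 \<Longrightarrow> sieve_ok k m"
  by (rule large_row[where n = 35 and B = 38 and u = 15 and C = "{2, 11}" and S = "{}" and Z = 751 and J = 14]) (simp_all add: known_def order_table_def)

lemma large_37: "37 = k * m \<Longrightarrow> m \<ge> 3 \<Longrightarrow> sieve_ok k m"
  by (rule large_row[where n = 37 and B = 38 and u = 16 and C = "{2}" and S = "{}" and Z = 2070 and J = 14]) (simp_all add: known_def order_table_def)

lemma large_38: "38 = k * m \<Longrightarrow> m \<ge> 3 \<Longrightarrow> sieve_ok k m"
  by (rule large_row[where n = 38 and B = 38 and u = 16 and C = "{2, 3}" and S = "{}" and Z = 2100 and J = 15]) (simp_all add: known_def order_table_def)

lemma large_39: "39 = k * m \<Longrightarrow> m \<ge> 3 \<Longrightarrow> sieve_ok k m"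
  by (rule large_row[where n = 39 and B = 42 and u = 16 and C = "{2}" and S = "{31}" and Z = 1485 and J = 13]) (simp_all add: known_def order_table_def)

lemma large_40: "40 = k * m \<Longrightarrow> m \<ge> 3 \<Longrightarrow> sieve_ok k m"
  by (rule large_row[where n = 40 and B = 52 and u = 16 and C = "{2, 3, 11}" and S = "{13, 41}" and Z = 1319 and J = 16]) (simp_all add: known_def order_table_def)

lemma large_41: "41 = k * m \<Longrightarrow> m \<ge> 3 \<Longrightarrow> sieve_ok k m"
  by (rule large_row[where n = 41 and B = 40 and u = 17 and C = "{2}" and S = "{}" and Z = 2962 and J = 16]) (simp_all add: known_def order_table_def)

lemma large_42: "42 = k * m \<Longrightarrow> m \<ge> 3 \<Longrightarrow> sieve_ok k m"
  by (rule large_row[where n = 42 and B = 70 and u = 15 and C = "{2, 3, 7}" and S = "{29, 31, 43}" and Z = 292 and J = 14]) (simp_all add: known_def order_table_def)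

lemma large_43: "43 = k * m \<Longrightarrow> m \<ge> 3 \<Longrightarrow> sieve_ok k m"
  by (rule large_row[where n = 43 and B = 42 and u = 18 and C = "{2}" and S = "{}" and Z = 4370 and J = 17]) (simp_all add: known_def order_table_def)

lemma large_44: "44 = k * m \<Longrightarrow> m \<ge> 3 \<Longrightarrow> sieve_ok k m"
  by (rule large_row[where n = 44 and B = 48 and u = 18 and C = "{2, 3, 13}" and S = "{23}" and Z = 2132 and J = 17]) (simp_all add: known_def order_table_def)

lemma large_45: "45 = k * m \<Longrightarrow> m \<ge> 3 \<Longrightarrow> sieve_ok k m"
  by (rule large_row[where n = 45 and B = 54 and u = 18 and C = "{2, 11}" and S = "{19, 31}" and Z = 2181 and J = 15]) (simp_all add: known_def order_table_def)

lemma large_46: "46 = k * m \<Longrightarrow> m \<ge> 3 \<Longrightarrow> sieve_ok k m"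
  by (rule large_row[where n = 46 and B = 44 and u = 19 and C = "{2, 3}" and S = "{}" and Z = 7306 and J = 18]) (simp_all add: known_def order_table_def)

lemma large_47: "47 = k * m \<Longrightarrow> m \<ge> 3 \<Longrightarrow> sieve_ok k m"
  by (rule large_row[where n = 47 and B = 44 and u = 19 and C = "{2}" and S = "{}" and Z = 7394 and J = 18]) (simp_all add: known_def order_table_def)

lemma large_48: "48 = k * m \<Longrightarrow> m \<ge> 3 \<Longrightarrow> sieve_ok k m"
  by (rule large_row[where n = 48 and B = 74 and u = 17 and C = "{2, 3, 7}" and S = "{13, 17, 31}" and Z = 1096 and J = 16]) (simp_all add: known_def order_table_def)

lemma large_49: "49 = k * m \<Longrightarrow> m \<ge> 3 \<Longrightarrow> sieve_ok k m"
  by (rule large_row[where n = 49 and B = 46 and u = 20 and C = "{2}" and S = "{}" and Z = 16194 and J = 19]) (simp_all add: known_def order_table_def)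

lemma large_50: "50 = k * m \<Longrightarrow> m \<ge> 3 \<Longrightarrow> sieve_ok k m"
  by (rule large_row[where n = 50 and B = 48 and u = 20 and C = "{2, 3, 11}" and S = "{}" and Z = 2138 and J = 20]) (simp_all add: known_def order_table_def)

lemma large_51: "51 = k * m \<Longrightarrow> m \<ge> 3 \<Longrightarrow> sieve_ok k m"
  by (rule large_row[where n = 51 and B = 50 and u = 20 and C = "{2}" and S = "{31}" and Z = 8778 and J = 17]) (simp_all add: known_def order_table_def)

lemma large_52: "52 = k * m \<Longrightarrow> m \<ge> 3 \<Longrightarrow> sieve_ok k m"
  by (rule large_row[where n = 52 and B = 50 and u = 21 and C = "{2, 3, 13}" and S = "{}" and Z = 2660 and J = 20]) (simp_all add: known_def order_table_def)

lemma large_53: "53 = k * m \<Longrightarrow> m \<ge> 3 \<Longrightarrow> sieve_ok k m"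
  by (rule large_row[where n = 53 and B = 50 and u = 21 and C = "{2}" and S = "{}" and Z = 2688 and J = 21]) (simp_all add: known_def order_table_def)

lemma large_54: "54 = k * m \<Longrightarrow> m \<ge> 3 \<Longrightarrow> sieve_ok k m"
  by (rule large_row[where n = 54 and B = 56 and u = 21 and C = "{2, 3, 7, 19}" and S = "{31}" and Z = 1606 and J = 18]) (simp_all add: known_def order_table_def)

lemma large_55: "55 = k * m \<Longrightarrow> m \<ge> 3 \<Longrightarrow> sieve_ok k m"
  by (rule large_row[where n = 55 and B = 52 and u = 22 and C = "{2, 11}" and S = "{}" and Z = 3400 and J = 22]) (simp_all add: known_def order_table_def)

lemma large_56: "56 = k * m \<Longrightarrow> m \<ge> 3 \<Longrightarrow> sieve_ok k m"
  by (rule large_row[where n = 56 and B = 52 and u = 22 and C = "{2, 3, 13, 29}" and S = "{}" and Z = 3434 and J = 22]) (simp_all add: known_def order_table_def)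

lemma large_57: "57 = k * m \<Longrightarrow> m \<ge> 3 \<Longrightarrow> sieve_ok k m"
  by (rule large_row[where n = 57 and B = 54 and u = 22 and C = "{2, 31}" and S = "{}" and Z = 1664 and J = 19]) (simp_all add: known_def order_table_def)

lemma large_58: "58 = k * m \<Longrightarrow> m \<ge> 3 \<Longrightarrow> sieve_ok k m"
  by (rule large_row[where n = 58 and B = 54 and u = 23 and C = "{2, 3}" and S = "{}" and Z = 4452 and J = 23]) (simp_all add: known_def order_table_def)

lemma large_59: "59 = k * m \<Longrightarrow> m \<ge> 3 \<Longrightarrow> sieve_ok k m"
  by (rule large_row[where n = 59 and B = 54 and u = 23 and C = "{2}" and S = "{}" and Z = 4495 and J = 23]) (simp_all add: known_def order_table_def)

lemma large_60: "60 = k * m \<Longrightarrow> m \<ge> 3 \<Longrightarrow> sieve_ok k m"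
  by (rule large_row[where n = 60 and B = 68 and u = 22 and C = "{2, 3, 7, 11, 13}" and S = "{31, 41, 61}" and Z = 1334 and J = 20]) (simp_all add: known_def order_table_def)

text \<open>Here k and m are both fixed, so the orbits of one element are counted exactly and the
  others bounded by half of the rest; the flags choose which kind is sieved. In these rows
  one-element orbits are never sieved for k = 1, where each would cost 1 / 5.\<close>

lemma small_1_11: "sieve_ok 1 11"
  by (rule row[where B = 22 and u = 5 and C = "{2}" and S = "{}" and Z = 43 and ?b1.0 = False and ?b2.0 = True and ?g1.0 = 1 and ?o2.0 = 5 and s = 15]) (simp_all add: known_def order_table_def gcd_non_0_nat)

lemma small_1_13: "sieve_ok 1 13"
  by (rule row[where B = 20 and u = 6 and C = "{2}" and S = "{}" and Z = 109 and ?b1.0 = False and ?b2.0 = True and ?g1.0 = 1 and ?o2.0 = 6 and s = 18]) (simp_all add: known_def order_table_def gcd_non_0_nat)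

lemma small_2_7: "sieve_ok 2 7"
  by (rule row[where B = 24 and u = 7 and C = "{2, 3}" and S = "{}" and Z = 48 and ?b1.0 = True and ?b2.0 = True and ?g1.0 = 1 and ?o2.0 = 3 and s = 18]) (simp_all add: known_def order_table_def gcd_non_0_nat)

lemma small_1_14: "sieve_ok 1 14"
  by (rule row[where B = 26 and u = 6 and C = "{2, 3}" and S = "{}" and Z = 59 and ?b1.0 = False and ?b2.0 = True and ?g1.0 = 2 and ?o2.0 = 6 and s = 18]) (simp_all add: known_def order_table_def gcd_non_0_nat)

lemma small_3_5: "sieve_ok 3 5"
  by (rule row[where B = 24 and u = 7 and C = "{2}" and S = "{11}" and Z = 82 and ?b1.0 = True and ?b2.0 = True and ?g1.0 = 1 and ?o2.0 = 2 and s = 19]) (simp_all add: known_def order_table_def gcd_non_0_nat)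

lemma small_1_15: "sieve_ok 1 15"
  by (rule row[where B = 22 and u = 7 and C = "{2, 11}" and S = "{}" and Z = 242 and ?b1.0 = False and ?b2.0 = True and ?g1.0 = 1 and ?o2.0 = 7 and s = 21]) (simp_all add: known_def order_table_def gcd_non_0_nat)

lemma small_2_8: "sieve_ok 2 8"
  by (rule row[where B = 40 and u = 6 and C = "{2, 3}" and S = "{13, 17}" and Z = 214 and ?b1.0 = True and ?b2.0 = True and ?g1.0 = 8 and ?o2.0 = 0 and s = 24]) (simp_all add: known_def order_table_def gcd_non_0_nat)

lemma small_1_16: "sieve_ok 1 16"
  by (rule row[where B = 60 and u = 6 and C = "{2, 3}" and S = "{13, 17}" and Z = 75 and ?b1.0 = False and ?b2.0 = True and ?g1.0 = 4 and ?o2.0 = 6 and s = 22]) (simp_all add: known_def order_table_def gcd_non_0_nat)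

lemma small_1_17: "sieve_ok 1 17"
  by (rule row[where B = 24 and u = 8 and C = "{2}" and S = "{}" and Z = 1727 and ?b1.0 = False and ?b2.0 = True and ?g1.0 = 1 and ?o2.0 = 8 and s = 24]) (simp_all add: known_def order_table_def gcd_non_0_nat)

lemma small_3_6: "sieve_ok 3 6"
  by (rule row[where B = 38 and u = 7 and C = "{2, 3}" and S = "{7, 19, 31}" and Z = 146 and ?b1.0 = True and ?b2.0 = True and ?g1.0 = 2 and ?o2.0 = 2 and s = 24]) (simp_all add: known_def order_table_def gcd_non_0_nat)

lemma small_2_9: "sieve_ok 2 9"
  by (rule row[where B = 26 and u = 8 and C = "{2, 3, 7}" and S = "{19}" and Z = 151 and ?b1.0 = True and ?b2.0 = True and ?g1.0 = 3 and ?o2.0 = 3 and s = 24]) (simp_all add: known_def order_table_def gcd_non_0_nat)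

lemma small_1_18: "sieve_ok 1 18"
  by (rule row[where B = 38 and u = 7 and C = "{2, 3, 7}" and S = "{19, 31}" and Z = 179 and ?b1.0 = False and ?b2.0 = True and ?g1.0 = 2 and ?o2.0 = 8 and s = 26]) (simp_all add: known_def order_table_def gcd_non_0_nat)

lemma small_1_19: "sieve_ok 1 19"
  by (rule row[where B = 28 and u = 9 and C = "{2}" and S = "{}" and Z = 50 and ?b1.0 = False and ?b2.0 = False and ?g1.0 = 1 and ?o2.0 = 9 and s = 18]) (simp_all add: known_def order_table_def gcd_non_0_nat)

lemma small_5_4: "sieve_ok 5 4"
  by (rule row[where B = 140 and u = 6 and C = "{2, 3}" and S = "{11, 13, 41, 71}" and Z = 48 and ?b1.0 = True and ?b2.0 = True and ?g1.0 = 4 and ?o2.0 = 0 and s = 24]) (simp_all add: known_def order_table_def gcd_non_0_nat)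

lemma small_4_5: "sieve_ok 4 5"
  by (rule row[where B = 32 and u = 9 and C = "{2, 3}" and S = "{11, 13}" and Z = 242 and ?b1.0 = True and ?b2.0 = True and ?g1.0 = 1 and ?o2.0 = 2 and s = 25]) (simp_all add: known_def order_table_def gcd_non_0_nat)

lemma small_2_10: "sieve_ok 2 10"
  by (rule row[where B = 24 and u = 10 and C = "{2, 3, 11, 13}" and S = "{}" and Z = 314 and ?b1.0 = True and ?b2.0 = True and ?g1.0 = 2 and ?o2.0 = 4 and s = 26]) (simp_all add: known_def order_table_def gcd_non_0_nat)

lemma small_1_20: "sieve_ok 1 20"
  by (rule row[where B = 36 and u = 8 and C = "{2, 3, 11}" and S = "{13}" and Z = 308 and ?b1.0 = False and ?b2.0 = True and ?g1.0 = 4 and ?o2.0 = 8 and s = 26]) (simp_all add: known_def order_table_def gcd_non_0_nat)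

lemma small_3_7: "sieve_ok 3 7"
  by (rule row[where B = 22 and u = 10 and C = "{2}" and S = "{}" and Z = 281 and ?b1.0 = True and ?b2.0 = True and ?g1.0 = 1 and ?o2.0 = 3 and s = 24]) (simp_all add: known_def order_table_def gcd_non_0_nat)

lemma small_1_21: "sieve_ok 1 21"
  by (rule row[where B = 24 and u = 10 and C = "{2}" and S = "{}" and Z = 116 and ?b1.0 = False and ?b2.0 = False and ?g1.0 = 1 and ?o2.0 = 10 and s = 20]) (simp_all add: known_def order_table_def gcd_non_0_nat)

lemma small_2_11: "sieve_ok 2 11"
  by (rule row[where B = 24 and u = 11 and C = "{2, 3, 23}" and S = "{}" and Z = 767 and ?b1.0 = True and ?b2.0 = True and ?g1.0 = 1 and ?o2.0 = 5 and s = 28]) (simp_all add: known_def order_table_def gcd_non_0_nat)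

lemma small_1_22: "sieve_ok 1 22"
  by (rule row[where B = 34 and u = 10 and C = "{2, 3, 23}" and S = "{}" and Z = 2467 and ?b1.0 = False and ?b2.0 = True and ?g1.0 = 2 and ?o2.0 = 10 and s = 30]) (simp_all add: known_def order_table_def gcd_non_0_nat)

lemma small_1_23: "sieve_ok 1 23"
  by (rule row[where B = 24 and u = 11 and C = "{2}" and S = "{}" and Z = 254 and ?b1.0 = False and ?b2.0 = False and ?g1.0 = 1 and ?o2.0 = 11 and s = 22]) (simp_all add: known_def order_table_def gcd_non_0_nat)

lemma small_6_4: "sieve_ok 6 4"
  by (rule row[where B = 48 and u = 9 and C = "{2, 3}" and S = "{7, 13, 31}" and Z = 226 and ?b1.0 = True and ?b2.0 = True and ?g1.0 = 4 and ?o2.0 = 0 and s = 28]) (simp_all add: known_def order_table_def gcd_non_0_nat)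

lemma small_4_6: "sieve_ok 4 6"
  by (rule row[where B = 26 and u = 11 and C = "{2, 3, 7, 13}" and S = "{}" and Z = 190 and ?b1.0 = True and ?b2.0 = True and ?g1.0 = 6 and ?o2.0 = 0 and s = 28]) (simp_all add: known_def order_table_def gcd_non_0_nat)

lemma small_3_8: "sieve_ok 3 8"
  by (rule row[where B = 26 and u = 11 and C = "{2, 3, 7, 13}" and S = "{}" and Z = 224 and ?b1.0 = True and ?b2.0 = True and ?g1.0 = 4 and ?o2.0 = 2 and s = 28]) (simp_all add: known_def order_table_def gcd_non_0_nat)

lemma small_2_12: "sieve_ok 2 12"
  by (rule row[where B = 40 and u = 10 and C = "{2, 3, 7, 13, 31}" and S = "{}" and Z = 1552 and ?b1.0 = True and ?b2.0 = True and ?g1.0 = 12 and ?o2.0 = 0 and s = 32]) (simp_all add: known_def order_table_def gcd_non_0_nat)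

lemma small_1_24: "sieve_ok 1 24"
  by (rule row[where B = 36 and u = 10 and C = "{2, 3, 7, 13, 31}" and S = "{}" and Z = 655 and ?b1.0 = False and ?b2.0 = True and ?g1.0 = 4 and ?o2.0 = 10 and s = 30]) (simp_all add: known_def order_table_def gcd_non_0_nat)

lemma small_2_13: "sieve_ok 2 13"
  by (rule row[where B = 26 and u = 12 and C = "{2, 3}" and S = "{}" and Z = 1100 and ?b1.0 = True and ?b2.0 = True and ?g1.0 = 1 and ?o2.0 = 6 and s = 31]) (simp_all add: known_def order_table_def gcd_non_0_nat)

lemma small_1_26: "sieve_ok 1 26"
  by (rule row[where B = 28 and u = 12 and C = "{2, 3}" and S = "{}" and Z = 163 and ?b1.0 = False and ?b2.0 = False and ?g1.0 = 2 and ?o2.0 = 12 and s = 24]) (simp_all add: known_def order_table_def gcd_non_0_nat)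

lemma small_6_5: "sieve_ok 6 5"
  by (rule row[where B = 30 and u = 14 and C = "{2, 3, 7, 11}" and S = "{}" and Z = 453 and ?b1.0 = True and ?b2.0 = True and ?g1.0 = 1 and ?o2.0 = 2 and s = 31]) (simp_all add: known_def order_table_def gcd_non_0_nat)

lemma small_5_6: "sieve_ok 5 6"
  by (rule row[where B = 30 and u = 14 and C = "{2, 3, 7, 11}" and S = "{}" and Z = 472 and ?b1.0 = True and ?b2.0 = True and ?g1.0 = 2 and ?o2.0 = 2 and s = 32]) (simp_all add: known_def order_table_def gcd_non_0_nat)

lemma small_3_10: "sieve_ok 3 10"
  by (rule row[where B = 30 and u = 14 and C = "{2, 3, 7, 11}" and S = "{}" and Z = 657 and ?b1.0 = True and ?b2.0 = True and ?g1.0 = 2 and ?o2.0 = 4 and s = 34]) (simp_all add: known_def order_table_def gcd_non_0_nat)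

lemma small_2_15: "sieve_ok 2 15"
  by (rule row[where B = 30 and u = 14 and C = "{2, 3, 7, 11}" and S = "{}" and Z = 581 and ?b1.0 = False and ?b2.0 = True and ?g1.0 = 3 and ?o2.0 = 6 and s = 34]) (simp_all add: known_def order_table_def gcd_non_0_nat)

lemma small_1_30: "sieve_ok 1 30"
  by (rule row[where B = 40 and u = 13 and C = "{2, 3, 7}" and S = "{11, 31}" and Z = 282 and ?b1.0 = False and ?b2.0 = False and ?g1.0 = 2 and ?o2.0 = 14 and s = 30]) (simp_all add: known_def order_table_def gcd_non_0_nat)

lemma small_12_3: "sieve_ok 12 3"
  by (rule row[where B = 126 and u = 11 and C = "{2, 3}" and S = "{7, 13, 19, 31, 37}" and Z = 212 and ?b1.0 = True and ?b2.0 = True and ?g1.0 = 3 and ?o2.0 = 0 and s = 35]) (simp_all add: known_def order_table_def gcd_non_0_nat)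

lemma small_9_4: "sieve_ok 9 4"
  by (rule row[where B = 38 and u = 15 and C = "{2, 3, 7, 13, 19}" and S = "{31, 37}" and Z = 405 and ?b1.0 = True and ?b2.0 = True and ?g1.0 = 4 and ?o2.0 = 0 and s = 38]) (simp_all add: known_def order_table_def gcd_non_0_nat)

lemma small_6_6: "sieve_ok 6 6"
  by (rule row[where B = 34 and u = 16 and C = "{2, 3, 7, 13, 19, 31}" and S = "{}" and Z = 636 and ?b1.0 = True and ?b2.0 = True and ?g1.0 = 6 and ?o2.0 = 0 and s = 38]) (simp_all add: known_def order_table_def gcd_non_0_nat)

lemma small_4_9: "sieve_ok 4 9"
  by (rule row[where B = 34 and u = 16 and C = "{2, 3, 7, 13, 19, 31}" and S = "{}" and Z = 687 and ?b1.0 = True and ?b2.0 = True and ?g1.0 = 3 and ?o2.0 = 3 and s = 38]) (simp_all add: known_def order_table_def gcd_non_0_nat)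

lemma small_3_12: "sieve_ok 3 12"
  by (rule row[where B = 34 and u = 16 and C = "{2, 3, 7, 13, 19, 31}" and S = "{}" and Z = 1470 and ?b1.0 = True and ?b2.0 = True and ?g1.0 = 4 and ?o2.0 = 4 and s = 40]) (simp_all add: known_def order_table_def gcd_non_0_nat)

lemma small_2_18: "sieve_ok 2 18"
  by (rule row[where B = 34 and u = 16 and C = "{2, 3, 7, 13, 19, 31}" and S = "{}" and Z = 754 and ?b1.0 = False and ?b2.0 = True and ?g1.0 = 6 and ?o2.0 = 6 and s = 38]) (simp_all add: known_def order_table_def gcd_non_0_nat)

lemma small_1_36: "sieve_ok 1 36"
  by (rule row[where B = 42 and u = 15 and C = "{2, 3, 7, 13}" and S = "{19, 31, 37}" and Z = 568 and ?b1.0 = False and ?b2.0 = False and ?g1.0 = 4 and ?o2.0 = 16 and s = 36]) (simp_all add: known_def order_table_def gcd_non_0_nat)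

end

section \<open>The pairs (7, 3) and (1, 9), and the combination of all ranges\<close>

context pchar5
begin

text \<open>As 5 ^ 21 exceeds 150 ^ 6, size alone would admit six large primes. Splitting off 124 =
  4 * 31 leaves less than 150 ^ 6, hence at most five.\<close>

lemma small_7_3: "sieve_ok 7 3"
proof (rule sieve_ok_orbitsI[where D = 124 and c = 3845460953251 and B = 150 and u = 5 and C = "{2}" and S = "{31}" and Z = 17
      and ?b1.0 = True and ?b2.0 = True and ?g1.0 = 1 and ?o2.0 = 1 and s = 14])
  show "l \<in> {2} \<union> {31}" if "prime l" "l dvd 5 ^ (7 * 3) - 1" "l < 150" for l :: nat
    using known[of l 21 150] that by (auto simp: known_def order_table_def)
  show "l < 150" if "prime l" "l dvd 124" for l :: nat
    using dvd_imp_le[OF that(2)] by simp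
qed (simp_all add: gcd_non_0_nat)

text \<open>The general bound would be (9 - 1) / 2 = 4. But the two primitive cube roots of unity
  form one orbit, and an orbit of primitive ninth roots has at least 5 elements among at most 9
  roots, so there is at most one of these.\<close>

lemma orbits_1_9:
  "card {A \<in> orbits 1 9 :: 'k set set. card A \<noteq> 1} \<le> 2"
proof -
  define S2 where "S2 = {A \<in> orbits 1 9 :: 'k set set. card A \<noteq> 1}"
  note ob = orbits_by_size[of 1 9, simplified, folded S2_def[simplified]]
  define W where "W = {y :: 'k. y ^ 3 = 1} - {1}"
  have c3: "card {y :: 'k. y ^ 3 = 1} = 3" by (rule card_roots_of_unity) auto
  hence f3: "finite {y :: 'k. y ^ 3 = 1}" by (metis card.infinite zero_neq_numeral)
  have W: "finite W" "card W = 2" using f3 c3 by (simp_all add: W_def card_Diff_singleton)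
  have A: "A = W \<or> card A \<ge> 5" if A: "A \<in> S2" for A
  proof -
    have A2: "card A \<ge> 2" and fA: "finite A" using orbits_by_size(3)[of 1 9] A orbits_finite(2)[of 9] by (auto simp: S2_def)
    obtain x where x: "x ^ 9 = 1" "A = orb 1 x" using A by (auto simp: S2_def orbits_def)
    show ?thesis
    proof (cases "x ^ 3 = 1")
      case True
      have "A \<subseteq> {y. y ^ 3 = 1}" unfolding x(2) by (rule orb_roots[OF True])
      moreover have "1 \<notin> A"
      proof
        assume "1 \<in> A"
        hence "A = orb 1 1" using orb_eq[of 1 x 1] fA x(2) by simp
        also have "\<dots> = {1}" by (auto simp: orb_def)
        finally show False using A2 by simp
      qed
      ultimately have "A \<subseteq> W" by (auto simp: W_def)
      thus ?thesis using card_seteq[OF W(1), of A] W(2) A2 by simp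
    next
      case False
      have x0: "x \<noteq> 0" using x(1) by auto
      have ne: "x ^ i \<noteq> x ^ j" if ij: "i < j" "j < 9" for i j
      proof
        assume "x ^ i = x ^ j"
        moreover have "x ^ j = x ^ i * x ^ (j - i)" using ij by (simp flip: power_add)
        ultimately have e: "x ^ (j - i) = 1" using x0 by simp
        obtain u v where uv: "(j - i) * u = 9 * v + gcd (j - i) 9" using bezout_nat[of "j - i" 9] ij by auto
        have "x ^ ((j - i) * u) = x ^ (9 * v + gcd (j - i) 9)" by (simp only: uv)
        hence g: "x ^ gcd (j - i) 9 = 1" using e x(1) by (simp only: power_add power_mult) simp
        have "gcd (j - i) 9 dvd 3"
        proof -
          have "j - i \<in> {1, 2, 3, 4, 5, 6, 7, 8}" using ij by auto
          thus ?thesis by (auto simp: gcd_non_0_nat)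
        qed
        thus False using False g by (auto elim!: dvdE simp: power_mult)
      qed
      \<comment> \<open>The powers 5 ^ i modulo 9 for i = 0, ..., 4 are 1, 5, 7, 8, 4; five elements
        already exclude a second orbit of this kind.\<close>
      have "x ^ j \<in> A" if "j \<in> {1, 5, 7, 8, 4}" for j
      proof -
        have red: "x ^ i = x ^ (i mod 9)" for i
        proof -
          have "x ^ i = x ^ (9 * (i div 9) + i mod 9)" by simp
          thus ?thesis unfolding power_add power_mult using x(1) by simp
        qed
        have "x ^ (5 ^ (1 * i)) \<in> A" for i unfolding x(2) orb_def by (rule rangeI)
        from this[of 0] this[of 1] this[of 2] this[of 3] this[of 4]
        have "x ^ 1 \<in> A" "x ^ 5 \<in> A" "x ^ 25 \<in> A" "x ^ 125 \<in> A" "x ^ 625 \<in> A" by simp_all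
        thus ?thesis using that red[of 25] red[of 125] red[of 625] by auto
      qed
      hence "(\<lambda>j. x ^ j) ` {1, 5, 7, 8, 4} \<subseteq> A" by blast
      moreover have "inj_on (\<lambda>j. x ^ j) {..<9}"
        by (rule linorder_inj_onI') (use ne in auto)
      hence "inj_on (\<lambda>j. x ^ j) {1, 5, 7, 8, 4}" by (rule inj_on_subset) auto
      hence "card ((\<lambda>j. x ^ j) ` {1, 5, 7, 8, 4}) = card {1, 5, 7, 8, 4 :: nat}" by (rule card_image)
      ultimately have "card {1, 5, 7, 8, 4 :: nat} \<le> card A" using card_mono[OF fA] by metis
      thus ?thesis by simp
    qed
  qed
  have fS: "finite S2" using orbits_finite(1)[of 9 1] by (simp add: S2_def)
  have "5 * card (S2 - {W}) = (\<Sum>A\<in>S2 - {W}. 5)" by simp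
  also have "\<dots> \<le> (\<Sum>A\<in>S2 - {W}. card A)" using A by (intro sum_mono) auto
  also have "\<dots> \<le> (\<Sum>A\<in>S2. card A)" using fS by (intro sum_mono2) auto
  also have "\<dots> \<le> 9" using orbits_by_size(8)[of 1 9] by (simp add: S2_def)
  finally have "card (S2 - {W}) \<le> 1" by simp
  moreover have "card S2 \<le> card (S2 - {W}) + 1" using fS by (cases "W \<in> S2") (auto simp: card_Diff_singleton)
  ultimately show ?thesis by (simp add: S2_def)
qed

text \<open>5 ^ 9 - 1 = 2356 * 829 with 2356 = 4 * 19 * 31 is used in factored form, and
  \<open>B\<close> is set to the prime 829, the only large one. All orbits, at most three, are
  sieved at a cost of at most 1 / 5 + 2 / 25 = 7 / 25.\<close>

lemma small_1_9: "sieve_ok 1 9"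
proof -
  define S1 where "S1 = {A \<in> orbits 1 9 :: 'k set set. card A = 1}"
  define S2 where "S2 = {A \<in> orbits 1 9 :: 'k set set. card A \<noteq> 1}"
  have c1: "card S1 = 1" using orbits_by_size(1)[of 1 9] by (simp add: S1_def gcd_non_0_nat)
  have c2: "card S2 \<le> 2" using orbits_1_9 by (simp add: S2_def)
  have un: "S1 \<union> S2 = orbits 1 9" "S1 \<inter> S2 = {}" by (auto simp: S1_def S2_def)
  have fin: "finite S1" "finite S2" using orbits_finite(1)[of 9 1] by (auto simp: S1_def S2_def)
  have "(\<Sum>A\<in>S1. 1 / (5 :: real) ^ (1 * card A)) = (\<Sum>A\<in>S1. 1 / 5)" by (intro sum.cong) (auto simp: S1_def)
  moreover have "(\<Sum>A\<in>S2. 1 / (5 :: real) ^ (1 * card A)) \<le> (\<Sum>A\<in>S2. 1 / 5 ^ 2)"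
    using orbits_by_size(3)[of 1 9] by (intro sum_mono frac_le power_increasing) (auto simp: S2_def)
  moreover have "(\<Sum>A\<in>S2. 1 / (5 :: real) ^ 2) \<le> 2 / 25" using c2 by simp
  ultimately have loss: "(\<Sum>A\<in>orbits 1 9. 1 / real 5 ^ (1 * card (A :: 'k set))) \<le> 7 / 25"
    unfolding un(1)[symmetric] using fin un(2) c1 by (simp add: sum.union_disjoint)
  show ?thesis
  proof (rule sieve_okI[where D = 2356 and c = 829 and B = 829 and u = 1 and C = "{2}" and S = "{19, 31}" and Z = 17
        and ?O0.0 = "{}" and ?O1.0 = "orbits 1 9" and g = 0 and sO = 3 and h = "1 / 829" and loss = "7 / 25" and s = 9])
    have dvd: "l dvd 4 \<or> l dvd 19 \<or> l dvd 31" if "prime l" "l dvd 2356" for l :: nat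
    proof -
      have "l dvd 4 * (19 * 31)" using that(2) by simp
      thus ?thesis using that(1) by (simp only: prime_dvd_mult_iff)
    qed
    show "l < 829" if "prime l" "l dvd 2356" for l :: nat
      using dvd[OF that] by (auto dest!: dvd_imp_le)
    show "l \<in> {2} \<union> {19, 31}" if l: "prime l" "l dvd 5 ^ (1 * 9) - 1" "l < 829" for l :: nat
    proof (cases "l < 150")
      case True
      thus ?thesis using known[of l 9 150] l(1,2) True by (auto simp: known_def order_table_def)
    next
      case False
      have "l dvd 2356 * 829" using l(2) by simp
      hence "l dvd 2356 \<or> l dvd 829" using l(1) by (simp only: prime_dvd_mult_iff)
      moreover have "\<not> l dvd 2356"
      proof
        assume "l dvd 2356"
        from dvd[OF l(1) this] show False using False by (auto dest!: dvd_imp_le)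
      qed
      ultimately have "l dvd 829" by blast
      then obtain j where j: "829 = l * j" by (elim dvdE)
      \<comment> \<open>A divisor l of 829 from 150 on has a cofactor of at most 5, and 829 is not
        divisible by 2, 3, 4 or 5; so l would be 829 itself.\<close>
      have "150 * j \<le> l * j" using False by simp
      hence "j \<le> 5" using j by linarith
      hence "j = 0 \<or> j = 1 \<or> j = 2 \<or> j = 3 \<or> j = 4 \<or> j = 5" by arith
      hence False using j l(3) by (elim disjE; hypsubst; presburger)
      thus ?thesis ..
    qed
    show "(\<Sum>l\<in>A. 1 / real l) \<le> 1 / 829" if "finite A" "\<And>l. l \<in> A \<Longrightarrow> prime l \<and> l \<ge> 829" "card A \<le> 1" for A
      using sum_inverse_primes_le[OF that] by simp
    show "card (orbits 1 9 :: 'k set set) \<le> 3"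
      unfolding un(1)[symmetric] using card_Un_le[of S1 S2] c1 c2 by linarith
    show "(\<Sum>A\<in>orbits 1 9. 1 / real 5 ^ (1 * card (A :: 'k set))) \<le> 7 / 25" by (rule loss)
  qed simp_all
qed

theorem sieve_ok_5:
  assumes k: "k \<ge> 1" and m: "m \<ge> 3"
    and ne: "\<not> (m = 3 \<and> k \<in> {1, 2, 3, 4, 5, 6, 8, 10})" "\<not> (m = 4 \<and> k \<in> {1, 2, 3, 4})"
      "\<not> (m \<in> {5, 6} \<and> k \<in> {1, 2})" "\<not> (m \<in> {7, 8, 10, 12} \<and> k = 1)"
  shows "sieve_ok k m"
proof -
  define n where "n = k * m"
  \<comment> \<open>For n = 26, 30 and 36 the pairs are treated one by one with the finer orbit
    counts of \<open>row\<close>; 432 = 48 * 9 is where \<open>asymptotic\<close> sets in.\<close>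
  consider "n \<le> 24" | "n \<in> {26, 30, 36}" | "25 \<le> n" "n \<le> 60" "n \<notin> {26, 30, 36}" | "61 \<le> n" "n \<le> 431" | "n \<ge> 432"
    by force
  thus ?thesis
  proof cases
    case 1
    have "k * 3 \<le> k * m" using m by simp
    hence "k \<le> 8" using 1 unfolding n_def by linarith
    hence "k = 1 \<or> k = 2 \<or> k = 3 \<or> k = 4 \<or> k = 5 \<or> k = 6 \<or> k = 7 \<or> k = 8" using k by arith
    moreover have "k * m \<le> 24" using 1 by (simp add: n_def)
    ultimately consider "k = 1" "m \<le> 24" | "k = 2" "m \<le> 12" | "k = 3" "m \<le> 8" | "k = 4" "m \<le> 6" | "k = 5" "m \<le> 4" | "k = 6" "m \<le> 4" | "k = 7" "m \<le> 3" | "k = 8" "m \<le> 3"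
      by (elim disjE) auto
    thus ?thesis
    proof cases
      case 1
      have "m = 3 \<or> m = 4 \<or> m = 5 \<or> m = 6 \<or> m = 7 \<or> m = 8 \<or> m = 9 \<or> m = 10 \<or> m = 11 \<or> m = 12 \<or> m = 13 \<or> m = 14 \<or> m = 15 \<or> m = 16 \<or> m = 17 \<or> m = 18 \<or> m = 19 \<or> m = 20 \<or> m = 21 \<or> m = 22 \<or> m = 23 \<or> m = 24" using m 1(2) by arith
      thus ?thesis using ne small_1_9 small_1_11 small_1_13 small_1_14 small_1_15 small_1_16 small_1_17 small_1_18 small_1_19 small_1_20 small_1_21 small_1_22 small_1_23 small_1_24 unfolding 1(1) by (elim disjE) simp_all
    next
      case 2
      have "m = 3 \<or> m = 4 \<or> m = 5 \<or> m = 6 \<or> m = 7 \<or> m = 8 \<or> m = 9 \<or> m = 10 \<or> m = 11 \<or> m = 12" using m 2(2) by arith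
      thus ?thesis using ne small_2_7 small_2_8 small_2_9 small_2_10 small_2_11 small_2_12 unfolding 2(1) by (elim disjE) simp_all
    next
      case 3
      have "m = 3 \<or> m = 4 \<or> m = 5 \<or> m = 6 \<or> m = 7 \<or> m = 8" using m 3(2) by arith
      thus ?thesis using ne small_3_5 small_3_6 small_3_7 small_3_8 unfolding 3(1) by (elim disjE) simp_all
    next
      case 4
      have "m = 3 \<or> m = 4 \<or> m = 5 \<or> m = 6" using m 4(2) by arith
      thus ?thesis using ne small_4_5 small_4_6 unfolding 4(1) by (elim disjE) simp_all
    next
      case 5
      have "m = 3 \<or> m = 4" using m 5(2) by arith
      thus ?thesis using ne small_5_4 unfolding 5(1) by (elim disjE) simp_all
    next
      case 6
      have "m = 3 \<or> m = 4" using m 6(2) by arith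
      thus ?thesis using ne small_6_4 unfolding 6(1) by (elim disjE) simp_all
    next
      case 7
      have "m = 3" using m 7(2) by arith
      thus ?thesis using ne small_7_3 unfolding 7(1) by simp
    next
      case 8
      have "m = 3" using m 8(2) by arith
      thus ?thesis using ne  unfolding 8(1) by simp
    qed
  next
    case 2
    have "k * 3 \<le> k * m" using m by simp
    moreover have "n \<le> 36" using 2 by auto
    ultimately have "k \<le> 12" unfolding n_def by linarith
    hence "k = 1 \<or> k = 2 \<or> k = 3 \<or> k = 4 \<or> k = 5 \<or> k = 6 \<or> k = 7 \<or> k = 8 \<or> k = 9 \<or> k = 10 \<or> k = 11 \<or> k = 12" using k by arith
    moreover have "k * m = 26 \<or> k * m = 30 \<or> k * m = 36" using 2 by (simp add: n_def)
    ultimately have "(k = 2 \<and> m = 13) \<or> (k = 1 \<and> m = 26) \<or> (k = 10 \<and> m = 3) \<or> (k = 6 \<and> m = 5) \<or> (k = 5 \<and> m = 6) \<or> (k = 3 \<and> m = 10) \<or> (k = 2 \<and> m = 15) \<or> (k = 1 \<and> m = 30) \<or> (k = 12 \<and> m = 3) \<or> (k = 9 \<and> m = 4) \<or> (k = 6 \<and> m = 6) \<or> (k = 4 \<and> m = 9) \<or> (k = 3 \<and> m = 12) \<or> (k = 2 \<and> m = 18) \<or> (k = 1 \<and> m = 36)"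
      using m by (elim disjE; hypsubst; presburger)
    thus ?thesis using ne small_2_13 small_1_26 small_6_5 small_5_6 small_3_10 small_2_15 small_1_30 small_12_3 small_9_4 small_6_6 small_4_9 small_3_12 small_2_18 small_1_36 by auto
  next
    case 3
    from 3(1,2) have "n = 25 \<or> n = 26 \<or> n = 27 \<or> n = 28 \<or> n = 29 \<or> n = 30 \<or> n = 31 \<or> n = 32 \<or> n = 33 \<or> n = 34 \<or> n = 35 \<or> n = 36 \<or> n = 37 \<or> n = 38 \<or> n = 39 \<or> n = 40 \<or> n = 41 \<or> n = 42 \<or> n = 43 \<or> n = 44 \<or> n = 45 \<or> n = 46 \<or> n = 47 \<or> n = 48 \<or> n = 49 \<or> n = 50 \<or> n = 51 \<or> n = 52 \<or> n = 53 \<or> n = 54 \<or> n = 55 \<or> n = 56 \<or> n = 57 \<or> n = 58 \<or> n = 59 \<or> n = 60" by arith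
    thus ?thesis using 3(3) by (elim disjE) (simp_all add: large_25[OF _ m] large_27[OF _ m] large_28[OF _ m] large_29[OF _ m] large_31[OF _ m] large_32[OF _ m] large_33[OF _ m] large_34[OF _ m] large_35[OF _ m] large_37[OF _ m] large_38[OF _ m] large_39[OF _ m] large_40[OF _ m] large_41[OF _ m] large_42[OF _ m] large_43[OF _ m] large_44[OF _ m] large_45[OF _ m] large_46[OF _ m] large_47[OF _ m] large_48[OF _ m] large_49[OF _ m] large_50[OF _ m] large_51[OF _ m] large_52[OF _ m] large_53[OF _ m] large_54[OF _ m] large_55[OF _ m] large_56[OF _ m] large_57[OF _ m] large_58[OF _ m] large_59[OF _ m] large_60[OF _ m] n_def[symmetric])
  next
    case 4
    \<comment> \<open>In the first three ranges the number of table primes with order dividing n is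
      bounded by checking every n; in the last two the whole table below 90 and below 150 is
      counted, 23 and 34 primes.\<close>
    consider "61 \<le> n" "n \<le> 71" | "72 \<le> n" "n \<le> 119" | "120 \<le> n" "n \<le> 159" | "160 \<le> n" "n \<le> 218" | "219 \<le> n" "n \<le> 431" using 4 by linarith
    thus ?thesis
    proof cases
      case 1
      hence "n \<in> set [61..<72]" unfolding set_upt atLeastLessThan_iff by linarith
      hence "length (known n (30 * 2)) \<le> 5" using length_known_61 by auto
      thus ?thesis
        by (intro interval[OF n_def 1(1,2) _ m, where b = 2 and u = 27 and J = 3 and T = 5 and Z = 485]) (simp_all add: lessThan_nat_numeral)
    next
      case 2
      hence "n \<in> set [72..<120]" unfolding set_upt atLeastLessThan_iff by linarith
      hence "length (known n (30 * 3)) \<le> 8" using length_known_72 by auto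
      thus ?thesis
        by (intro interval[OF n_def 2(1,2) _ m, where b = 3 and u = 42 and J = 5 and T = 8 and Z = 736]) (simp_all add: lessThan_nat_numeral)
    next
      case 3
      hence "n \<in> set [120..<160]" unfolding set_upt atLeastLessThan_iff by linarith
      hence "length (known n (30 * 3)) \<le> 9" using length_known_120 by auto
      thus ?thesis
        by (intro interval[OF n_def 3(1,2) _ m, where b = 3 and u = 56 and J = 7 and T = 9 and Z = 1627]) (simp_all add: lessThan_nat_numeral)
    next
      case 4
      have "length (known n (30 * 3)) \<le> 23" using length_known_le[of n "30 * 3"] by (simp add: orders_90)
      thus ?thesis
        by (intro interval[OF n_def 4(1,2) _ m, where b = 3 and u = 77 and J = 9 and T = 23 and Z = 10133]) (simp_all add: lessThan_nat_numeral)
    next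
      case 5
      have "length (known n (30 * 5)) \<le> 34" using length_known_le[of n "30 * 5"] by (simp add: orders_150)
      thus ?thesis
        by (intro interval[OF n_def 5(1,2) _ m, where b = 5 and u = 138 and J = 17 and T = 34 and Z = 19691]) (simp_all add: lessThan_nat_numeral)
    qed
  next
    case 5
    thus ?thesis using asymptotic[OF n_def _ m] by simp
  qed
qed

end

theorem theorem5p1:
  fixes k q m :: nat
  assumes "k \<ge> 1" and "q = 5 ^ k" and "m \<ge> 3"
    and "CARD('a::finite_field) = q ^ m"
  shows "(q, m) \<in> T_total TYPE('a) 2 \<or>
    (q \<in> {5, 5^2, 5^3, 5^4, 5^5, 5^6, 5^8, 5^10} \<and> m = 3) \<or>
    (q \<in> {5, 5^2, 5^3, 5^4} \<and> m = 4) \<or>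
    (q \<in> {5, 5^2} \<and> m \<in> {5, 6}) \<or>
    (q = 5 \<and> m \<in> {7, 8, 10, 12})"
proof (cases "(m = 3 \<and> k \<in> {1, 2, 3, 4, 5, 6, 8, 10}) \<or> (m = 4 \<and> k \<in> {1, 2, 3, 4}) \<or>
    (m \<in> {5, 6} \<and> k \<in> {1, 2}) \<or> (m \<in> {7, 8, 10, 12} \<and> k = 1)")
  case True
  thus ?thesis using assms(2) by auto
next
  case False
  have card: "CARD('a) = 5 ^ (k * m)" using assms(2,4) by (simp add: power_mult)
  interpret pchar5 "TYPE('a alg_closure)"
    using CHAR_finite_field[where 'a='a, OF _ card] by unfold_locales auto
  have "sieve_ok k m" using False by (intro sieve_ok_5 assms) auto
  from sieve_ok_imp_T_total[OF _ _ card this] show ?thesis using assms(2) by simp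
qed

end
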